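(* Let $d\geq 1$ be an integer, let $1<p<\infty$, and let $\varphi\colon S^{d-1}\to\mathbb{R}$ be a smooth real-valued function on the unit sphere of $\mathbb{R}^d$. There exists a constant $c$ (depending on $d$, $p$ and $\varphi$, but not on $\lambda$) such that for all real $\lambda$ with $|\lambda|\geq 1$, $$\|A_\lambda\|_{L_p(\mathbb{R}^d)\to L_p(\mathbb{R}^d)}\leq c\,|\lambda|^{d\left|\frac12-\frac1p\right|}.$$
   Context: For a smooth real-valued function $\varphi$ on the unit sphere $S^{d-1}\subset\mathbb{R}^d$ and $\lambda\in\mathbb{R}$, $A_\lambda$ denotes the Fourier multiplier on $\mathbb{R}^d$ with symbol $\xi\mapsto e^{i\lambda\varphi(\xi/|\xi|)}$, $\xi\neq 0$, that is, $\widehat{A_\lambda f}(\xi)=e^{i\lambda\varphi(\xi/|\xi|)}\hat f(\xi)$ (initially for $f\in L_2\cap L_p$), where $\hat f(\xi)=\int_{\mathbb{R}^d}f(x)e^{-2\pi i\langle x,\xi\rangle}\,dx$. The quantity $\|A_\lambda\|_{L_p\to L_p}$ is its operator norm on $L_p(\mathbb{R}^d)$, i.e. the supremum of $\|A_\lambda f\|_{L_p}/\|f\|_{L_p}$ over nonzero $f\in L_2\cap L_p$. *)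

theory Defs
  imports "HOL-Analysis.Analysis"
begin

section \<open>Smooth functions on subsets of Euclidean space\<close>

text \<open>Meaningful for open \<open>U\<close> only, since the derivatives are taken at \<open>at x\<close> rather than
  within \<open>U\<close>.\<close>

fun Ck_on :: "nat \<Rightarrow> 'a::euclidean_space set \<Rightarrow> ('a \<Rightarrow> 'b::real_normed_vector) \<Rightarrow> bool" where
  "Ck_on 0 U f \<longleftrightarrow> continuous_on U f"
| "Ck_on (Suc k) U f \<longleftrightarrow>
     (\<forall>x\<in>U. f differentiable (at x)) \<and>
     (\<forall>v. Ck_on k U (\<lambda>x. frechet_derivative f (at x) v))"

text \<open>As usual for submanifolds, a function given on an arbitrary set \<open>S\<close> is smooth if near every
  point of \<open>S\<close> it is the restriction of a smooth function on an open set.  Values of \<open>f\<close> outside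
  \<open>S\<close> are irrelevant.\<close>

definition smooth_on_subset :: "'a::euclidean_space set \<Rightarrow> ('a \<Rightarrow> 'b::real_normed_vector) \<Rightarrow> bool" where
  "smooth_on_subset S f \<longleftrightarrow>
     (\<forall>x\<in>S. \<exists>U g. open U \<and> x \<in> U \<and> (\<forall>k. Ck_on k U g) \<and> (\<forall>y\<in>U \<inter> S. g y = f y))"

section \<open>Lebesgue spaces\<close>

text \<open>Elements of \<open>L\<^sub>p\<close> are represented by Borel functions; every class of Lebesgue measurable
  functions modulo null sets contains one.\<close>

definition Lp_space :: "real \<Rightarrow> ('a::euclidean_space \<Rightarrow> complex) set" where
  "Lp_space p = {f \<in> borel_measurable lborel. integrable lborel (\<lambda>x. norm (f x) powr p)}"

definition Lp_norm :: "real \<Rightarrow> ('a::euclidean_space \<Rightarrow> complex) \<Rightarrow> ennreal" where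
  "Lp_norm p f =
     (if f \<in> Lp_space p
      then ennreal ((\<integral>x. norm (f x) powr p \<partial>lborel) powr (1 / p))
      else \<infinity>)"

section \<open>Fourier transform and Fourier multipliers\<close>

definition fourier_integral :: "('a::euclidean_space \<Rightarrow> complex) \<Rightarrow> 'a \<Rightarrow> complex" where
  "fourier_integral f \<xi> = (\<integral>x. f x * exp (- 2 * of_real pi * \<i> * of_real (x \<bullet> \<xi>)) \<partial>lborel)"

text \<open>On \<open>L\<^sub>2\<close> the Fourier integral need not converge, and the transform is Plancherel's: the
  \<open>L\<^sub>2\<close>-limit of the Fourier integrals of the truncations of \<open>f\<close> to balls, which lie in
  both \<open>L\<^sub>1\<close> and \<open>L\<^sub>2\<close>.  The limit is determined up to a null set only, so that an arbitrary
  representative is chosen; the same applies to the multiplier operator.\<close>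

definition fourier_L2 :: "('a::euclidean_space \<Rightarrow> complex) \<Rightarrow> 'a \<Rightarrow> complex" where
  "fourier_L2 f = (SOME F. F \<in> Lp_space 2 \<and>
     (\<lambda>n. Lp_norm 2 (\<lambda>\<xi>. fourier_integral (\<lambda>x. indicator (cball 0 (real n)) x * f x) \<xi> - F \<xi>))
       \<longlonglongrightarrow> 0)"

definition fourier_multiplier ::
  "('a::euclidean_space \<Rightarrow> complex) \<Rightarrow> ('a \<Rightarrow> complex) \<Rightarrow> 'a \<Rightarrow> complex" where
  "fourier_multiplier m f = (SOME g. g \<in> Lp_space 2 \<and>
     (AE \<xi> in lborel. fourier_L2 g \<xi> = m \<xi> * fourier_L2 f \<xi>))"

definition Lp_op_norm ::
  "real \<Rightarrow> (('a::euclidean_space \<Rightarrow> complex) \<Rightarrow> 'a \<Rightarrow> complex) \<Rightarrow> ennreal" where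
  "Lp_op_norm p T =
     (SUP f \<in> {f \<in> Lp_space 2 \<inter> Lp_space p. \<not> (AE x in lborel. f x = 0)}.
        Lp_norm p (T f) / Lp_norm p f)"

text \<open>Only the values of \<open>\<phi>\<close> on the unit sphere matter, except at the single point
  \<open>\<xi> = 0\<close>, which is a null set.\<close>

definition A_op ::
  "('a::euclidean_space \<Rightarrow> real) \<Rightarrow> real \<Rightarrow> ('a \<Rightarrow> complex) \<Rightarrow> 'a \<Rightarrow> complex" where
  "A_op \<phi> t = fourier_multiplier (\<lambda>\<xi>. exp (\<i> * of_real (t * \<phi> (\<xi> /\<^sub>R norm \<xi>))))"

end

theory Submission
  imports Defs "HOL-Probability.Characteristic_Functions" "HOL-Probability.Sinc_Integral"
begin

text \<open>For \<open>p > 2\<close> the operator is controlled through its dyadic mean oscillation.  On a cube \<open>Q\<close> the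
  oscillation of \<open>A f\<close> is dual to \<open>A\<close> applied to a bounded mean zero function \<open>a\<close> on \<open>Q\<close>; after
  rescaling, \<open>Q\<close> is the unit cube.  The \<open>L\<^sub>1\<close> norm of \<open>A a\<close> is \<open>O(\<bar>t\<bar>\<^bsup>d/2\<^esup>)\<close>: within distance \<open>\<bar>t\<bar>\<close> by
  the Cauchy--Schwarz inequality, and at distance \<open>R > \<bar>t\<bar>\<close> because multiplication by \<open>(e\<^bsup>ih x\<^esup> - 1)\<^bsup>N\<^esup>\<close>
  with \<open>h\<close> of order \<open>1/R\<close> turns into an \<open>N\<close>-fold difference on the Fourier side, which gains a factor
  \<open>(\<bar>t\<bar>/R)\<^bsup>d/2+1\<^esup>\<close>; here the vanishing mean makes the transform of \<open>a\<close> small near the singularity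
  \<open>\<xi> = 0\<close> of the symbol.  Thus a bounded \<open>f\<close> is mapped to BMO with norm \<open>O(\<bar>t\<bar>\<^bsup>d/2\<^esup>)\<close>.  Splitting \<open>f\<close>
  at height \<open>c \<alpha> \<bar>t\<bar>\<^bsup>-d/2\<^esup>\<close>, using unitarity on \<open>L\<^sub>2\<close> for the large part, and feeding both into a
  good-\<open>\<lambda>\<close> inequality at level \<open>\<alpha>\<close> gives the exponent \<open>d(1/2 - 1/p)\<close> without logarithmic loss.
  The range \<open>p < 2\<close> follows by duality.\<close>

section \<open>Square integrable functions\<close>

text \<open>The exponent is what interpolation predicts: with norm 1 on L_2 and norm |t|^(d/2) from
  bounded functions to BMO, the intermediate exponent for p > 2 is (d/2)(1 - 2/p) = d(1/2 - 1/p).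
  Interpolating by hand means absorbing half of a sum over dyadic levels of the maximal function of
  A f. This is legitimate only for a finite sum, while finiteness of the p-norm of A f is part of
  the claim. Hence only finitely many levels \<delta> 2^n are summed, each finite by the weak L_2
  bound; the lowest level leaves \<delta>^(p-2) times the squared L_2 norm, which disappears as
  \<delta> tends to 0 because p > 2. Transforms and operators are representatives picked by a choice
  operator, so identities between them are available almost everywhere only; those for the transform
  are checked on integrable functions in L_2 and passed to the limit. Finite differences take the
  place of derivatives of the transform, whose regularity then never enters.\<close>

definition N2 :: "('a::euclidean_space \<Rightarrow> complex) \<Rightarrow> ennreal" where
  "N2 f = (\<integral>\<^sup>+x. ennreal ((cmod (f x))\<^sup>2) \<partial>lborel)"

lemma powr_two: "0 \<le> x \<Longrightarrow> x powr 2 = (x::real)\<^sup>2"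
  by (cases "x = 0") auto

lemma L2_iff: "f \<in> Lp_space 2 \<longleftrightarrow> f \<in> borel_measurable borel \<and> N2 f < \<infinity>"
proof -
  have "integrable lborel (\<lambda>x. norm (f x) powr 2) \<longleftrightarrow> N2 f < \<infinity>" if [measurable]: "f \<in> borel_measurable borel"
    unfolding N2_def by (subst integrable_iff_bounded) (simp add: powr_two)
  then show ?thesis by (auto simp: Lp_space_def)
qed

lemma L2_measurable[measurable_dest]: "f \<in> Lp_space p \<Longrightarrow> f \<in> borel_measurable borel"
  by (simp add: Lp_space_def)

lemma L2_finite: "f \<in> Lp_space 2 \<Longrightarrow> N2 f < \<infinity>"
  by (simp add: L2_iff)

lemma L2_I: "f \<in> borel_measurable borel \<Longrightarrow> N2 f < \<infinity> \<Longrightarrow> f \<in> Lp_space 2"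
  by (simp add: L2_iff)

lemma Lp_norm_2_sq:
  assumes [measurable]: "f \<in> borel_measurable borel"
  shows "(Lp_norm 2 f)\<^sup>2 = N2 f"
proof (cases "f \<in> Lp_space 2")
  case True
  then have fin: "N2 f < \<infinity>" by (simp add: L2_iff)
  have i: "integrable lborel (\<lambda>x. norm (f x) powr 2)" using True by (simp add: Lp_space_def)
  have "N2 f = (\<integral>x. norm (f x) powr 2 \<partial>lborel)"
    unfolding N2_def using nn_integral_eq_integral[OF i] by (simp add: powr_two)
  then show ?thesis using True
    by (simp add: Lp_norm_def ennreal_power powr_half_sqrt)
next
  case False
  then have "N2 f = \<infinity>" using assms less_top[of "N2 f"] by (auto simp: L2_iff)
  then show ?thesis using False by (simp add: Lp_norm_def)
qed

lemma ennreal_sq_tendsto_0_iff: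
  fixes f :: "nat \<Rightarrow> ennreal"
  shows "(\<lambda>n. (f n)\<^sup>2) \<longlonglongrightarrow> 0 \<longleftrightarrow> f \<longlonglongrightarrow> 0"
proof
  assume "f \<longlonglongrightarrow> 0"
  from tendsto_mult_ennreal[OF this this] show "(\<lambda>n. (f n)\<^sup>2) \<longlonglongrightarrow> 0"
    by (simp add: power2_eq_square)
next
  assume L: "(\<lambda>n. (f n)\<^sup>2) \<longlonglongrightarrow> 0"
  show "f \<longlonglongrightarrow> 0"
  proof (rule order_tendstoI)
    fix a :: ennreal assume "0 < a"
    then obtain b where b: "0 < b" "b < a" using dense by blast
    have "eventually (\<lambda>n. (f n)\<^sup>2 < b\<^sup>2) sequentially"
      using order_tendstoD(2)[OF L, of "b\<^sup>2"] b by (simp add: zero_less_iff_neq_zero)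
    then show "eventually (\<lambda>n. f n < a) sequentially"
    proof eventually_elim
      case (elim n)
      have "f n < b"
      proof (rule ccontr)
        assume "\<not> f n < b"
        then have "b\<^sup>2 \<le> (f n)\<^sup>2" by (intro power_mono) auto
        with elim show False by simp
      qed
      with b show ?case by simp
    qed
  qed auto
qed

text \<open>\<open>fourier_L2\<close> is specified through \<open>Lp_norm 2\<close>; this passes to
  the squared norm \<open>N2\<close>, in which later limits are taken without square roots.\<close>

lemma Lp_norm_2_tendsto_0_iff:
  assumes "\<And>n. f n \<in> borel_measurable borel"
  shows "(\<lambda>n. Lp_norm 2 (f n)) \<longlonglongrightarrow> 0 \<longleftrightarrow> (\<lambda>n. N2 (f n)) \<longlonglongrightarrow> 0"
  using ennreal_sq_tendsto_0_iff[of "\<lambda>n. Lp_norm 2 (f n)"] Lp_norm_2_sq[OF assms] by simp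

lemma cmod_add_sq: "(cmod (a + b))\<^sup>2 \<le> 2 * (cmod a)\<^sup>2 + 2 * (cmod b)\<^sup>2"
proof -
  have "(cmod (a + b))\<^sup>2 \<le> (cmod a + cmod b)\<^sup>2" by (intro power_mono norm_triangle_ineq) auto
  also have "\<dots> \<le> 2 * (cmod a)\<^sup>2 + 2 * (cmod b)\<^sup>2"
    using sum_squares_bound[of "cmod a" "cmod b"] by (simp add: power2_sum)
  finally show ?thesis .
qed

text \<open>The quasi-triangle inequality with factor 2 stands in for Minkowski's: it keeps squares
  throughout and suffices for finiteness and for limits equal to 0.\<close>

lemma N2_add:
  assumes [measurable]: "f \<in> borel_measurable borel" "g \<in> borel_measurable borel"
  shows "N2 (\<lambda>x. f x + g x) \<le> 2 * N2 f + 2 * N2 g"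
proof -
  have "N2 (\<lambda>x. f x + g x) \<le> (\<integral>\<^sup>+x. ennreal (2 * (cmod (f x))\<^sup>2 + 2 * (cmod (g x))\<^sup>2) \<partial>lborel)"
    unfolding N2_def by (intro nn_integral_mono ennreal_leI cmod_add_sq)
  also have "\<dots> = 2 * N2 f + 2 * N2 g"
    by (simp add: N2_def nn_integral_add nn_integral_cmult ennreal_mult'')
  finally show ?thesis .
qed

lemma N2_minus: "N2 (\<lambda>x. - f x) = N2 f"
  by (simp add: N2_def)

lemma N2_minus_commute: "N2 (\<lambda>x. f x - g x) = N2 (\<lambda>x. g x - f x)"
  by (simp add: N2_def norm_minus_commute)

lemma N2_diff:
  assumes [measurable]: "f \<in> borel_measurable borel" "g \<in> borel_measurable borel"
  shows "N2 (\<lambda>x. f x - g x) \<le> 2 * N2 f + 2 * N2 g"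
  using N2_add[of f "\<lambda>x. - g x"] by (simp add: N2_minus)

lemma N2_triangle:
  assumes [measurable]: "f \<in> borel_measurable borel" "g \<in> borel_measurable borel" "h \<in> borel_measurable borel"
  shows "N2 (\<lambda>x. f x - h x) \<le> 2 * N2 (\<lambda>x. f x - g x) + 2 * N2 (\<lambda>x. g x - h x)"
  using N2_add[of "\<lambda>x. f x - g x" "\<lambda>x. g x - h x"] by simp

lemma N2_cmult:
  assumes [measurable]: "f \<in> borel_measurable borel"
  shows "N2 (\<lambda>x. c * f x) = ennreal ((cmod c)\<^sup>2) * N2 f"
  by (simp add: N2_def norm_mult power_mult_distrib ennreal_mult nn_integral_cmult)

lemma N2_cnj: "N2 (\<lambda>x. cnj (f x)) = N2 f"
  by (simp add: N2_def)

lemma N2_mono: "(\<And>x. cmod (f x) \<le> cmod (g x)) \<Longrightarrow> N2 f \<le> N2 g"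
  unfolding N2_def by (intro nn_integral_mono ennreal_leI power_mono) auto

lemma N2_cong_AE: "AE x in lborel. f x = g x \<Longrightarrow> N2 f = N2 g"
  unfolding N2_def by (intro nn_integral_cong_AE) auto

lemma N2_eq_0_iff:
  assumes [measurable]: "f \<in> borel_measurable borel"
  shows "N2 f = 0 \<longleftrightarrow> (AE x in lborel. f x = 0)"
  unfolding N2_def by (subst nn_integral_0_iff_AE) auto

lemma L2_add: "f \<in> Lp_space 2 \<Longrightarrow> g \<in> Lp_space 2 \<Longrightarrow> (\<lambda>x. f x + g x) \<in> Lp_space 2"
  using N2_add[of f g] by (auto simp: L2_iff ennreal_mult_less_top elim!: order.strict_trans1)

lemma L2_diff: "f \<in> Lp_space 2 \<Longrightarrow> g \<in> Lp_space 2 \<Longrightarrow> (\<lambda>x. f x - g x) \<in> Lp_space 2"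
  using N2_diff[of f g] by (auto simp: L2_iff ennreal_mult_less_top elim!: order.strict_trans1)

lemma L2_cmult: "f \<in> Lp_space 2 \<Longrightarrow> (\<lambda>x. c * f x) \<in> Lp_space 2"
  by (auto simp: L2_iff N2_cmult ennreal_mult_less_top)

lemma borel_measurable_cnj[measurable (raw)]:
  "f \<in> borel_measurable M \<Longrightarrow> (\<lambda>x. cnj (f x)) \<in> borel_measurable M"
  by (rule borel_measurable_continuous_on[OF continuous_on_cnj]) (auto intro: continuous_intros)

lemma L2_cnj: "f \<in> Lp_space 2 \<Longrightarrow> (\<lambda>x. cnj (f x)) \<in> Lp_space 2"
  by (auto simp: L2_iff N2_cnj)

lemma L2_bound_mult:
  assumes f: "f \<in> Lp_space 2" and [measurable]: "m \<in> borel_measurable borel" and "\<And>x. cmod (m x) \<le> C"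
  shows "(\<lambda>x. m x * f x) \<in> Lp_space 2"
proof -
  have "0 \<le> C" by (rule order_trans[OF norm_ge_zero assms(3)])
  have "N2 (\<lambda>x. m x * f x) \<le> N2 (\<lambda>x. of_real C * f x)"
    using \<open>0 \<le> C\<close> by (intro N2_mono) (auto simp: norm_mult intro!: mult_right_mono assms(3))
  also have "\<dots> < \<infinity>" using L2_cmult[OF f] by (simp add: L2_iff)
  finally show ?thesis using f by (auto simp: L2_iff)
qed

lemma L2_mult_nn:
  assumes [measurable]: "f \<in> borel_measurable borel" "g \<in> borel_measurable borel"
  shows "(\<integral>\<^sup>+x. ennreal (cmod (f x * g x)) \<partial>lborel)\<^sup>2 \<le> N2 f * N2 g"
  using Cauchy_Schwarz_nn_integral[of "\<lambda>x. ennreal (cmod (f x))" lborel "\<lambda>x. ennreal (cmod (g x))"]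
  by (simp add: N2_def norm_mult ennreal_mult ennreal_power)

lemma L2_mult_integrable:
  assumes f: "f \<in> Lp_space 2" and g: "g \<in> Lp_space 2"
  shows "integrable lborel (\<lambda>x. f x * g x)"
proof -
  have [measurable]: "f \<in> borel_measurable borel" "g \<in> borel_measurable borel" using f g by (auto simp: L2_iff)
  have "(\<integral>\<^sup>+x. ennreal (cmod (f x * g x)) \<partial>lborel)\<^sup>2 < \<infinity>"
    using L2_mult_nn[of f g] f g by (auto simp: L2_iff ennreal_mult_less_top elim!: order.strict_trans1)
  then show ?thesis
    by (subst integrable_iff_bounded) (auto simp: power2_eq_square ennreal_mult_less_top)
qed

lemma L2_mult_bound:
  assumes f: "f \<in> borel_measurable borel" and g: "g \<in> borel_measurable borel"
  shows "ennreal ((cmod (\<integral>x. f x * g x \<partial>lborel))\<^sup>2) \<le> N2 f * N2 g"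
proof -
  have "ennreal (cmod (\<integral>x. f x * g x \<partial>lborel)) \<le> (\<integral>\<^sup>+x. ennreal (cmod (f x * g x)) \<partial>lborel)"
    by (cases "integrable lborel (\<lambda>x. f x * g x)") (auto simp: integral_norm_bound_ennreal not_integrable_integral_eq)
  from power_mono[OF this, of 2] L2_mult_nn[OF f g] show ?thesis
    by (simp add: ennreal_power)
qed

lemma tendsto_0_ennreal_le:
  fixes f g :: "nat \<Rightarrow> ennreal"
  assumes "g \<longlonglongrightarrow> 0" "\<And>n. f n \<le> g n" shows "f \<longlonglongrightarrow> 0"
  by (rule tendsto_sandwich[OF _ _ tendsto_const assms(1)]) (auto simp: assms(2))

lemma tendsto_cmod_sq_ennreal_0:
  fixes f :: "nat \<Rightarrow> complex"
  assumes "(\<lambda>n. ennreal ((cmod (f n))\<^sup>2)) \<longlonglongrightarrow> 0" shows "f \<longlonglongrightarrow> 0"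
proof -
  have "(\<lambda>n. ennreal (cmod (f n))) \<longlonglongrightarrow> 0"
    using assms ennreal_sq_tendsto_0_iff[of "\<lambda>n. ennreal (cmod (f n))"] by (simp add: ennreal_power)
  then have "(\<lambda>n. cmod (f n)) \<longlonglongrightarrow> 0"
    using tendsto_ennrealD[of "\<lambda>n. cmod (f n)" 0 sequentially] by simp
  then show ?thesis by (simp add: tendsto_norm_zero_iff)
qed

text \<open>Write fn un - f u as (fn - f)(un - u) + (fn - f) u + f (un - u) and apply Cauchy-Schwarz
  to each product.\<close>

lemma L2_mult_tendsto:
  assumes f: "f \<in> Lp_space 2" and u: "u \<in> Lp_space 2"
    and fn: "\<And>n. fn n \<in> Lp_space 2" and un: "\<And>n. un n \<in> Lp_space 2"
    and cf: "(\<lambda>n. N2 (\<lambda>x. fn n x - f x)) \<longlonglongrightarrow> 0" and cu: "(\<lambda>n. N2 (\<lambda>x. un n x - u x)) \<longlonglongrightarrow> 0"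
  shows "(\<lambda>n. \<integral>x. fn n x * un n x \<partial>lborel) \<longlonglongrightarrow> (\<integral>x. f x * u x \<partial>lborel)"
proof -
  note [measurable] = L2_measurable[OF f] L2_measurable[OF u] L2_measurable[OF fn] L2_measurable[OF un]
  let ?A = "\<lambda>n. \<integral>x. (fn n x - f x) * (un n x - u x) \<partial>lborel"
  let ?B = "\<lambda>n. \<integral>x. (fn n x - f x) * u x \<partial>lborel"
  let ?C = "\<lambda>n. \<integral>x. f x * (un n x - u x) \<partial>lborel"
  have "(\<lambda>n. N2 (\<lambda>x. fn n x - f x) * N2 (\<lambda>x. un n x - u x)) \<longlonglongrightarrow> 0 * 0"
    by (intro tendsto_mult_ennreal cf cu) auto
  then have A: "?A \<longlonglongrightarrow> 0"
    by (intro tendsto_cmod_sq_ennreal_0 tendsto_0_ennreal_le[OF _ L2_mult_bound]) auto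
  have "(\<lambda>n. N2 (\<lambda>x. fn n x - f x) * N2 u) \<longlonglongrightarrow> 0 * N2 u"
    using L2_finite[OF u] by (intro tendsto_mult_ennreal cf tendsto_const) auto
  then have B: "?B \<longlonglongrightarrow> 0"
    by (intro tendsto_cmod_sq_ennreal_0 tendsto_0_ennreal_le[OF _ L2_mult_bound]) auto
  have "(\<lambda>n. N2 f * N2 (\<lambda>x. un n x - u x)) \<longlonglongrightarrow> N2 f * 0"
    using L2_finite[OF f] by (intro tendsto_mult_ennreal cu tendsto_const) auto
  then have C: "?C \<longlonglongrightarrow> 0"
    by (intro tendsto_cmod_sq_ennreal_0 tendsto_0_ennreal_le[OF _ L2_mult_bound]) auto
  have eq: "(\<integral>x. fn n x * un n x \<partial>lborel) = ?A n + ?B n + ?C n + (\<integral>x. f x * u x \<partial>lborel)" for n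
  proof -
    have i: "integrable lborel (\<lambda>x. (fn n x - f x) * (un n x - u x))" "integrable lborel (\<lambda>x. (fn n x - f x) * u x)"
      "integrable lborel (\<lambda>x. f x * (un n x - u x))" "integrable lborel (\<lambda>x. f x * u x)"
      by (intro L2_mult_integrable L2_diff f u fn un)+
    have "(\<integral>x. fn n x * un n x \<partial>lborel)
      = (\<integral>x. (fn n x - f x) * (un n x - u x) + (fn n x - f x) * u x + f x * (un n x - u x) + f x * u x \<partial>lborel)"
      by (intro Bochner_Integration.integral_cong) (auto simp: algebra_simps)
    also have "\<dots> = ?A n + ?B n + ?C n + (\<integral>x. f x * u x \<partial>lborel)"
      by (intro trans[OF Bochner_Integration.integral_add] arg_cong2[where f="(+)"] refl Bochner_Integration.integrable_add i)
    finally show ?thesis .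
  qed
  show ?thesis unfolding eq
    using tendsto_add[OF tendsto_add[OF tendsto_add[OF A B] C] tendsto_const] by simp
qed

text \<open>The factor 2 in \<open>N2_add\<close> is too lossy for a limit other than 0, so
  \<open>N2\<close> is written as the integral of a function times its conjugate and the previous
  lemma applies.\<close>

lemma L2_norm_tendsto:
  assumes f: "f \<in> Lp_space 2" and fn: "\<And>n. fn n \<in> Lp_space 2"
    and cf: "(\<lambda>n. N2 (\<lambda>x. fn n x - f x)) \<longlonglongrightarrow> 0"
  shows "(\<lambda>n. N2 (fn n)) \<longlonglongrightarrow> N2 f"
proof -
  have eq: "N2 g = ennreal (Re (\<integral>x. g x * cnj (g x) \<partial>lborel))" if g: "g \<in> Lp_space 2" for g :: "'a \<Rightarrow> complex"
  proof -
    have i: "integrable lborel (\<lambda>x. g x * cnj (g x))" by (intro L2_mult_integrable L2_cnj g)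
    then have i': "integrable lborel (\<lambda>x. (cmod (g x))\<^sup>2)"
      by (simp only: complex_norm_square[symmetric] complex_of_real_integrable_eq)
    have "Re (\<integral>x. g x * cnj (g x) \<partial>lborel) = (\<integral>x. (cmod (g x))\<^sup>2 \<partial>lborel)"
      by (simp only: complex_norm_square[symmetric] integral_complex_of_real Re_complex_of_real)
    then show ?thesis
      unfolding N2_def using i' by (simp add: nn_integral_eq_integral)
  qed
  have "(\<lambda>n. N2 (\<lambda>x. cnj (fn n x) - cnj (f x))) \<longlonglongrightarrow> 0"
    using cf N2_cnj[of "\<lambda>x. fn n x - f x" for n] by simp
  from L2_mult_tendsto[OF f L2_cnj[OF f] fn L2_cnj[OF fn] cf this]
  show ?thesis unfolding eq[OF f] eq[OF fn] by (intro tendsto_ennrealI tendsto_Re)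
qed

definition trunc :: "nat \<Rightarrow> ('a::euclidean_space \<Rightarrow> complex) \<Rightarrow> 'a \<Rightarrow> complex" where
  "trunc n f = (\<lambda>x. indicator (cball 0 (real n)) x * f x)"

lemma trunc_L2: "f \<in> Lp_space 2 \<Longrightarrow> trunc n f \<in> Lp_space 2"
  unfolding trunc_def by (rule L2_bound_mult[where C=1]) (auto simp: indicator_def)

lemma indicator_L2:
  assumes [measurable]: "A \<in> sets borel" and "emeasure lborel A < \<infinity>"
  shows "(\<lambda>x. indicator A x :: complex) \<in> Lp_space 2"
proof (rule L2_I)
  have "emeasure lborel A = (\<integral>\<^sup>+x. indicator A x \<partial>lborel)" by simp
  also have "\<dots> = N2 (\<lambda>x. indicator A x)"
    unfolding N2_def by (intro nn_integral_cong) (auto simp: indicator_def)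
  finally show "N2 (\<lambda>x. indicator A x) < \<infinity>" using assms(2) by simp
qed measurable

text \<open>The truncation is f times the indicator of a ball, a product of two square integrable
  functions.\<close>

lemma trunc_integrable: "f \<in> Lp_space 2 \<Longrightarrow> integrable lborel (trunc n f)"
  unfolding trunc_def
  by (intro L2_mult_integrable indicator_L2) (auto simp: emeasure_lborel_cball_finite[unfolded infinity_ennreal_def])

lemma trunc_tendsto:
  assumes f: "f \<in> Lp_space 2"
  shows "(\<lambda>n. N2 (\<lambda>x. trunc n f x - f x)) \<longlonglongrightarrow> 0"
proof -
  note [measurable] = L2_measurable[OF f]
  have "(\<lambda>n. \<integral>\<^sup>+x. ennreal ((cmod (trunc n f x - f x))\<^sup>2) \<partial>lborel) \<longlonglongrightarrow> (\<integral>\<^sup>+x. 0 \<partial>(lborel::'a measure))"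
  proof (rule nn_integral_dominated_convergence[where w="\<lambda>x. ennreal ((cmod (f x))\<^sup>2)"])
    show "AE x in lborel. (\<lambda>n. ennreal ((cmod (trunc n f x - f x))\<^sup>2)) \<longlonglongrightarrow> 0"
    proof (rule AE_I2)
      fix x
      have "eventually (\<lambda>n. ennreal ((cmod (trunc n f x - f x))\<^sup>2) = 0) sequentially"
        using eventually_ge_at_top[of "nat \<lceil>norm x\<rceil>"]
        by eventually_elim (auto simp: trunc_def indicator_def le_nat_iff ceiling_le_iff)
      then show "(\<lambda>n. ennreal ((cmod (trunc n f x - f x))\<^sup>2)) \<longlonglongrightarrow> 0" by (simp add: tendsto_eventually)
    qed
    show "(\<integral>\<^sup>+x. ennreal ((cmod (f x))\<^sup>2) \<partial>lborel) < \<infinity>" using f by (simp add: L2_iff N2_def)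
  qed (auto simp: trunc_def indicator_def)
  then show "(\<lambda>n. N2 (\<lambda>x. trunc n f x - f x)) \<longlonglongrightarrow> 0" by (simp add: N2_def)
qed

text \<open>Riesz-Fischer. Along a fast subsequence the squared increments, weighted by 2^k, still
  have a finite total integral; so almost everywhere the increments decay geometrically and the
  subsequence converges. Fatou's lemma then carries the Cauchy estimate over to the limit.\<close>

lemma L2_complete:
  fixes s :: "nat \<Rightarrow> 'a::euclidean_space \<Rightarrow> complex"
  assumes s: "\<And>n. s n \<in> Lp_space 2"
    and cauchy: "\<And>e. e > 0 \<Longrightarrow> \<exists>M. \<forall>m\<ge>M. \<forall>n\<ge>M. N2 (\<lambda>x. s m x - s n x) < e"
  shows "\<exists>F. F \<in> Lp_space 2 \<and> (\<lambda>n. N2 (\<lambda>x. s n x - F x)) \<longlonglongrightarrow> 0"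
proof -
  note [measurable] = L2_measurable[OF s]
  have "\<exists>M. \<forall>m\<ge>M. \<forall>n\<ge>M. N2 (\<lambda>x. s m x - s n x) < ennreal ((1/4)^k)" for k
    by (rule cauchy) simp
  then obtain M where M: "\<And>k m n. m \<ge> M k \<Longrightarrow> n \<ge> M k \<Longrightarrow> N2 (\<lambda>x. s m x - s n x) < ennreal ((1/4)^k)"
    by metis
  \<comment> \<open>The partial sum makes \<open>r j\<close> at least \<open>M k\<close> for all k
    <= j although \<open>M\<close> may fail to be monotone; the summand k makes the indices tend to
    infinity.\<close>
  define r where "r k = k + (\<Sum>i\<le>k. M i)" for k
  have rM: "r j \<ge> M k" if "k \<le> j" for k j
    unfolding r_def using member_le_sum[of k "{..j}" M] that by simp
  have rk: "r k \<ge> k" for k by (simp add: r_def)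
  define d where "d k x = cmod (s (r (Suc k)) x - s (r k) x)" for k x
  have [measurable]: "d k \<in> borel_measurable borel" for k unfolding d_def by measurable
  \<comment> \<open>The increments have squared norm below 4^-k, so the weight 2^k leaves a
    convergent series and turns a bound on it into geometric decay of \<open>d k x\<close>.\<close>
  define D where "D x = (\<Sum>k. ennreal (2^k * (d k x)\<^sup>2))" for x
  have [measurable]: "D \<in> borel_measurable borel" unfolding D_def by measurable
  have "(\<integral>\<^sup>+x. D x \<partial>lborel) = (\<Sum>k. \<integral>\<^sup>+x. ennreal (2^k * (d k x)\<^sup>2) \<partial>lborel)"
    unfolding D_def by (rule nn_integral_suminf) measurable
  also have "\<dots> \<le> (\<Sum>k. ennreal ((1/2)^k))"
  proof (intro suminf_le)
    fix k
    have "(\<integral>\<^sup>+x. ennreal (2^k * (d k x)\<^sup>2) \<partial>lborel) = ennreal (2^k) * N2 (\<lambda>x. s (r (Suc k)) x - s (r k) x)"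
      unfolding N2_def d_def by (simp add: ennreal_mult nn_integral_cmult)
    also have "\<dots> \<le> ennreal (2^k) * ennreal ((1/4)^k)"
      by (intro mult_left_mono M[THEN less_imp_le] rM) auto
    also have "\<dots> = ennreal ((1/2)^k)"
      by (simp add: ennreal_mult[symmetric] power_mult_distrib[symmetric])
    finally show "(\<integral>\<^sup>+x. ennreal (2^k * (d k x)\<^sup>2) \<partial>lborel) \<le> ennreal ((1/2)^k)" .
  qed auto
  also have "\<dots> < \<infinity>"
    by (subst suminf_ennreal2) (auto intro!: summable_geometric)
  finally have "AE x in lborel. D x \<noteq> \<infinity>"
    by (intro nn_integral_PInf_AE) (auto simp: less_top)
  then have conv: "AE x in lborel. convergent (\<lambda>k. s (r k) x)"
  proof eventually_elim
    case (elim x)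
    then obtain B where B: "0 \<le> B" "D x = ennreal B" by (cases "D x") auto
    have dB: "d k x \<le> sqrt B * (sqrt (1/2))^k" for k
    proof -
      have "(\<Sum>j\<in>{k}. ennreal (2^j * (d j x)\<^sup>2)) \<le> D x"
        unfolding D_def by (rule sum_le_suminf) (rule summableI, simp_all)
      then have "ennreal (2^k * (d k x)\<^sup>2) \<le> ennreal B" unfolding B(2) by simp
      then have "2^k * (d k x)\<^sup>2 \<le> B" using B(1) ennreal_le_iff by blast
      then have "(d k x)\<^sup>2 \<le> B * (1/2)^k" by (simp add: field_simps power_divide)
      then have "d k x \<le> sqrt (B * (1/2)^k)" by (simp add: real_le_rsqrt)
      then show ?thesis by (simp add: real_sqrt_mult real_sqrt_power)
    qed
    have "summable (\<lambda>k. sqrt B * (sqrt (1/2))^k)"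
      by (intro summable_mult summable_geometric) (simp add: real_sqrt_lt_1_iff)
    then have "summable (\<lambda>k. s (r (Suc k)) x - s (r k) x)"
      by (rule summable_comparison_test'[where N=0]) (use dB in \<open>simp add: d_def\<close>)
    then have "convergent (\<lambda>n. \<Sum>k<n. s (r (Suc k)) x - s (r k) x)"
      by (simp add: summable_iff_convergent)
    then have "convergent (\<lambda>n. s (r n) x - s (r 0) x)"
      by (simp add: sum_lessThan_telescope[of "\<lambda>k. s (r k) x"])
    then show ?case
      using convergent_add[of "\<lambda>n. s (r n) x - s (r 0) x" "\<lambda>_. s (r 0) x"] by (simp add: convergent_const)
  qed
  define F where "F x = lim (\<lambda>k. s (r k) x)" for x
  have [measurable]: "F \<in> borel_measurable borel" unfolding F_def by measurable
  \<comment> \<open>Fatou along the subsequence: whatever bounds the distance of \<open>s n\<close>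
    to all late \<open>s k\<close> also bounds its distance to \<open>F\<close>.\<close>
  have close: "N2 (\<lambda>x. s n x - F x) \<le> e" if "e > 0" "\<And>k. k \<ge> K \<Longrightarrow> N2 (\<lambda>x. s n x - s k x) \<le> e" for n e K
  proof -
    have "N2 (\<lambda>x. s n x - F x) = (\<integral>\<^sup>+x. liminf (\<lambda>k. ennreal ((cmod (s n x - s (r k) x))\<^sup>2)) \<partial>lborel)"
      unfolding N2_def
    proof (rule nn_integral_cong_AE, use conv in eventually_elim)
      case (elim x)
      then have "(\<lambda>k. s (r k) x) \<longlonglongrightarrow> F x" unfolding F_def by (simp add: convergent_LIMSEQ_iff)
      then have "(\<lambda>k. ennreal ((cmod (s n x - s (r k) x))\<^sup>2)) \<longlonglongrightarrow> ennreal ((cmod (s n x - F x))\<^sup>2)"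
        by (intro tendsto_intros)
      then show ?case by (intro lim_imp_Liminf[symmetric]) auto
    qed
    also have "\<dots> \<le> liminf (\<lambda>k. N2 (\<lambda>x. s n x - s (r k) x))"
      unfolding N2_def by (intro nn_integral_liminf) measurable
    also have "\<dots> \<le> liminf (\<lambda>k. e)"
      by (intro Liminf_mono eventually_sequentiallyI[of K] that(2) order_trans[OF _ rk])
    also have "\<dots> = e" by (rule lim_imp_Liminf) auto
    finally show ?thesis .
  qed
  have lim: "(\<lambda>n. N2 (\<lambda>x. s n x - F x)) \<longlonglongrightarrow> 0"
  proof (rule order_tendstoI)
    fix a :: ennreal assume "0 < a"
    then obtain b where b: "0 < b" "b < a" using dense by blast
    obtain M where "\<And>m n. m \<ge> M \<Longrightarrow> n \<ge> M \<Longrightarrow> N2 (\<lambda>x. s m x - s n x) < b"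
      using cauchy[OF b(1)] by blast
    then have "N2 (\<lambda>x. s n x - F x) \<le> b" if "n \<ge> M" for n
      using that by (intro close[of b M] b) (auto intro: less_imp_le)
    then have "N2 (\<lambda>x. s n x - F x) < a" if "n \<ge> M" for n
      using that b by (meson le_less_trans)
    then show "eventually (\<lambda>n. N2 (\<lambda>x. s n x - F x) < a) sequentially"
      by (rule eventually_sequentiallyI)
  qed auto
  \<comment> \<open>\<open>F\<close> differs from some \<open>s n\<close> by a function of finite
    norm, so it is square integrable itself.\<close>
  from order_tendstoD(2)[OF lim, of 1] obtain n where "N2 (\<lambda>x. s n x - F x) < 1"
    by (auto simp: eventually_sequentially)
  then have "(\<lambda>x. s n x - F x) \<in> Lp_space 2" by (auto simp: L2_iff elim: order.strict_trans)
  from L2_diff[OF s[of n] this] have "F \<in> Lp_space 2" by simp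
  with lim show ?thesis by blast
qed

section \<open>Affine changes of variables\<close>

lemma nn_integral_affine:
  fixes f :: "'a::euclidean_space \<Rightarrow> ennreal"
  assumes [measurable]: "f \<in> borel_measurable borel" and c: "c \<noteq> 0"
  shows "(\<integral>\<^sup>+x. f x \<partial>lborel) = ennreal (\<bar>c\<bar>^DIM('a)) * (\<integral>\<^sup>+x. f (t + c *\<^sub>R x) \<partial>lborel)"
  by (subst lborel_affine[OF c, of t])
     (simp add: nn_integral_density nn_integral_distr nn_integral_cmult)

lemma integrable_affine:
  fixes f :: "'a::euclidean_space \<Rightarrow> 'b::{banach, second_countable_topology}"
  assumes f: "integrable lborel f" and c: "c \<noteq> 0"
  shows "integrable lborel (\<lambda>x. f (t + c *\<^sub>R x))"
  using f f[THEN borel_measurable_integrable] c unfolding integrable_iff_bounded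
  by (subst (asm) nn_integral_affine[where c=c and t=t]) (auto simp: ennreal_mult_less_top)

lemma integrable_affine_iff:
  fixes f :: "'a::euclidean_space \<Rightarrow> 'b::{banach, second_countable_topology}"
  assumes c: "c \<noteq> 0"
  shows "integrable lborel (\<lambda>x. f (t + c *\<^sub>R x)) \<longleftrightarrow> integrable lborel f"
  using integrable_affine[of f c t] integrable_affine[of "\<lambda>x. f (t + c *\<^sub>R x)" "1/c" "-(1/c) *\<^sub>R t"] c
  by (auto simp: scaleR_right_diff_distrib)

lemma integral_affine:
  fixes f :: "'a::euclidean_space \<Rightarrow> 'b::{banach, second_countable_topology}"
  assumes c: "c \<noteq> 0"
  shows "(\<integral>x. f x \<partial>lborel) = \<bar>c\<bar>^DIM('a) *\<^sub>R (\<integral>x. f (t + c *\<^sub>R x) \<partial>lborel)"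
proof cases
  assume f[measurable]: "integrable lborel f" then show ?thesis
    using c f f[THEN borel_measurable_integrable] f[THEN integrable_affine, of c t]
    by (subst lborel_affine[OF c, of t]) (simp add: integral_density integral_distr)
next
  assume "\<not> integrable lborel f" with c show ?thesis
    by (simp add: integrable_affine_iff not_integrable_integral_eq)
qed

lemma AE_affine:
  fixes P :: "'a::euclidean_space \<Rightarrow> bool"
  assumes c: "c \<noteq> 0" and P: "AE x in lborel. P x"
  shows "AE x in lborel. P (t + c *\<^sub>R x)"
proof -
  from P obtain N where N: "N \<in> null_sets lborel" "{x. \<not> P x} \<subseteq> N" by (auto simp: eventually_ae_filter)
  then have [measurable]: "N \<in> sets borel" by auto
  have "0 = (\<integral>\<^sup>+x. indicator N x \<partial>lborel)" using null_setsD1[OF N(1)] by simp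
  also have "\<dots> = ennreal (\<bar>c\<bar>^DIM('a)) * (\<integral>\<^sup>+x. indicator N (t + c *\<^sub>R x) \<partial>lborel)"
    by (rule nn_integral_affine[OF _ c]) measurable
  finally have "(\<integral>\<^sup>+x. indicator N (t + c *\<^sub>R x) \<partial>lborel) = (0::ennreal)"
    using c by (auto simp: ennreal_eq_0_iff zero_less_power not_le[symmetric] power_le_zero_eq)
  then have "AE x in lborel. indicator N (t + c *\<^sub>R x) = (0::ennreal)"
    by (subst (asm) nn_integral_0_iff_AE) auto
  then show ?thesis
    by eventually_elim (use N(2) in \<open>auto simp: indicator_def split: if_splits\<close>)
qed

lemma nn_integral_translate:
  fixes f :: "'a::euclidean_space \<Rightarrow> ennreal"
  assumes [measurable]: "f \<in> borel_measurable borel"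
  shows "(\<integral>\<^sup>+x. f (x + z) \<partial>lborel) = (\<integral>\<^sup>+x. f x \<partial>lborel)"
  using nn_integral_affine[of f 1 z] by (simp add: add.commute)

lemma AE_translate:
  fixes P :: "'a::euclidean_space \<Rightarrow> bool"
  assumes P: "AE x in lborel. P x"
  shows "AE x in lborel. P (x + z)"
  using AE_affine[of 1 P z] P by (simp add: add.commute)

lemma N2_translate:
  assumes [measurable]: "f \<in> borel_measurable borel"
  shows "N2 (\<lambda>x. f (x + z)) = N2 f"
  unfolding N2_def using nn_integral_translate[of "\<lambda>x. ennreal ((cmod (f x))\<^sup>2)" z] by simp

lemma L2_translate: "f \<in> Lp_space 2 \<Longrightarrow> (\<lambda>x. f (x + z)) \<in> Lp_space 2"
  by (auto simp: L2_iff N2_translate)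

section \<open>The Gaussian and its Fourier transform\<close>

lemma lborel_integral_prod:
  fixes g :: "'a::euclidean_space \<Rightarrow> real \<Rightarrow> complex"
  assumes g: "\<And>b. b \<in> Basis \<Longrightarrow> integrable lborel (g b)"
  shows "(\<integral>x. (\<Prod>b\<in>Basis. g b (x \<bullet> b)) \<partial>lborel) = (\<Prod>b\<in>Basis. \<integral>y. g b y \<partial>lborel)"
proof -
  interpret product_sigma_finite "\<lambda>_::'a. lborel :: real measure" ..
  note [measurable] = borel_measurable_integrable[OF g]
  have "(\<integral>x. (\<Prod>b\<in>Basis. g b (x \<bullet> b)) \<partial>lborel)
      = (\<integral>f. (\<Prod>b\<in>Basis. g b ((\<Sum>b'\<in>Basis. f b' *\<^sub>R b') \<bullet> b)) \<partial>(\<Pi>\<^sub>M b\<in>(Basis::'a set). lborel))"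
    by (subst lborel_eq, subst integral_distr) auto
  also have "\<dots> = (\<integral>f. (\<Prod>b\<in>Basis. g b (f b)) \<partial>(\<Pi>\<^sub>M b\<in>(Basis::'a set). lborel))"
    by (intro Bochner_Integration.integral_cong prod.cong refl) (simp add: inner_sum_left inner_Basis if_distrib cong: if_cong)
  also have "\<dots> = (\<Prod>b\<in>Basis. \<integral>y. g b y \<partial>lborel)"
    by (intro product_integral_prod g) auto
  finally show ?thesis .
qed

lemma gaussian_char_1d:
  fixes t :: real
  shows "integrable lborel (\<lambda>y. complex_of_real (exp (- pi * y\<^sup>2)) * exp (- 2 * of_real pi * \<i> * of_real (y * t)))" (is "integrable _ ?f")
    and "(\<integral>y. complex_of_real (exp (- pi * y\<^sup>2)) * exp (- 2 * of_real pi * \<i> * of_real (y * t)) \<partial>lborel) = of_real (exp (- pi * t\<^sup>2))"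
proof -
  \<comment> \<open>The substitution x = c y turns the density exp(-x^2/2)/sqrt(2 pi) into exp(-pi
    y^2)/c, so the known characteristic function of the normal distribution, at -c t, gives the
    transform.\<close>
  define c where "c = sqrt (2 * pi)"
  have c: "c > 0" "c\<^sup>2 = 2 * pi" unfolding c_def by auto
  let ?h = "\<lambda>x. std_normal_density x *\<^sub>R exp (\<i> * complex_of_real (- c * t) * complex_of_real x)"
  have h: "?h (0 + c * y) = (1 / c) *\<^sub>R ?f y" for y
  proof -
    have "complex_of_real c * complex_of_real c = 2 * complex_of_real pi"
      using arg_cong[OF c(2), of complex_of_real] by (simp add: power2_eq_square)
    moreover have "\<i> * complex_of_real (- c * t) * complex_of_real (c * y)
        = - (complex_of_real c * complex_of_real c) * \<i> * of_real (y * t)"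
      by (simp add: mult_ac)
    ultimately have "\<i> * complex_of_real (- c * t) * complex_of_real (c * y) = - 2 * of_real pi * \<i> * of_real (y * t)"
      by simp
    moreover have "std_normal_density (c * y) = (1 / c) * exp (- pi * y\<^sup>2)"
      by (simp add: std_normal_density_def c_def power_mult_distrib)
    ultimately show ?thesis
      by (simp only: add_0 scaleR_conv_of_real of_real_mult mult.assoc)
  qed
  have ih: "integrable lborel ?h"
  proof (rule Bochner_Integration.integrable_bound)
    show "integrable lborel std_normal_density" by simp
  qed (auto simp: norm_exp_eq_Re)
  from lborel_integrable_real_affine[OF ih, of c 0] c
  have "integrable lborel (\<lambda>y. (1 / c) *\<^sub>R ?f y)" unfolding h by simp
  from integrable_scaleR_right[OF this, of c] c show "integrable lborel ?f" by simp
  have "of_real (exp (- (- c * t)\<^sup>2 / 2)) = char std_normal_distribution (- c * t)"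
    by (simp add: char_std_normal_distribution)
  also have "\<dots> = (\<integral>x. ?h x \<partial>lborel)"
    unfolding char_def by (subst integral_density) (auto simp: normal_density_nonneg mult_ac)
  also have "\<dots> = \<bar>c\<bar> *\<^sub>R (\<integral>y. (1 / c) *\<^sub>R ?f y \<partial>lborel)"
    using lborel_integral_real_affine[of c ?h 0] c unfolding h by simp
  also have "\<dots> = (\<integral>y. ?f y \<partial>lborel)" using c by simp
  also have "exp (- (- c * t)\<^sup>2 / 2) = exp (- pi * t\<^sup>2)" using c(2) by (simp add: power_mult_distrib)
  finally show "(\<integral>y. ?f y \<partial>lborel) = of_real (exp (- pi * t\<^sup>2))" by simp
qed

lemma exp_norm_sq_prod:
  fixes x :: "'a::euclidean_space"
  shows "exp (- pi * (norm x)\<^sup>2) = (\<Prod>b\<in>Basis. exp (- pi * (x \<bullet> b)\<^sup>2))"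
  by (simp add: exp_sum[symmetric] norm_eq_sqrt_inner euclidean_inner[of x x] sum_distrib_left power2_eq_square
    real_sqrt_mult_self sum_nonneg flip: sum_negf)

lemma gaussian_integrable:
  "integrable lborel (\<lambda>x::'a::euclidean_space. exp (- pi * (norm x)\<^sup>2))"
proof -
  have i: "integrable lborel (\<lambda>y::real. exp (- pi * y\<^sup>2))"
    using gaussian_char_1d(1)[of 0] complex_of_real_integrable_eq[of lborel "\<lambda>y. exp (- pi * y\<^sup>2)"]
    by (simp del: complex_of_real_integrable_eq of_real_exp)
  have "(\<integral>\<^sup>+x. ennreal (exp (- pi * (norm x)\<^sup>2)) \<partial>(lborel::'a measure))
      = (\<integral>\<^sup>+x. (\<Prod>b\<in>Basis. ennreal (exp (- pi * (x \<bullet> b)\<^sup>2))) \<partial>(lborel::'a measure))"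
    unfolding exp_norm_sq_prod by (simp add: prod_ennreal)
  also have "\<dots> = (\<Prod>b\<in>(Basis::'a set). (\<integral>\<^sup>+y. ennreal (exp (- pi * y\<^sup>2)) \<partial>lborel))"
    by (rule nn_integral_lborel_prod) auto
  also have "\<dots> < \<infinity>"
    using i by (simp add: integrable_iff_bounded power_less_top_ennreal)
  finally show ?thesis by (simp add: integrable_iff_bounded)
qed

lemma gaussian_char:
  fixes \<xi> :: "'a::euclidean_space"
  shows "fourier_integral (\<lambda>x. of_real (exp (- pi * (norm x)\<^sup>2))) \<xi> = of_real (exp (- pi * (norm \<xi>)\<^sup>2))"
proof -
  have "exp (- 2 * of_real pi * \<i> * of_real (x \<bullet> \<xi>))
      = (\<Prod>b\<in>Basis. exp (- 2 * of_real pi * \<i> * of_real ((x \<bullet> b) * (\<xi> \<bullet> b))))" for x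
    by (subst exp_sum[symmetric]) (simp_all add: euclidean_inner[of x \<xi>] sum_distrib_left)
  then have "fourier_integral (\<lambda>x. of_real (exp (- pi * (norm x)\<^sup>2))) \<xi>
     = (\<integral>x. (\<Prod>b\<in>Basis. complex_of_real (exp (- pi * (x \<bullet> b)\<^sup>2)) * exp (- 2 * of_real pi * \<i> * of_real ((x \<bullet> b) * (\<xi> \<bullet> b)))) \<partial>lborel)"
    unfolding fourier_integral_def exp_norm_sq_prod
    by (intro Bochner_Integration.integral_cong refl)
      (simp add: prod.distrib)
  also have "\<dots> = (\<Prod>b\<in>Basis. of_real (exp (- pi * (\<xi> \<bullet> b)\<^sup>2)))"
    by (simp only: lborel_integral_prod[OF gaussian_char_1d(1)] gaussian_char_1d(2))
  also have "\<dots> = of_real (exp (- pi * (norm \<xi>)\<^sup>2))"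
    unfolding exp_norm_sq_prod by simp
  finally show ?thesis .
qed

section \<open>Continuity of translations\<close>

definition L1_translation_continuous :: "('a::euclidean_space \<Rightarrow> complex) \<Rightarrow> bool" where
  "L1_translation_continuous f \<longleftrightarrow>
    (\<forall>z::nat \<Rightarrow> 'a. z \<longlonglongrightarrow> 0 \<longrightarrow> (\<lambda>n. \<integral>\<^sup>+x. ennreal (cmod (f (x + z n) - f x)) \<partial>lborel) \<longlonglongrightarrow> 0)"

text \<open>An \<epsilon>/3 argument: the two approximation errors coincide because Lebesgue measure
  is translation invariant.\<close>

lemma L1_translation_continuous_closed:
  fixes f :: "'a::euclidean_space \<Rightarrow> complex"
  assumes [measurable]: "f \<in> borel_measurable borel"
    and appr: "\<And>e::real. e > 0 \<Longrightarrow> \<exists>g. g \<in> borel_measurable borel \<and> L1_translation_continuous g \<and>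
        (\<integral>\<^sup>+x. ennreal (cmod (f x - g x)) \<partial>lborel) \<le> ennreal e"
  shows "L1_translation_continuous f"
  unfolding L1_translation_continuous_def
proof (intro allI impI order_tendstoI)
  fix z :: "nat \<Rightarrow> 'a" and a :: ennreal assume z: "z \<longlonglongrightarrow> 0" and "0 < a"
  then obtain b where b: "0 < b" "b < a" using dense by blast
  then obtain r where r: "b = ennreal r" by (cases b) auto
  have r0: "r > 0" using b r by (cases "r > 0") (auto simp: ennreal_neg not_less)
  obtain g where [measurable]: "g \<in> borel_measurable borel" and g: "L1_translation_continuous g"
    "(\<integral>\<^sup>+x. ennreal (cmod (f x - g x)) \<partial>lborel) \<le> ennreal (r/3)"
    using appr[of "r/3"] r0 by auto
  have "(\<lambda>n. \<integral>\<^sup>+x. ennreal (cmod (g (x + z n) - g x)) \<partial>lborel) \<longlonglongrightarrow> 0"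
    using g z by (simp add: L1_translation_continuous_def)
  then have "eventually (\<lambda>n. (\<integral>\<^sup>+x. ennreal (cmod (g (x + z n) - g x)) \<partial>lborel) < ennreal (r/3)) sequentially"
    using r0 by (intro order_tendstoD(2)) (auto simp: ennreal_zero_less_divide)
  then show "eventually (\<lambda>n. (\<integral>\<^sup>+x. ennreal (cmod (f (x + z n) - f x)) \<partial>lborel) < a) sequentially"
  proof eventually_elim
    case (elim n)
    have "(\<integral>\<^sup>+x. ennreal (cmod (f (x + z n) - f x)) \<partial>lborel) \<le>
      (\<integral>\<^sup>+x. ennreal (cmod (f (x + z n) - g (x + z n))) + ennreal (cmod (g (x + z n) - g x)) + ennreal (cmod (f x - g x)) \<partial>lborel)"
    proof (intro nn_integral_mono)
      fix x
      have "cmod (f (x + z n) - f x) \<le> cmod (f (x + z n) - g (x + z n)) + cmod (g (x + z n) - g x) + cmod (f x - g x)"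
        using norm_triangle_ineq[of "f (x + z n) - g (x + z n)" "g (x + z n) - f x"]
          norm_triangle_ineq[of "g (x + z n) - g x" "g x - f x"] norm_minus_commute[of "f x" "g x"] by simp
      then show "ennreal (cmod (f (x + z n) - f x)) \<le> ennreal (cmod (f (x + z n) - g (x + z n))) + ennreal (cmod (g (x + z n) - g x)) + ennreal (cmod (f x - g x))"
        by (simp add: ennreal_plus[symmetric] del: ennreal_plus)
    qed
    also have "\<dots> = (\<integral>\<^sup>+x. ennreal (cmod (f (x + z n) - g (x + z n))) \<partial>lborel)
        + (\<integral>\<^sup>+x. ennreal (cmod (g (x + z n) - g x)) \<partial>lborel) + (\<integral>\<^sup>+x. ennreal (cmod (f x - g x)) \<partial>lborel)"
      by (subst nn_integral_add; (subst nn_integral_add)?; measurable)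
    also have "(\<integral>\<^sup>+x. ennreal (cmod (f (x + z n) - g (x + z n))) \<partial>lborel) = (\<integral>\<^sup>+x. ennreal (cmod (f x - g x)) \<partial>lborel)"
      by (rule nn_integral_translate[of "\<lambda>x. ennreal (cmod (f x - g x))"]) measurable
    also have "(\<integral>\<^sup>+x. ennreal (cmod (f x - g x)) \<partial>lborel) + (\<integral>\<^sup>+x. ennreal (cmod (g (x + z n) - g x)) \<partial>lborel)
       + (\<integral>\<^sup>+x. ennreal (cmod (f x - g x)) \<partial>lborel) \<le> ennreal (r/3) + ennreal (r/3) + ennreal (r/3)"
      using g(2) elim by (intro add_mono) auto
    also have "\<dots> = b" using r r0 by (simp add: ennreal_plus[symmetric] del: ennreal_plus)
    finally show ?case using b by simp
  qed
qed auto

text \<open>A point of the open set U stays in U under small translations, so the indicator of the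
  points leaving U tends to 0 pointwise, dominated by \<open>indicator U\<close>. The points
  entering U give the same quantity for the opposite translation.\<close>

lemma L1_translation_continuous_open:
  fixes U :: "'a::euclidean_space set"
  assumes U: "open U" and fin: "emeasure lborel U < \<infinity>"
  shows "L1_translation_continuous (indicator U)"
  unfolding L1_translation_continuous_def
proof (intro allI impI)
  have [measurable]: "U \<in> sets borel" using U by simp
  let ?a = "\<lambda>z. \<integral>\<^sup>+x. indicator U x * indicator (-U) (x + z) \<partial>(lborel::'a measure)"
  have a: "(\<lambda>n. ?a (z n)) \<longlonglongrightarrow> 0" if z: "z \<longlonglongrightarrow> 0" for z :: "nat \<Rightarrow> 'a"
  proof -
    have "(\<lambda>n. ?a (z n)) \<longlonglongrightarrow> (\<integral>\<^sup>+x. 0 \<partial>(lborel::'a measure))"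
    proof (rule nn_integral_dominated_convergence[where w="indicator U"])
      show "AE x in lborel. (\<lambda>n. indicator U x * indicator (-U) (x + z n)) \<longlonglongrightarrow> (0::ennreal)"
      proof (rule AE_I2)
        fix x
        show "(\<lambda>n. indicator U x * indicator (-U) (x + z n)) \<longlonglongrightarrow> (0::ennreal)"
        proof (cases "x \<in> U")
          case True
          have "(\<lambda>n. x + z n) \<longlonglongrightarrow> x + 0" by (intro tendsto_intros z)
          then have "eventually (\<lambda>n. x + z n \<in> U) sequentially"
            using U True by (auto simp: tendsto_def)
          then have "eventually (\<lambda>n. indicator U x * indicator (-U) (x + z n) = (0::ennreal)) sequentially"
            by eventually_elim auto
          then show ?thesis by (rule tendsto_eventually)
        qed simp
      qed
      show "(\<integral>\<^sup>+x. indicator U x \<partial>lborel) < \<infinity>" using fin by simp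
    qed (auto simp: indicator_def)
    then show ?thesis by simp
  qed
  fix z :: "nat \<Rightarrow> 'a" assume z: "z \<longlonglongrightarrow> 0"
  have eq: "(\<integral>\<^sup>+x. ennreal (cmod (indicator U (x + z n) - indicator U x)) \<partial>lborel) = ?a (- z n) + ?a (z n)" for n
  proof -
    have "(\<integral>\<^sup>+x. ennreal (cmod (indicator U (x + z n) - indicator U x)) \<partial>lborel)
       = (\<integral>\<^sup>+x. indicator U (x + z n) * indicator (-U) (x + z n + - z n) + indicator U x * indicator (-U) (x + z n) \<partial>lborel)"
      by (intro nn_integral_cong) (auto simp: indicator_def)
    also have "\<dots> = (\<integral>\<^sup>+x. indicator U (x + z n) * indicator (-U) (x + z n + - z n) \<partial>lborel) + ?a (z n)"
      by (rule nn_integral_add) measurable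
    also have "(\<integral>\<^sup>+x. indicator U (x + z n) * indicator (-U) (x + z n + - z n) \<partial>lborel) = ?a (- z n)"
      by (rule nn_integral_translate[of "\<lambda>x. indicator U x * indicator (-U) (x + - z n)"]) measurable
    finally show ?thesis .
  qed
  have "(\<lambda>n. - z n) \<longlonglongrightarrow> - 0" by (intro tendsto_intros z)
  then have "(\<lambda>n. - z n) \<longlonglongrightarrow> 0" by simp
  from tendsto_add[OF a[OF this] a[OF z]]
  show "(\<lambda>n. \<integral>\<^sup>+x. ennreal (cmod (indicator U (x + z n) - indicator U x)) \<partial>lborel) \<longlonglongrightarrow> 0"
    unfolding eq by simp
qed

text \<open>Reduction to indicators by the induction rule for integrable functions; a Borel set of
  finite measure is approximated from outside by open sets, for which the previous lemma
  holds.\<close>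

lemma L1_translation_continuous_integrable:
  fixes f :: "'a::euclidean_space \<Rightarrow> complex"
  assumes "integrable lborel f"
  shows "L1_translation_continuous f"
  using assms
proof (induction rule: integrable_induct)
  case (base A c)
  then have [measurable]: "A \<in> sets borel" by simp
  have "L1_translation_continuous (indicator A)"
  proof (rule L1_translation_continuous_closed)
    fix e :: real assume "e > 0"
    have "A \<in> sets lebesgue" by simp
    from sets_lebesgue_outer_open[OF this \<open>e > 0\<close>]
    obtain U where U: "open U" "A \<subseteq> U" "emeasure lebesgue (U - A) < ennreal e" by metis
    have [measurable]: "U \<in> sets borel" using U by simp
    have UA: "emeasure lborel (U - A) < ennreal e" using U(3) by simp
    have "emeasure lborel U = emeasure lborel A + emeasure lborel (U - A)"
      using U(2) by (subst plus_emeasure) (auto simp: Un_absorb1)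
    then have "emeasure lborel U < \<infinity>" using UA base by (auto intro: less_trans)
    then have "L1_translation_continuous (indicator U)" by (rule L1_translation_continuous_open[OF U(1)])
    moreover have "(\<integral>\<^sup>+x. ennreal (cmod (indicator A x - indicator U x)) \<partial>lborel) \<le> ennreal e"
    proof -
      have "(\<integral>\<^sup>+x. ennreal (cmod (indicator A x - indicator U x)) \<partial>lborel) = (\<integral>\<^sup>+x. indicator (U - A) x \<partial>lborel)"
        using U(2) by (intro nn_integral_cong) (auto simp: indicator_def)
      then show ?thesis using UA by simp
    qed
    ultimately show "\<exists>g. g \<in> borel_measurable borel \<and> L1_translation_continuous g \<and>
        (\<integral>\<^sup>+x. ennreal (cmod (indicator A x - g x)) \<partial>lborel) \<le> ennreal e"
      by (intro exI[of _ "indicator U"] conjI) measurable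
  qed measurable
  then have *: "(\<lambda>n. ennreal (cmod c) * (\<integral>\<^sup>+x. ennreal (cmod (indicator A (x + z n) - indicator A x)) \<partial>lborel)) \<longlonglongrightarrow> ennreal (cmod c) * 0"
    if "z \<longlonglongrightarrow> 0" for z :: "nat \<Rightarrow> 'a"
    using that by (intro tendsto_mult_ennreal tendsto_const) (auto simp: L1_translation_continuous_def)
  have eq: "(\<integral>\<^sup>+x. ennreal (cmod (indicator A (x + y) *\<^sub>R c - indicator A x *\<^sub>R c)) \<partial>lborel)
     = ennreal (cmod c) * (\<integral>\<^sup>+x. ennreal (cmod (indicator A (x + y) - indicator A x)) \<partial>lborel)" for y
    by (subst nn_integral_cmult[symmetric]) (auto intro!: nn_integral_cong simp: indicator_def)
  show ?case unfolding L1_translation_continuous_def eq using * by simp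
next
  case (add f g)
  then have [measurable]: "f \<in> borel_measurable borel" "g \<in> borel_measurable borel" by auto
  show ?case unfolding L1_translation_continuous_def
  proof (intro allI impI)
    fix z :: "nat \<Rightarrow> 'a" assume z: "z \<longlonglongrightarrow> 0"
    have "(\<lambda>n. (\<integral>\<^sup>+x. ennreal (cmod (f (x + z n) - f x)) \<partial>lborel) + (\<integral>\<^sup>+x. ennreal (cmod (g (x + z n) - g x)) \<partial>lborel)) \<longlonglongrightarrow> 0 + 0"
      using add z by (intro tendsto_add) (auto simp: L1_translation_continuous_def)
    then have "(\<lambda>n. (\<integral>\<^sup>+x. ennreal (cmod (f (x + z n) - f x)) \<partial>lborel) + (\<integral>\<^sup>+x. ennreal (cmod (g (x + z n) - g x)) \<partial>lborel)) \<longlonglongrightarrow> 0"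
      by simp
    then show "(\<lambda>n. \<integral>\<^sup>+x. ennreal (cmod (f (x + z n) + g (x + z n) - (f x + g x))) \<partial>lborel) \<longlonglongrightarrow> 0"
    proof (rule tendsto_0_ennreal_le)
      fix n
      have "(\<integral>\<^sup>+x. ennreal (cmod (f (x + z n) + g (x + z n) - (f x + g x))) \<partial>lborel)
        \<le> (\<integral>\<^sup>+x. ennreal (cmod (f (x + z n) - f x)) + ennreal (cmod (g (x + z n) - g x)) \<partial>lborel)"
        by (intro nn_integral_mono) (auto simp: ennreal_plus[symmetric] norm_diff_triangle_ineq simp del: ennreal_plus)
      then show "(\<integral>\<^sup>+x. ennreal (cmod (f (x + z n) + g (x + z n) - (f x + g x))) \<partial>lborel)
        \<le> (\<integral>\<^sup>+x. ennreal (cmod (f (x + z n) - f x)) \<partial>lborel) + (\<integral>\<^sup>+x. ennreal (cmod (g (x + z n) - g x)) \<partial>lborel)"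
        by (subst (asm) nn_integral_add) measurable
    qed
  qed
next
  case (lim f s)
  then have [measurable]: "f \<in> borel_measurable borel" "\<And>i. s i \<in> borel_measurable borel" by auto
  have s_lim: "(\<lambda>i. s i x) \<longlonglongrightarrow> f x" and s_le: "cmod (s i x) \<le> 2 * cmod (f x)"
    and s_cont: "L1_translation_continuous (s i)" and f: "integrable lborel f" for i x
    using lim by auto
  show ?case
  proof (rule L1_translation_continuous_closed)
    have "(\<lambda>i. \<integral>\<^sup>+x. ennreal (cmod (f x - s i x)) \<partial>lborel) \<longlonglongrightarrow> (\<integral>\<^sup>+x. 0 \<partial>(lborel::'a measure))"
    proof (rule nn_integral_dominated_convergence[where w="\<lambda>x. 3 * ennreal (cmod (f x))"])
      show "AE x in lborel. ennreal (cmod (f x - s i x)) \<le> 3 * ennreal (cmod (f x))" for i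
      proof (rule AE_I2)
        fix x
        have "cmod (f x - s i x) \<le> cmod (f x) + cmod (s i x)" by (rule norm_triangle_ineq4)
        then have "cmod (f x - s i x) \<le> 3 * cmod (f x)" using s_le[of i x] by simp
        then have "ennreal (cmod (f x - s i x)) \<le> ennreal (3 * cmod (f x))" by (rule ennreal_leI)
        then show "ennreal (cmod (f x - s i x)) \<le> 3 * ennreal (cmod (f x))" by (simp add: ennreal_mult'')
      qed
      show "(\<integral>\<^sup>+x. 3 * ennreal (cmod (f x)) \<partial>lborel) < \<infinity>"
        using f by (simp add: nn_integral_cmult integrable_iff_bounded ennreal_mult_less_top)
      show "AE x in lborel. (\<lambda>i. ennreal (cmod (f x - s i x))) \<longlonglongrightarrow> 0"
      proof (rule AE_I2)
        fix x
        have "(\<lambda>i. ennreal (cmod (f x - s i x))) \<longlonglongrightarrow> ennreal (cmod (f x - f x))"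
          by (intro tendsto_intros s_lim)
        then show "(\<lambda>i. ennreal (cmod (f x - s i x))) \<longlonglongrightarrow> 0" by simp
      qed
    qed measurable
    then have L: "(\<lambda>i. \<integral>\<^sup>+x. ennreal (cmod (f x - s i x)) \<partial>lborel) \<longlonglongrightarrow> 0" by simp
    fix e :: real assume "e > 0"
    with order_tendstoD(2)[OF L, of "ennreal e"] obtain i where "(\<integral>\<^sup>+x. ennreal (cmod (f x - s i x)) \<partial>lborel) < ennreal e"
      by (auto simp: eventually_sequentially)
    then show "\<exists>g. g \<in> borel_measurable borel \<and> L1_translation_continuous g \<and> (\<integral>\<^sup>+x. ennreal (cmod (f x - g x)) \<partial>lborel) \<le> ennreal e"
      using s_cont[of i] by (intro exI[of _ "s i"]) auto
  qed measurable
qed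

text \<open>Cutting f off both in space and in height gives an integrable function bounded by m; for
  such a function the squared difference is at most 2 m times the difference, and continuity in L_1
  applies.\<close>

lemma L2_translation_tendsto:
  fixes f :: "'a::euclidean_space \<Rightarrow> complex"
  assumes f: "f \<in> Lp_space 2" and z: "z \<longlonglongrightarrow> 0"
  shows "(\<lambda>n. N2 (\<lambda>x. f (x + z n) - f x)) \<longlonglongrightarrow> 0"
proof (rule order_tendstoI)
  note [measurable] = L2_measurable[OF f]
  fix a :: ennreal assume "0 < a"
  then obtain b where b: "0 < b" "b < a" using dense by blast
  then obtain r where r: "b = ennreal r" by (cases b) auto
  have r0: "r > 0" using b r by (cases "r > 0") (auto simp: ennreal_neg not_less)
  define F where "F m x = indicator {x. cmod (f x) \<le> real m} x * trunc m f x" for m x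
  have [measurable]: "F m \<in> borel_measurable borel" for m unfolding F_def by (intro borel_measurable_times L2_measurable[OF trunc_L2[OF f]]) measurable
  have FL1: "integrable lborel (F m)" for m
    by (rule Bochner_Integration.integrable_bound[OF trunc_integrable[OF f, of m]])
      (auto simp: F_def indicator_def)
  have FL2: "F m \<in> Lp_space 2" for m
    unfolding F_def by (intro L2_bound_mult[where C=1] trunc_L2 f) (auto simp: indicator_def)
  have Fb: "cmod (F m x) \<le> real m" for m x
    by (auto simp: F_def trunc_def indicator_def)
  have "(\<lambda>m. \<integral>\<^sup>+x. ennreal ((cmod (f x - F m x))\<^sup>2) \<partial>lborel) \<longlonglongrightarrow> (\<integral>\<^sup>+x. 0 \<partial>(lborel::'a measure))"
  proof (rule nn_integral_dominated_convergence[where w="\<lambda>x. ennreal ((cmod (f x))\<^sup>2)"])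
    show "(\<integral>\<^sup>+x. ennreal ((cmod (f x))\<^sup>2) \<partial>lborel) < \<infinity>" using L2_finite[OF f] by (simp add: N2_def)
    show "AE x in lborel. (\<lambda>m. ennreal ((cmod (f x - F m x))\<^sup>2)) \<longlonglongrightarrow> 0"
    proof (rule AE_I2)
      fix x
      have "eventually (\<lambda>m. ennreal ((cmod (f x - F m x))\<^sup>2) = 0) sequentially"
        using eventually_ge_at_top[of "nat \<lceil>norm x\<rceil>"] eventually_ge_at_top[of "nat \<lceil>cmod (f x)\<rceil>"]
        by eventually_elim (auto simp: F_def trunc_def indicator_def le_nat_iff ceiling_le_iff)
      then show "(\<lambda>m. ennreal ((cmod (f x - F m x))\<^sup>2)) \<longlonglongrightarrow> 0" by (simp add: tendsto_eventually)
    qed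
  qed (auto simp: F_def trunc_def indicator_def)
  then have "(\<lambda>m. N2 (\<lambda>x. f x - F m x)) \<longlonglongrightarrow> 0" by (simp add: N2_def)
  \<comment> \<open>The triangle inequalities below add up to 2 + 4 + 4 copies of this bound, and
    10/16 < 1.\<close>
  from order_tendstoD(2)[OF this, of "ennreal (r/16)"] r0
  obtain m where m: "N2 (\<lambda>x. f x - F m x) < ennreal (r/16)" by (auto simp: eventually_sequentially)
  have "(\<lambda>n. \<integral>\<^sup>+x. ennreal (cmod (F m (x + z n) - F m x)) \<partial>lborel) \<longlonglongrightarrow> 0"
    using L1_translation_continuous_integrable[OF FL1] z by (simp add: L1_translation_continuous_def)
  then have "(\<lambda>n. ennreal (2 * real m) * (\<integral>\<^sup>+x. ennreal (cmod (F m (x + z n) - F m x)) \<partial>lborel)) \<longlonglongrightarrow> 0"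
    using tendsto_mult_ennreal[OF tendsto_const, of _ 0 sequentially "ennreal (2 * real m)"] by simp
  then have "(\<lambda>n. N2 (\<lambda>x. F m (x + z n) - F m x)) \<longlonglongrightarrow> 0"
  proof (rule tendsto_0_ennreal_le)
    fix n
    have "(cmod (F m (x + z n) - F m x))\<^sup>2 \<le> 2 * real m * cmod (F m (x + z n) - F m x)" for x
    proof -
      have "cmod (F m (x + z n) - F m x) \<le> 2 * real m"
        using norm_triangle_ineq4[of "F m (x + z n)" "F m x"] Fb[of m x] Fb[of m "x + z n"] by simp
      then show ?thesis unfolding power2_eq_square by (intro mult_right_mono) auto
    qed
    then have "N2 (\<lambda>x. F m (x + z n) - F m x) \<le> (\<integral>\<^sup>+x. ennreal (2 * real m * cmod (F m (x + z n) - F m x)) \<partial>lborel)"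
      unfolding N2_def by (auto intro!: nn_integral_mono ennreal_leI)
    then show "N2 (\<lambda>x. F m (x + z n) - F m x) \<le> ennreal (2 * real m) * (\<integral>\<^sup>+x. ennreal (cmod (F m (x + z n) - F m x)) \<partial>lborel)"
      by (subst nn_integral_cmult[symmetric]) (simp_all add: ennreal_mult)
  qed
  from order_tendstoD(2)[OF this, of "ennreal (r/16)"] r0
  have "eventually (\<lambda>n. N2 (\<lambda>x. F m (x + z n) - F m x) < ennreal (r/16)) sequentially" by auto
  then show "eventually (\<lambda>n. N2 (\<lambda>x. f (x + z n) - f x) < a) sequentially"
  proof eventually_elim
    case (elim n)
    have "N2 (\<lambda>x. f (x + z n) - f x) \<le> 2 * N2 (\<lambda>x. f (x + z n) - F m (x + z n)) + 2 * N2 (\<lambda>x. F m (x + z n) - f x)"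
      by (rule N2_triangle) measurable
    also have "\<dots> \<le> 2 * N2 (\<lambda>x. f (x + z n) - F m (x + z n)) + 2 * (2 * N2 (\<lambda>x. F m (x + z n) - F m x) + 2 * N2 (\<lambda>x. F m x - f x))"
      by (intro add_left_mono mult_left_mono N2_triangle) measurable
    also have "N2 (\<lambda>x. F m x - f x) = N2 (\<lambda>x. f x - F m x)" by (rule N2_minus_commute)
    also have "N2 (\<lambda>x. f (x + z n) - F m (x + z n)) = N2 (\<lambda>x. f x - F m x)"
      by (rule N2_translate[of "\<lambda>x. f x - F m x"]) measurable
    also have "2 * N2 (\<lambda>x. f x - F m x) + 2 * (2 * N2 (\<lambda>x. F m (x + z n) - F m x) + 2 * N2 (\<lambda>x. f x - F m x))
      \<le> 2 * ennreal (r/16) + 2 * (2 * ennreal (r/16) + 2 * ennreal (r/16))"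
      using elim m by (intro add_mono mult_left_mono) auto
    also have "\<dots> = (2 + 2 * (2 + 2)) * ennreal (r/16)"
      by (simp only: distrib_left distrib_right mult.assoc)
    also have "\<dots> = ennreal 10 * ennreal (r/16)" by simp
    also have "\<dots> = ennreal (10 * (r/16))" using r0 by (simp only: ennreal_mult)
    also have "\<dots> \<le> b" unfolding r using r0 by (intro ennreal_leI) simp
    finally show ?case using b by simp
  qed
qed auto

section \<open>The Fourier transform on \<open>L\<^sub>2\<close>\<close>

definition fker :: "'a::euclidean_space \<Rightarrow> 'a \<Rightarrow> complex" where
  "fker x \<xi> = exp (- 2 * of_real pi * \<i> * of_real (x \<bullet> \<xi>))"

lemma fourier_integral_fker: "fourier_integral f \<xi> = (\<integral>x. f x * fker x \<xi> \<partial>lborel)"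
  by (simp add: fourier_integral_def fker_def)

lemma cmod_fker[simp]: "cmod (fker x \<xi>) = 1"
  by (simp add: fker_def norm_exp_eq_Re)

lemma fker_add_left: "fker (x + y) \<xi> = fker x \<xi> * fker y \<xi>"
  by (simp add: fker_def inner_add_left exp_add[symmetric] algebra_simps)

lemma fker_add_right: "fker x (\<xi> + \<eta>) = fker x \<xi> * fker x \<eta>"
  by (simp add: fker_def inner_add_right exp_add[symmetric] algebra_simps)

lemma fker_commute: "fker x \<xi> = fker \<xi> x"
  by (simp add: fker_def inner_commute)

lemma fker_scaleR: "fker (c *\<^sub>R x) \<xi> = fker x (c *\<^sub>R \<xi>)"
  by (simp add: fker_def)

lemma fker_0[simp]: "fker 0 \<xi> = 1" "fker x 0 = 1"
  by (simp_all add: fker_def)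

lemma cnj_fker: "cnj (fker x \<xi>) = fker (- x) \<xi>"
  by (simp add: fker_def exp_cnj)

lemma fker_minus_mult[simp]: "fker (- x) \<xi> * fker x \<xi> = 1" "fker x \<xi> * fker (- x) \<xi> = 1"
  by (simp_all add: fker_add_left[symmetric])

lemma fker_measurable[measurable (raw)]:
  assumes [measurable]: "f \<in> borel_measurable M" "g \<in> borel_measurable M"
  shows "(\<lambda>x. fker (f x) (g x)) \<in> borel_measurable M"
  unfolding fker_def by (intro borel_measurable_continuous_on[of exp]) (auto intro: continuous_intros)

lemma fourier_integrable:
  "integrable lborel f \<Longrightarrow> integrable lborel (\<lambda>x. f x * fker x \<xi>)"
  by (rule Bochner_Integration.integrable_bound[of lborel f]) (auto simp: norm_mult)

lemma fourier_measurable[measurable]: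
  assumes [measurable]: "f \<in> borel_measurable borel"
  shows "fourier_integral f \<in> borel_measurable borel"
proof -
  have "(\<lambda>\<xi>. \<integral>x. f x * fker x \<xi> \<partial>lborel) \<in> borel_measurable borel"
    by (rule lborel.borel_measurable_lebesgue_integral) measurable
  then show ?thesis by (simp add: fourier_integral_fker[abs_def])
qed

lemma fourier_add:
  "integrable lborel f \<Longrightarrow> integrable lborel g \<Longrightarrow>
    fourier_integral (\<lambda>x. f x + g x) \<xi> = fourier_integral f \<xi> + fourier_integral g \<xi>"
  by (simp add: fourier_integral_fker distrib_right fourier_integrable)

lemma fourier_diff:
  "integrable lborel f \<Longrightarrow> integrable lborel g \<Longrightarrow>
    fourier_integral (\<lambda>x. f x - g x) \<xi> = fourier_integral f \<xi> - fourier_integral g \<xi>"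
  by (simp add: fourier_integral_fker left_diff_distrib fourier_integrable)

text \<open>With this sign convention multiplication by \<open>fker x h\<close> shifts the transform
  to \<xi> + h; hence multiplication by \<open>fker x h - 1\<close> becomes a forward
  difference.\<close>

lemma fourier_modulate:
  "fourier_integral (\<lambda>x. f x * fker x h) \<xi> = fourier_integral f (\<xi> + h)"
  by (simp add: fourier_integral_fker fker_add_right mult_ac)

lemma fourier_integral_mult_swap:
  fixes f u :: "'a::euclidean_space \<Rightarrow> complex"
  assumes f: "integrable lborel f" and u: "integrable lborel u"
  shows "(\<integral>\<xi>. fourier_integral f \<xi> * u \<xi> \<partial>lborel) = (\<integral>x. f x * fourier_integral u x \<partial>lborel)"
proof -
  have [measurable]: "f \<in> borel_measurable borel" "u \<in> borel_measurable borel" using f u by auto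
  have "integrable (lborel \<Otimes>\<^sub>M lborel) (\<lambda>(x, \<xi>). f x * u \<xi> * fker x \<xi>)"
  proof (rule lborel_pair.Fubini_integrable)
    show "integrable lborel (\<lambda>x. LINT y|lborel. norm (case (x, y) of (x, \<xi>) \<Rightarrow> f x * u \<xi> * fker x \<xi>))"
      using f u by (simp add: norm_mult)
    show "AE x in lborel. integrable lborel (\<lambda>y. case (x, y) of (x, \<xi>) \<Rightarrow> f x * u \<xi> * fker x \<xi>)"
      using fourier_integrable[OF u] by (simp add: mult.assoc fker_commute[of _ "_::'a"])
  qed measurable
  from lborel_pair.Fubini_integral[OF this]
  have "(\<integral>\<xi>. \<integral>x. f x * u \<xi> * fker x \<xi> \<partial>lborel \<partial>lborel) = (\<integral>x. \<integral>\<xi>. f x * u \<xi> * fker x \<xi> \<partial>lborel \<partial>lborel)" .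
  moreover have "(\<integral>x. f x * u \<xi> * fker x \<xi> \<partial>lborel) = fourier_integral f \<xi> * u \<xi>" for \<xi>
    unfolding fourier_integral_fker by (subst integral_mult_left_zero[symmetric]) (simp add: mult_ac)
  moreover have "(\<integral>\<xi>. f x * u \<xi> * fker x \<xi> \<partial>lborel) = f x * fourier_integral u x" for x
    unfolding fourier_integral_fker by (subst integral_mult_right_zero[symmetric]) (simp add: mult_ac fker_commute[of x])
  ultimately show ?thesis by simp
qed

lemma fourier_bound:
  assumes "integrable lborel f"
  shows "cmod (fourier_integral f \<xi>) \<le> (\<integral>x. cmod (f x) \<partial>lborel)"
  using integral_norm_bound[of lborel "\<lambda>x. f x * fker x \<xi>"] by (simp add: fourier_integral_fker norm_mult)

abbreviation gauss :: "'a::euclidean_space \<Rightarrow> complex" where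
  "gauss x \<equiv> of_real (exp (- pi * (norm x)\<^sup>2))"

lemma gauss_integrable: "integrable lborel (gauss :: 'a::euclidean_space \<Rightarrow> complex)"
  using gaussian_integrable by (simp only: complex_of_real_integrable_eq)

lemma fourier_gauss_scaled:
  fixes \<xi> :: "'a::euclidean_space"
  assumes "n > 0"
  shows "fourier_integral (\<lambda>x. gauss ((1/n) *\<^sub>R x)) \<xi> = of_real (n ^ DIM('a)) * gauss (n *\<^sub>R \<xi>)"
proof -
  have "fourier_integral (\<lambda>x. gauss ((1/n) *\<^sub>R x)) \<xi> = n ^ DIM('a) *\<^sub>R (\<integral>x. gauss x * fker (n *\<^sub>R x) \<xi> \<partial>lborel)"
    unfolding fourier_integral_fker using assms
    by (subst integral_affine[of n _ 0]) auto
  also have "(\<integral>x. gauss x * fker (n *\<^sub>R x) \<xi> \<partial>lborel) = fourier_integral gauss (n *\<^sub>R \<xi>)"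
    unfolding fourier_integral_fker fker_scaleR ..
  also have "\<dots> = gauss (n *\<^sub>R \<xi>)" by (rule gaussian_char)
  finally show ?thesis by (simp add: scaleR_conv_of_real)
qed

text \<open>The transform of the autocorrelation \<open>A\<close> of f is the squared modulus of the
  transform of f, and \<open>A 0\<close> is the squared norm of f. Testing this square against
  Gaussians that increase to 1 and moving the transform onto them gives averages of \<open>A\<close>
  that concentrate at 0, where \<open>A\<close> is continuous by the continuity of
  translations.\<close>

lemma plancherel_L1_L2:
  fixes f :: "'a::euclidean_space \<Rightarrow> complex"
  assumes f1: "integrable lborel f" and f2: "f \<in> Lp_space 2"
  shows "N2 (fourier_integral f) = N2 f"
proof -
  have [measurable]: "f \<in> borel_measurable borel" using f1 by auto
  define A where "A z = (\<integral>y. f (y + z) * cnj (f y) \<partial>lborel)" for z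
  let ?G = "\<lambda>\<xi>. \<lambda>(y, z). cnj (f y) * f (y + z) * fker z \<xi>"
  have shift: "integrable lborel (\<lambda>z. f (y + z))" for y
    using integrable_affine[OF f1, of 1 y] by simp
  have G: "integrable (lborel \<Otimes>\<^sub>M lborel) (?G \<xi>)" for \<xi>
  proof (rule lborel_pair.Fubini_integrable)
    have "(LINT z|lborel. norm (?G \<xi> (y, z))) = cmod (f y) * (\<integral>z. cmod (f z) \<partial>lborel)" for y
      using integral_affine[of 1 "\<lambda>z. cmod (f z)" y] by (simp add: norm_mult)
    then show "integrable lborel (\<lambda>y. LINT z|lborel. norm (?G \<xi> (y, z)))"
      using f1 by simp
    show "AE y in lborel. integrable lborel (\<lambda>z. ?G \<xi> (y, z))"
      using fourier_integrable[OF shift] by (simp add: mult.assoc)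
  qed measurable
  have A1: "A z = (\<integral>y. cnj (f y) * f (y + z) \<partial>lborel)" for z
    unfolding A_def by (simp add: mult.commute)
  have "integrable lborel (\<lambda>z. \<integral>y. ?G 0 (y, z) \<partial>lborel)"
    using lborel_pair.integrable_snd[of "\<lambda>y z. ?G 0 (y, z)"] G[of 0] by (simp add: split_def)
  then have A_int: "integrable lborel A" by (simp add: A1[abs_def])
  \<comment> \<open>The substitution x = y + z factors the double integral into the transform of f
    and its conjugate.\<close>
  have FA: "fourier_integral A \<xi> = of_real ((cmod (fourier_integral f \<xi>))\<^sup>2)" for \<xi>
  proof -
    have "fourier_integral A \<xi> = (\<integral>z. (\<integral>y. ?G \<xi> (y, z) \<partial>lborel) \<partial>lborel)"
      unfolding fourier_integral_fker A1 by simp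
    also have "\<dots> = (\<integral>y. (\<integral>z. ?G \<xi> (y, z) \<partial>lborel) \<partial>lborel)"
      using lborel_pair.Fubini_integral[of "\<lambda>y z. ?G \<xi> (y, z)"] G[of \<xi>] by (simp add: split_def)
    also have "\<dots> = (\<integral>y. cnj (f y * fker y \<xi>) * fourier_integral f \<xi> \<partial>lborel)"
    proof (intro Bochner_Integration.integral_cong refl)
      fix y
      have "fourier_integral f \<xi> = (\<integral>z. fker y \<xi> * (f (y + z) * fker z \<xi>) \<partial>lborel)"
        unfolding fourier_integral_fker using integral_affine[of 1 "\<lambda>x. f x * fker x \<xi>" y]
        by (simp add: fker_add_left mult_ac)
      also have "\<dots> = fker y \<xi> * (\<integral>z. f (y + z) * fker z \<xi> \<partial>lborel)" by (rule integral_mult_right_zero)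
      finally have "fourier_integral f \<xi> = fker y \<xi> * (\<integral>z. f (y + z) * fker z \<xi> \<partial>lborel)" .
      then have "(\<integral>z. f (y + z) * fker z \<xi> \<partial>lborel) = fker (- y) \<xi> * fourier_integral f \<xi>"
        by (simp add: mult.assoc[symmetric])
      then show "(\<integral>z. ?G \<xi> (y, z) \<partial>lborel) = cnj (f y * fker y \<xi>) * fourier_integral f \<xi>"
        by (simp add: mult.assoc cnj_fker)
    qed
    also have "\<dots> = cnj (fourier_integral f \<xi>) * fourier_integral f \<xi>"
      unfolding integral_mult_left_zero Bochner_Integration.integral_cnj fourier_integral_fker ..
    finally show ?thesis by (simp add: complex_norm_square mult.commute del: of_real_power)
  qed
  have A0: "A 0 = of_real (enn2real (N2 f))"
  proof -
    have "integrable lborel (\<lambda>x. f x * cnj (f x))" by (intro L2_mult_integrable L2_cnj f2)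
    then have "integrable lborel (\<lambda>x. (cmod (f x))\<^sup>2)"
      by (simp only: complex_norm_square[symmetric] complex_of_real_integrable_eq)
    then have "N2 f = ennreal (\<integral>x. (cmod (f x))\<^sup>2 \<partial>lborel)"
      unfolding N2_def by (intro nn_integral_eq_integral) auto
    moreover have "A 0 = of_real (\<integral>x. (cmod (f x))\<^sup>2 \<partial>lborel)"
      unfolding A_def by (simp only: add_0_right complex_norm_square[symmetric] integral_complex_of_real)
    ultimately show ?thesis by simp
  qed
  \<comment> \<open>Cauchy-Schwarz and translation invariance; this is the dominating bound for the
    limit below.\<close>
  have Abound: "cmod (A z) \<le> enn2real (N2 f)" for z
  proof -
    have "ennreal ((cmod (A z))\<^sup>2) \<le> N2 (\<lambda>y. f (y + z)) * N2 (\<lambda>y. cnj (f y))"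
      unfolding A_def by (intro L2_mult_bound) measurable
    also have "\<dots> = N2 f * N2 f" by (simp add: N2_translate N2_cnj)
    also have "\<dots> = ennreal ((enn2real (N2 f))\<^sup>2)"
      using L2_finite[OF f2] by (simp add: power2_eq_square ennreal_mult)
    finally have "(cmod (A z))\<^sup>2 \<le> (enn2real (N2 f))\<^sup>2" by simp
    then show ?thesis by (rule power2_le_imp_le) simp
  qed
  have Acont: "(\<lambda>n. A (z n)) \<longlonglongrightarrow> A 0" if "z \<longlonglongrightarrow> 0" for z
    unfolding A_def
    using L2_mult_tendsto[OF f2 L2_cnj[OF f2] L2_translate[OF f2] L2_cnj[OF f2] L2_translation_tendsto[OF f2 that]]
    by (simp add: N2_def)
  define w where "w n x = exp (- pi * (norm ((1 / real (Suc n)) *\<^sub>R x))\<^sup>2)" for n and x :: 'a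
  have w_int: "integrable lborel (\<lambda>x. complex_of_real (w n x))" for n
    unfolding w_def using integrable_affine[OF gauss_integrable, of "1 / real (Suc n)" 0] by simp
  \<comment> \<open>Multiplication formula, then the change of variables z = v/(n+1), which moves
    the dilation from the Gaussian to \<open>A\<close>.\<close>
  have key: "(\<integral>\<xi>. of_real ((cmod (fourier_integral f \<xi>))\<^sup>2) * of_real (w n \<xi>) \<partial>lborel)
     = (\<integral>v. A ((1 / real (Suc n)) *\<^sub>R v) * gauss v \<partial>lborel)" for n
  proof -
    have "(\<integral>\<xi>. of_real ((cmod (fourier_integral f \<xi>))\<^sup>2) * of_real (w n \<xi>) \<partial>lborel)
       = (\<integral>z. A z * fourier_integral (\<lambda>\<xi>. of_real (w n \<xi>)) z \<partial>lborel)"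
      unfolding FA[symmetric] by (rule fourier_integral_mult_swap[OF A_int w_int])
    also have "\<dots> = (\<integral>z. A z * (of_real (real (Suc n) ^ DIM('a)) * gauss (real (Suc n) *\<^sub>R z)) \<partial>lborel)"
      unfolding w_def by (subst fourier_gauss_scaled) auto
    also have "\<dots> = (1 / real (Suc n)) ^ DIM('a) *\<^sub>R (\<integral>v. A ((1 / real (Suc n)) *\<^sub>R v) * (of_real (real (Suc n) ^ DIM('a)) * gauss v) \<partial>lborel)"
      by (subst integral_affine[of "1 / real (Suc n)" _ 0]) auto
    also have "(\<integral>v. A ((1 / real (Suc n)) *\<^sub>R v) * (of_real (real (Suc n) ^ DIM('a)) * gauss v) \<partial>lborel)
       = of_real (real (Suc n) ^ DIM('a)) * (\<integral>v. A ((1 / real (Suc n)) *\<^sub>R v) * gauss v \<partial>lborel)"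
      by (subst integral_mult_right_zero[symmetric]) (simp add: mult_ac)
    finally show ?thesis
      by (simp add: scaleR_conv_of_real power_one_over mult.assoc[symmetric] del: of_nat_Suc)
  qed
  have "(\<lambda>n. \<integral>v. A ((1 / real (Suc n)) *\<^sub>R v) * gauss v \<partial>lborel) \<longlonglongrightarrow> (\<integral>v. A 0 * gauss v \<partial>(lborel :: 'a measure))"
  proof (rule integral_dominated_convergence[where w="\<lambda>v::'a. enn2real (N2 f) * exp (- pi * (norm v)\<^sup>2)"])
    show "integrable lborel (\<lambda>v::'a. enn2real (N2 f) * exp (- pi * (norm v)\<^sup>2))"
      using gaussian_integrable[where 'a='a] by simp
    show "AE v in lborel. (\<lambda>n. A ((1 / real (Suc n)) *\<^sub>R v) * gauss v) \<longlonglongrightarrow> A 0 * gauss v"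
    proof (rule AE_I2)
      fix v :: 'a
      have "(\<lambda>n. (1 / real (Suc n)) *\<^sub>R v) \<longlonglongrightarrow> 0 *\<^sub>R v"
        by (intro tendsto_intros LIMSEQ_Suc[OF lim_1_over_n])
      then show "(\<lambda>n. A ((1 / real (Suc n)) *\<^sub>R v) * gauss v) \<longlonglongrightarrow> A 0 * gauss v"
        by (intro tendsto_intros Acont) simp
    qed
    show "AE v in lborel. norm (A ((1 / real (Suc n)) *\<^sub>R v) * gauss v) \<le> enn2real (N2 f) * exp (- pi * (norm v)\<^sup>2)" for n
      using Abound by (auto simp: norm_mult intro!: mult_right_mono)
    have "A \<in> borel_measurable borel" using A_int by auto
    note [measurable] = this
    show "(\<lambda>v. A ((1 / real (Suc n)) *\<^sub>R v) * gauss v) \<in> borel_measurable lborel" for n by measurable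
  qed measurable
  moreover have "(\<integral>v. A 0 * gauss v \<partial>(lborel :: 'a measure)) = A 0"
    using gaussian_char[of "0::'a"] by (simp add: fourier_integral_fker)
  ultimately have L: "(\<lambda>n. \<integral>\<xi>. of_real ((cmod (fourier_integral f \<xi>))\<^sup>2) * complex_of_real (w n \<xi>) \<partial>lborel) \<longlonglongrightarrow> of_real (enn2real (N2 f))"
    by (simp only: key A0[symmetric])
  \<comment> \<open>The same integrals seen through monotone convergence, which yields a limit
    without knowing beforehand that the transform is square integrable.\<close>
  let ?I = "\<lambda>n. \<integral>\<^sup>+\<xi>. ennreal ((cmod (fourier_integral f \<xi>))\<^sup>2 * w n \<xi>) \<partial>lborel"
  have [measurable]: "w n \<in> borel_measurable borel" for n unfolding w_def by measurable
  have I: "?I n = ennreal (Re (\<integral>\<xi>. of_real ((cmod (fourier_integral f \<xi>))\<^sup>2) * complex_of_real (w n \<xi>) \<partial>lborel))" for n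
  proof -
    have "integrable lborel (\<lambda>\<xi>. (cmod (fourier_integral f \<xi>))\<^sup>2 * w n \<xi>)"
    proof (rule Bochner_Integration.integrable_bound)
      show "integrable lborel (\<lambda>\<xi>. (\<integral>x. cmod (f x) \<partial>lborel)\<^sup>2 * w n \<xi>)"
        using w_int[of n] by (simp only: complex_of_real_integrable_eq integrable_mult_right)
      show "AE \<xi> in lborel. norm ((cmod (fourier_integral f \<xi>))\<^sup>2 * w n \<xi>) \<le> norm ((\<integral>x. cmod (f x) \<partial>lborel)\<^sup>2 * w n \<xi>)"
        using fourier_bound[OF f1] by (auto simp: abs_mult w_def intro!: mult_right_mono power_mono)
    qed measurable
    then have "?I n = ennreal (\<integral>\<xi>. (cmod (fourier_integral f \<xi>))\<^sup>2 * w n \<xi> \<partial>lborel)"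
      by (intro nn_integral_eq_integral) (auto simp: w_def)
    also have "(\<integral>\<xi>. (cmod (fourier_integral f \<xi>))\<^sup>2 * w n \<xi> \<partial>lborel)
       = Re (\<integral>\<xi>. of_real ((cmod (fourier_integral f \<xi>))\<^sup>2) * complex_of_real (w n \<xi>) \<partial>lborel)"
      by (simp only: of_real_mult[symmetric] integral_complex_of_real Re_complex_of_real)
    finally show ?thesis .
  qed
  have "?I \<longlonglongrightarrow> ennreal (Re (of_real (enn2real (N2 f))))"
    unfolding I by (intro tendsto_ennrealI tendsto_Re L)
  then have "?I \<longlonglongrightarrow> N2 f" using L2_finite[OF f2] by simp
  moreover have "?I \<longlonglongrightarrow> (\<integral>\<^sup>+\<xi>. ennreal ((cmod (fourier_integral f \<xi>))\<^sup>2) \<partial>lborel)"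
  proof (rule nn_integral_LIMSEQ)
    show "incseq (\<lambda>n \<xi>. ennreal ((cmod (fourier_integral f \<xi>))\<^sup>2 * w n \<xi>))"
    proof (intro incseq_SucI le_funI ennreal_leI mult_left_mono)
      fix n and x :: 'a
      have "norm ((1 / real (Suc (Suc n))) *\<^sub>R x) \<le> norm ((1 / real (Suc n)) *\<^sub>R x)"
        by (simp add: divide_simps mult_left_mono)
      then have "(norm ((1 / real (Suc (Suc n))) *\<^sub>R x))\<^sup>2 \<le> (norm ((1 / real (Suc n)) *\<^sub>R x))\<^sup>2"
        by (intro power_mono) auto
      then show "w n x \<le> w (Suc n) x" unfolding w_def by (simp del: norm_scaleR)
    qed auto
    show "(\<lambda>n. ennreal ((cmod (fourier_integral f \<xi>))\<^sup>2 * w n \<xi>)) \<longlonglongrightarrow> ennreal ((cmod (fourier_integral f \<xi>))\<^sup>2)" for \<xi>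
    proof -
      have "(\<lambda>n. w n \<xi>) \<longlonglongrightarrow> exp (- pi * (norm (0 *\<^sub>R \<xi>))\<^sup>2)"
        unfolding w_def by (intro tendsto_intros LIMSEQ_Suc[OF lim_1_over_n])
      then have "(\<lambda>n. ennreal ((cmod (fourier_integral f \<xi>))\<^sup>2 * w n \<xi>)) \<longlonglongrightarrow> ennreal ((cmod (fourier_integral f \<xi>))\<^sup>2 * exp (- pi * (norm (0 *\<^sub>R \<xi>))\<^sup>2))"
        by (intro tendsto_intros)
      then show ?thesis by simp
    qed
  qed measurable
  ultimately show ?thesis unfolding N2_def by (rule LIMSEQ_unique[symmetric])
qed

lemma fourier_trunc_diff:
  assumes "f \<in> Lp_space 2"
  shows "N2 (\<lambda>\<xi>. fourier_integral (trunc m f) \<xi> - fourier_integral (trunc n f) \<xi>) = N2 (\<lambda>x. trunc m f x - trunc n f x)"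
  using plancherel_L1_L2[of "\<lambda>x. trunc m f x - trunc n f x"] assms
  by (simp add: trunc_integrable trunc_L2 L2_diff ext[OF fourier_diff[OF trunc_integrable[OF assms] trunc_integrable[OF assms]]])

text \<open>The choice in \<open>fourier_L2\<close> is not vacuous: truncations are Cauchy in L_2,
  Plancherel for integrable functions carries this to their transforms, and L_2 is complete.\<close>

lemma fourier_L2_spec:
  fixes f :: "'a::euclidean_space \<Rightarrow> complex"
  assumes f: "f \<in> Lp_space 2"
  shows fourier_L2_L2: "fourier_L2 f \<in> Lp_space 2"
    and fourier_L2_trunc_tendsto: "(\<lambda>n. N2 (\<lambda>\<xi>. fourier_integral (trunc n f) \<xi> - fourier_L2 f \<xi>)) \<longlonglongrightarrow> 0"
proof -
  have [measurable]: "trunc n f \<in> borel_measurable borel" for n by (rule L2_measurable[OF trunc_L2[OF f]])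
  have "\<exists>F. F \<in> Lp_space 2 \<and> (\<lambda>n. N2 (\<lambda>\<xi>. fourier_integral (trunc n f) \<xi> - F \<xi>)) \<longlonglongrightarrow> 0"
  proof (rule L2_complete)
    show "fourier_integral (trunc n f) \<in> Lp_space 2" for n
      using L2_finite[OF trunc_L2[OF f, of n]]
      by (intro L2_I) (simp_all add: plancherel_L1_L2 trunc_integrable trunc_L2 f fourier_measurable)
    fix e :: ennreal assume "e > 0"
    then have "e / 4 > 0" by (simp add: ennreal_zero_less_divide)
    from order_tendstoD(2)[OF trunc_tendsto[OF f] this]
    obtain M where M: "\<And>n. n \<ge> M \<Longrightarrow> N2 (\<lambda>x. trunc n f x - f x) < e / 4" by (auto simp: eventually_sequentially)
    have "N2 (\<lambda>\<xi>. fourier_integral (trunc m f) \<xi> - fourier_integral (trunc n f) \<xi>) < e" if "m \<ge> M" "n \<ge> M" for m n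
    proof -
      have "N2 (\<lambda>x. trunc m f x - trunc n f x) \<le> 2 * N2 (\<lambda>x. trunc m f x - f x) + 2 * N2 (\<lambda>x. f x - trunc n f x)"
        by (intro N2_triangle L2_measurable[OF f] L2_measurable[OF trunc_L2[OF f]])
      also have "N2 (\<lambda>x. f x - trunc n f x) = N2 (\<lambda>x. trunc n f x - f x)" by (rule N2_minus_commute)
      also have "2 * N2 (\<lambda>x. trunc m f x - f x) + 2 * N2 (\<lambda>x. trunc n f x - f x) < 2 * (e / 4) + 2 * (e / 4)"
        by (intro add_strict_mono ennreal_mult_strict_left_mono M that) auto
      also have "2 * (e / 4) + 2 * (e / 4) = 4 * (e / 4)"
        by (simp add: distrib_right[symmetric])
      also have "\<dots> = e"
        by (subst ennreal_times_divide, subst mult.commute, rule ennreal_mult_divide_eq) auto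
      finally show ?thesis by (simp add: fourier_trunc_diff[OF f])
    qed
    then show "\<exists>M. \<forall>m\<ge>M. \<forall>n\<ge>M. N2 (\<lambda>\<xi>. fourier_integral (trunc m f) \<xi> - fourier_integral (trunc n f) \<xi>) < e" by blast
  qed
  then have "\<exists>F. F \<in> Lp_space 2 \<and> (\<lambda>n. Lp_norm 2 (\<lambda>\<xi>. fourier_integral (trunc n f) \<xi> - F \<xi>)) \<longlonglongrightarrow> 0"
    using Lp_norm_2_tendsto_0_iff[of "\<lambda>n \<xi>. fourier_integral (trunc n f) \<xi> - F \<xi>" for F]
    by (force dest: L2_measurable)
  from someI_ex[OF this]
  have *: "fourier_L2 f \<in> Lp_space 2 \<and> (\<lambda>n. Lp_norm 2 (\<lambda>\<xi>. fourier_integral (trunc n f) \<xi> - fourier_L2 f \<xi>)) \<longlonglongrightarrow> 0"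
    unfolding fourier_L2_def trunc_def by simp
  then show 1: "fourier_L2 f \<in> Lp_space 2" by simp
  note [measurable] = L2_measurable[OF this]
  show "(\<lambda>n. N2 (\<lambda>\<xi>. fourier_integral (trunc n f) \<xi> - fourier_L2 f \<xi>)) \<longlonglongrightarrow> 0"
    using * by (subst Lp_norm_2_tendsto_0_iff[symmetric]) auto
qed

lemma fourier_integral_L2:
  assumes "integrable lborel f" "f \<in> Lp_space 2"
  shows "fourier_integral f \<in> Lp_space 2"
  using assms L2_finite[OF assms(2)] by (intro L2_I) (auto simp: plancherel_L1_L2)

text \<open>Truncating to balls is only one way to reach the transform: any approximation in L_2 by
  integrable functions computes it, by comparison with the truncations through Plancherel.\<close>

lemma fourier_L2_limit:
  assumes f: "f \<in> Lp_space 2"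
    and fn1: "\<And>n. integrable lborel (fn n)" and fn2: "\<And>n. fn n \<in> Lp_space 2"
    and lim: "(\<lambda>n. N2 (\<lambda>x. fn n x - f x)) \<longlonglongrightarrow> 0"
  shows "(\<lambda>n. N2 (\<lambda>\<xi>. fourier_integral (fn n) \<xi> - fourier_L2 f \<xi>)) \<longlonglongrightarrow> 0"
proof -
  note [measurable] = L2_measurable[OF f] L2_measurable[OF fn2] L2_measurable[OF fourier_L2_L2[OF f]]
    L2_measurable[OF trunc_L2[OF f]]
  let ?a = "\<lambda>n. N2 (\<lambda>x. fn n x - f x)" and ?b = "\<lambda>n. N2 (\<lambda>x. trunc n f x - f x)"
    and ?c = "\<lambda>n. N2 (\<lambda>\<xi>. fourier_integral (trunc n f) \<xi> - fourier_L2 f \<xi>)"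
  have "(\<lambda>n. 2 * (2 * ?a n + 2 * ?b n) + 2 * ?c n) \<longlonglongrightarrow> 2 * (2 * 0 + 2 * 0) + 2 * 0"
    by (intro tendsto_add tendsto_mult_ennreal tendsto_const lim trunc_tendsto[OF f] fourier_L2_trunc_tendsto[OF f]) auto
  then have "(\<lambda>n. 2 * (2 * ?a n + 2 * ?b n) + 2 * ?c n) \<longlonglongrightarrow> 0" by simp
  then show ?thesis
  proof (rule tendsto_0_ennreal_le)
    fix n
    have "N2 (\<lambda>\<xi>. fourier_integral (fn n) \<xi> - fourier_L2 f \<xi>)
      \<le> 2 * N2 (\<lambda>\<xi>. fourier_integral (fn n) \<xi> - fourier_integral (trunc n f) \<xi>) + 2 * ?c n"
      by (rule N2_triangle) measurable
    also have "N2 (\<lambda>\<xi>. fourier_integral (fn n) \<xi> - fourier_integral (trunc n f) \<xi>) = N2 (\<lambda>x. fn n x - trunc n f x)"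
      using plancherel_L1_L2[of "\<lambda>x. fn n x - trunc n f x"]
      by (simp add: fourier_diff fn1 fn2 trunc_integrable[OF f] trunc_L2[OF f] L2_diff ext[OF fourier_diff[OF fn1 trunc_integrable[OF f]]])
    also have "\<dots> \<le> 2 * ?a n + 2 * N2 (\<lambda>x. f x - trunc n f x)"
      by (rule N2_triangle) measurable
    also have "N2 (\<lambda>x. f x - trunc n f x) = ?b n" by (rule N2_minus_commute)
    finally show "N2 (\<lambda>\<xi>. fourier_integral (fn n) \<xi> - fourier_L2 f \<xi>) \<le> 2 * (2 * ?a n + 2 * ?b n) + 2 * ?c n"
      by (simp add: add_mono mult_left_mono)
  qed
qed

lemma L2_limit_unique:
  assumes "\<And>n. fn n \<in> borel_measurable borel" "f \<in> borel_measurable borel" "g \<in> borel_measurable borel"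
    and f: "(\<lambda>n. N2 (\<lambda>x. fn n x - f x)) \<longlonglongrightarrow> 0" and g: "(\<lambda>n. N2 (\<lambda>x. fn n x - g x)) \<longlonglongrightarrow> 0"
  shows "AE x in lborel. f x = g x"
proof -
  note [measurable] = assms(1-3)
  have "(\<lambda>n. 2 * N2 (\<lambda>x. fn n x - f x) + 2 * N2 (\<lambda>x. fn n x - g x)) \<longlonglongrightarrow> 2 * 0 + 2 * 0"
    by (intro tendsto_add tendsto_mult_ennreal tendsto_const f g) auto
  then have "(\<lambda>n. 2 * N2 (\<lambda>x. fn n x - f x) + 2 * N2 (\<lambda>x. fn n x - g x)) \<longlonglongrightarrow> 0" by simp
  then have "(\<lambda>n::nat. N2 (\<lambda>x. f x - g x)) \<longlonglongrightarrow> 0"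
  proof (rule tendsto_0_ennreal_le)
    show "N2 (\<lambda>x. f x - g x) \<le> 2 * N2 (\<lambda>x. fn n x - f x) + 2 * N2 (\<lambda>x. fn n x - g x)" for n
      using N2_triangle[of f "fn n" g] by (simp add: N2_minus_commute[of f])
  qed
  then have "N2 (\<lambda>x. f x - g x) = 0" by (simp add: LIMSEQ_const_iff)
  then show ?thesis by (subst (asm) N2_eq_0_iff) auto
qed

text \<open>The pattern for the calculation rules of \<open>fourier_L2\<close>: verify them on
  integrable approximants and pass to the limit. Equality holds almost everywhere because the
  transform is only a representative.\<close>

lemma fourier_L2_eqI:
  assumes f: "f \<in> Lp_space 2"
    and fn: "\<And>n. integrable lborel (fn n)" "\<And>n. fn n \<in> Lp_space 2"
    and lim: "(\<lambda>n. N2 (\<lambda>x. fn n x - f x)) \<longlonglongrightarrow> 0"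
    and [measurable]: "G \<in> borel_measurable borel"
    and G: "(\<lambda>n. N2 (\<lambda>\<xi>. fourier_integral (fn n) \<xi> - G \<xi>)) \<longlonglongrightarrow> 0"
  shows "AE \<xi> in lborel. fourier_L2 f \<xi> = G \<xi>"
proof (rule L2_limit_unique[OF _ _ _ fourier_L2_limit[OF f fn lim] G])
qed (use L2_measurable[OF fn(2)] L2_measurable[OF fourier_L2_L2[OF f]] in auto)

lemma fourier_L2_eq_integral:
  assumes "integrable lborel f" "f \<in> Lp_space 2"
  shows "AE \<xi> in lborel. fourier_L2 f \<xi> = fourier_integral f \<xi>"
  by (rule fourier_L2_eqI[of f "\<lambda>_. f"]) (use assms in \<open>auto simp: N2_def\<close>)

lemma plancherel: "f \<in> Lp_space 2 \<Longrightarrow> N2 (fourier_L2 f) = N2 f"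
proof -
  assume f: "f \<in> Lp_space 2"
  have "(\<lambda>n. N2 (fourier_integral (trunc n f))) \<longlonglongrightarrow> N2 (fourier_L2 f)"
    by (intro L2_norm_tendsto fourier_L2_L2 f fourier_integral_L2 trunc_integrable trunc_L2 fourier_L2_trunc_tendsto)
  moreover have "(\<lambda>n. N2 (fourier_integral (trunc n f))) \<longlonglongrightarrow> N2 f"
    unfolding plancherel_L1_L2[OF trunc_integrable[OF f] trunc_L2[OF f]]
    by (intro L2_norm_tendsto f trunc_L2 trunc_tendsto)
  ultimately show ?thesis by (rule LIMSEQ_unique)
qed

text \<open>The scalar on the second summand makes one rule serve for sums and, with c = -1, for
  differences.\<close>

lemma fourier_L2_lincomb:
  assumes f: "f \<in> Lp_space 2" and g: "g \<in> Lp_space 2"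
  shows "AE \<xi> in lborel. fourier_L2 (\<lambda>x. f x + c * g x) \<xi> = fourier_L2 f \<xi> + c * fourier_L2 g \<xi>"
proof (rule fourier_L2_eqI[where fn="\<lambda>n x. trunc n f x + c * trunc n g x"])
  note [measurable] = L2_measurable[OF f] L2_measurable[OF g] L2_measurable[OF fourier_L2_L2[OF f]] L2_measurable[OF fourier_L2_L2[OF g]]
    L2_measurable[OF trunc_L2[OF f]] L2_measurable[OF trunc_L2[OF g]]
  show "(\<lambda>x. f x + c * g x) \<in> Lp_space 2" by (intro L2_add L2_cmult f g)
  show "integrable lborel (\<lambda>x. trunc n f x + c * trunc n g x)" for n
    by (intro Bochner_Integration.integrable_add integrable_mult_right trunc_integrable f g)
  show "(\<lambda>x. trunc n f x + c * trunc n g x) \<in> Lp_space 2" for n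
    by (intro L2_add L2_cmult trunc_L2 f g)
  have *: "(\<lambda>n. N2 (\<lambda>x. u n x + c * v n x)) \<longlonglongrightarrow> 0"
    if [measurable]: "\<And>n. u n \<in> borel_measurable borel" "\<And>n. v n \<in> borel_measurable borel"
      and uv: "(\<lambda>n. N2 (u n)) \<longlonglongrightarrow> 0" "(\<lambda>n. N2 (v n)) \<longlonglongrightarrow> 0" for u v :: "nat \<Rightarrow> 'a \<Rightarrow> complex"
  proof -
    have "(\<lambda>n. 2 * N2 (u n) + 2 * (ennreal ((cmod c)\<^sup>2) * N2 (v n))) \<longlonglongrightarrow> 2 * 0 + 2 * (ennreal ((cmod c)\<^sup>2) * 0)"
      by (intro tendsto_add tendsto_mult_ennreal tendsto_const uv) auto
    then have "(\<lambda>n. 2 * N2 (u n) + 2 * (ennreal ((cmod c)\<^sup>2) * N2 (v n))) \<longlonglongrightarrow> 0" by simp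
    then show ?thesis
      by (rule tendsto_0_ennreal_le) (use N2_add[of "u n" "\<lambda>x. c * v n x" for n] in \<open>simp add: N2_cmult\<close>)
  qed
  have "(\<lambda>n. N2 (\<lambda>x. (trunc n f x - f x) + c * (trunc n g x - g x))) \<longlonglongrightarrow> 0"
    by (intro * trunc_tendsto f g) measurable
  then show "(\<lambda>n. N2 (\<lambda>x. trunc n f x + c * trunc n g x - (f x + c * g x))) \<longlonglongrightarrow> 0"
    by (simp add: algebra_simps)
  have F: "fourier_integral (\<lambda>x. trunc n f x + c * trunc n g x) \<xi> = fourier_integral (trunc n f) \<xi> + c * fourier_integral (trunc n g) \<xi>" for n \<xi>
  proof -
    have "fourier_integral (\<lambda>x. c * trunc n g x) \<xi> = c * fourier_integral (trunc n g) \<xi>"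
      by (simp add: fourier_integral_fker mult.assoc)
    then show ?thesis
      using fourier_add[OF trunc_integrable[OF f] integrable_mult_right[OF trunc_integrable[OF g]]] by simp
  qed
  have "(\<lambda>n. N2 (\<lambda>\<xi>. (fourier_integral (trunc n f) \<xi> - fourier_L2 f \<xi>) + c * (fourier_integral (trunc n g) \<xi> - fourier_L2 g \<xi>))) \<longlonglongrightarrow> 0"
    by (intro * fourier_L2_trunc_tendsto f g) measurable
  then show "(\<lambda>n. N2 (\<lambda>\<xi>. fourier_integral (\<lambda>x. trunc n f x + c * trunc n g x) \<xi> - (fourier_L2 f \<xi> + c * fourier_L2 g \<xi>))) \<longlonglongrightarrow> 0"
    unfolding F by (simp add: algebra_simps)
qed (use L2_measurable[OF fourier_L2_L2[OF f]] L2_measurable[OF fourier_L2_L2[OF g]] in simp)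

lemma fourier_L2_modulate:
  assumes f: "f \<in> Lp_space 2"
  shows "AE \<xi> in lborel. fourier_L2 (\<lambda>x. f x * fker x h) \<xi> = fourier_L2 f (\<xi> + h)"
proof (rule fourier_L2_eqI[where fn="\<lambda>n x. trunc n f x * fker x h"])
  note [measurable] = L2_measurable[OF f] L2_measurable[OF fourier_L2_L2[OF f]] L2_measurable[OF trunc_L2[OF f]]
  have mod: "(\<lambda>x. g x * fker x h) \<in> Lp_space 2" if "g \<in> Lp_space 2" for g
    using L2_bound_mult[OF that, of "\<lambda>x. fker x h" 1] by (simp add: mult.commute)
  show "(\<lambda>x. f x * fker x h) \<in> Lp_space 2" "(\<lambda>x. trunc n f x * fker x h) \<in> Lp_space 2" for n
    by (intro mod trunc_L2 f)+
  show "integrable lborel (\<lambda>x. trunc n f x * fker x h)" for n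
    by (intro fourier_integrable trunc_integrable f)
  have "N2 (\<lambda>x. trunc n f x * fker x h - f x * fker x h) = N2 (\<lambda>x. trunc n f x - f x)" for n
    by (simp add: N2_def left_diff_distrib[symmetric] norm_mult)
  then show "(\<lambda>n. N2 (\<lambda>x. trunc n f x * fker x h - f x * fker x h)) \<longlonglongrightarrow> 0"
    using trunc_tendsto[OF f] by simp
  have "N2 (\<lambda>\<xi>. fourier_integral (trunc n f) (\<xi> + h) - fourier_L2 f (\<xi> + h)) = N2 (\<lambda>\<xi>. fourier_integral (trunc n f) \<xi> - fourier_L2 f \<xi>)" for n
    by (rule N2_translate[of "\<lambda>\<xi>. fourier_integral (trunc n f) \<xi> - fourier_L2 f \<xi>"]) measurable
  then show "(\<lambda>n. N2 (\<lambda>\<xi>. fourier_integral (\<lambda>x. trunc n f x * fker x h) \<xi> - fourier_L2 f (\<xi> + h))) \<longlonglongrightarrow> 0"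
    using fourier_L2_trunc_tendsto[OF f] by (simp add: fourier_modulate)
qed (use L2_measurable[OF L2_translate[OF fourier_L2_L2[OF f]]] in simp)

lemma fourier_affine:
  fixes f :: "'a::euclidean_space \<Rightarrow> complex"
  assumes c: "c > 0"
  shows "fourier_integral (\<lambda>x. f (t + c *\<^sub>R x)) \<xi> = of_real ((1/c) ^ DIM('a)) * fker (- t) ((1/c) *\<^sub>R \<xi>) * fourier_integral f ((1/c) *\<^sub>R \<xi>)"
proof -
  have "fourier_integral f ((1/c) *\<^sub>R \<xi>) = c ^ DIM('a) *\<^sub>R (\<integral>x. f (t + c *\<^sub>R x) * fker (t + c *\<^sub>R x) ((1/c) *\<^sub>R \<xi>) \<partial>lborel)"
    unfolding fourier_integral_fker using c by (subst integral_affine[of c _ t]) auto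
  also have "(\<integral>x. f (t + c *\<^sub>R x) * fker (t + c *\<^sub>R x) ((1/c) *\<^sub>R \<xi>) \<partial>lborel)
     = (\<integral>x. fker t ((1/c) *\<^sub>R \<xi>) * (f (t + c *\<^sub>R x) * fker x \<xi>) \<partial>lborel)"
    using c by (simp add: fker_add_left fker_scaleR mult_ac)
  also have "\<dots> = fker t ((1/c) *\<^sub>R \<xi>) * fourier_integral (\<lambda>x. f (t + c *\<^sub>R x)) \<xi>"
    unfolding fourier_integral_fker by (rule integral_mult_right_zero)
  finally have "of_real ((1/c) ^ DIM('a)) * fker (- t) ((1/c) *\<^sub>R \<xi>) * fourier_integral f ((1/c) *\<^sub>R \<xi>)
    = (of_real ((1/c) ^ DIM('a)) * of_real (c ^ DIM('a))) * (fker (- t) ((1/c) *\<^sub>R \<xi>) * fker t ((1/c) *\<^sub>R \<xi>)) * fourier_integral (\<lambda>x. f (t + c *\<^sub>R x)) \<xi>"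
    by (simp add: scaleR_conv_of_real mult_ac)
  also have "of_real ((1/c) ^ DIM('a)) * of_real (c ^ DIM('a)) = (1 :: complex)"
    using c by (simp add: of_real_mult[symmetric] power_mult_distrib[symmetric] del: of_real_mult of_real_power)
  finally show ?thesis by simp
qed

lemma N2_affine:
  fixes f :: "'a::euclidean_space \<Rightarrow> complex"
  assumes [measurable]: "f \<in> borel_measurable borel" and c: "c > 0"
  shows "N2 (\<lambda>x. f (t + c *\<^sub>R x)) = ennreal ((1/c) ^ DIM('a)) * N2 f"
proof -
  have "N2 f = ennreal (c ^ DIM('a)) * N2 (\<lambda>x. f (t + c *\<^sub>R x))"
    unfolding N2_def using c by (subst nn_integral_affine[of _ c t]) auto
  then have "ennreal ((1/c) ^ DIM('a)) * N2 f = (ennreal ((1/c) ^ DIM('a)) * ennreal (c ^ DIM('a))) * N2 (\<lambda>x. f (t + c *\<^sub>R x))"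
    by (simp add: mult.assoc)
  also have "ennreal ((1/c) ^ DIM('a)) * ennreal (c ^ DIM('a)) = 1"
    using c by (simp add: ennreal_mult[symmetric] power_mult_distrib[symmetric])
  finally show ?thesis by simp
qed

lemma L2_affine: "f \<in> Lp_space 2 \<Longrightarrow> c > 0 \<Longrightarrow> (\<lambda>x. f (t + c *\<^sub>R x)) \<in> Lp_space 2"
  by (auto simp: L2_iff N2_affine ennreal_mult_less_top)

lemma fourier_L2_affine:
  fixes f :: "'a::euclidean_space \<Rightarrow> complex"
  assumes f: "f \<in> Lp_space 2" and c: "c > 0"
  shows "AE \<xi> in lborel. fourier_L2 (\<lambda>x. f (t + c *\<^sub>R x)) \<xi>
    = of_real ((1/c) ^ DIM('a)) * fker (- t) ((1/c) *\<^sub>R \<xi>) * fourier_L2 f ((1/c) *\<^sub>R \<xi>)"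
proof (rule fourier_L2_eqI[where fn="\<lambda>n x. trunc n f (t + c *\<^sub>R x)"])
  note [measurable] = L2_measurable[OF f] L2_measurable[OF fourier_L2_L2[OF f]] L2_measurable[OF trunc_L2[OF f]]
  show "(\<lambda>x. f (t + c *\<^sub>R x)) \<in> Lp_space 2" "(\<lambda>x. trunc n f (t + c *\<^sub>R x)) \<in> Lp_space 2" for n
    by (intro L2_affine trunc_L2 f c)+
  show "integrable lborel (\<lambda>x. trunc n f (t + c *\<^sub>R x))" for n
    using c by (intro integrable_affine trunc_integrable f) auto
  have "(\<lambda>n. ennreal ((1/c) ^ DIM('a)) * N2 (\<lambda>x. trunc n f x - f x)) \<longlonglongrightarrow> ennreal ((1/c) ^ DIM('a)) * 0"
    by (intro tendsto_mult_ennreal tendsto_const trunc_tendsto f) auto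
  then show "(\<lambda>n. N2 (\<lambda>x. trunc n f (t + c *\<^sub>R x) - f (t + c *\<^sub>R x))) \<longlonglongrightarrow> 0"
    using N2_affine[of "\<lambda>x. trunc n f x - f x" c t for n] c by simp
  let ?C = "of_real ((1/c) ^ DIM('a)) :: complex"
  let ?d = "\<lambda>n \<xi>. fourier_integral (trunc n f) \<xi> - fourier_L2 f \<xi>"
  have eq: "N2 (\<lambda>\<xi>. fourier_integral (\<lambda>x. trunc n f (t + c *\<^sub>R x)) \<xi> - ?C * fker (- t) ((1/c) *\<^sub>R \<xi>) * fourier_L2 f ((1/c) *\<^sub>R \<xi>))
     = ennreal ((cmod ?C)\<^sup>2) * (ennreal (c ^ DIM('a)) * N2 (?d n))" for n
  proof -
    have "N2 (\<lambda>\<xi>. fourier_integral (\<lambda>x. trunc n f (t + c *\<^sub>R x)) \<xi> - ?C * fker (- t) ((1/c) *\<^sub>R \<xi>) * fourier_L2 f ((1/c) *\<^sub>R \<xi>))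
      = N2 (\<lambda>\<xi>. ?C * ?d n (0 + (1/c) *\<^sub>R \<xi>))"
      unfolding fourier_affine[OF c] right_diff_distrib[symmetric] N2_def by (simp add: norm_mult)
    also have "\<dots> = ennreal ((cmod ?C)\<^sup>2) * N2 (\<lambda>\<xi>. ?d n (0 + (1/c) *\<^sub>R \<xi>))"
      by (rule N2_cmult) measurable
    also have "N2 (\<lambda>\<xi>. ?d n (0 + (1/c) *\<^sub>R \<xi>)) = ennreal (c ^ DIM('a)) * N2 (?d n)"
      using c by (subst N2_affine) auto
    finally show ?thesis .
  qed
  have "(\<lambda>n. ennreal ((cmod ?C)\<^sup>2) * (ennreal (c ^ DIM('a)) * N2 (?d n))) \<longlonglongrightarrow> ennreal ((cmod ?C)\<^sup>2) * (ennreal (c ^ DIM('a)) * 0)"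
    by (intro tendsto_mult_ennreal tendsto_const fourier_L2_trunc_tendsto f) auto
  then show "(\<lambda>n. N2 (\<lambda>\<xi>. fourier_integral (\<lambda>x. trunc n f (t + c *\<^sub>R x)) \<xi> - ?C * fker (- t) ((1/c) *\<^sub>R \<xi>) * fourier_L2 f ((1/c) *\<^sub>R \<xi>))) \<longlonglongrightarrow> 0"
    unfolding eq by simp
qed (use L2_measurable[OF L2_affine[OF fourier_L2_L2[OF f], of "1/c" 0]] c in simp)

lemma fourier_L2_mult_swap:
  assumes f: "f \<in> Lp_space 2" and u: "u \<in> Lp_space 2"
  shows "(\<integral>\<xi>. fourier_L2 f \<xi> * u \<xi> \<partial>lborel) = (\<integral>x. f x * fourier_L2 u x \<partial>lborel)"
proof -
  have "(\<lambda>n. \<integral>\<xi>. fourier_integral (trunc n f) \<xi> * trunc n u \<xi> \<partial>lborel) \<longlonglongrightarrow> (\<integral>\<xi>. fourier_L2 f \<xi> * u \<xi> \<partial>lborel)"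
    by (intro L2_mult_tendsto fourier_L2_L2 fourier_integral_L2 trunc_integrable trunc_L2 trunc_tendsto fourier_L2_trunc_tendsto f u)
  moreover have "(\<lambda>n. \<integral>x. trunc n f x * fourier_integral (trunc n u) x \<partial>lborel) \<longlonglongrightarrow> (\<integral>x. f x * fourier_L2 u x \<partial>lborel)"
    by (intro L2_mult_tendsto fourier_L2_L2 fourier_integral_L2 trunc_integrable trunc_L2 trunc_tendsto fourier_L2_trunc_tendsto f u)
  ultimately show ?thesis
    unfolding fourier_integral_mult_swap[OF trunc_integrable[OF f] trunc_integrable[OF u]] by (rule LIMSEQ_unique)
qed

lemma L2_norm_integral:
  assumes f: "f \<in> Lp_space 2"
  shows "of_real (enn2real (N2 f)) = (\<integral>x. f x * cnj (f x) \<partial>lborel)"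
proof -
  have "integrable lborel (\<lambda>x. f x * cnj (f x))" by (intro L2_mult_integrable L2_cnj f)
  then have "integrable lborel (\<lambda>x. (cmod (f x))\<^sup>2)"
    by (simp only: complex_norm_square[symmetric] complex_of_real_integrable_eq)
  then have "N2 f = ennreal (\<integral>x. (cmod (f x))\<^sup>2 \<partial>lborel)"
    unfolding N2_def by (intro nn_integral_eq_integral) auto
  moreover have "(\<integral>x. f x * cnj (f x) \<partial>lborel) = of_real (\<integral>x. (cmod (f x))\<^sup>2 \<partial>lborel)"
    by (simp only: complex_norm_square[symmetric] integral_complex_of_real)
  ultimately show ?thesis by simp
qed

text \<open>Polarization: Plancherel for f + c g with c = 1 gives the sum of the two mixed products,
  with c = i their difference.\<close>

lemma parseval:
  assumes f: "f \<in> Lp_space 2" and g: "g \<in> Lp_space 2"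
  shows "(\<integral>\<xi>. fourier_L2 f \<xi> * cnj (fourier_L2 g \<xi>) \<partial>lborel) = (\<integral>x. f x * cnj (g x) \<partial>lborel)"
proof -
  define I where "I u v = (\<integral>x. u x * cnj (v x) \<partial>lborel)" for u v :: "'a \<Rightarrow> complex"
  have expand: "I (\<lambda>x. u x + c * v x) (\<lambda>x. u x + c * v x) = I u u + cnj c * I u v + c * I v u + c * cnj c * I v v"
    if u: "u \<in> Lp_space 2" and v: "v \<in> Lp_space 2" for u v :: "'a \<Rightarrow> complex" and c
  proof -
    have i: "integrable lborel (\<lambda>x. u x * cnj (u x))" "integrable lborel (\<lambda>x. cnj c * (u x * cnj (v x)))"
      "integrable lborel (\<lambda>x. c * (v x * cnj (u x)))" "integrable lborel (\<lambda>x. c * cnj c * (v x * cnj (v x)))"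
      by (intro integrable_mult_right L2_mult_integrable L2_cnj u v)+
    have "I (\<lambda>x. u x + c * v x) (\<lambda>x. u x + c * v x)
      = (\<integral>x. u x * cnj (u x) + cnj c * (u x * cnj (v x)) + c * (v x * cnj (u x)) + c * cnj c * (v x * cnj (v x)) \<partial>lborel)"
      unfolding I_def by (intro Bochner_Integration.integral_cong) (auto simp: algebra_simps)
    also have "\<dots> = I u u + cnj c * I u v + c * I v u + c * cnj c * I v v"
      unfolding I_def
      by (simp only: Bochner_Integration.integral_add i Bochner_Integration.integrable_add integral_mult_right_zero)
    finally show ?thesis .
  qed
  let ?F = fourier_L2
  have eq: "I (\<lambda>x. f x + c * g x) (\<lambda>x. f x + c * g x) = I (\<lambda>x. ?F f x + c * ?F g x) (\<lambda>x. ?F f x + c * ?F g x)" for c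
  proof -
    have L: "(\<lambda>x. f x + c * g x) \<in> Lp_space 2" "(\<lambda>x. ?F f x + c * ?F g x) \<in> Lp_space 2"
      by (intro L2_add L2_cmult fourier_L2_L2 f g)+
    have "N2 (\<lambda>x. f x + c * g x) = N2 (?F (\<lambda>x. f x + c * g x))" by (rule plancherel[OF L(1), symmetric])
    also have "\<dots> = N2 (\<lambda>x. ?F f x + c * ?F g x)" by (rule N2_cong_AE[OF fourier_L2_lincomb[OF f g]])
    finally show ?thesis using L2_norm_integral[OF L(1)] L2_norm_integral[OF L(2)] unfolding I_def by simp
  qed
  have eqf: "I f f = I (?F f) (?F f)" if "f \<in> Lp_space 2" for f :: "'a \<Rightarrow> complex"
    using L2_norm_integral[OF that] L2_norm_integral[OF fourier_L2_L2[OF that]] plancherel[OF that] unfolding I_def by simp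
  have e1: "cnj c * I f g + c * I g f = cnj c * I (?F f) (?F g) + c * I (?F g) (?F f)" for c
    using eq[of c] expand[OF f g, of c] expand[OF fourier_L2_L2[OF f] fourier_L2_L2[OF g], of c] eqf[OF f] eqf[OF g] by simp
  have a: "I f g + I g f = I (?F f) (?F g) + I (?F g) (?F f)" using e1[of 1] by simp
  have "- \<i> * (I f g - I g f) = - \<i> * (I (?F f) (?F g) - I (?F g) (?F f))"
    using e1[of \<i>] by (simp add: algebra_simps)
  then have b: "I f g - I g f = I (?F f) (?F g) - I (?F g) (?F f)" by simp
  have "2 * I f g = (I f g + I g f) + (I f g - I g f)" by simp
  also have "\<dots> = 2 * I (?F f) (?F g)" unfolding a b by simp
  finally show ?thesis unfolding I_def by simp
qed

text \<open>Fourier inversion in conjugated form, so that no separate inverse transform is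
  introduced. By the multiplication formula and Parseval both sides have the same integral against
  every f; testing with the conjugate of their difference shows that the difference
  vanishes.\<close>

lemma fourier_L2_cnj_inverse:
  assumes h: "h \<in> Lp_space 2"
  shows "AE x in lborel. fourier_L2 (\<lambda>\<xi>. cnj (fourier_L2 h \<xi>)) x = cnj (h x)"
proof -
  let ?u = "fourier_L2 (\<lambda>\<xi>. cnj (fourier_L2 h \<xi>))"
  have u: "?u \<in> Lp_space 2" by (intro fourier_L2_L2 L2_cnj h)
  have L: "(\<lambda>x. ?u x - cnj (h x)) \<in> Lp_space 2" by (intro L2_diff L2_cnj u h)
  have test: "(\<integral>x. f x * (?u x - cnj (h x)) \<partial>lborel) = 0" if f: "f \<in> Lp_space 2" for f
  proof -
    have "(\<integral>x. f x * ?u x \<partial>lborel) = (\<integral>\<xi>. fourier_L2 f \<xi> * cnj (fourier_L2 h \<xi>) \<partial>lborel)"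
      by (rule fourier_L2_mult_swap[symmetric]) (intro f L2_cnj fourier_L2_L2 h)+
    also have "\<dots> = (\<integral>x. f x * cnj (h x) \<partial>lborel)" by (rule parseval[OF f h])
    finally have "(\<integral>x. f x * ?u x - f x * cnj (h x) \<partial>lborel) = 0"
      by (subst Bochner_Integration.integral_diff) (auto intro!: L2_mult_integrable L2_cnj f u h)
    then show ?thesis by (simp add: right_diff_distrib)
  qed
  have "complex_of_real (enn2real (N2 (\<lambda>x. ?u x - cnj (h x)))) = 0"
    unfolding L2_norm_integral[OF L] using test[OF L2_cnj[OF L]] by (simp add: mult.commute)
  then have "N2 (\<lambda>x. ?u x - cnj (h x)) = 0"
    using L2_finite[OF L] by (auto simp: enn2real_eq_0_iff)
  then show ?thesis using L2_measurable[OF L] by (subst (asm) N2_eq_0_iff) auto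
qed

text \<open>The witness is the conjugate of the transform of \<open>cnj G\<close>. Surjectivity is
  what provides a function with the transform prescribed in
  \<open>fourier_multiplier\<close>.\<close>

lemma fourier_L2_surj:
  assumes G: "G \<in> Lp_space 2"
  shows "\<exists>g. g \<in> Lp_space 2 \<and> (AE \<xi> in lborel. fourier_L2 g \<xi> = G \<xi>)"
  using fourier_L2_cnj_inverse[OF L2_cnj[OF G]] L2_cnj[OF fourier_L2_L2[OF L2_cnj[OF G]]] by auto

lemma fourier_L2_inj:
  assumes f: "f \<in> Lp_space 2" and g: "g \<in> Lp_space 2"
    and eq: "AE \<xi> in lborel. fourier_L2 f \<xi> = fourier_L2 g \<xi>"
  shows "AE x in lborel. f x = g x"
proof -
  have L: "(\<lambda>x. f x + (-1) * g x) \<in> Lp_space 2" by (intro L2_add L2_cmult f g)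
  have "N2 (\<lambda>x. f x + (-1) * g x) = N2 (\<lambda>_::'a. 0)"
    unfolding plancherel[OF L, symmetric]
    by (rule N2_cong_AE) (use fourier_L2_lincomb[OF f g, of "-1"] eq in eventually_elim, simp)
  then have "N2 (\<lambda>x. f x + (-1) * g x) = 0" by (simp add: N2_def)
  then show ?thesis using L2_measurable[OF L] by (subst (asm) N2_eq_0_iff) auto
qed

section \<open>Smoothness of the homogeneous extension\<close>

lemma Ck_on_cong:
  assumes "open U" "\<And>x. x \<in> U \<Longrightarrow> f x = g x"
  shows "Ck_on k U f \<longleftrightarrow> Ck_on k U g"
proof -
  have "Ck_on k U g" if "Ck_on k U f" "\<And>x. x \<in> U \<Longrightarrow> f x = g x" for f g :: "'a \<Rightarrow> 'b"
    using that
  proof (induction k arbitrary: f g)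
    case 0
    then show ?case using continuous_on_cong[of U U f g] by simp
  next
    case (Suc k)
    have d: "g differentiable (at x)" and e: "frechet_derivative f (at x) = frechet_derivative g (at x)" if x: "x \<in> U" for x
    proof -
      have fd: "f differentiable (at x)" using Suc.prems x by simp
      then obtain D where D: "(f has_derivative D) (at x)" by (auto simp: differentiable_def)
      have "(g has_derivative D) (at x)"
        by (rule has_derivative_transform_within_open[OF D assms(1) x]) (use Suc.prems in auto)
      then show "g differentiable (at x)" "frechet_derivative f (at x) = frechet_derivative g (at x)"
        using frechet_derivative_at[OF D] frechet_derivative_at[of g D x] by (auto simp: differentiable_def)
    qed
    have "Ck_on k U (\<lambda>x. frechet_derivative g (at x) v)" for v
      by (rule Suc.IH[of "\<lambda>x. frechet_derivative f (at x) v"]) (use Suc.prems e in auto)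
    then show ?case using d by simp
  qed
  then show ?thesis using assms(2) by metis
qed

lemma Ck_on_subset: "Ck_on k U f \<Longrightarrow> V \<subseteq> U \<Longrightarrow> Ck_on k V f"
  by (induction k arbitrary: f) (auto intro: continuous_on_subset)

text \<open>\<open>smooth_on_subset\<close> supplies a different neighbourhood and extension at each
  point; this glues the local statements, differentiability being local.\<close>

lemma Ck_on_local:
  assumes "\<And>x. x \<in> U \<Longrightarrow> \<exists>V. open V \<and> x \<in> V \<and> Ck_on k V f"
  shows "Ck_on k U f"
  using assms
proof (induction k arbitrary: f)
  case 0
  have "continuous (at x) f" if "x \<in> U" for x
    using 0[OF that] by (auto simp: continuous_on_eq_continuous_at)
  then show ?case by (simp add: continuous_at_imp_continuous_on)
next
  case (Suc k)
  have "f differentiable (at x)" if "x \<in> U" for x using Suc.prems[OF that] by auto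
  moreover have "Ck_on k U (\<lambda>x. frechet_derivative f (at x) v)" for v
    by (rule Suc.IH) (use Suc.prems in force)
  ultimately show ?case by simp
qed

lemma Ck_on_continuous: "Ck_on k U f \<Longrightarrow> continuous_on U f"
  by (cases k) (auto intro!: continuous_at_imp_continuous_on differentiable_imp_continuous_within)

lemma Ck_on_SucD: "Ck_on (Suc k) U f \<Longrightarrow> Ck_on k U f"
proof (induction k arbitrary: f)
  case 0
  then show ?case by (metis Ck_on.simps(1) Ck_on_continuous)
next
  case (Suc k)
  then show ?case
    using Ck_on.simps(2)[of "Suc k" U f] Ck_on.simps(2)[of k U f] by blast
qed

text \<open>Lets the derivative be given by any formula D in place of
  \<open>frechet_derivative\<close>; on an open set the two agree.\<close>

lemma Ck_on_SucI:
  assumes "open U" and der: "\<And>x. x \<in> U \<Longrightarrow> (f has_derivative D x) (at x)" and "\<And>v. Ck_on k U (\<lambda>x. D x v)"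
  shows "Ck_on (Suc k) U f"
proof -
  have "Ck_on k U (\<lambda>x. frechet_derivative f (at x) v)" for v
    using Ck_on_cong[OF assms(1), of "\<lambda>x. frechet_derivative f (at x) v" "\<lambda>x. D x v" k] assms(3)[of v]
      frechet_derivative_at[OF der] by metis
  then show ?thesis using der by (auto simp: differentiable_def)
qed

lemma Ck_on_derivative:
  assumes "Ck_on (Suc k) U f" "x \<in> U"
  shows "(f has_derivative frechet_derivative f (at x)) (at x)"
  using assms by (simp add: frechet_derivative_works)

lemma Ck_on_const: "open U \<Longrightarrow> Ck_on k U (\<lambda>x. c)"
  by (induction k arbitrary: c) (auto intro!: Ck_on_SucI[where D="\<lambda>_ _. 0"] derivative_eq_intros simp del: Ck_on.simps(2))

lemma Ck_on_add:
  assumes "open U"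
  shows "Ck_on k U f \<Longrightarrow> Ck_on k U g \<Longrightarrow> Ck_on k U (\<lambda>x. f x + g x)"
proof (induction k arbitrary: f g)
  case (Suc k)
  show ?case
    by (rule Ck_on_SucI[OF assms has_derivative_add[OF Ck_on_derivative[OF Suc.prems(1)] Ck_on_derivative[OF Suc.prems(2)]]])
      (use Suc in auto)
qed (auto intro: continuous_intros)

lemma Ck_on_linear:
  assumes "open U" and L: "bounded_linear L"
  shows "Ck_on k U f \<Longrightarrow> Ck_on k U (\<lambda>x. L (f x))"
proof (induction k arbitrary: f)
  case 0
  then show ?case by (auto intro: bounded_linear.continuous_on[OF L])
next
  case (Suc k)
  show ?case
    by (rule Ck_on_SucI[OF assms(1) bounded_linear.has_derivative[OF L Ck_on_derivative[OF Suc.prems]]])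
      (use Suc in auto)
qed

lemma Ck_on_mult:
  fixes f g :: "'a::euclidean_space \<Rightarrow> 'b::real_normed_algebra"
  assumes "open U"
  shows "Ck_on k U f \<Longrightarrow> Ck_on k U g \<Longrightarrow> Ck_on k U (\<lambda>x. f x * g x)"
proof (induction k arbitrary: f g)
  case (Suc k)
  show ?case
    by (rule Ck_on_SucI[OF assms has_derivative_mult[OF Ck_on_derivative[OF Suc.prems(1)] Ck_on_derivative[OF Suc.prems(2)]]])
      (auto intro!: Ck_on_add assms Suc.IH Ck_on_SucD[OF Suc.prems(1)] Ck_on_SucD[OF Suc.prems(2)] simp del: Ck_on.simps(2) intro: Suc.prems[unfolded Ck_on.simps(2), THEN conjunct2, rule_format])
qed (auto intro: continuous_intros)

lemma Ck_on_sum: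
  assumes "open U" "finite I" "\<And>i. i \<in> I \<Longrightarrow> Ck_on k U (f i)"
  shows "Ck_on k U (\<lambda>x. \<Sum>i\<in>I. f i x)"
  using assms(2,3)
proof (induction I rule: finite_induct)
  case empty
  then show ?case by (simp add: Ck_on_const assms(1))
next
  case (insert i I)
  then show ?case by (simp add: Ck_on_add assms(1))
qed

lemma Ck_on_inner: "open U \<Longrightarrow> Ck_on k U (\<lambda>x. x \<bullet> b)"
  by (cases k) (auto intro!: continuous_intros Ck_on_SucI[where D="\<lambda>_ v. v \<bullet> b"] derivative_eq_intros Ck_on_const simp del: Ck_on.simps(2))

text \<open>The chain rule is written with partial derivatives, as a sum over \<open>Basis\<close>
  of products of real functions, so that the induction uses only products, sums and the claim for
  the partial derivatives of g.\<close>

lemma Ck_on_compose: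
  fixes f :: "'a::euclidean_space \<Rightarrow> 'c::euclidean_space" and g :: "'c \<Rightarrow> real"
  assumes "open U" and fU: "f ` U \<subseteq> V"
  shows "(\<And>b. b \<in> Basis \<Longrightarrow> Ck_on k U (\<lambda>x. f x \<bullet> b)) \<Longrightarrow> Ck_on k V g \<Longrightarrow> Ck_on k U (\<lambda>x. g (f x))"
proof (induction k arbitrary: g)
  case 0
  have "continuous_on U (\<lambda>x. \<Sum>b\<in>Basis. (f x \<bullet> b) *\<^sub>R b)"
    using 0(1) by (intro continuous_on_sum continuous_on_scaleR continuous_on_const) auto
  then have "continuous_on U f" by (simp add: euclidean_representation)
  then show ?case using 0 fU by (auto intro: continuous_on_compose2)
next
  case (Suc k)
  let ?g = "\<lambda>y. frechet_derivative g (at y)"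
  have fd: "(f has_derivative frechet_derivative f (at x)) (at x)" if "x \<in> U" for x
    using Suc.prems(1) that by (simp add: frechet_derivative_works[symmetric] differentiable_componentwise_within[of f])
  have gd: "(g has_derivative ?g y) (at y)" if "y \<in> V" for y
    by (rule Ck_on_derivative[OF Suc.prems(2) that])
  show ?case
  proof (rule Ck_on_SucI[OF assms(1)])
    fix x assume x: "x \<in> U"
    then have fx: "f x \<in> V" using fU by auto
    have comp: "((\<lambda>x. g (f x)) has_derivative (\<lambda>v. ?g (f x) (frechet_derivative f (at x) v))) (at x)"
      using diff_chain_at[OF fd[OF x] gd[OF fx]] by (simp add: o_def)
    have "?g (f x) (frechet_derivative f (at x) v)
        = (\<Sum>b\<in>Basis. frechet_derivative (\<lambda>x. f x \<bullet> b) (at x) v * ?g (f x) b)" for v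
    proof -
      have lin: "linear (?g (f x))" using gd[OF fx] has_derivative_linear by blast
      have "frechet_derivative f (at x) v \<bullet> b = frechet_derivative (\<lambda>x. f x \<bullet> b) (at x) v" for b
        using frechet_derivative_at[OF has_derivative_inner_left[OF fd[OF x], of b]] by metis
      then have "frechet_derivative f (at x) v = (\<Sum>b\<in>Basis. frechet_derivative (\<lambda>x. f x \<bullet> b) (at x) v *\<^sub>R b)"
        using euclidean_representation[of "frechet_derivative f (at x) v"] by simp
      then show ?thesis by (simp add: linear_sum[OF lin] linear_scale[OF lin] o_def)
    qed
    with comp show "((\<lambda>x. g (f x)) has_derivative (\<lambda>v. \<Sum>b\<in>Basis. frechet_derivative (\<lambda>x. f x \<bullet> b) (at x) v * ?g (f x) b)) (at x)"
      by simp
  next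
    fix v
    have "Ck_on k U (\<lambda>x. ?g (f x) b)" for b
    proof (rule Suc.IH)
      show "Ck_on k U (\<lambda>x. f x \<bullet> b)" if "b \<in> Basis" for b
        by (rule Ck_on_SucD[OF Suc.prems(1)[OF that]])
      show "Ck_on k V (\<lambda>y. ?g y b)" using Suc.prems(2) by simp
    qed
    then show "Ck_on k U (\<lambda>x. \<Sum>b\<in>Basis. frechet_derivative (\<lambda>x. f x \<bullet> b) (at x) v * ?g (f x) b)"
      using Suc.prems(1) by (intro Ck_on_sum Ck_on_mult assms) auto
  qed
qed

text \<open>The derivative in direction v is -(x . v)/|x|^3, a polynomial in a linear form and the
  function itself, so the induction closes.\<close>

lemma Ck_on_inverse_norm: "Ck_on k (-{0::'a::euclidean_space}) (\<lambda>x. inverse (norm x))"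
proof (induction k)
  case 0
  then show ?case by (auto intro!: continuous_intros)
next
  case (Suc k)
  show ?case
  proof (rule Ck_on_SucI)
    fix x :: 'a assume "x \<in> -{0}"
    then have "x \<noteq> 0" by simp
    then have "((\<lambda>x. inverse (norm x)) has_derivative (\<lambda>v. - (inverse (norm x) * (v \<bullet> sgn x) * inverse (norm x)))) (at x)"
      by (intro Deriv.has_derivative_inverse has_derivative_norm) auto
    then show "((\<lambda>x. inverse (norm x)) has_derivative (\<lambda>v. (-1) * (x \<bullet> v) * (inverse (norm x) * inverse (norm x) * inverse (norm x)))) (at x)"
      by (simp add: sgn_div_norm inner_commute mult_ac)
  next
    show "Ck_on k (-{0}) (\<lambda>x. (-1) * (x \<bullet> v) * (inverse (norm x) * inverse (norm x) * inverse (norm x)))" for v :: 'a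
      by (intro Ck_on_mult Ck_on_const Ck_on_inner Suc) auto
  qed auto
qed

text \<open>A local extension g agrees with \<phi> on the sphere only. Composing it with the radial
  projection, which is smooth off the origin, gives the homogeneous extension whatever g does off
  the sphere.\<close>

lemma Ck_on_homogeneous_extension:
  fixes \<phi> :: "'a::euclidean_space \<Rightarrow> real"
  assumes "smooth_on_subset (sphere 0 1) \<phi>"
  shows "Ck_on k (-{0}) (\<lambda>x. \<phi> (x /\<^sub>R norm x))"
proof (rule Ck_on_local)
  fix x0 :: 'a assume x0: "x0 \<in> -{0}"
  define \<pi> :: "'a \<Rightarrow> 'a" where "\<pi> x = x /\<^sub>R norm x" for x
  have pi_cont: "continuous_on (-{0}) \<pi>" unfolding \<pi>_def by (intro continuous_intros) auto
  have sph: "\<pi> x \<in> sphere 0 1" if "x \<noteq> 0" for x using that by (simp add: \<pi>_def)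
  with x0 assms obtain U g where U: "open U" "\<pi> x0 \<in> U" "\<And>k. Ck_on k U g" "\<And>y. y \<in> U \<inter> sphere 0 1 \<Longrightarrow> g y = \<phi> y"
    unfolding smooth_on_subset_def by (metis Compl_iff singletonI)
  define V where "V = -{0} \<inter> \<pi> -` U"
  have V: "open V" unfolding V_def using continuous_open_preimage[OF pi_cont _ U(1)] by auto
  have "Ck_on k V (\<lambda>x. g (\<pi> x))"
  proof (rule Ck_on_compose[OF V _ _ U(3)])
    show "\<pi> ` V \<subseteq> U" by (auto simp: V_def)
    fix b :: 'a
    have "Ck_on k (-{0}) (\<lambda>x. inverse (norm x) * (x \<bullet> b))"
      by (intro Ck_on_mult Ck_on_inverse_norm Ck_on_inner) auto
    then have "Ck_on k V (\<lambda>x. inverse (norm x) * (x \<bullet> b))"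
      by (rule Ck_on_subset) (auto simp: V_def)
    then show "Ck_on k V (\<lambda>x. \<pi> x \<bullet> b)" by (simp only: \<pi>_def inner_scaleR_left)
  qed
  moreover have "g (\<pi> x) = \<phi> (x /\<^sub>R norm x)" if "x \<in> V" for x
    using U(4)[of "\<pi> x"] sph[of x] that by (simp add: V_def \<pi>_def)
  ultimately have "Ck_on k V (\<lambda>x. \<phi> (x /\<^sub>R norm x))"
    using Ck_on_cong[OF V, of "\<lambda>x. g (\<pi> x)" "\<lambda>x. \<phi> (x /\<^sub>R norm x)" k] by simp
  moreover have "x0 \<in> V" using x0 U by (simp add: V_def)
  ultimately show "\<exists>V. open V \<and> x0 \<in> V \<and> Ck_on k V (\<lambda>x. \<phi> (x /\<^sub>R norm x))" using V by blast
qed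

section \<open>Iterated differences of the symbol\<close>

definition fdiff :: "'a::real_vector \<Rightarrow> ('a \<Rightarrow> complex) \<Rightarrow> 'a \<Rightarrow> complex" where
  "fdiff h f = (\<lambda>x. f (x + h) - f x)"

lemma has_vector_derivative_bound:
  fixes f :: "real \<Rightarrow> 'b::real_normed_vector"
  assumes S: "convex S" "x \<in> S" "y \<in> S"
    and f: "\<And>z. z \<in> S \<Longrightarrow> (f has_vector_derivative f' z) (at z)" "\<And>z. z \<in> S \<Longrightarrow> norm (f' z) \<le> B"
  shows "norm (f x - f y) \<le> B * norm (x - y)"
proof (rule differentiable_bound[OF S(1) _ _ S(2,3)])
  fix z assume z: "z \<in> S"
  show "(f has_derivative (\<lambda>h. h *\<^sub>R f' z)) (at z within S)"
    using f(1)[OF z] by (simp add: has_vector_derivative_def has_derivative_at_withinI)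
  have "0 \<le> B" using order_trans[OF norm_ge_zero f(2)[OF z]] .
  then show "onorm (\<lambda>h. h *\<^sub>R f' z) \<le> B"
    by (rule onorm_bound) (use f(2)[OF z] in \<open>auto simp: mult.commute[of B] intro!: mult_left_mono\<close>)
qed

text \<open>The mean value theorem iterated along the segment. The whole chain of derivatives
  \<open>G j\<close> is carried so that the induction can replace each by its difference with step s
  b; the order drops by one while the final bound gains a factor s.\<close>

lemma fdiff_funpow_bound:
  fixes G :: "nat \<Rightarrow> 'a::real_normed_vector \<Rightarrow> complex"
  assumes "0 \<le> s"
    and "\<And>j r. j < k \<Longrightarrow> 0 \<le> r \<Longrightarrow> r \<le> real k * s \<Longrightarrow>
      ((\<lambda>r. G j (x + r *\<^sub>R b)) has_vector_derivative G (Suc j) (x + r *\<^sub>R b)) (at r)"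
    and "\<And>r. 0 \<le> r \<Longrightarrow> r \<le> real k * s \<Longrightarrow> cmod (G k (x + r *\<^sub>R b)) \<le> B"
  shows "cmod ((fdiff (s *\<^sub>R b) ^^ k) (G 0) x) \<le> s ^ k * B"
  using assms
proof (induction k arbitrary: G B)
  case 0
  then show ?case using 0(3)[of 0] by simp
next
  case (Suc k)
  have step: "cmod ((fdiff (s *\<^sub>R b) ^^ k) (fdiff (s *\<^sub>R b) (G 0)) x) \<le> s ^ k * (s * B)"
  proof (rule Suc.IH[of "\<lambda>j. fdiff (s *\<^sub>R b) (G j)"])
    show "0 \<le> s" by (rule Suc.prems)
    fix r assume r: "0 \<le> r" "r \<le> real k * s"
    have rs: "r + s \<le> real (Suc k) * s" using r by (simp add: algebra_simps)
    have r': "r \<le> real (Suc k) * s" using r Suc.prems(1) by (simp add: algebra_simps)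
    {
      fix j assume j: "j < k"
      have "((\<lambda>r. G j (x + r *\<^sub>R b)) \<circ> (\<lambda>r. r + s) has_vector_derivative 1 *\<^sub>R G (Suc j) (x + (r + s) *\<^sub>R b)) (at r)"
        using j rs r Suc.prems(1)
        by (intro vector_diff_chain_at Suc.prems(2)) (auto intro!: derivative_eq_intros)
      then have "((\<lambda>r. G j (x + (r + s) *\<^sub>R b)) has_vector_derivative G (Suc j) (x + (r + s) *\<^sub>R b)) (at r)"
        by (simp add: o_def)
      moreover have "((\<lambda>r. G j (x + r *\<^sub>R b)) has_vector_derivative G (Suc j) (x + r *\<^sub>R b)) (at r)"
        using Suc.prems(2)[of j r] j r r' by simp
      ultimately have "((\<lambda>r. G j (x + (r + s) *\<^sub>R b) - G j (x + r *\<^sub>R b)) has_vector_derivative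
         G (Suc j) (x + (r + s) *\<^sub>R b) - G (Suc j) (x + r *\<^sub>R b)) (at r)"
        by (rule has_vector_derivative_diff)
      then show "((\<lambda>r. fdiff (s *\<^sub>R b) (G j) (x + r *\<^sub>R b)) has_vector_derivative fdiff (s *\<^sub>R b) (G (Suc j)) (x + r *\<^sub>R b)) (at r)"
        by (simp add: fdiff_def scaleR_left_distrib add.assoc)
    }
    have "cmod (G k (x + (r + s) *\<^sub>R b) - G k (x + r *\<^sub>R b)) \<le> B * norm ((r + s) - r)"
    proof (rule has_vector_derivative_bound[where S="{r..r+s}" and f="\<lambda>q. G k (x + q *\<^sub>R b)" and f'="\<lambda>q. G (Suc k) (x + q *\<^sub>R b)"])
      fix q assume q: "q \<in> {r..r+s}"
      then show "((\<lambda>q. G k (x + q *\<^sub>R b)) has_vector_derivative G (Suc k) (x + q *\<^sub>R b)) (at q)"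
        "cmod (G (Suc k) (x + q *\<^sub>R b)) \<le> B"
        using Suc.prems(2)[of k q] Suc.prems(3)[of q] r rs by auto
    qed (use Suc.prems(1) in auto)
    then show "cmod (fdiff (s *\<^sub>R b) (G k) (x + r *\<^sub>R b)) \<le> s * B"
      using Suc.prems(1) by (simp add: fdiff_def scaleR_left_distrib add.assoc mult.commute)
  qed
  then show ?case by (simp add: funpow_swap1 mult_ac)
qed

text \<open>Differences of a function homogeneous of degree 0 depend only on the ratio of step and
  point; this transports estimates to the unit sphere.\<close>

lemma fdiff_funpow_scale:
  assumes "\<And>x. m (c *\<^sub>R x) = m x"
  shows "(fdiff (c *\<^sub>R h) ^^ k) m (c *\<^sub>R x) = (fdiff h ^^ k) m x"
proof (induction k arbitrary: x)
  case (Suc k)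
  show ?case using Suc[of "x + h"] Suc[of x] by (simp add: fdiff_def scaleR_right_distrib)
qed (simp add: assms)

lemma has_vector_derivative_along_line:
  assumes "(f has_derivative D) (at (x + r *\<^sub>R b))"
  shows "((\<lambda>r. f (x + r *\<^sub>R b)) has_vector_derivative D b) (at r)"
proof -
  have "((\<lambda>r. x + r *\<^sub>R b) has_derivative (\<lambda>h. h *\<^sub>R b)) (at r)"
    by (auto intro!: derivative_eq_intros)
  from diff_chain_at[OF this assms]
  have "((\<lambda>r. f (x + r *\<^sub>R b)) has_derivative (\<lambda>h. D (h *\<^sub>R b))) (at r)" by (simp add: o_def)
  then show ?thesis
    using has_derivative_linear[OF assms] by (simp add: has_vector_derivative_def linear_scale)
qed

text \<open>The \<open>k\<close>-th derivative of \<open>exp (\<i> t \<psi>)\<close> in direction \<open>b\<close> is this exponential times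
  a polynomial of degree \<open>k\<close> in \<open>t\<close>, with the following coefficients.\<close>

primrec sym_coeff :: "('a::euclidean_space \<Rightarrow> real) \<Rightarrow> 'a \<Rightarrow> nat \<Rightarrow> nat \<Rightarrow> 'a \<Rightarrow> complex" where
  "sym_coeff \<psi> b 0 = (\<lambda>l x. if l = 0 then 1 else 0)"
| "sym_coeff \<psi> b (Suc k) = (\<lambda>l x. frechet_derivative (sym_coeff \<psi> b k l) (at x) b +
    (case l of 0 \<Rightarrow> 0 | Suc l' \<Rightarrow> \<i> * of_real (frechet_derivative \<psi> (at x) b) * sym_coeff \<psi> b k l' x))"

lemma sym_coeff_smooth:
  assumes "open U" and \<psi>: "\<And>j. Ck_on j U \<psi>"
  shows "Ck_on j U (sym_coeff \<psi> b k l)"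
proof (induction k arbitrary: j l)
  case 0
  then show ?case by (simp add: Ck_on_const assms(1))
next
  case (Suc k)
  have a: "Ck_on j U (\<lambda>x. frechet_derivative (sym_coeff \<psi> b k l) (at x) b)" for l
    using Suc[of "Suc j" l] by simp
  have "Ck_on j U (\<lambda>x. frechet_derivative \<psi> (at x) b)" using \<psi>[of "Suc j"] by simp
  then have "Ck_on j U (\<lambda>x. complex_of_real (frechet_derivative \<psi> (at x) b))"
    by (rule Ck_on_linear[OF assms(1) bounded_linear_of_real])
  then have "Ck_on j U (\<lambda>x. \<i> * of_real (frechet_derivative \<psi> (at x) b) * sym_coeff \<psi> b k l' x)" for l'
    by (intro Ck_on_mult Ck_on_const assms(1) Suc)
  then show ?case
    by (cases l) (auto intro!: Ck_on_add a assms(1) Ck_on_const)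
qed

lemma sym_coeff_zero: "l > k \<Longrightarrow> sym_coeff \<psi> b k l = (\<lambda>x. 0)"
proof (induction k arbitrary: l)
  case (Suc k)
  then show ?case by (cases l) simp_all
qed auto

text \<open>Product rule: the derivative falls on the coefficients or on the exponential, and the
  latter raises the power of t by one. This is the recursion of \<open>sym_coeff\<close>.\<close>

lemma symbol_derivative:
  fixes \<psi> :: "'a::euclidean_space \<Rightarrow> real" and t :: real
  assumes "open U" and \<psi>: "\<And>j. Ck_on j U \<psi>" and y: "x + r *\<^sub>R b \<in> U"
  defines "G \<equiv> \<lambda>k x. exp (\<i> * of_real (t * \<psi> x)) * (\<Sum>l\<le>k. of_real t ^ l * sym_coeff \<psi> b k l x)"
  shows "((\<lambda>r. G k (x + r *\<^sub>R b)) has_vector_derivative G (Suc k) (x + r *\<^sub>R b)) (at r)"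
proof -
  let ?y = "x + r *\<^sub>R b"
  let ?d = "\<lambda>l. frechet_derivative (sym_coeff \<psi> b k l) (at ?y) b"
  let ?c = "\<lambda>l. sym_coeff \<psi> b k l ?y" and ?p = "frechet_derivative \<psi> (at ?y) b"
  have c: "((\<lambda>r. sym_coeff \<psi> b k l (x + r *\<^sub>R b)) has_vector_derivative ?d l) (at r)" for l
    by (rule has_vector_derivative_along_line[OF Ck_on_derivative[OF sym_coeff_smooth[OF assms(1) \<psi>] y]])
  have p: "((\<lambda>r. \<psi> (x + r *\<^sub>R b)) has_vector_derivative ?p) (at r)"
    by (rule has_vector_derivative_along_line[OF Ck_on_derivative[OF \<psi> y]])
  have "((\<lambda>r. \<i> * of_real (t * \<psi> (x + r *\<^sub>R b))) has_vector_derivative \<i> * of_real (t * ?p)) (at r)"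
    using has_vector_derivative_mult_right[OF p, of t]
    by (intro has_vector_derivative_mult_right has_vector_derivative_of_real)
      (simp add: has_real_derivative_iff_has_vector_derivative)
  then have "((exp \<circ> (\<lambda>r. \<i> * of_real (t * \<psi> (x + r *\<^sub>R b)))) has_vector_derivative (\<i> * of_real (t * ?p)) * exp (\<i> * of_real (t * \<psi> ?y))) (at r)"
    by (intro field_vector_diff_chain_at DERIV_exp)
  then have e: "((\<lambda>r. exp (\<i> * of_real (t * \<psi> (x + r *\<^sub>R b)))) has_vector_derivative (\<i> * of_real (t * ?p)) * exp (\<i> * of_real (t * \<psi> ?y))) (at r)"
    by (simp add: o_def)
  have s: "((\<lambda>r. \<Sum>l\<le>k. of_real t ^ l * sym_coeff \<psi> b k l (x + r *\<^sub>R b)) has_vector_derivative (\<Sum>l\<le>k. of_real t ^ l * ?d l)) (at r)"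
    by (intro has_vector_derivative_sum has_vector_derivative_mult_right c)
  \<comment> \<open>The sum for order k + 1 has one more term; its part with the differentiated
    coefficient vanishes, as order k has no coefficient of degree k + 1.\<close>
  have zero: "?d (Suc k) = 0" by (simp add: sym_coeff_zero)
  have "G (Suc k) ?y = exp (\<i> * of_real (t * \<psi> ?y)) *
      ((\<Sum>l\<le>Suc k. of_real t ^ l * ?d l) + (\<Sum>l\<le>Suc k. of_real t ^ l * (case l of 0 \<Rightarrow> 0 | Suc l' \<Rightarrow> \<i> * of_real ?p * ?c l')))"
    unfolding G_def by (simp only: sym_coeff.simps distrib_left sum.distrib)
  also have "(\<Sum>l\<le>Suc k. of_real t ^ l * ?d l) = (\<Sum>l\<le>k. of_real t ^ l * ?d l)"
    using zero by simp
  also have "(\<Sum>l\<le>Suc k. of_real t ^ l * (case l of 0 \<Rightarrow> 0 | Suc l' \<Rightarrow> \<i> * of_real ?p * ?c l'))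
     = \<i> * of_real (t * ?p) * (\<Sum>l\<le>k. of_real t ^ l * ?c l)"
    by (subst sum.atMost_Suc_shift) (simp add: sum_distrib_left mult_ac)
  finally have "G (Suc k) ?y = exp (\<i> * of_real (t * \<psi> ?y)) * (\<Sum>l\<le>k. of_real t ^ l * ?d l)
     + (\<i> * of_real (t * ?p)) * exp (\<i> * of_real (t * \<psi> ?y)) * (\<Sum>l\<le>k. of_real t ^ l * ?c l)"
    by (simp add: algebra_simps)
  with has_vector_derivative_mult[OF e s] show ?thesis unfolding G_def by simp
qed

text \<open>By homogeneity \<xi> may be moved to the unit sphere. There k derivatives cost at most a
  multiple of |t|^k because |t| >= 1 and the coefficients are bounded on a compact shell. The
  condition 2 N s <= |\<xi>| keeps the segment covered by the differences at distance at least
  |\<xi>|/2 from the singularity.\<close>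

lemma symbol_fdiff_bound:
  fixes \<phi> :: "'a::euclidean_space \<Rightarrow> real"
  assumes \<phi>: "smooth_on_subset (sphere 0 1) \<phi>"
  defines "m \<equiv> \<lambda>t \<xi>. exp (\<i> * complex_of_real (t * \<phi> (\<xi> /\<^sub>R norm \<xi>)))"
  shows "\<exists>C\<ge>0. \<forall>t b \<xi> s k. \<bar>t\<bar> \<ge> 1 \<longrightarrow> b \<in> Basis \<longrightarrow> k \<le> N \<longrightarrow> 0 \<le> s \<longrightarrow> \<xi> \<noteq> 0 \<longrightarrow> 2 * real N * s \<le> norm \<xi> \<longrightarrow>
    cmod ((fdiff (s *\<^sub>R b) ^^ k) (m t) \<xi>) \<le> C * (\<bar>t\<bar> * s / norm \<xi>) ^ k"
proof -
  define \<psi> where "\<psi> x = \<phi> (x /\<^sub>R norm x)" for x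
  have U: "open (-{0::'a})" by auto
  have \<psi>: "Ck_on j (-{0}) \<psi>" for j
    using Ck_on_homogeneous_extension[OF \<phi>] by (simp add: \<psi>_def[abs_def])
  \<comment> \<open>The points within distance 1/2 of the unit sphere: compact, and away from the
    origin.\<close>
  define K where "K = {x::'a. 1/2 \<le> norm x \<and> norm x \<le> 3/2}"
  have "K = cball 0 (3/2) - ball 0 (1/2)" by (auto simp: K_def)
  then have "compact K" by (simp add: compact_diff)
  have "\<exists>B. \<forall>x\<in>K. cmod (sym_coeff \<psi> b k l x) \<le> B" for b k l
  proof -
    have "continuous_on K (sym_coeff \<psi> b k l)"
      using Ck_on_continuous[OF sym_coeff_smooth[OF U \<psi>, of 0 b k l]] by (rule continuous_on_subset) (auto simp: K_def)
    from compact_continuous_image[OF this \<open>compact K\<close>] show ?thesis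
      using compact_imp_bounded bounded_iff by (metis image_eqI)
  qed
  then obtain B where B: "\<And>b k l x. x \<in> K \<Longrightarrow> cmod (sym_coeff \<psi> b k l x) \<le> B b k l" by metis
  \<comment> \<open>One constant for the finitely many directions and orders up to N.\<close>
  define C where "C = (\<Sum>b\<in>Basis. \<Sum>k\<le>N. \<Sum>l\<le>k. \<bar>B b k l\<bar>)"
  have C: "(\<Sum>l\<le>k. \<bar>B b k l\<bar>) \<le> C" if "b \<in> Basis" "k \<le> N" for b k
  proof -
    have "(\<Sum>l\<le>k. \<bar>B b k l\<bar>) \<le> (\<Sum>k\<le>N. \<Sum>l\<le>k. \<bar>B b k l\<bar>)"
      using that by (intro member_le_sum) (auto intro: sum_nonneg)
    also have "\<dots> \<le> C" unfolding C_def
      using that by (intro member_le_sum) (auto intro!: sum_nonneg)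
    finally show ?thesis .
  qed
  have "cmod ((fdiff (s *\<^sub>R b) ^^ k) (m t) \<xi>) \<le> C * (\<bar>t\<bar> * s / norm \<xi>) ^ k"
    if t: "\<bar>t\<bar> \<ge> 1" and b: "b \<in> Basis" and k: "k \<le> N" and s: "0 \<le> s" and \<xi>: "\<xi> \<noteq> 0" "2 * real N * s \<le> norm \<xi>" for t b \<xi> s k
  proof -
    define \<rho> where "\<rho> = norm \<xi>"
    have \<rho>: "\<rho> > 0" using \<xi> by (simp add: \<rho>_def)
    define x where "x = (1/\<rho>) *\<^sub>R \<xi>"
    define s' where "s' = s / \<rho>"
    have x: "norm x = 1" using \<xi> by (simp add: x_def \<rho>_def)
    have hom: "m t (\<rho> *\<^sub>R x) = m t x" for x
    proof -
      have "(\<rho> *\<^sub>R x) /\<^sub>R norm (\<rho> *\<^sub>R x) = x /\<^sub>R norm x" using \<rho> by simp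
      then show ?thesis unfolding m_def by (simp only:)
    qed
    have "(fdiff (\<rho> *\<^sub>R (s' *\<^sub>R b)) ^^ k) (m t) (\<rho> *\<^sub>R x) = (fdiff (s' *\<^sub>R b) ^^ k) (m t) x"
      by (rule fdiff_funpow_scale) (rule hom)
    then have eq: "(fdiff (s *\<^sub>R b) ^^ k) (m t) \<xi> = (fdiff (s' *\<^sub>R b) ^^ k) (m t) x"
      using \<rho> by (simp add: s'_def x_def)
    define G where "G k x = exp (\<i> * of_real (t * \<psi> x)) * (\<Sum>l\<le>k. of_real t ^ l * sym_coeff \<psi> b k l x)" for k x
    have G0: "G 0 = m t" by (simp add: G_def m_def \<psi>_def fun_eq_iff)
    have inK: "x + r *\<^sub>R b \<in> K" if r: "0 \<le> r" "r \<le> real k * s'" for r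
    proof -
      have "real k * s' \<le> real N * s'" using k s \<rho> by (intro mult_right_mono) (auto simp: s'_def)
      also have "\<dots> \<le> 1/2" using \<xi>(2) \<rho> by (simp add: s'_def \<rho>_def[symmetric] field_simps)
      finally have "norm (r *\<^sub>R b) \<le> 1/2" using r b by simp
      then show ?thesis
        using norm_triangle_ineq[of x "r *\<^sub>R b"] norm_diff_ineq[of x "r *\<^sub>R b"] x by (simp add: K_def)
    qed
    have "cmod ((fdiff (s' *\<^sub>R b) ^^ k) (G 0) x) \<le> s' ^ k * (C * \<bar>t\<bar> ^ k)"
    proof (rule fdiff_funpow_bound)
      show "0 \<le> s'" using s \<rho> by (simp add: s'_def)
      fix r assume r: "0 \<le> r" "r \<le> real k * s'"
      have nz: "x + r *\<^sub>R b \<in> -{0}" using inK[OF r] by (auto simp: K_def)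
      show "((\<lambda>r. G j (x + r *\<^sub>R b)) has_vector_derivative G (Suc j) (x + r *\<^sub>R b)) (at r)" for j
        unfolding G_def by (rule symbol_derivative[OF U \<psi> nz])
      have "cmod (G k (x + r *\<^sub>R b)) = cmod (\<Sum>l\<le>k. of_real t ^ l * sym_coeff \<psi> b k l (x + r *\<^sub>R b))"
        by (simp add: G_def norm_mult)
      also have "\<dots> \<le> (\<Sum>l\<le>k. \<bar>t\<bar> ^ k * \<bar>B b k l\<bar>)"
      proof (rule sum_norm_le)
        fix l assume l: "l \<in> {..k}"
        have "cmod (sym_coeff \<psi> b k l (x + r *\<^sub>R b)) \<le> \<bar>B b k l\<bar>"
          using B[OF inK[OF r], of b k l] by simp
        moreover have "\<bar>t\<bar> ^ l \<le> \<bar>t\<bar> ^ k" using t l by (intro power_increasing) auto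
        ultimately show "cmod (of_real t ^ l * sym_coeff \<psi> b k l (x + r *\<^sub>R b)) \<le> \<bar>t\<bar> ^ k * \<bar>B b k l\<bar>"
          by (simp add: norm_mult norm_power mult_mono)
      qed
      also have "\<dots> = \<bar>t\<bar> ^ k * (\<Sum>l\<le>k. \<bar>B b k l\<bar>)" by (simp add: sum_distrib_left)
      also have "\<dots> \<le> \<bar>t\<bar> ^ k * C" by (intro mult_left_mono C b k) auto
      finally show "cmod (G k (x + r *\<^sub>R b)) \<le> C * \<bar>t\<bar> ^ k" by (simp add: mult.commute)
    qed
    then show ?thesis
      unfolding eq G0 by (simp add: s'_def \<rho>_def power_mult_distrib power_divide mult_ac)
  qed
  moreover have "C \<ge> 0" unfolding C_def by (intro sum_nonneg) auto
  ultimately show ?thesis by blast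
qed

section \<open>The multiplier operator and iterated differences\<close>

definition symb :: "('a::euclidean_space \<Rightarrow> real) \<Rightarrow> real \<Rightarrow> 'a \<Rightarrow> complex" where
  "symb \<phi> t \<xi> = exp (\<i> * of_real (t * \<phi> (\<xi> /\<^sub>R norm \<xi>)))"

lemma cmod_symb[simp]: "cmod (symb \<phi> t \<xi>) = 1"
  by (simp add: symb_def)

lemma symb_scaleR: "c > 0 \<Longrightarrow> symb \<phi> t (c *\<^sub>R \<xi>) = symb \<phi> t \<xi>"
proof -
  assume "c > 0"
  then have "(c *\<^sub>R \<xi>) /\<^sub>R norm (c *\<^sub>R \<xi>) = \<xi> /\<^sub>R norm \<xi>" by simp
  then show ?thesis unfolding symb_def by (simp only:)
qed

lemma cnj_symb: "cnj (symb \<phi> t \<xi>) = symb \<phi> (-t) \<xi>"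
  by (simp add: symb_def exp_cnj)

lemma symb_measurable:
  assumes "smooth_on_subset (sphere 0 1) \<phi>"
  shows "symb \<phi> t \<in> borel_measurable borel"
proof -
  have "continuous_on (-{0}) (\<lambda>x. \<phi> (x /\<^sub>R norm x))"
    using Ck_on_continuous[OF Ck_on_homogeneous_extension[OF assms, of 0]] .
  \<comment> \<open>Continuity can fail at the origin only; there x/|x| evaluates to 0, so the
    patched value is \<open>\<phi> 0\<close>.\<close>
  then have "(\<lambda>x. if x \<in> -{0} then \<phi> (x /\<^sub>R norm x) else \<phi> 0) \<in> borel_measurable borel"
    by (intro borel_measurable_continuous_on_if) auto
  also have "(\<lambda>x. if x \<in> -{0} then \<phi> (x /\<^sub>R norm x) else \<phi> 0) = (\<lambda>x. \<phi> (x /\<^sub>R norm x))"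
    by auto
  finally have [measurable]: "(\<lambda>x. \<phi> (x /\<^sub>R norm x)) \<in> borel_measurable borel" .
  have "(\<lambda>\<xi>. exp (\<i> * complex_of_real (t * \<phi> (\<xi> /\<^sub>R norm \<xi>)))) \<in> borel_measurable borel"
    by (intro borel_measurable_continuous_on[of exp]) (auto intro: continuous_intros)
  then show ?thesis by (simp add: symb_def[abs_def])
qed

context
  fixes \<phi> :: "'a::euclidean_space \<Rightarrow> real"
  assumes smooth: "smooth_on_subset (sphere 0 1) \<phi>"
begin

lemma symb_mult_L2: "f \<in> Lp_space 2 \<Longrightarrow> (\<lambda>\<xi>. symb \<phi> t \<xi> * f \<xi>) \<in> Lp_space 2"
  by (intro L2_bound_mult[where C=1] symb_measurable smooth) auto

lemma A_op_spec:
  assumes f: "f \<in> Lp_space 2"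
  shows A_op_L2: "A_op \<phi> t f \<in> Lp_space 2"
    and A_op_fourier: "AE \<xi> in lborel. fourier_L2 (A_op \<phi> t f) \<xi> = symb \<phi> t \<xi> * fourier_L2 f \<xi>"
  using someI_ex[OF fourier_L2_surj[OF symb_mult_L2[OF fourier_L2_L2[OF f], of t]]]
  unfolding A_op_def fourier_multiplier_def symb_def by auto

text \<open>Injectivity of the transform determines the chosen representative up to a null set;
  rules for the operator follow by exhibiting a function with the right transform.\<close>

lemma A_op_unique:
  assumes f: "f \<in> Lp_space 2" and g: "g \<in> Lp_space 2"
    and "AE \<xi> in lborel. fourier_L2 g \<xi> = symb \<phi> t \<xi> * fourier_L2 f \<xi>"
  shows "AE x in lborel. A_op \<phi> t f x = g x"
  by (rule fourier_L2_inj[OF A_op_L2[OF f] g]) (use A_op_fourier[OF f, of t] assms(3) in eventually_elim, simp)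

lemma A_op_norm:
  assumes f: "f \<in> Lp_space 2"
  shows "N2 (A_op \<phi> t f) = N2 f"
proof -
  have "N2 (A_op \<phi> t f) = N2 (fourier_L2 (A_op \<phi> t f))" by (simp add: plancherel A_op_L2 f)
  also have "\<dots> = N2 (\<lambda>\<xi>. symb \<phi> t \<xi> * fourier_L2 f \<xi>)" by (rule N2_cong_AE[OF A_op_fourier[OF f]])
  also have "\<dots> = N2 (fourier_L2 f)" by (simp add: N2_def norm_mult)
  finally show ?thesis by (simp add: plancherel f)
qed

lemma A_op_lincomb:
  assumes f: "f \<in> Lp_space 2" and g: "g \<in> Lp_space 2"
  shows "AE x in lborel. A_op \<phi> t (\<lambda>x. f x + c * g x) x = A_op \<phi> t f x + c * A_op \<phi> t g x"
proof (rule A_op_unique)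
  show "(\<lambda>x. f x + c * g x) \<in> Lp_space 2" "(\<lambda>x. A_op \<phi> t f x + c * A_op \<phi> t g x) \<in> Lp_space 2"
    by (intro L2_add L2_cmult A_op_L2 f g)+
  show "AE \<xi> in lborel. fourier_L2 (\<lambda>x. A_op \<phi> t f x + c * A_op \<phi> t g x) \<xi> = symb \<phi> t \<xi> * fourier_L2 (\<lambda>x. f x + c * g x) \<xi>"
    using fourier_L2_lincomb[OF f g, of c] fourier_L2_lincomb[OF A_op_L2[OF f, of t] A_op_L2[OF g, of t], of c]
      A_op_fourier[OF f, of t] A_op_fourier[OF g, of t]
    by eventually_elim (simp add: algebra_simps)
qed

text \<open>The conjugate of the symbol for t is the symbol for -t, so the adjoint belongs to the
  same family and bounds in |t| apply to it.\<close>

lemma A_op_adjoint: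
  assumes f: "f \<in> Lp_space 2" and g: "g \<in> Lp_space 2"
  shows "(\<integral>x. A_op \<phi> t f x * cnj (g x) \<partial>lborel) = (\<integral>x. f x * cnj (A_op \<phi> (-t) g x) \<partial>lborel)"
proof -
  note [measurable] = L2_measurable[OF fourier_L2_L2[OF f]] L2_measurable[OF fourier_L2_L2[OF g]]
    L2_measurable[OF fourier_L2_L2[OF A_op_L2[OF f]]] L2_measurable[OF fourier_L2_L2[OF A_op_L2[OF g]]]
  have "(\<integral>x. A_op \<phi> t f x * cnj (g x) \<partial>lborel) = (\<integral>\<xi>. fourier_L2 (A_op \<phi> t f) \<xi> * cnj (fourier_L2 g \<xi>) \<partial>lborel)"
    by (rule parseval[symmetric]) (intro A_op_L2 f g)+
  also have "\<dots> = (\<integral>\<xi>. fourier_L2 f \<xi> * cnj (fourier_L2 (A_op \<phi> (-t) g) \<xi>) \<partial>lborel)"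
  proof (rule integral_cong_AE)
    show "AE \<xi> in lborel. fourier_L2 (A_op \<phi> t f) \<xi> * cnj (fourier_L2 g \<xi>) = fourier_L2 f \<xi> * cnj (fourier_L2 (A_op \<phi> (-t) g) \<xi>)"
      using A_op_fourier[OF f, of t] A_op_fourier[OF g, of "-t"]
      by eventually_elim (simp add: cnj_symb)
  qed measurable
  also have "\<dots> = (\<integral>x. f x * cnj (A_op \<phi> (-t) g x) \<partial>lborel)"
    by (rule parseval) (intro A_op_L2 f g)+
  finally show ?thesis .
qed

text \<open>Translation multiplies transforms by a character and dilation rescales \<xi>, to which a
  symbol homogeneous of degree 0 is insensitive. This reduces cubes of every size and position to
  one.\<close>

lemma A_op_affine:
  assumes f: "f \<in> Lp_space 2" and c: "c > 0"
  shows "AE x in lborel. A_op \<phi> t (\<lambda>x. f (y + c *\<^sub>R x)) x = A_op \<phi> t f (y + c *\<^sub>R x)"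
proof (rule A_op_unique)
  show "(\<lambda>x. f (y + c *\<^sub>R x)) \<in> Lp_space 2" "(\<lambda>x. A_op \<phi> t f (y + c *\<^sub>R x)) \<in> Lp_space 2"
    by (intro L2_affine A_op_L2 f c)+
  have "AE \<xi> in lborel. fourier_L2 (A_op \<phi> t f) (0 + (1/c) *\<^sub>R \<xi>) = symb \<phi> t (0 + (1/c) *\<^sub>R \<xi>) * fourier_L2 f (0 + (1/c) *\<^sub>R \<xi>)"
    using c by (intro AE_affine A_op_fourier[OF f]) auto
  with fourier_L2_affine[OF f c, of y] fourier_L2_affine[OF A_op_L2[OF f, of t] c, of y]
  show "AE \<xi> in lborel. fourier_L2 (\<lambda>x. A_op \<phi> t f (y + c *\<^sub>R x)) \<xi> = symb \<phi> t \<xi> * fourier_L2 (\<lambda>x. f (y + c *\<^sub>R x)) \<xi>"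
    by eventually_elim (use c symb_scaleR[of "1/c" \<phi> t] in simp)
qed

end

section \<open>Differences on the Fourier side\<close>

lemma fdiff_cong_AE:
  fixes f :: "'a::euclidean_space \<Rightarrow> complex"
  assumes "AE x in lborel. f x = g x"
  shows "AE x in lborel. (fdiff h ^^ n) f x = (fdiff h ^^ n) g x"
proof (induction n)
  case (Suc n)
  show ?case using Suc AE_translate[OF Suc, of h] by eventually_elim (simp add: fdiff_def)
qed (simp add: assms)

lemma modulate_power_L2:
  assumes u: "u \<in> Lp_space 2"
  shows "(\<lambda>x. u x * (fker x h - 1) ^ n) \<in> Lp_space 2"
proof -
  have "(\<lambda>x. (fker x h - 1) ^ n * u x) \<in> Lp_space 2"
  proof (rule L2_bound_mult[OF u])
    show "cmod ((fker x h - 1) ^ n) \<le> 2 ^ n" for x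
      using norm_triangle_ineq4[of "fker x h" 1] by (auto simp: norm_power intro!: power_mono)
  qed measurable
  then show ?thesis by (simp add: mult.commute)
qed

lemma fourier_L2_modulate_power:
  assumes u: "u \<in> Lp_space 2"
  shows "AE \<xi> in lborel. fourier_L2 (\<lambda>x. u x * (fker x h - 1) ^ n) \<xi> = (fdiff h ^^ n) (fourier_L2 u) \<xi>"
proof (induction n)
  case (Suc n)
  let ?v = "\<lambda>x. u x * (fker x h - 1) ^ n"
  have v: "?v \<in> Lp_space 2" by (rule modulate_power_L2[OF u])
  have vm: "(\<lambda>x. ?v x * fker x h) \<in> Lp_space 2"
    using L2_bound_mult[OF v, of "\<lambda>x. fker x h" 1] by (simp add: mult.commute)
  have eq: "(\<lambda>x. u x * (fker x h - 1) ^ Suc n) = (\<lambda>x. ?v x * fker x h + (-1) * ?v x)"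
    by (simp add: algebra_simps)
  show ?case unfolding eq
    using fourier_L2_lincomb[OF vm v, of "-1"] fourier_L2_modulate[OF v, of h] Suc AE_translate[OF Suc, of h]
    by eventually_elim (simp add: fdiff_def)
qed simp

text \<open>A weight in x becomes a difference in \<xi>; spatial decay is measured in this way
  without differentiating the transform.\<close>

lemma N2_modulate_power:
  assumes u: "u \<in> Lp_space 2"
  shows "N2 (\<lambda>x. u x * (fker x h - 1) ^ n) = N2 ((fdiff h ^^ n) (fourier_L2 u))"
  using plancherel[OF modulate_power_L2[OF u]] N2_cong_AE[OF fourier_L2_modulate_power[OF u]] by simp

text \<open>Counterpart for integrable functions, valid at every point and not only almost
  everywhere, as the pointwise bounds for the transform of an atom require.\<close>

lemma fdiff_fourier:
  assumes f: "integrable lborel f"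
  shows "(fdiff h ^^ n) (fourier_integral f) = fourier_integral (\<lambda>x. f x * (fker x h - 1) ^ n)
    \<and> integrable lborel (\<lambda>x. f x * (fker x h - 1) ^ n)"
proof (induction n)
  case (Suc n)
  let ?v = "\<lambda>x. f x * (fker x h - 1) ^ n"
  have i: "integrable lborel ?v" "integrable lborel (\<lambda>x. ?v x * fker x h)"
    using Suc by (auto intro: fourier_integrable)
  have eq: "(\<lambda>x. f x * (fker x h - 1) ^ Suc n) = (\<lambda>x. ?v x * fker x h - ?v x)"
    by (simp add: algebra_simps)
  show ?case unfolding eq
    using Suc i by (auto simp: fdiff_def fourier_diff fourier_modulate fun_eq_iff)
qed (simp add: f)

lemma cmod_fker_diff: "cmod (fker x h - 1) \<le> 2 * pi * \<bar>x \<bullet> h\<bar>"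
  using iexp_approx1[of "- 2 * pi * (x \<bullet> h)" 0]
  by (simp add: fker_def mult_ac abs_mult)

text \<open>With \<theta> the phase, the first-order Taylor error is at most \<theta>^2/2 <=
  |\<theta>|/2 for |\<theta>| <= 1, which leaves half of |\<theta>| = 2 pi |x . h|.\<close>

lemma cmod_fker_diff_ge:
  assumes "2 * pi * \<bar>x \<bullet> h\<bar> \<le> 1"
  shows "cmod (fker x h - 1) \<ge> pi * \<bar>x \<bullet> h\<bar>"
proof -
  let ?\<theta> = "- 2 * pi * (x \<bullet> h)"
  have eq: "fker x h = iexp ?\<theta>" by (simp add: fker_def mult_ac)
  have "cmod (iexp ?\<theta> - (1 + \<i> * ?\<theta>)) \<le> \<bar>?\<theta>\<bar>\<^sup>2 / 2"
    using iexp_approx1[of ?\<theta> 1] by (simp add: numeral_2_eq_2)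
  then have "cmod (\<i> * ?\<theta>) - cmod (fker x h - 1) \<le> \<bar>?\<theta>\<bar>\<^sup>2 / 2"
    unfolding eq using norm_triangle_ineq2[of "\<i> * ?\<theta>" "iexp ?\<theta> - 1"]
    by (simp add: norm_minus_commute algebra_simps)
  moreover have "cmod (\<i> * ?\<theta>) = \<bar>?\<theta>\<bar>" by (simp only: norm_mult norm_of_real norm_ii mult_1)
  moreover have "\<bar>?\<theta>\<bar> = 2 * pi * \<bar>x \<bullet> h\<bar>" by (simp add: abs_mult)
  moreover have "\<bar>?\<theta>\<bar>\<^sup>2 \<le> \<bar>?\<theta>\<bar>"
  proof -
    have "\<bar>?\<theta>\<bar> \<le> 1" using assms by (simp add: abs_mult)
    from mult_left_mono[OF this abs_ge_zero[of ?\<theta>]] show ?thesis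
      by (simp only: power2_eq_square mult_1_right)
  qed
  ultimately show ?thesis by linarith
qed

lemma fdiff_bound:
  assumes "\<And>k. k \<le> n \<Longrightarrow> cmod (w (x + real k *\<^sub>R h)) \<le> M"
  shows "cmod ((fdiff h ^^ n) w x) \<le> 2 ^ n * M"
  using assms
proof (induction n arbitrary: x)
  case 0
  then show ?case using 0[of 0] by simp
next
  case (Suc n)
  have "cmod ((fdiff h ^^ n) w x) \<le> 2 ^ n * M" by (rule Suc.IH) (use Suc.prems in auto)
  moreover have "cmod ((fdiff h ^^ n) w (x + h)) \<le> 2 ^ n * M"
  proof (rule Suc.IH)
    fix k assume "k \<le> n"
    then show "cmod (w (x + h + real k *\<^sub>R h)) \<le> M"
      using Suc.prems[of "Suc k"] by (simp add: scaleR_left_distrib add.assoc)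
  qed
  moreover have "(fdiff h ^^ Suc n) w x = (fdiff h ^^ n) w (x + h) - (fdiff h ^^ n) w x"
    by (simp add: fdiff_def)
  ultimately show ?case
    using norm_triangle_ineq4[of "(fdiff h ^^ n) w (x + h)" "(fdiff h ^^ n) w x"] by (simp del: funpow.simps)
qed

lemma fdiff_add: "(fdiff h ^^ n) (\<lambda>x. f x + g x) = (\<lambda>x. (fdiff h ^^ n) f x + (fdiff h ^^ n) g x)"
  by (induction n) (auto simp: fdiff_def)

lemma fdiff_shift: "(fdiff h ^^ n) (\<lambda>x. f (x + y)) = (\<lambda>x. (fdiff h ^^ n) f (x + y))"
  by (induction n) (auto simp: fdiff_def add_ac)

text \<open>Discrete Leibniz rule: a difference falls on f or on g, and in the second case f is
  shifted by h. After n steps there are 2^n terms, and f with k differences is evaluated at x + (n -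
  k) h.\<close>

lemma fdiff_mult_bound:
  assumes "\<And>k. k \<le> n \<Longrightarrow> cmod ((fdiff h ^^ k) f (x + real (n - k) *\<^sub>R h)) * cmod ((fdiff h ^^ (n - k)) g x) \<le> M"
  shows "cmod ((fdiff h ^^ n) (\<lambda>x. f x * g x) x) \<le> 2 ^ n * M"
  using assms
proof (induction n arbitrary: f g)
  case 0
  then show ?case using 0[of 0] by (simp add: norm_mult)
next
  case (Suc n)
  have "fdiff h (\<lambda>x. f x * g x) = (\<lambda>x. fdiff h f x * g x + f (x + h) * fdiff h g x)"
    by (simp add: fdiff_def algebra_simps)
  then have eq: "(fdiff h ^^ Suc n) (\<lambda>x. f x * g x) x
     = (fdiff h ^^ n) (\<lambda>x. fdiff h f x * g x) x + (fdiff h ^^ n) (\<lambda>x. f (x + h) * fdiff h g x) x"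
    unfolding funpow_Suc_right o_def by (simp only: fdiff_add)
  have "cmod ((fdiff h ^^ n) (\<lambda>x. fdiff h f x * g x) x) \<le> 2 ^ n * M"
  proof (rule Suc.IH)
    fix k assume "k \<le> n"
    then show "cmod ((fdiff h ^^ k) (fdiff h f) (x + real (n - k) *\<^sub>R h)) * cmod ((fdiff h ^^ (n - k)) g x) \<le> M"
      using Suc.prems[of "Suc k"] by (simp add: funpow_swap1)
  qed
  moreover have "cmod ((fdiff h ^^ n) (\<lambda>x. f (x + h) * fdiff h g x) x) \<le> 2 ^ n * M"
  proof (rule Suc.IH)
    fix k assume k: "k \<le> n"
    have "(fdiff h ^^ k) (\<lambda>x. f (x + h)) (x + real (n - k) *\<^sub>R h) = (fdiff h ^^ k) f (x + real (Suc n - k) *\<^sub>R h)"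
      unfolding fdiff_shift using k by (simp add: Suc_diff_le scaleR_left_distrib add_ac)
    moreover have "(fdiff h ^^ (n - k)) (fdiff h g) x = (fdiff h ^^ (Suc n - k)) g x"
      using k by (simp add: Suc_diff_le funpow_swap1)
    ultimately show "cmod ((fdiff h ^^ k) (\<lambda>x. f (x + h)) (x + real (n - k) *\<^sub>R h)) * cmod ((fdiff h ^^ (n - k)) (fdiff h g) x) \<le> M"
      using Suc.prems[of k] k by simp
  qed
  ultimately show ?case unfolding eq
    using norm_triangle_ineq[of "(fdiff h ^^ n) (\<lambda>x. fdiff h f x * g x) x" "(fdiff h ^^ n) (\<lambda>x. f (x + h) * fdiff h g x) x"]
    by simp
qed

lemma cauchy_kernel_finite: "(\<integral>\<^sup>+y. ennreal (1 / (1 + y\<^sup>2)) \<partial>lborel) < \<infinity>"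
proof -
  have "integrable lborel (\<lambda>y::real. inverse (1 + y\<^sup>2))"
    using integrable_inverse_1_plus_square by (simp add: set_integrable_def)
  then show ?thesis by (simp add: integrable_iff_bounded inverse_eq_divide)
qed

text \<open>The product of Cauchy kernels replaces the radial weight min(1, r/|\<xi>|)^(2d), which
  it dominates up to a constant by \<open>product_kernel_ge\<close>, while its integral factors over
  the coordinates.\<close>

lemma product_kernel_scaled:
  "\<exists>I\<ge>0. \<forall>r>0. (\<integral>\<^sup>+\<xi>. ennreal (\<Prod>b\<in>Basis. 1 / (1 + ((\<xi> \<bullet> b) / r)\<^sup>2)) \<partial>(lborel :: 'a::euclidean_space measure)) = ennreal (I * r ^ DIM('a))"
proof -
  obtain J where J: "J \<ge> 0" "(\<integral>\<^sup>+y. ennreal (1 / (1 + y\<^sup>2)) \<partial>lborel) = ennreal J"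
    using cauchy_kernel_finite by (cases "(\<integral>\<^sup>+y. ennreal (1 / (1 + y\<^sup>2)) \<partial>lborel)") auto
  have "(\<integral>\<^sup>+\<xi>. ennreal (\<Prod>b\<in>Basis. 1 / (1 + ((\<xi> \<bullet> b) / r)\<^sup>2)) \<partial>(lborel :: 'a measure)) = ennreal (J ^ DIM('a) * r ^ DIM('a))"
    if r: "r > 0" for r
  proof -
    have "(\<integral>\<^sup>+\<xi>. ennreal (\<Prod>b\<in>Basis. 1 / (1 + ((\<xi> \<bullet> b) / r)\<^sup>2)) \<partial>(lborel :: 'a measure))
       = (\<integral>\<^sup>+\<xi>. (\<Prod>b\<in>Basis. ennreal (1 / (1 + ((\<xi> \<bullet> b) / r)\<^sup>2))) \<partial>(lborel :: 'a measure))"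
      by (intro nn_integral_cong) (simp add: prod_ennreal)
    also have "\<dots> = (\<Prod>b\<in>(Basis::'a set). \<integral>\<^sup>+y. ennreal (1 / (1 + (y / r)\<^sup>2)) \<partial>lborel)"
      by (rule nn_integral_lborel_prod[where f="\<lambda>b y. ennreal (1 / (1 + (y / r)\<^sup>2))"]) auto
    also have "(\<integral>\<^sup>+y. ennreal (1 / (1 + (y / r)\<^sup>2)) \<partial>lborel) = ennreal (r * J)"
      using r J nn_integral_real_affine[of "\<lambda>y. ennreal (1 / (1 + (y / r)\<^sup>2))" r 0] by (simp add: ennreal_mult)
    finally show ?thesis using r J by (simp add: ennreal_power power_mult_distrib mult.commute)
  qed
  moreover have "J ^ DIM('a) \<ge> 0" using J by simp
  ultimately show ?thesis by blast
qed

section \<open>The estimate for atoms\<close>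

text \<open>The radius \<open>DIM('a)\<close> is what \<open>cube_norm_diff\<close> gives for a unit
  cube seen from any of its points, so a rescaled cube may sit off centre.\<close>

definition unit_atom :: "('a::euclidean_space \<Rightarrow> complex) \<Rightarrow> bool" where
  "unit_atom a \<longleftrightarrow> a \<in> borel_measurable borel \<and> (\<forall>x. cmod (a x) \<le> 1) \<and>
    (\<forall>x. norm x > real DIM('a) \<longrightarrow> a x = 0) \<and> (\<integral>x. a x \<partial>lborel) = 0"

lemma fdiff_measurable[measurable]:
  assumes [measurable]: "f \<in> borel_measurable borel"
  shows "(fdiff h ^^ n) f \<in> borel_measurable (borel :: 'a::euclidean_space measure)"
proof (induction n)
  case (Suc n)
  note [measurable] = Suc
  have "(fdiff h ^^ Suc n) f = (\<lambda>x. (fdiff h ^^ n) f (x + h) - (fdiff h ^^ n) f x)" by (simp add: fdiff_def)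
  then show ?case by (simp only:) measurable
qed simp

lemma integral_le_ball:
  fixes f :: "'a::euclidean_space \<Rightarrow> real"
  assumes [measurable]: "f \<in> borel_measurable borel" and "0 \<le> r"
    and f: "\<And>x. 0 \<le> f x" "\<And>x. norm x \<le> r \<Longrightarrow> f x \<le> c" "\<And>x. norm x > r \<Longrightarrow> f x = 0"
  shows "(\<integral>\<^sup>+x. ennreal (f x) \<partial>lborel) \<le> ennreal (c * (unit_ball_vol (DIM('a)) * r ^ DIM('a)))"
proof -
  have "0 \<le> c" using order_trans[OF f(1) f(2)[of 0]] \<open>0 \<le> r\<close> by simp
  have "(\<integral>\<^sup>+x. ennreal (f x) \<partial>lborel) \<le> (\<integral>\<^sup>+x. ennreal c * indicator (cball (0::'a) r) x \<partial>lborel)"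
    using f by (intro nn_integral_mono) (auto simp: indicator_def not_le intro!: ennreal_leI)
  also have "\<dots> = ennreal c * ennreal (unit_ball_vol (DIM('a)) * r ^ DIM('a))"
    using \<open>0 \<le> r\<close> by (subst nn_integral_cmult_indicator) (auto simp: emeasure_cball)
  finally show ?thesis using \<open>0 \<le> c\<close> by (simp add: ennreal_mult')
qed

text \<open>V is the volume of the ball that carries the atom, and |\<open>fker x h\<close> - 1| <=
  P |h| on it. Inserting the factor (\<open>fker x h\<close> - 1)^j under the integral gives the
  pointwise bounds in L_1 and the norm bounds in L_2.\<close>

lemma unit_atom_fourier:
  fixes a :: "'a::euclidean_space \<Rightarrow> complex"
  assumes "unit_atom a"
  defines "V \<equiv> unit_ball_vol (real DIM('a)) * real DIM('a) ^ DIM('a)" and "P \<equiv> 2 * pi * real DIM('a)"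
  shows unit_atom_integrable: "integrable lborel a" and unit_atom_L2: "a \<in> Lp_space 2"
    and unit_atom_N2: "N2 a \<le> ennreal V"
    and unit_atom_fdiff: "\<And>j h \<xi>. cmod ((fdiff h ^^ j) (fourier_integral a) \<xi>) \<le> V * (P * norm h) ^ j"
    and unit_atom_fourier_le: "\<And>\<xi>. cmod (fourier_integral a \<xi>) \<le> V * P * norm \<xi>"
    and unit_atom_fdiff_N2: "\<And>j h. N2 ((fdiff h ^^ j) (fourier_integral a)) \<le> ennreal (V * (P * norm h) ^ (2 * j))"
proof -
  have [measurable]: "a \<in> borel_measurable borel" and a: "\<And>x. cmod (a x) \<le> 1" "\<And>x. norm x > real DIM('a) \<Longrightarrow> a x = 0" "(\<integral>x. a x \<partial>lborel) = 0"
    using assms(1) by (auto simp: unit_atom_def)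
  have nn: "(\<integral>\<^sup>+x. ennreal (cmod (a x)) \<partial>lborel) \<le> ennreal (1 * V)"
    unfolding V_def by (rule integral_le_ball) (use a in auto)
  then show i: "integrable lborel a"
    by (auto simp: integrable_iff_bounded elim!: order.strict_trans1)
  have p: "cmod (a x * (fker x h - 1) ^ j) \<le> (P * norm h) ^ j" if x: "norm x \<le> real DIM('a)" for x h j
  proof -
    have "cmod (fker x h - 1) \<le> 2 * pi * (norm x * norm h)"
      by (rule order_trans[OF cmod_fker_diff]) (simp add: Cauchy_Schwarz_ineq2)
    also have "\<dots> \<le> P * norm h" unfolding P_def using x by (simp add: mult_right_mono mult.assoc)
    finally have "cmod (fker x h - 1) ^ j \<le> (P * norm h) ^ j" by (intro power_mono) auto
    then have "cmod (a x) * cmod (fker x h - 1) ^ j \<le> 1 * (P * norm h) ^ j"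
      using a(1) by (intro mult_mono) auto
    then show ?thesis by (simp add: norm_mult norm_power)
  qed
  have N2j: "N2 (\<lambda>x. a x * (fker x h - 1) ^ j) \<le> ennreal (V * (P * norm h) ^ (2 * j))" for h j
  proof -
    have "(\<integral>\<^sup>+x. ennreal ((cmod (a x * (fker x h - 1) ^ j))\<^sup>2) \<partial>lborel) \<le> ennreal (((P * norm h) ^ j)\<^sup>2 * V)"
      unfolding V_def
      by (rule integral_le_ball) (auto simp: a(2) intro!: power_mono p)
    then show ?thesis by (simp add: N2_def power_mult[symmetric] mult.commute)
  qed
  show N: "N2 a \<le> ennreal V" using N2j[of 0 0] by simp
  then show L: "a \<in> Lp_space 2" by (intro L2_I) (auto elim!: order.strict_trans1)
  show fd: "cmod ((fdiff h ^^ j) (fourier_integral a) \<xi>) \<le> V * (P * norm h) ^ j" for j h \<xi>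
  proof -
    note F = fdiff_fourier[OF i, where h=h and n=j]
    have "(\<integral>\<^sup>+x. ennreal (cmod (a x * (fker x h - 1) ^ j)) \<partial>lborel) \<le> ennreal ((P * norm h) ^ j * V)"
      unfolding V_def by (rule integral_le_ball) (auto simp: a(2) intro!: p)
    then have "ennreal (\<integral>x. cmod (a x * (fker x h - 1) ^ j) \<partial>lborel) \<le> ennreal ((P * norm h) ^ j * V)"
      using F by (subst nn_integral_eq_integral[symmetric]) auto
    moreover have "0 \<le> (P * norm h) ^ j * V" by (simp add: P_def V_def unit_ball_vol_nonneg)
    ultimately have "(\<integral>x. cmod (a x * (fker x h - 1) ^ j) \<partial>lborel) \<le> (P * norm h) ^ j * V"
      using ennreal_le_iff by blast
    with fourier_bound[of "\<lambda>x. a x * (fker x h - 1) ^ j" \<xi>] F show ?thesis by (simp add: mult.commute)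
  qed
  \<comment> \<open>The mean of the atom is its transform at 0; since it vanishes, the transform at
    \<xi> is its first difference at 0 with step \<xi>.\<close>
  show "cmod (fourier_integral a \<xi>) \<le> V * P * norm \<xi>" for \<xi>
    using fd[where h=\<xi> and j=1 and \<xi>=0] a(3) by (simp add: fdiff_def fourier_integral_fker mult.assoc)
  show "N2 ((fdiff h ^^ j) (fourier_integral a)) \<le> ennreal (V * (P * norm h) ^ (2 * j))" for j h
    using fdiff_fourier[OF i, where h=h and n=j] N2j[of h j] plancherel_L1_L2[of "\<lambda>x. a x * (fker x h - 1) ^ j"] modulate_power_L2[OF L, where h=h and n=j]
    by simp
qed

lemma product_kernel_ge:
  fixes \<xi> :: "'a::euclidean_space"
  assumes "norm \<xi> \<le> q * r" "r > 0"
  shows "(1 / (1 + q\<^sup>2)) ^ DIM('a) \<le> (\<Prod>b\<in>Basis. 1 / (1 + ((\<xi> \<bullet> b) / r)\<^sup>2))"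
proof -
  have "(1 / (1 + q\<^sup>2)) ^ DIM('a) = (\<Prod>b\<in>(Basis::'a set). 1 / (1 + q\<^sup>2))" by simp
  also have "\<dots> \<le> (\<Prod>b\<in>Basis. 1 / (1 + ((\<xi> \<bullet> b) / r)\<^sup>2))"
  proof (intro prod_mono conjI)
    fix b :: 'a assume b: "b \<in> Basis"
    have "\<bar>(\<xi> \<bullet> b) / r\<bar> \<le> q"
      using Basis_le_norm[OF b, of \<xi>] assms by (simp add: field_simps)
    from power_mono[OF this abs_ge_zero, of 2] have "((\<xi> \<bullet> b) / r)\<^sup>2 \<le> q\<^sup>2" by (simp only: power2_abs)
    then show "1 / (1 + q\<^sup>2) \<le> 1 / (1 + ((\<xi> \<bullet> b) / r)\<^sup>2)"
      by (intro divide_left_mono) (auto intro!: mult_pos_pos add_pos_nonneg)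
  qed auto
  finally show ?thesis .
qed

lemma sum_power2_le:
  fixes x :: "nat \<Rightarrow> real"
  shows "(\<Sum>k\<le>n. x k)\<^sup>2 \<le> real (Suc n) * (\<Sum>k\<le>n. (x k)\<^sup>2)"
  using Cauchy_Schwarz_ineq_sum[of "\<lambda>_. 1" x "{..n}"] by simp

lemma ennreal_le_of_sq_le:
  assumes "x\<^sup>2 \<le> ennreal (c\<^sup>2)" "0 \<le> c"
  shows "x \<le> ennreal c"
proof (cases x)
  case (real y)
  then have "y\<^sup>2 \<le> c\<^sup>2" using assms by (simp add: ennreal_power)
  then show ?thesis using real assms(2) by (simp add: power2_le_iff_abs_le ennreal_leI)
qed (use assms in \<open>auto simp: top_power_ennreal top_unique\<close>)

text \<open>Cauchy-Schwarz against the indicator of A, whose measure is at most that of the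
  ball.\<close>

lemma nn_integral_ball_L2:
  fixes u :: "'a::euclidean_space \<Rightarrow> complex"
  assumes [measurable]: "u \<in> borel_measurable borel" "A \<in> sets borel" and A: "A \<subseteq> cball 0 \<rho>" and "0 \<le> \<rho>" "0 \<le> c"
    and c: "N2 (\<lambda>x. indicator A x * u x) * ennreal (unit_ball_vol (DIM('a)) * \<rho> ^ DIM('a)) \<le> ennreal (c\<^sup>2)"
  shows "(\<integral>\<^sup>+x. ennreal (cmod (u x)) * indicator A x \<partial>lborel) \<le> ennreal c"
proof (rule ennreal_le_of_sq_le)
  have "(\<integral>\<^sup>+x. ennreal (cmod (u x)) * indicator A x \<partial>lborel) = (\<integral>\<^sup>+x. ennreal (cmod ((indicator A x * u x) * indicator A x)) \<partial>lborel)"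
    by (intro nn_integral_cong) (auto simp: indicator_def)
  then have "(\<integral>\<^sup>+x. ennreal (cmod (u x)) * indicator A x \<partial>lborel)\<^sup>2 \<le> N2 (\<lambda>x. indicator A x * u x) * N2 (\<lambda>x. indicator A x :: complex)"
    using L2_mult_nn[of "\<lambda>x. indicator A x * u x" "indicator A"] by simp
  also have "N2 (\<lambda>x. indicator A x :: complex) = (\<integral>\<^sup>+x. indicator A x \<partial>lborel)"
    unfolding N2_def by (intro nn_integral_cong) (auto simp: indicator_def)
  also have "\<dots> = emeasure lborel A" by simp
  also have "N2 (\<lambda>x. indicator A x * u x) * emeasure lborel A \<le> N2 (\<lambda>x. indicator A x * u x) * emeasure lborel (cball (0::'a) \<rho>)"
    by (intro mult_left_mono emeasure_mono A) auto
  also have "\<dots> \<le> ennreal (c\<^sup>2)" using c \<open>0 \<le> \<rho>\<close> by (simp add: emeasure_cball)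
  finally show "(\<integral>\<^sup>+x. ennreal (cmod (u x)) * indicator A x \<partial>lborel)\<^sup>2 \<le> ennreal (c\<^sup>2)" .
qed fact

lemma powr_half_sq: "x > 0 \<Longrightarrow> (x powr (real n / 2))\<^sup>2 = x ^ n"
  by (simp add: power2_eq_square powr_add[symmetric] powr_realpow)

context
  fixes \<phi> :: "'a::euclidean_space \<Rightarrow> real"
  assumes smooth: "smooth_on_subset (sphere 0 1) \<phi>"
begin

text \<open>Let r = |t|/(4 pi R), the frequency below which differences of the symbol gain nothing.
  For |\<xi>| of order at most r, the cancellation bound on the atom gives a square of size r^2 on a
  volume r^d. For larger |\<xi>| up to 1, k differences of the symbol give (r/|\<xi>|)^k; the worst
  case k = d + 1, multiplied by the bound |\<xi>| for the atom, gives r^(d+1)/|\<xi>|^d, whose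
  square integrates to order r^(d+2) as 2d > d. For |\<xi>| > 1 the transform of the atom is
  controlled in L_2, which gives r^(2d+2).\<close>

lemma atom_fdiff_estimate:
  defines "N \<equiv> Suc DIM('a)"
  shows "\<exists>C\<ge>0. \<forall>t a b R. 1 \<le> \<bar>t\<bar> \<longrightarrow> unit_atom a \<longrightarrow> b \<in> Basis \<longrightarrow> real N * \<bar>t\<bar> \<le> R \<longrightarrow>
    N2 ((fdiff ((1 / (4 * pi * R)) *\<^sub>R b) ^^ N) (\<lambda>\<xi>. symb \<phi> t \<xi> * fourier_integral a \<xi>))
      \<le> ennreal (C * (\<bar>t\<bar> / R) ^ (DIM('a) + 2))"
proof -
  define V where "V = unit_ball_vol (real DIM('a)) * real DIM('a) ^ DIM('a)"
  define P where "P = 2 * pi * real DIM('a)"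
  \<comment> \<open>Q >= 1 lets every power of P up to N be replaced by the N-th power of Q.\<close>
  define Q where "Q = max 1 P"
  have V: "V \<ge> 0" by (simp add: V_def unit_ball_vol_nonneg)
  have P: "P \<ge> 0" "P \<le> Q" "Q \<ge> 1" by (auto simp: P_def Q_def)
  obtain Cm where Cm: "Cm \<ge> 0" and sym0: "\<forall>t b \<xi> s k. \<bar>t\<bar> \<ge> 1 \<longrightarrow> b \<in> Basis \<longrightarrow> k \<le> N \<longrightarrow> 0 \<le> s \<longrightarrow> \<xi> \<noteq> 0 \<longrightarrow>
      2 * real N * s \<le> norm \<xi> \<longrightarrow> cmod ((fdiff (s *\<^sub>R b) ^^ k) (symb \<phi> t) \<xi>) \<le> Cm * (\<bar>t\<bar> * s / norm \<xi>) ^ k"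
    using symbol_fdiff_bound[OF smooth, of N] unfolding symb_def[abs_def] by blast
  have sym: "cmod ((fdiff (s *\<^sub>R b) ^^ k) (symb \<phi> t) \<xi>) \<le> Cm * (\<bar>t\<bar> * s / norm \<xi>) ^ k"
    if "\<bar>t\<bar> \<ge> 1" "b \<in> Basis" "k \<le> N" "0 \<le> s" "\<xi> \<noteq> 0" "2 * real N * s \<le> norm \<xi>" for t b \<xi> s k
    using sym0 that by blast
  obtain I where I: "I \<ge> 0" "\<And>r. r > 0 \<Longrightarrow>
      (\<integral>\<^sup>+\<xi>. ennreal (\<Prod>b\<in>Basis. 1 / (1 + ((\<xi> \<bullet> b) / r)\<^sup>2)) \<partial>(lborel :: 'a measure)) = ennreal (I * r ^ DIM('a))"
    using product_kernel_scaled[where 'a='a] by metis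
  define cA where "cA = 2 ^ N * (V * P * (5 * real N))"
  define cB where "cB = 2 ^ N * (Cm * V * 2 ^ N * Q ^ N)"
  \<comment> \<open>\<open>c3\<close> collects the regions |\<xi>| <= 4 N r and 4 N r < |\<xi>| <=
    1, each bound being divided by a lower bound of the kernel \<open>H\<close> there;
    \<open>c4\<close> belongs to |\<xi>| > 1.\<close>
  define c3 where "c3 = cA\<^sup>2 * (1 + (4 * real N)\<^sup>2) ^ DIM('a) + cB\<^sup>2 * 2 ^ DIM('a)"
  define c4 where "c4 = 4 ^ N * real (Suc N) * Cm\<^sup>2"
  define C where "C = c3 * I + real (Suc N) * (c4 * V * (2 * Q) ^ (2 * N))"
  have c3: "c3 \<ge> 0" unfolding c3_def by (intro add_nonneg_nonneg mult_nonneg_nonneg) auto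
  have c4: "c4 \<ge> 0" unfolding c4_def by (intro mult_nonneg_nonneg) auto
  have C: "C \<ge> 0" unfolding C_def using c3 c4 I V P by (intro add_nonneg_nonneg mult_nonneg_nonneg) auto
  have "N2 ((fdiff ((1 / (4 * pi * R)) *\<^sub>R b) ^^ N) (\<lambda>\<xi>. symb \<phi> t \<xi> * fourier_integral a \<xi>)) \<le> ennreal (C * (\<bar>t\<bar> / R) ^ (DIM('a) + 2))"
    if t: "1 \<le> \<bar>t\<bar>" and a: "unit_atom a" and b: "b \<in> Basis" and R: "real N * \<bar>t\<bar> \<le> R" for t a b R
  proof -
    have N1: "real N \<ge> 1" by (simp add: N_def)
    have R0: "R > 0" using R t N1 by (meson le_less_trans less_le_trans mult_pos_pos not_le zero_less_one)
    define s where "s = 1 / (4 * pi * R)"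
    define r where "r = \<bar>t\<bar> * s"
    define h where "h = s *\<^sub>R b"
    have s: "s > 0" using R0 by (simp add: s_def)
    have r: "r > 0" using s t by (simp add: r_def)
    have sr: "s \<le> r" using mult_right_mono[OF t, of s] s by (simp add: r_def)
    have pi1: "4 * pi \<ge> 4" "pi \<ge> 1" using pi_ge_two by auto
    \<comment> \<open>This is where R >= N |t| enters: the low region lies in the unit ball, and r
      <= 1.\<close>
    have r4: "4 * real N * r \<le> 1"
    proof -
      have "4 * real N * r = (real N * \<bar>t\<bar>) / (pi * R)" by (simp add: r_def s_def)
      also have "\<dots> \<le> R / (pi * R)" using R R0 by (intro divide_right_mono) auto
      also have "\<dots> = 1 / pi" using R0 by simp
      also have "\<dots> \<le> 1" using pi1 by simp
      finally show ?thesis .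
    qed
    have rN: "1 * r \<le> 4 * real N * r" using N1 r by (intro mult_right_mono) linarith+
    then have r1: "r \<le> 1" using r4 by linarith
    have Nr: "0 \<le> real N * r" using r by simp
    have rt: "r \<le> \<bar>t\<bar> / R"
    proof -
      have "r = (\<bar>t\<bar> / R) / (4 * pi)" by (simp add: r_def s_def)
      also have "\<dots> \<le> (\<bar>t\<bar> / R) / 1" using pi1 R0 by (intro divide_left_mono) auto
      finally show ?thesis by simp
    qed
    have norm_h: "norm h = s" using s b by (simp add: h_def)
    let ?f = "fourier_integral a"
    note A = unit_atom_fdiff[OF a, folded V_def P_def] unit_atom_fourier_le[OF a, folded V_def P_def]
      unit_atom_fdiff_N2[OF a, folded V_def P_def]
    define W where "W = (fdiff h ^^ N) (\<lambda>\<xi>. symb \<phi> t \<xi> * ?f \<xi>)"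
    define H where "H \<xi> = (\<Prod>b\<in>Basis. 1 / (1 + ((\<xi> \<bullet> b) / r)\<^sup>2))" for \<xi> :: 'a
    have [measurable]: "a \<in> borel_measurable borel" using a by (simp add: unit_atom_def)
    note [measurable] = symb_measurable[OF smooth]
    have [measurable]: "W \<in> borel_measurable borel" "H \<in> borel_measurable borel"
      unfolding W_def H_def by measurable
    have H0: "H \<xi> \<ge> 0" for \<xi> unfolding H_def by (intro prod_nonneg) auto
    \<comment> \<open>The N-th difference may straddle the singularity here, so the symbol
      contributes only its modulus 1; all sample points lie within 5 N r of the origin.\<close>
    have low: "cmod (W \<xi>) \<le> cA * r" if \<xi>: "norm \<xi> \<le> 4 * real N * r" for \<xi>
    proof -
      have "cmod (symb \<phi> t (\<xi> + real k *\<^sub>R h) * ?f (\<xi> + real k *\<^sub>R h)) \<le> V * P * (5 * real N * r)" if k: "k \<le> N" for k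
      proof -
        have "norm (\<xi> + real k *\<^sub>R h) \<le> norm \<xi> + real k * s"
          using norm_triangle_ineq[of \<xi> "real k *\<^sub>R h"] norm_h by simp
        also have "real k * s \<le> real N * r" using k sr s by (intro mult_mono) auto
        finally have "norm (\<xi> + real k *\<^sub>R h) \<le> 5 * real N * r" using \<xi> by simp
        then have "V * P * norm (\<xi> + real k *\<^sub>R h) \<le> V * P * (5 * real N * r)" using V P by (intro mult_left_mono) auto
        with A(2)[of "\<xi> + real k *\<^sub>R h"] show ?thesis by (simp add: norm_mult)
      qed
      then have "cmod (W \<xi>) \<le> 2 ^ N * (V * P * (5 * real N * r))" unfolding W_def by (rule fdiff_bound)
      then show ?thesis by (simp add: cA_def mult_ac)
    qed
    \<comment> \<open>The sample point is displaced by at most |\<xi>|/2, hence keeps half of its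
      distance to the origin; this is the factor 2.\<close>
    have term_bound: "cmod ((fdiff h ^^ k) (symb \<phi> t) (\<xi> + real (N - k) *\<^sub>R h)) \<le> Cm * (2 * r / norm \<xi>) ^ k"
      if \<xi>: "norm \<xi> > 4 * real N * r" and k: "k \<le> N" for \<xi> k
    proof -
      let ?y = "\<xi> + real (N - k) *\<^sub>R h"
      have \<xi>0: "norm \<xi> > 0" using \<xi> r N1 by (meson le_less_trans mult_nonneg_nonneg less_imp_le of_nat_0_le_iff zero_le_numeral)
      have "real (N - k) * s \<le> real N * r" using sr s by (intro mult_mono) auto
      also have "\<dots> \<le> norm \<xi> / 2" using \<xi> Nr by linarith
      finally have "norm \<xi> / 2 \<le> norm \<xi> - norm (real (N - k) *\<^sub>R h)" using norm_h by simp
      also have "\<dots> \<le> norm ?y" by (rule norm_diff_ineq)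
      finally have y: "norm \<xi> / 2 \<le> norm ?y" .
      have "2 * real N * s \<le> 2 * real N * r" using sr by (intro mult_left_mono) auto
      also have "\<dots> \<le> norm \<xi> / 2" using \<xi> by simp
      finally have "2 * real N * s \<le> norm ?y" using y by simp
      moreover have "?y \<noteq> 0" using y \<xi>0 by auto
      ultimately have "cmod ((fdiff h ^^ k) (symb \<phi> t) ?y) \<le> Cm * (\<bar>t\<bar> * s / norm ?y) ^ k"
        unfolding h_def using t b k s by (intro sym) auto
      also have "\<dots> \<le> Cm * (2 * r / norm \<xi>) ^ k"
      proof (intro mult_left_mono power_mono Cm)
        have "norm ?y > 0" using y \<xi>0 by linarith
        then have "r / norm ?y \<le> r / (norm \<xi> / 2)" using y \<xi>0 r by (intro divide_left_mono mult_pos_pos) auto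
        then show "\<bar>t\<bar> * s / norm ?y \<le> 2 * r / norm \<xi>" by (simp add: r_def mult_ac)
      qed (use s in auto)
      finally show ?thesis .
    qed
    \<comment> \<open>For k = N no difference falls on the atom and its cancellation supplies the
      missing factor |\<xi>|; for k < N one has k <= d and |\<xi>| <= 1, so 1 <=
      |\<xi>|^k/|\<xi>|^d.\<close>
    have mid: "cmod (W \<xi>) \<le> cB * (r ^ N / norm \<xi> ^ DIM('a))" if \<xi>: "norm \<xi> > 4 * real N * r" "norm \<xi> \<le> 1" for \<xi>
    proof -
      have \<xi>0: "norm \<xi> > 0" using \<xi> r N1 by (meson le_less_trans mult_nonneg_nonneg less_imp_le of_nat_0_le_iff zero_le_numeral)
      have "cmod ((fdiff h ^^ k) (symb \<phi> t) (\<xi> + real (N - k) *\<^sub>R h)) * cmod ((fdiff h ^^ (N - k)) ?f \<xi>)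
        \<le> Cm * V * 2 ^ N * Q ^ N * (r ^ N / norm \<xi> ^ DIM('a))" if k: "k \<le> N" for k
      proof -
        have "cmod ((fdiff h ^^ (N - k)) ?f \<xi>) \<le> V * Q ^ N * (r ^ (N - k) * (norm \<xi> ^ k / norm \<xi> ^ DIM('a)))"
        proof (cases "k = N")
          case True
          have "Q ^ 1 \<le> Q ^ N" using P N1 by (intro power_increasing) auto
          then have "P \<le> Q ^ N" using P(2) by (simp only: power_one_right)
          then have "V * P * norm \<xi> \<le> V * Q ^ N * norm \<xi>" using V by (intro mult_left_mono mult_right_mono) auto
          then show ?thesis using True A(2)[of \<xi>] \<xi>0 by (simp add: N_def)
        next
          case False
          have "(P * s) ^ (N - k) \<le> (Q * r) ^ (N - k)" using P s sr by (intro power_mono mult_mono) auto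
          also have "\<dots> = Q ^ (N - k) * r ^ (N - k)" by (simp add: power_mult_distrib)
          also have "\<dots> \<le> Q ^ N * r ^ (N - k)" using P r by (intro mult_right_mono power_increasing) auto
          also have "\<dots> \<le> Q ^ N * (r ^ (N - k) * (norm \<xi> ^ k / norm \<xi> ^ DIM('a)))"
          proof -
            have "norm \<xi> ^ DIM('a) \<le> norm \<xi> ^ k" using False k \<xi> \<xi>0 by (intro power_decreasing) (auto simp: N_def)
            then have "1 \<le> norm \<xi> ^ k / norm \<xi> ^ DIM('a)" using \<xi>0 by simp
            then have "r ^ (N - k) * 1 \<le> r ^ (N - k) * (norm \<xi> ^ k / norm \<xi> ^ DIM('a))" using r by (intro mult_left_mono) auto
            then show ?thesis using P by (intro mult_left_mono) auto
          qed
          finally have "V * (P * s) ^ (N - k) \<le> V * (Q ^ N * (r ^ (N - k) * (norm \<xi> ^ k / norm \<xi> ^ DIM('a))))"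
            using V by (intro mult_left_mono)
          then show ?thesis using A(1)[where h=h and j="N - k" and \<xi>=\<xi>] norm_h by (simp add: mult.assoc)
        qed
        then have "cmod ((fdiff h ^^ k) (symb \<phi> t) (\<xi> + real (N - k) *\<^sub>R h)) * cmod ((fdiff h ^^ (N - k)) ?f \<xi>)
          \<le> (Cm * (2 * r / norm \<xi>) ^ k) * (V * Q ^ N * (r ^ (N - k) * (norm \<xi> ^ k / norm \<xi> ^ DIM('a))))"
          using term_bound[OF \<xi>(1) k] Cm r \<xi>0 by (intro mult_mono) auto
        also have "\<dots> = Cm * V * 2 ^ k * Q ^ N * (r ^ k * r ^ (N - k) / norm \<xi> ^ DIM('a))"
          using \<xi>0 by (simp add: power_mult_distrib power_divide)
        also have "r ^ k * r ^ (N - k) = r ^ N" using k by (simp add: power_add[symmetric])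
        also have "Cm * V * 2 ^ k * Q ^ N * (r ^ N / norm \<xi> ^ DIM('a)) \<le> Cm * V * 2 ^ N * Q ^ N * (r ^ N / norm \<xi> ^ DIM('a))"
          using Cm V P r k by (intro mult_right_mono mult_left_mono power_increasing) auto
        finally show ?thesis .
      qed
      then have "cmod (W \<xi>) \<le> 2 ^ N * (Cm * V * 2 ^ N * Q ^ N * (r ^ N / norm \<xi> ^ DIM('a)))"
        unfolding W_def by (rule fdiff_mult_bound)
      then show ?thesis by (simp add: cB_def mult.assoc)
    qed
    have inner: "(cmod (W \<xi>))\<^sup>2 \<le> c3 * r\<^sup>2 * H \<xi>" if \<xi>1: "norm \<xi> \<le> 1" for \<xi>
    proof (cases "norm \<xi> \<le> 4 * real N * r")
      case True
      let ?p = "(1 + (4 * real N)\<^sup>2) ^ DIM('a)"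
      have "(1 / (1 + (4 * real N)\<^sup>2)) ^ DIM('a) \<le> H \<xi>" unfolding H_def by (rule product_kernel_ge[OF True r])
      then have "1 \<le> ?p * H \<xi>" by (simp add: power_one_over divide_simps add_pos_nonneg mult.commute split: if_splits)
      then have "cA\<^sup>2 * r\<^sup>2 * 1 \<le> cA\<^sup>2 * r\<^sup>2 * (?p * H \<xi>)" by (intro mult_left_mono) auto
      moreover have "(cmod (W \<xi>))\<^sup>2 \<le> cA\<^sup>2 * r\<^sup>2" using power_mono[OF low[OF True], of 2] by (simp add: power_mult_distrib)
      moreover have "0 \<le> cB\<^sup>2 * 2 ^ DIM('a) * (r\<^sup>2 * H \<xi>)" using H0 by (intro mult_nonneg_nonneg) auto
      ultimately show ?thesis by (simp add: c3_def algebra_simps)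
    next
      case False
      then have F: "norm \<xi> > 4 * real N * r" by simp
      have \<xi>r: "r < norm \<xi>" using F rN by linarith
      then have \<xi>0: "norm \<xi> > 0" using r by linarith
      \<comment> \<open>Here |\<xi>| > r, so 1 + (|\<xi>|/r)^2 <= 2 (|\<xi>|/r)^2, and
        \<open>H\<close> is at least the power d of r^2/(2 |\<xi>|^2).\<close>
      have "(1 / (1 + (norm \<xi> / r)\<^sup>2)) ^ DIM('a) \<le> H \<xi>" unfolding H_def
        by (rule product_kernel_ge) (use r in auto)
      moreover have "(r\<^sup>2 / (2 * (norm \<xi>)\<^sup>2)) ^ DIM('a) \<le> (1 / (1 + (norm \<xi> / r)\<^sup>2)) ^ DIM('a)"
      proof (rule power_mono)
        have "r\<^sup>2 \<le> (norm \<xi>)\<^sup>2" using \<xi>r r by (intro power_mono) auto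
        then have "1 \<le> (norm \<xi>)\<^sup>2 / r\<^sup>2" using r by simp
        then have "1 + (norm \<xi> / r)\<^sup>2 \<le> 2 * (norm \<xi>)\<^sup>2 / r\<^sup>2" by (simp add: power_divide)
        then have "1 / (2 * (norm \<xi>)\<^sup>2 / r\<^sup>2) \<le> 1 / (1 + (norm \<xi> / r)\<^sup>2)"
          using r \<xi>0 by (intro divide_left_mono mult_pos_pos divide_pos_pos add_pos_nonneg) auto
        then show "r\<^sup>2 / (2 * (norm \<xi>)\<^sup>2) \<le> 1 / (1 + (norm \<xi> / r)\<^sup>2)" by simp
      qed auto
      ultimately have Hge: "(r\<^sup>2 / (2 * (norm \<xi>)\<^sup>2)) ^ DIM('a) \<le> H \<xi>" by (rule order_trans[rotated])
      have "(cmod (W \<xi>))\<^sup>2 \<le> (cB * (r ^ N / norm \<xi> ^ DIM('a)))\<^sup>2" using mid[OF F \<xi>1] by (intro power_mono) auto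
      also have "\<dots> = cB\<^sup>2 * 2 ^ DIM('a) * r\<^sup>2 * (r\<^sup>2 / (2 * (norm \<xi>)\<^sup>2)) ^ DIM('a)"
        by (simp add: N_def power_mult_distrib power_divide power_mult[symmetric] mult.commute)
      also have "\<dots> \<le> cB\<^sup>2 * 2 ^ DIM('a) * r\<^sup>2 * H \<xi>" by (intro mult_left_mono Hge) auto
      finally have "(cmod (W \<xi>))\<^sup>2 \<le> cB\<^sup>2 * 2 ^ DIM('a) * r\<^sup>2 * H \<xi>" .
      moreover have "0 \<le> cA\<^sup>2 * (1 + (4 * real N)\<^sup>2) ^ DIM('a) * (r\<^sup>2 * H \<xi>)" using H0 by (intro mult_nonneg_nonneg) auto
      ultimately show ?thesis by (simp add: c3_def algebra_simps)
    qed
    \<comment> \<open>The differences of the transform are left unestimated here, to be integrated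
      afterwards by Plancherel. Cauchy-Schwarz over the N + 1 orders turns the square of the sum
      into a sum of squares.\<close>
    have outer: "(cmod (W \<xi>))\<^sup>2 \<le> (\<Sum>k\<le>N. c4 * (2 * r) ^ (2 * k) * (cmod ((fdiff h ^^ (N - k)) ?f \<xi>))\<^sup>2)" if \<xi>: "norm \<xi> > 1" for \<xi>
    proof -
      have F: "norm \<xi> > 4 * real N * r" using \<xi> r4 by simp
      let ?X = "\<lambda>k. Cm * (2 * r) ^ k * cmod ((fdiff h ^^ (N - k)) ?f \<xi>)"
      have "cmod ((fdiff h ^^ k) (symb \<phi> t) (\<xi> + real (N - k) *\<^sub>R h)) * cmod ((fdiff h ^^ (N - k)) ?f \<xi>) \<le> (\<Sum>k\<le>N. ?X k)" if k: "k \<le> N" for k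
      proof -
        have "2 * r / norm \<xi> \<le> 2 * r" using \<xi> r by (simp add: divide_le_eq mult_le_cancel_left1)
        then have "Cm * (2 * r / norm \<xi>) ^ k \<le> Cm * (2 * r) ^ k" using r Cm by (intro mult_left_mono power_mono) auto
        then have "cmod ((fdiff h ^^ k) (symb \<phi> t) (\<xi> + real (N - k) *\<^sub>R h)) * cmod ((fdiff h ^^ (N - k)) ?f \<xi>) \<le> ?X k"
          using term_bound[OF F k] by (intro mult_right_mono) auto
        also have "\<dots> \<le> (\<Sum>k\<le>N. ?X k)" using k Cm r by (intro member_le_sum[where f="?X"]) auto
        finally show ?thesis .
      qed
      then have "cmod (W \<xi>) \<le> 2 ^ N * (\<Sum>k\<le>N. ?X k)" unfolding W_def by (rule fdiff_mult_bound)
      then have "(cmod (W \<xi>))\<^sup>2 \<le> (2 ^ N * (\<Sum>k\<le>N. ?X k))\<^sup>2" by (intro power_mono) auto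
      also have "\<dots> = 4 ^ N * (\<Sum>k\<le>N. ?X k)\<^sup>2" by (simp add: power_mult_distrib power_mult[symmetric] mult.commute[of N] power_mult)
      also have "\<dots> \<le> 4 ^ N * (real (Suc N) * (\<Sum>k\<le>N. (?X k)\<^sup>2))" by (intro mult_left_mono sum_power2_le) auto
      also have "\<dots> = (\<Sum>k\<le>N. c4 * (2 * r) ^ (2 * k) * (cmod ((fdiff h ^^ (N - k)) ?f \<xi>))\<^sup>2)"
        by (simp add: c4_def sum_distrib_left power_mult_distrib power_mult[symmetric] mult_ac)
      finally show ?thesis .
    qed
    let ?Y = "\<lambda>k \<xi>. (cmod ((fdiff h ^^ (N - k)) ?f \<xi>))\<^sup>2"
    have pw: "(cmod (W \<xi>))\<^sup>2 \<le> c3 * r\<^sup>2 * H \<xi> + (\<Sum>k\<le>N. c4 * (2 * r) ^ (2 * k) * ?Y k \<xi>)" for \<xi>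
    proof -
      have "0 \<le> c3 * r\<^sup>2 * H \<xi>" using c3 H0 by simp
      moreover have "0 \<le> (\<Sum>k\<le>N. c4 * (2 * r) ^ (2 * k) * ?Y k \<xi>)" using c4 r by (intro sum_nonneg) auto
      ultimately show ?thesis using inner[of \<xi>] outer[of \<xi>] by (cases "norm \<xi> \<le> 1") auto
    qed
    have "N2 W \<le> (\<integral>\<^sup>+\<xi>. ennreal (c3 * r\<^sup>2) * ennreal (H \<xi>) + (\<Sum>k\<le>N. ennreal (c4 * (2 * r) ^ (2 * k)) * ennreal (?Y k \<xi>)) \<partial>lborel)"
      unfolding N2_def
    proof (intro nn_integral_mono)
      fix \<xi>
      have "ennreal ((cmod (W \<xi>))\<^sup>2) \<le> ennreal (c3 * r\<^sup>2 * H \<xi> + (\<Sum>k\<le>N. c4 * (2 * r) ^ (2 * k) * ?Y k \<xi>))"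
        by (intro ennreal_leI pw)
      also have "\<dots> = ennreal (c3 * r\<^sup>2 * H \<xi>) + ennreal (\<Sum>k\<le>N. c4 * (2 * r) ^ (2 * k) * ?Y k \<xi>)"
        using c3 c4 r H0 by (intro ennreal_plus sum_nonneg mult_nonneg_nonneg) auto
      also have "\<dots> = ennreal (c3 * r\<^sup>2) * ennreal (H \<xi>) + (\<Sum>k\<le>N. ennreal (c4 * (2 * r) ^ (2 * k)) * ennreal (?Y k \<xi>))"
        using c3 c4 r H0 by (simp add: ennreal_mult sum_ennreal[symmetric])
      finally show "ennreal ((cmod (W \<xi>))\<^sup>2)
        \<le> ennreal (c3 * r\<^sup>2) * ennreal (H \<xi>) + (\<Sum>k\<le>N. ennreal (c4 * (2 * r) ^ (2 * k)) * ennreal (?Y k \<xi>))" .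
    qed
    also have "\<dots> = ennreal (c3 * r\<^sup>2) * (\<integral>\<^sup>+\<xi>. ennreal (H \<xi>) \<partial>lborel) + (\<Sum>k\<le>N. ennreal (c4 * (2 * r) ^ (2 * k)) * N2 ((fdiff h ^^ (N - k)) ?f))"
      unfolding N2_def by (subst nn_integral_add) (auto simp: nn_integral_cmult nn_integral_sum)
    also have "(\<integral>\<^sup>+\<xi>. ennreal (H \<xi>) \<partial>lborel) = ennreal (I * r ^ DIM('a))" unfolding H_def by (rule I(2)[OF r])
    also have "(\<Sum>k\<le>N. ennreal (c4 * (2 * r) ^ (2 * k)) * N2 ((fdiff h ^^ (N - k)) ?f)) \<le> (\<Sum>k\<le>N. ennreal (c4 * V * (2 * Q) ^ (2 * N) * r ^ (DIM('a) + 2)))"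
    proof (intro sum_mono)
      fix k assume k: "k \<in> {..N}"
      have "ennreal (c4 * (2 * r) ^ (2 * k)) * N2 ((fdiff h ^^ (N - k)) ?f) \<le> ennreal (c4 * (2 * r) ^ (2 * k)) * ennreal (V * (P * s) ^ (2 * (N - k)))"
        using A(3)[where h=h and j="N - k"] norm_h by (intro mult_left_mono) auto
      also have "\<dots> = ennreal (c4 * (2 * r) ^ (2 * k) * (V * (P * s) ^ (2 * (N - k))))"
        using c4 r V P s by (simp add: ennreal_mult)
      also have "\<dots> \<le> ennreal (c4 * V * (2 * Q) ^ (2 * N) * r ^ (DIM('a) + 2))"
      proof (rule ennreal_leI)
        \<comment> \<open>As s <= r, each order contributes at most a constant times r^(2N), and 2N
          = 2d + 2 >= d + 2 with r <= 1.\<close>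
        have kN: "2 * k + 2 * (N - k) = 2 * N" using k by auto
        have "(2 * r) ^ (2 * k) * (P * s) ^ (2 * (N - k)) \<le> (2 * Q * r) ^ (2 * k) * (2 * Q * r) ^ (2 * (N - k))"
        proof (rule mult_mono[OF power_mono power_mono])
          show "2 * r \<le> 2 * Q * r" using P r by simp
          have "P * s \<le> Q * r" using P s sr by (intro mult_mono) auto
          also have "\<dots> \<le> 2 * Q * r" using P r by simp
          finally show "P * s \<le> 2 * Q * r" .
        qed (use P r s in auto)
        also have "\<dots> = (2 * Q * r) ^ (2 * N)" by (simp only: power_add[symmetric] kN)
        also have "\<dots> = (2 * Q) ^ (2 * N) * r ^ (2 * N)" by (simp add: power_mult_distrib)
        also have "\<dots> \<le> (2 * Q) ^ (2 * N) * r ^ (DIM('a) + 2)"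
          using r r1 P by (intro mult_left_mono power_decreasing) (auto simp: N_def)
        finally have "c4 * V * ((2 * r) ^ (2 * k) * (P * s) ^ (2 * (N - k))) \<le> c4 * V * ((2 * Q) ^ (2 * N) * r ^ (DIM('a) + 2))"
          using c4 V by (intro mult_left_mono) auto
        then show "c4 * (2 * r) ^ (2 * k) * (V * (P * s) ^ (2 * (N - k))) \<le> c4 * V * (2 * Q) ^ (2 * N) * r ^ (DIM('a) + 2)"
          by (simp add: mult_ac)
      qed
      finally show "ennreal (c4 * (2 * r) ^ (2 * k)) * N2 ((fdiff h ^^ (N - k)) ?f) \<le> ennreal (c4 * V * (2 * Q) ^ (2 * N) * r ^ (DIM('a) + 2))" .
    qed
    also have "ennreal (c3 * r\<^sup>2) * ennreal (I * r ^ DIM('a)) + (\<Sum>k\<le>N. ennreal (c4 * V * (2 * Q) ^ (2 * N) * r ^ (DIM('a) + 2)))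
       = ennreal (C * r ^ (DIM('a) + 2))"
    proof -
      have n: "0 \<le> c3 * r\<^sup>2 * (I * r ^ DIM('a))" "0 \<le> real (Suc N) * (c4 * V * (2 * Q) ^ (2 * N) * r ^ (DIM('a) + 2))"
        using c3 c4 I V P r by (auto intro!: mult_nonneg_nonneg)
      have "(\<Sum>k\<le>N. ennreal (c4 * V * (2 * Q) ^ (2 * N) * r ^ (DIM('a) + 2))) = ennreal (real (Suc N)) * ennreal (c4 * V * (2 * Q) ^ (2 * N) * r ^ (DIM('a) + 2))"
        by (simp only: sum_constant card_atMost ennreal_of_nat_eq_real_of_nat)
      then have "ennreal (c3 * r\<^sup>2) * ennreal (I * r ^ DIM('a)) + (\<Sum>k\<le>N. ennreal (c4 * V * (2 * Q) ^ (2 * N) * r ^ (DIM('a) + 2)))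
        = ennreal (c3 * r\<^sup>2 * (I * r ^ DIM('a)) + real (Suc N) * (c4 * V * (2 * Q) ^ (2 * N) * r ^ (DIM('a) + 2)))"
        using c3 n I by (subst ennreal_plus) (simp_all add: ennreal_mult ennreal_mult')
      also have "c3 * r\<^sup>2 * (I * r ^ DIM('a)) + real (Suc N) * (c4 * V * (2 * Q) ^ (2 * N) * r ^ (DIM('a) + 2)) = C * r ^ (DIM('a) + 2)"
        by (simp add: C_def algebra_simps power_add power2_eq_square)
      finally show ?thesis .
    qed
    finally have "N2 W \<le> ennreal (C * r ^ (DIM('a) + 2))" by (simp add: add_left_mono)
    also have "\<dots> \<le> ennreal (C * (\<bar>t\<bar> / R) ^ (DIM('a) + 2))"
      using C r rt by (intro ennreal_leI mult_left_mono power_mono) auto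
    finally show ?thesis by (simp add: W_def h_def s_def)
  qed
  with C show ?thesis by blast
qed

text \<open>The step 1/(4 pi R) is fitted to the annulus: |x . b| <= 2R keeps the phase at most 1,
  so the lower bound for |\<open>fker x h\<close> - 1| applies, and it is at least 1/(4d) for some
  b. The weighted L_2 estimate thus bounds the plain L_2 norm on the annulus, and Cauchy-Schwarz
  with a volume of order R^d gives the L_1 bound.\<close>

lemma atom_annulus_bound:
  defines "N \<equiv> Suc DIM('a)"
  shows "\<exists>C\<ge>0. \<forall>t a R. 1 \<le> \<bar>t\<bar> \<longrightarrow> unit_atom a \<longrightarrow> real N * \<bar>t\<bar> \<le> R \<longrightarrow>
    (\<integral>\<^sup>+x. ennreal (cmod (A_op \<phi> t a x)) * indicator (cball 0 (2 * R) - ball 0 R) x \<partial>lborel)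
      \<le> ennreal (C * \<bar>t\<bar> powr (real DIM('a) / 2) * (\<bar>t\<bar> / R))"
proof -
  obtain C0 where C0: "C0 \<ge> 0" "\<forall>t a b R. 1 \<le> \<bar>t\<bar> \<longrightarrow> unit_atom a \<longrightarrow> b \<in> Basis \<longrightarrow> real N * \<bar>t\<bar> \<le> R \<longrightarrow>
    N2 ((fdiff ((1 / (4 * pi * R)) *\<^sub>R b) ^^ N) (\<lambda>\<xi>. symb \<phi> t \<xi> * fourier_integral a \<xi>))
      \<le> ennreal (C0 * (\<bar>t\<bar> / R) ^ (DIM('a) + 2))"
    using atom_fdiff_estimate unfolding N_def by blast
  \<comment> \<open>The reciprocal of the lower bound 1/(4d), raised to the power 2N.\<close>
  define G where "G = (4 * real DIM('a)) ^ (2 * N)"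
  define vol where "vol = unit_ball_vol (real DIM('a))"
  define K where "K = G * (real DIM('a) * C0) * (vol * 2 ^ DIM('a))"
  have G: "G \<ge> 0" by (simp add: G_def)
  have vol: "vol \<ge> 0" by (simp add: vol_def unit_ball_vol_nonneg)
  have K: "K \<ge> 0" unfolding K_def using C0 G vol by simp
  have "(\<integral>\<^sup>+x. ennreal (cmod (A_op \<phi> t a x)) * indicator (cball 0 (2 * R) - ball 0 R) x \<partial>lborel)
      \<le> ennreal (sqrt K * \<bar>t\<bar> powr (real DIM('a) / 2) * (\<bar>t\<bar> / R))"
    if t: "1 \<le> \<bar>t\<bar>" and a: "unit_atom a" and R: "real N * \<bar>t\<bar> \<le> R" for t a R
  proof -
    have t0: "\<bar>t\<bar> > 0" using t by linarith
    have "0 < real N * \<bar>t\<bar>" using t0 by (simp add: N_def)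
    then have R0: "R > 0" using R by linarith
    define u where "u = A_op \<phi> t a"
    note aL = unit_atom_L2[OF a] and ai = unit_atom_integrable[OF a]
    have u: "u \<in> Lp_space 2" unfolding u_def by (rule A_op_L2[OF smooth aL])
    note [measurable] = L2_measurable[OF u]
    define s where "s = 1 / (4 * pi * R)"
    have s: "s > 0" using R0 by (simp add: s_def)
    let ?A = "cball 0 (2 * R) - ball (0::'a) R"
    have Fu: "AE \<xi> in lborel. fourier_L2 u \<xi> = symb \<phi> t \<xi> * fourier_integral a \<xi>"
      using A_op_fourier[OF smooth aL, of t] fourier_L2_eq_integral[OF ai aL] unfolding u_def
      by eventually_elim simp
    have bound: "N2 (\<lambda>x. u x * (fker x (s *\<^sub>R b) - 1) ^ N) \<le> ennreal (C0 * (\<bar>t\<bar> / R) ^ (DIM('a) + 2))" if b: "b \<in> Basis" for b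
    proof -
      have "N2 (\<lambda>x. u x * (fker x (s *\<^sub>R b) - 1) ^ N) = N2 ((fdiff (s *\<^sub>R b) ^^ N) (fourier_L2 u))"
        by (rule N2_modulate_power[OF u])
      also have "\<dots> = N2 ((fdiff (s *\<^sub>R b) ^^ N) (\<lambda>\<xi>. symb \<phi> t \<xi> * fourier_integral a \<xi>))"
        by (rule N2_cong_AE[OF fdiff_cong_AE[OF Fu]])
      also have "\<dots> \<le> ennreal (C0 * (\<bar>t\<bar> / R) ^ (DIM('a) + 2))"
        using C0(2) t a b R unfolding s_def by blast
      finally show ?thesis .
    qed
    have pw: "(cmod (indicator ?A x * u x))\<^sup>2 \<le> G * (\<Sum>b\<in>Basis. (cmod (u x * (fker x (s *\<^sub>R b) - 1) ^ N))\<^sup>2)" for x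
    proof (cases "x \<in> ?A")
      case True
      then have x: "R \<le> norm x" "norm x \<le> 2 * R" by auto
      \<comment> \<open>The l_1 norm dominates the Euclidean norm, so not all d coordinates can lie
        below R/d.\<close>
      have "\<exists>b\<in>Basis. R / real DIM('a) \<le> \<bar>x \<bullet> b\<bar>"
      proof (rule ccontr)
        assume "\<not> ?thesis"
        then have "\<bar>x \<bullet> b\<bar> < R / real DIM('a)" if "b \<in> Basis" for b using that by (meson not_le)
        then have "(\<Sum>b\<in>Basis. \<bar>x \<bullet> b\<bar>) < (\<Sum>b\<in>(Basis::'a set). R / real DIM('a))"
          by (intro sum_strict_mono) auto
        then show False using norm_le_l1[of x] x by simp
      qed
      then obtain b where b: "b \<in> Basis" "R / real DIM('a) \<le> \<bar>x \<bullet> b\<bar>" by blast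
      have xb: "\<bar>x \<bullet> b\<bar> \<le> 2 * R" using Basis_le_norm[OF b(1), of x] x by simp
      have "2 * pi * \<bar>x \<bullet> (s *\<^sub>R b)\<bar> = \<bar>x \<bullet> b\<bar> / (2 * R)"
        using R0 by (simp add: s_def abs_mult)
      also have "\<dots> \<le> 1" using xb R0 by simp
      finally have "pi * \<bar>x \<bullet> (s *\<^sub>R b)\<bar> \<le> cmod (fker x (s *\<^sub>R b) - 1)" by (rule cmod_fker_diff_ge)
      moreover have "pi * \<bar>x \<bullet> (s *\<^sub>R b)\<bar> = \<bar>x \<bullet> b\<bar> / (4 * R)" using R0 by (simp add: s_def abs_mult)
      moreover have "1 / (4 * real DIM('a)) \<le> \<bar>x \<bullet> b\<bar> / (4 * R)" using b(2) R0 by (simp add: field_simps)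
      ultimately have ge: "1 / (4 * real DIM('a)) \<le> cmod (fker x (s *\<^sub>R b) - 1)" by linarith
      then have "1 \<le> (4 * real DIM('a)) * cmod (fker x (s *\<^sub>R b) - 1)" by (simp add: field_simps)
      then have "1 ^ (2 * N) \<le> ((4 * real DIM('a)) * cmod (fker x (s *\<^sub>R b) - 1)) ^ (2 * N)" by (intro power_mono) auto
      then have "1 \<le> G * cmod (fker x (s *\<^sub>R b) - 1) ^ (2 * N)" by (simp only: G_def power_mult_distrib power_one)
      then have "(cmod (u x))\<^sup>2 * 1 \<le> (cmod (u x))\<^sup>2 * (G * cmod (fker x (s *\<^sub>R b) - 1) ^ (2 * N))" by (intro mult_left_mono) auto
      also have "\<dots> = G * (cmod (u x * (fker x (s *\<^sub>R b) - 1) ^ N))\<^sup>2"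
        by (simp add: norm_mult norm_power power_mult_distrib power_mult[symmetric] mult_ac)
      also have "\<dots> \<le> G * (\<Sum>b\<in>Basis. (cmod (u x * (fker x (s *\<^sub>R b) - 1) ^ N))\<^sup>2)"
        using b(1) by (intro mult_left_mono member_le_sum[where f="\<lambda>b. (cmod (u x * (fker x (s *\<^sub>R b) - 1) ^ N))\<^sup>2"] G) auto
      finally show ?thesis using True by simp
    next
      case False
      then show ?thesis using G by (simp add: sum_nonneg)
    qed
    have N2A: "N2 (\<lambda>x. indicator ?A x * u x) \<le> ennreal (G * (real DIM('a) * C0) * (\<bar>t\<bar> / R) ^ (DIM('a) + 2))"
    proof -
      have "N2 (\<lambda>x. indicator ?A x * u x) \<le> (\<integral>\<^sup>+x. ennreal G * (\<Sum>b\<in>Basis. ennreal ((cmod (u x * (fker x (s *\<^sub>R b) - 1) ^ N))\<^sup>2)) \<partial>lborel)"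
        unfolding N2_def
      proof (intro nn_integral_mono)
        fix x
        have "ennreal ((cmod (indicator ?A x * u x))\<^sup>2) \<le> ennreal (G * (\<Sum>b\<in>Basis. (cmod (u x * (fker x (s *\<^sub>R b) - 1) ^ N))\<^sup>2))"
          by (rule ennreal_leI[OF pw])
        then show "ennreal ((cmod (indicator ?A x * u x))\<^sup>2) \<le> ennreal G * (\<Sum>b\<in>Basis. ennreal ((cmod (u x * (fker x (s *\<^sub>R b) - 1) ^ N))\<^sup>2))"
          using G by (simp add: ennreal_mult sum_nonneg sum_ennreal)
      qed
      also have "\<dots> = ennreal G * (\<Sum>b\<in>Basis. N2 (\<lambda>x. u x * (fker x (s *\<^sub>R b) - 1) ^ N))"
        unfolding N2_def by (simp add: nn_integral_cmult nn_integral_sum del: sum_ennreal)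
      also have "\<dots> \<le> ennreal G * (\<Sum>b\<in>(Basis::'a set). ennreal (C0 * (\<bar>t\<bar> / R) ^ (DIM('a) + 2)))"
        by (intro mult_left_mono sum_mono bound) auto
      also have "\<dots> = ennreal (G * (real DIM('a) * C0) * (\<bar>t\<bar> / R) ^ (DIM('a) + 2))"
      proof -
        have "(\<Sum>b\<in>(Basis::'a set). ennreal (C0 * (\<bar>t\<bar> / R) ^ (DIM('a) + 2))) = ennreal (\<Sum>b\<in>(Basis::'a set). C0 * (\<bar>t\<bar> / R) ^ (DIM('a) + 2))"
          using C0(1) R0 by (intro sum_ennreal) auto
        then show ?thesis using G C0(1) R0 by (simp add: ennreal_mult[symmetric] mult_ac)
      qed
      finally show ?thesis .
    qed
    \<comment> \<open>The volume R^d cancels d of the d + 2 factors 1/R; two remain, and the root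
      leaves the summable factor |t|/R.\<close>
    have alg: "G * (real DIM('a) * C0) * (\<tau> / R) ^ (DIM('a) + 2) * (vol * (2 * R) ^ DIM('a))
        = K * \<tau> ^ DIM('a) * (\<tau> / R)\<^sup>2" for \<tau> :: real
      using R0 by (simp add: K_def power_add power_divide power_mult_distrib power2_eq_square)
    show ?thesis unfolding u_def[symmetric]
    proof (rule nn_integral_ball_L2[where \<rho>="2 * R"])
      have "N2 (\<lambda>x. indicator ?A x * u x) * ennreal (unit_ball_vol (DIM('a)) * (2 * R) ^ DIM('a))
        \<le> ennreal (G * (real DIM('a) * C0) * (\<bar>t\<bar> / R) ^ (DIM('a) + 2)) * ennreal (unit_ball_vol (DIM('a)) * (2 * R) ^ DIM('a))"
        by (intro mult_right_mono N2A) auto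
      also have "\<dots> = ennreal (G * (real DIM('a) * C0) * (\<bar>t\<bar> / R) ^ (DIM('a) + 2) * (vol * (2 * R) ^ DIM('a)))"
        using G C0(1) R0 vol unfolding vol_def by (intro ennreal_mult[symmetric]) auto
      also have "G * (real DIM('a) * C0) * (\<bar>t\<bar> / R) ^ (DIM('a) + 2) * (vol * (2 * R) ^ DIM('a))
        = K * \<bar>t\<bar> ^ DIM('a) * (\<bar>t\<bar> / R)\<^sup>2"
        by (rule alg)
      also have "\<dots> = (sqrt K * \<bar>t\<bar> powr (real DIM('a) / 2) * (\<bar>t\<bar> / R))\<^sup>2"
        by (simp only: power_mult_distrib powr_half_sq[OF t0] real_sqrt_pow2[OF K])
      finally show "N2 (\<lambda>x. indicator ?A x * u x) * ennreal (unit_ball_vol (DIM('a)) * (2 * R) ^ DIM('a))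
        \<le> ennreal ((sqrt K * \<bar>t\<bar> powr (real DIM('a) / 2) * (\<bar>t\<bar> / R))\<^sup>2)" .
    qed (use R0 K in auto)
  qed
  moreover have "sqrt K \<ge> 0" using K by simp
  ultimately show ?thesis by blast
qed

lemma atom_bound:
  "\<exists>C\<ge>0. \<forall>t a. 1 \<le> \<bar>t\<bar> \<longrightarrow> unit_atom a \<longrightarrow>
    (\<integral>\<^sup>+x. ennreal (cmod (A_op \<phi> t a x)) \<partial>lborel) \<le> ennreal (C * \<bar>t\<bar> powr (real DIM('a) / 2))"
proof -
  define N where "N = Suc DIM('a)"
  obtain C0 where C0: "C0 \<ge> 0" "\<forall>t a R. 1 \<le> \<bar>t\<bar> \<longrightarrow> unit_atom a \<longrightarrow> real N * \<bar>t\<bar> \<le> R \<longrightarrow>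
    (\<integral>\<^sup>+x. ennreal (cmod (A_op \<phi> t a x)) * indicator (cball 0 (2 * R) - ball 0 R) x \<partial>lborel)
      \<le> ennreal (C0 * \<bar>t\<bar> powr (real DIM('a) / 2) * (\<bar>t\<bar> / R))"
    using atom_annulus_bound unfolding N_def by blast
  define vol where "vol = unit_ball_vol (real DIM('a))"
  have vol: "vol \<ge> 0" by (simp add: vol_def unit_ball_vol_nonneg)
  define K where "K = (vol * real DIM('a) ^ DIM('a)) * (vol * real N ^ DIM('a))"
  have K: "K \<ge> 0" using vol by (simp add: K_def)
  have "(\<integral>\<^sup>+x. ennreal (cmod (A_op \<phi> t a x)) \<partial>lborel) \<le> ennreal ((sqrt K + 2 * C0) * \<bar>t\<bar> powr (real DIM('a) / 2))"
    if t: "1 \<le> \<bar>t\<bar>" and a: "unit_atom a" for t a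
  proof -
    have t0: "\<bar>t\<bar> > 0" using t by linarith
    define \<Lambda> where "\<Lambda> = \<bar>t\<bar> powr (real DIM('a) / 2)"
    have \<Lambda>: "\<Lambda> > 0" using t0 by (simp add: \<Lambda>_def)
    define u where "u = A_op \<phi> t a"
    note aL = unit_atom_L2[OF a]
    have u: "u \<in> Lp_space 2" unfolding u_def by (rule A_op_L2[OF smooth aL])
    note [measurable] = L2_measurable[OF u]
    have [measurable]: "cball (0::'a) q \<in> sets borel" "ball (0::'a) q \<in> sets borel" for q by auto
    \<comment> \<open>The smallest radius to which the annulus estimate applies.\<close>
    define \<rho> where "\<rho> = real N * \<bar>t\<bar>"
    have \<rho>: "\<rho> > 0" using t0 by (simp add: \<rho>_def N_def)
    let ?R = "\<lambda>j. 2 ^ j * \<rho>"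
    let ?A = "\<lambda>j. cball 0 (2 * ?R j) - ball (0::'a) (?R j)"
    have near: "(\<integral>\<^sup>+x. ennreal (cmod (u x)) * indicator (cball 0 \<rho>) x \<partial>lborel) \<le> ennreal (sqrt K * \<Lambda>)"
    proof (rule nn_integral_ball_L2[where \<rho>=\<rho>])
      have "N2 (\<lambda>x. indicator (cball 0 \<rho>) x * u x) \<le> N2 u"
        by (rule N2_mono) (auto simp: indicator_def)
      also have "N2 u = N2 a" unfolding u_def by (rule A_op_norm[OF smooth aL])
      also have "\<dots> \<le> ennreal (vol * real DIM('a) ^ DIM('a))" unfolding vol_def by (rule unit_atom_N2[OF a])
      finally have "N2 (\<lambda>x. indicator (cball 0 \<rho>) x * u x) * ennreal (unit_ball_vol (DIM('a)) * \<rho> ^ DIM('a))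
         \<le> ennreal (vol * real DIM('a) ^ DIM('a)) * ennreal (unit_ball_vol (DIM('a)) * \<rho> ^ DIM('a))"
        by (intro mult_right_mono) auto
      also have "\<dots> = ennreal (vol * real DIM('a) ^ DIM('a) * (vol * \<rho> ^ DIM('a)))"
        using vol \<rho> unfolding vol_def by (intro ennreal_mult[symmetric]) auto
      also have "vol * real DIM('a) ^ DIM('a) * (vol * \<rho> ^ DIM('a)) = K * \<bar>t\<bar> ^ DIM('a)"
        by (simp add: K_def \<rho>_def power_mult_distrib)
      also have "\<dots> = (sqrt K * \<Lambda>)\<^sup>2"
        using K powr_half_sq[OF t0, of "DIM('a)"] by (simp add: power_mult_distrib \<Lambda>_def)
      finally show "N2 (\<lambda>x. indicator (cball 0 \<rho>) x * u x) * ennreal (unit_ball_vol (DIM('a)) * \<rho> ^ DIM('a)) \<le> ennreal ((sqrt K * \<Lambda>)\<^sup>2)" .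
    qed (use \<rho> K \<Lambda> in auto)
    have far: "(\<integral>\<^sup>+x. ennreal (cmod (u x)) * indicator (?A j) x \<partial>lborel) \<le> ennreal (C0 * \<Lambda> * (1/2) ^ j)" for j
    proof -
      have "real N * \<bar>t\<bar> * 1 \<le> real N * \<bar>t\<bar> * 2 ^ j" by (intro mult_left_mono) auto
      then have "real N * \<bar>t\<bar> \<le> ?R j" by (simp add: \<rho>_def mult_ac)
      with C0(2) t a have "(\<integral>\<^sup>+x. ennreal (cmod (u x)) * indicator (?A j) x \<partial>lborel) \<le> ennreal (C0 * \<Lambda> * (\<bar>t\<bar> / ?R j))"
        unfolding u_def \<Lambda>_def by blast
      also have "\<dots> \<le> ennreal (C0 * \<Lambda> * (1/2) ^ j)"
      proof (intro ennreal_leI mult_left_mono)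
        have "\<bar>t\<bar> / ?R j = (1/2) ^ j / real N" using t0 by (simp add: \<rho>_def power_one_over divide_simps)
        also have "\<dots> \<le> (1/2) ^ j / 1" by (intro divide_left_mono) (auto simp: N_def)
        finally show "\<bar>t\<bar> / ?R j \<le> (1/2) ^ j" by simp
      qed (use C0 \<Lambda> in auto)
      finally show ?thesis .
    qed
    have cover: "ennreal (cmod (u x)) \<le> ennreal (cmod (u x)) * indicator (cball 0 \<rho>) x + (\<Sum>j. ennreal (cmod (u x)) * indicator (?A j) x)" for x
    proof (cases "norm x \<le> \<rho>")
      case False
      \<comment> \<open>The least such j is not 0, so its predecessor gives an annulus containing x.
        Neighbouring annuli share a sphere, which an upper bound tolerates.\<close>
      define j where "j = (LEAST n. norm x < 2 ^ n * \<rho>)"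
      have "\<exists>n. norm x / \<rho> < 2 ^ n" by (rule real_arch_pow) simp
      then have "\<exists>n. norm x < 2 ^ n * \<rho>" using \<rho> by (simp add: pos_divide_less_eq)
      then have j: "norm x < 2 ^ j * \<rho>" unfolding j_def by (rule LeastI_ex)
      with False have "j \<noteq> 0" by (intro notI) simp
      then obtain i where i: "j = Suc i" using not0_implies_Suc by blast
      then have "\<not> norm x < 2 ^ i * \<rho>" using not_less_Least[of i "\<lambda>n. norm x < 2 ^ n * \<rho>"] unfolding j_def[symmetric] by simp
      then have "x \<in> ?A i" using j i by (auto simp: mult_ac)
      then have "ennreal (cmod (u x)) = (\<Sum>j\<in>{i}. ennreal (cmod (u x)) * indicator (?A j) x)" by simp
      also have "\<dots> \<le> (\<Sum>j. ennreal (cmod (u x)) * indicator (?A j) x)"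
        by (rule sum_le_suminf) (rule summableI, simp_all)
      finally show ?thesis by (rule order_trans) simp
    qed simp
    have "(\<integral>\<^sup>+x. ennreal (cmod (u x)) \<partial>lborel)
      \<le> (\<integral>\<^sup>+x. ennreal (cmod (u x)) * indicator (cball 0 \<rho>) x + (\<Sum>j. ennreal (cmod (u x)) * indicator (?A j) x) \<partial>lborel)"
      by (intro nn_integral_mono cover)
    also have "\<dots> = (\<integral>\<^sup>+x. ennreal (cmod (u x)) * indicator (cball 0 \<rho>) x \<partial>lborel)
       + (\<integral>\<^sup>+x. (\<Sum>j. ennreal (cmod (u x)) * indicator (?A j) x) \<partial>lborel)"
      by (rule nn_integral_add) measurable
    also have "(\<integral>\<^sup>+x. (\<Sum>j. ennreal (cmod (u x)) * indicator (?A j) x) \<partial>lborel)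
       = (\<Sum>j. \<integral>\<^sup>+x. ennreal (cmod (u x)) * indicator (?A j) x \<partial>lborel)"
      by (rule nn_integral_suminf) measurable
    also have "(\<integral>\<^sup>+x. ennreal (cmod (u x)) * indicator (cball 0 \<rho>) x \<partial>lborel)
       + (\<Sum>j. \<integral>\<^sup>+x. ennreal (cmod (u x)) * indicator (?A j) x \<partial>lborel) \<le> ennreal (sqrt K * \<Lambda>) + (\<Sum>j. ennreal (C0 * \<Lambda> * (1/2) ^ j))"
      by (intro add_mono near suminf_le far) auto
    also have "(\<Sum>j. ennreal (C0 * \<Lambda> * (1/2) ^ j)) = ennreal (\<Sum>j. C0 * \<Lambda> * (1/2) ^ j)"
      using C0 \<Lambda> by (intro suminf_ennreal2 summable_mult summable_geometric) auto
    also have "(\<Sum>j. C0 * \<Lambda> * (1/2) ^ j) = C0 * \<Lambda> * 2"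
      by (subst suminf_mult) (auto simp: suminf_geometric intro: summable_geometric)
    also have "ennreal (sqrt K * \<Lambda>) + ennreal (C0 * \<Lambda> * 2) = ennreal ((sqrt K + 2 * C0) * \<Lambda>)"
      using K C0 \<Lambda> by (subst ennreal_plus[symmetric]) (auto simp: algebra_simps)
    finally show ?thesis by (simp add: u_def \<Lambda>_def)
  qed
  moreover have "sqrt K + 2 * C0 \<ge> 0" using K C0 by simp
  ultimately show ?thesis by blast
qed

end

section \<open>Dyadic cubes and the good-\<open>\<lambda>\<close> inequality\<close>

definition side :: "int \<Rightarrow> real" where "side k = 2 powi (- k)"

lemma side_simps[simp]: "side k > 0" "side k \<ge> 0" "side k \<noteq> 0" "\<bar>side k\<bar> = side k"
  by (simp_all add: side_def)

lemma balls_borel[measurable]: "cball x r \<in> sets borel" "ball x r \<in> sets borel"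
  for x :: "'a::euclidean_space"
  by auto

lemma side_pred: "side (k - 1) = 2 * side k"
  by (simp add: side_def power_int_diff power_int_minus field_simps)

text \<open>Half-open dyadic cubes of side \<open>2\<^sup>-\<^sup>k\<close>; larger indices are finer.\<close>

definition cube :: "int \<Rightarrow> 'a::euclidean_space \<Rightarrow> 'a set" where
  "cube k x = {y. \<forall>b\<in>Basis. \<lfloor>(y \<bullet> b) / side k\<rfloor> = \<lfloor>(x \<bullet> b) / side k\<rfloor>}"

lemma cube_self[simp]: "x \<in> cube k x"
  by (simp add: cube_def)

lemma cube_eq: "y \<in> cube k x \<Longrightarrow> cube k y = cube k x"
  by (auto simp: cube_def)

text \<open>Cubes nest because the floor of a half is the integer quotient of the floor by
  2.\<close>

lemma cube_pred_subset: "cube k x \<subseteq> cube (k - 1) x"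
proof
  fix y assume y: "y \<in> cube k x"
  have "\<lfloor>(z \<bullet> b) / side (k - 1)\<rfloor> = \<lfloor>(z \<bullet> b) / side k\<rfloor> div 2" for z b :: 'a
    using floor_divide_real_eq_div[of 2 "(z \<bullet> b) / side k"] by (simp add: side_pred mult.commute)
  then show "y \<in> cube (k - 1) x" using y by (simp add: cube_def)
qed

lemma cube_subset: "j \<le> k \<Longrightarrow> cube k x \<subseteq> cube j x"
proof (induction k rule: int_ge_induct)
  case (step k)
  then show ?case using cube_pred_subset[of "k + 1" x] by auto
qed simp

lemma cube_eq_coarser: "y \<in> cube k x \<Longrightarrow> j \<le> k \<Longrightarrow> cube j y = cube j x"
  using cube_subset[of j k x] cube_eq by blast

lemma cube_measurable[measurable, simp]: "cube k x \<in> sets borel"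
proof -
  have "cube k x = {y \<in> space borel. \<forall>b\<in>Basis. \<lfloor>(y \<bullet> b) / side k\<rfloor> = \<lfloor>(x \<bullet> b) / side k\<rfloor>}"
    by (auto simp: cube_def)
  also have "\<dots> \<in> sets borel" by measurable
  finally show ?thesis .
qed

text \<open>Estimated through the l_1 norm, hence the factor d in place of its square root.\<close>

lemma cube_norm_diff:
  fixes x :: "'a::euclidean_space"
  assumes "y \<in> cube k x"
  shows "norm (y - x) \<le> real DIM('a) * side k"
proof -
  have "\<bar>(y - x) \<bullet> b\<bar> \<le> side k" if "b \<in> Basis" for b
  proof -
    have "\<lfloor>(y \<bullet> b) / side k\<rfloor> = \<lfloor>(x \<bullet> b) / side k\<rfloor>" using assms that by (simp add: cube_def)
    then have "\<bar>(y \<bullet> b) / side k - (x \<bullet> b) / side k\<bar> \<le> 1" by linarith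
    then show ?thesis
      by (simp add: diff_divide_distrib[symmetric] inner_diff_left[symmetric] pos_divide_le_eq)
  qed
  then have "(\<Sum>b\<in>Basis. \<bar>(y - x) \<bullet> b\<bar>) \<le> (\<Sum>b\<in>(Basis::'a set). side k)" by (rule sum_mono)
  with norm_le_l1[of "y - x"] show ?thesis by simp
qed

text \<open>The half-open cube lies between the open and the closed box with the same corners, which
  have equal measure.\<close>

lemma emeasure_cube:
  fixes x :: "'a::euclidean_space"
  shows "emeasure lborel (cube k x) = ennreal (side k ^ DIM('a))"
proof (rule antisym)
  define p where "p = (\<Sum>b\<in>Basis. (of_int \<lfloor>(x \<bullet> b) / side k\<rfloor> * side k) *\<^sub>R b)"
  let ?q = "p + side k *\<^sub>R One"
  have pb: "p \<bullet> b = of_int \<lfloor>(x \<bullet> b) / side k\<rfloor> * side k" if "b \<in> Basis" for b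
    using that by (simp add: p_def inner_sum_left inner_Basis if_distrib cong: if_cong)
  have qb: "?q \<bullet> b = (of_int \<lfloor>(x \<bullet> b) / side k\<rfloor> + 1) * side k" if "b \<in> Basis" for b
    using that by (simp add: pb inner_add_left algebra_simps)
  have prod: "(\<Prod>b\<in>Basis. (?q - p) \<bullet> b) = side k ^ DIM('a)" by simp
  have le: "p \<bullet> b \<le> ?q \<bullet> b" if "b \<in> Basis" for b using that by (simp add: inner_add_left less_imp_le)
  have mem: "y \<in> cube k x \<longleftrightarrow> (\<forall>b\<in>Basis. p \<bullet> b \<le> y \<bullet> b \<and> y \<bullet> b < ?q \<bullet> b)" for y
    unfolding cube_def by (auto simp: floor_eq_iff pb qb pos_le_divide_eq pos_divide_less_eq simp del: inner_add_left)
  have "emeasure lborel (cube k x) \<le> emeasure lborel (cbox p ?q)"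
  proof (intro emeasure_mono subsetI)
    show "y \<in> cbox p ?q" if "y \<in> cube k x" for y
      using that unfolding mem mem_box by (meson less_imp_le)
  qed auto
  also have "\<dots> = ennreal (side k ^ DIM('a))" using le prod by (subst emeasure_lborel_cbox) auto
  finally show "emeasure lborel (cube k x) \<le> ennreal (side k ^ DIM('a))" .
  have "ennreal (side k ^ DIM('a)) = emeasure lborel (box p ?q)" using le prod by (subst emeasure_lborel_box) auto
  also have "\<dots> \<le> emeasure lborel (cube k x)"
  proof (intro emeasure_mono subsetI)
    show "y \<in> cube k x" if "y \<in> box p ?q" for y
      using that unfolding mem mem_box by (meson less_imp_le)
  qed auto
  finally show "ennreal (side k ^ DIM('a)) \<le> emeasure lborel (cube k x)" .
qed

lemma countable_cubes: "countable (range (\<lambda>x::'a::euclidean_space. cube k x))"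
proof -
  have "countable ((Basis::'a set) \<rightarrow>\<^sub>E (UNIV :: int set))" by (intro countable_PiE) auto
  then have "countable ((\<lambda>f. {y::'a. \<forall>b\<in>Basis. \<lfloor>(y \<bullet> b) / side k\<rfloor> = f b}) ` ((Basis::'a set) \<rightarrow>\<^sub>E (UNIV :: int set)))"
    by (rule countable_image)
  moreover have "range (\<lambda>x::'a. cube k x) \<subseteq> (\<lambda>f. {y. \<forall>b\<in>Basis. \<lfloor>(y \<bullet> b) / side k\<rfloor> = f b}) ` ((Basis::'a set) \<rightarrow>\<^sub>E (UNIV :: int set))"
  proof
    fix Q assume "Q \<in> range (\<lambda>x::'a. cube k x)"
    then obtain x where "Q = cube k x" by auto
    then show "Q \<in> (\<lambda>f. {y. \<forall>b\<in>Basis. \<lfloor>(y \<bullet> b) / side k\<rfloor> = f b}) ` ((Basis::'a set) \<rightarrow>\<^sub>E (UNIV :: int set))"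
      by (intro image_eqI[of _ _ "\<lambda>b\<in>Basis. \<lfloor>(x \<bullet> b) / side k\<rfloor>"]) (auto simp: cube_def)
  qed
  ultimately show ?thesis by (rule countable_subset[rotated])
qed

lemma countable_all_cubes: "countable (\<Union>k. range (\<lambda>x::'a::euclidean_space. cube k x))"
  by (intro countable_UN countable_cubes) auto

text \<open>The set is a union of cubes, of which there are countably many in all generations
  together; so it is Borel for an arbitrary predicate R.\<close>

lemma cube_condition_measurable:
  "{x::'a::euclidean_space. \<exists>k. R (cube k x)} \<in> sets borel"
proof -
  let ?F = "{Q \<in> (\<Union>k. range (\<lambda>x::'a. cube k x)). R Q}"
  have "{x::'a. \<exists>k. R (cube k x)} = \<Union>?F"
  proof (intro set_eqI iffI)
    fix x assume "x \<in> {x. \<exists>k. R (cube k x)}"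
    then obtain k where "R (cube k x)" by auto
    then show "x \<in> \<Union>?F" by (intro UnionI[of "cube k x"]) auto
  next
    fix x assume "x \<in> \<Union>?F"
    then obtain k y where "R (cube k y)" "x \<in> cube k y" by auto
    then show "x \<in> {x. \<exists>k. R (cube k x)}" using cube_eq[of x k y] by (intro CollectI exI[of _ k]) simp
  qed
  also have "\<dots> \<in> sets borel"
  proof (rule sets.countable_Union)
    show "countable ?F" by (rule countable_subset[OF _ countable_all_cubes]) auto
  qed auto
  finally show ?thesis .
qed

section \<open>The dyadic maximal function\<close>

definition nn_on :: "('a::euclidean_space \<Rightarrow> ennreal) \<Rightarrow> 'a set \<Rightarrow> ennreal" where
  "nn_on u A = (\<integral>\<^sup>+x. u x * indicator A x \<partial>lborel)"

text \<open>The average of u over Q exceeds \<alpha>, multiplied out so that no quotient of extended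
  reals occurs.\<close>

definition heavy :: "('a::euclidean_space \<Rightarrow> ennreal) \<Rightarrow> real \<Rightarrow> 'a set \<Rightarrow> bool" where
  "heavy u \<alpha> Q \<longleftrightarrow> ennreal \<alpha> * emeasure lborel Q < nn_on u Q"

text \<open>The set where the dyadic maximal function of \<open>u\<close> exceeds \<open>\<alpha>\<close>.\<close>

definition level_set :: "('a::euclidean_space \<Rightarrow> ennreal) \<Rightarrow> real \<Rightarrow> 'a set" where
  "level_set u \<alpha> = {x. \<exists>k. heavy u \<alpha> (cube k x)}"

lemma level_set_measurable[measurable, simp]: "level_set u \<alpha> \<in> sets borel"
  unfolding level_set_def by (rule cube_condition_measurable)

lemma nn_on_mono: "(\<And>x. x \<in> A \<Longrightarrow> u x \<le> v x) \<Longrightarrow> A \<subseteq> B \<Longrightarrow> nn_on u A \<le> nn_on v B"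
  unfolding nn_on_def by (intro nn_integral_mono) (auto simp: indicator_def)

lemma nn_on_const: "A \<in> sets borel \<Longrightarrow> nn_on (\<lambda>_. c) A = c * emeasure lborel A"
  unfolding nn_on_def by (simp add: nn_integral_cmult_indicator)

lemma nn_on_add:
  "A \<in> sets borel \<Longrightarrow> u \<in> borel_measurable borel \<Longrightarrow> v \<in> borel_measurable borel \<Longrightarrow> nn_on (\<lambda>x. u x + v x) A = nn_on u A + nn_on v A"
  unfolding nn_on_def by (simp add: distrib_right nn_integral_add)

text \<open>Coarser cubes have smaller indices, so the coarsest heavy cube around a point is found
  by minimizing the index.\<close>

lemma int_least:
  fixes P :: "int \<Rightarrow> bool"
  assumes "P k0" and bound: "\<And>k. P k \<Longrightarrow> K \<le> k"
  shows "\<exists>k. P k \<and> (\<forall>j<k. \<not> P j)"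
proof -
  let ?R = "\<lambda>n. P (K + int n)"
  have "?R (nat (k0 - K))" using assms(1) bound[OF assms(1)] by simp
  then have 1: "?R (LEAST n. ?R n)" by (rule LeastI)
  have "\<not> P j" if "j < K + int (LEAST n. ?R n)" for j
  proof
    assume j: "P j"
    then have "?R (nat (j - K))" using bound[OF j] by simp
    moreover have "nat (j - K) < (LEAST n. ?R n)" using that bound[OF j] by linarith
    ultimately show False using not_less_Least by blast
  qed
  with 1 show ?thesis by blast
qed

text \<open>Summation over the cubes. Two measures are allowed because one side is a density: that
  of u in the weak type bound, that of an indicator in the good-\<lambda> inequality.\<close>

lemma countable_disjoint_measure_le:
  assumes "countable \<Q>" "disjoint \<Q>" "\<Q> \<subseteq> sets borel" "sets M1 = sets borel" "sets M2 = sets borel"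
    and le: "\<And>Q. Q \<in> \<Q> \<Longrightarrow> emeasure M1 Q \<le> c * emeasure M2 Q"
  shows "emeasure M1 (\<Union>\<Q>) \<le> c * emeasure M2 (\<Union>\<Q>)"
proof -
  have d: "disjoint_family_on (\<lambda>Q. Q) \<Q>" using assms(2) by (auto simp: disjoint_family_on_def disjoint_def)
  have eq: "emeasure M (\<Union>\<Q>) = (\<integral>\<^sup>+Q. emeasure M Q \<partial>count_space \<Q>)" if "sets M = sets borel" for M
  proof -
    have "Q \<in> sets M" if "Q \<in> \<Q>" for Q using that assms(3) \<open>sets M = sets borel\<close> by auto
    from emeasure_UN_countable[where X="\<lambda>Q. Q", OF this assms(1) d] show ?thesis by simp
  qed
  have "emeasure M1 (\<Union>\<Q>) = (\<integral>\<^sup>+Q. emeasure M1 Q \<partial>count_space \<Q>)"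
    by (rule eq) fact
  also have "\<dots> \<le> (\<integral>\<^sup>+Q. c * emeasure M2 Q \<partial>count_space \<Q>)"
    by (intro nn_integral_mono) (auto intro: le)
  also have "\<dots> = c * (\<integral>\<^sup>+Q. emeasure M2 Q \<partial>count_space \<Q>)" by (simp add: nn_integral_cmult)
  also have "(\<integral>\<^sup>+Q. emeasure M2 Q \<partial>count_space \<Q>) = emeasure M2 (\<Union>\<Q>)"
    by (rule eq[symmetric]) fact
  finally show ?thesis .
qed

text \<open>The stopping cubes of Calderon and Zygmund. They exist by the lower bound K on the
  index, and two that meet are equal since dyadic cubes are nested.\<close>

lemma maximal_cubes:
  fixes u :: "'a::euclidean_space \<Rightarrow> ennreal"
  assumes coarse: "\<forall>k x. heavy u \<alpha> (cube k x) \<longrightarrow> K \<le> k"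
  defines "\<Q> \<equiv> {cube k x | k x. heavy u \<alpha> (cube k x) \<and> (\<forall>j<k. \<not> heavy u \<alpha> (cube j x))}"
  shows "countable \<Q>" "disjoint \<Q>" "\<Q> \<subseteq> sets borel" "\<Union>\<Q> = level_set u \<alpha>"
proof -
  show "countable \<Q>" by (rule countable_subset[OF _ countable_all_cubes]) (auto simp: \<Q>_def)
  show "\<Q> \<subseteq> sets borel" by (auto simp: \<Q>_def)
  show "disjoint \<Q>"
  proof (rule disjointI, rule ccontr)
    fix Q Q' assume Q: "Q \<in> \<Q>" "Q' \<in> \<Q>" "Q \<noteq> Q'" and ne: "Q \<inter> Q' \<noteq> {}"
    then obtain k x k' x' where
      kx: "Q = cube k x" "heavy u \<alpha> (cube k x)" "\<forall>j<k. \<not> heavy u \<alpha> (cube j x)" and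
      kx': "Q' = cube k' x'" "heavy u \<alpha> (cube k' x')" "\<forall>j<k'. \<not> heavy u \<alpha> (cube j x')"
      unfolding \<Q>_def by blast
    obtain z where z: "z \<in> cube k x" "z \<in> cube k' x'" using ne kx kx' by auto
    have "k = k'"
      using kx(2,3) kx'(2,3) cube_eq_coarser[OF z(1)] cube_eq_coarser[OF z(2)] cube_eq[OF z(1)] cube_eq[OF z(2)]
      by (metis less_imp_le linorder_neqE)
    then have "Q = Q'" using kx kx' cube_eq[OF z(1)] cube_eq[OF z(2)] by simp
    with Q show False by simp
  qed
  show "\<Union>\<Q> = level_set u \<alpha>"
  proof (intro set_eqI iffI)
    fix z assume "z \<in> \<Union>\<Q>"
    then obtain k x where "z \<in> cube k x" "heavy u \<alpha> (cube k x)" unfolding \<Q>_def by blast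
    then have "heavy u \<alpha> (cube k z)" using cube_eq[of z k x] by simp
    then show "z \<in> level_set u \<alpha>" unfolding level_set_def by blast
  next
    fix z assume "z \<in> level_set u \<alpha>"
    then obtain k0 where "heavy u \<alpha> (cube k0 z)" by (auto simp: level_set_def)
    then have "\<exists>k. heavy u \<alpha> (cube k z) \<and> (\<forall>j<k. \<not> heavy u \<alpha> (cube j z))"
      by (rule int_least[where K=K]) (use coarse in blast)
    then obtain k where "heavy u \<alpha> (cube k z)" "\<forall>j<k. \<not> heavy u \<alpha> (cube j z)" by blast
    then have "cube k z \<in> \<Q>" unfolding \<Q>_def by blast
    then show "z \<in> \<Union>\<Q>" by (intro UnionI[of "cube k z"]) auto
  qed
qed

text \<open>For a very coarse cube \<alpha> |Q| exceeds the bound B on the mass of u, so the cube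
  cannot be heavy.\<close>

lemma coarse_not_heavy:
  assumes "\<alpha> > 0" "\<And>Q. nn_on u Q \<le> ennreal B"
  shows "\<exists>K. \<forall>k x. heavy u \<alpha> (cube k (x::'a::euclidean_space)) \<longrightarrow> K \<le> k"
proof -
  obtain n where n: "\<bar>B\<bar> / \<alpha> < 2 ^ n" using real_arch_pow[of 2 "\<bar>B\<bar> / \<alpha>"] by auto
  have "- int n \<le> k" if h: "heavy u \<alpha> (cube k x)" for k and x :: 'a
  proof (rule ccontr)
    assume "\<not> - int n \<le> k"
    then have "(2::real) powi int n \<le> 2 powi (- k)" by (intro power_int_increasing) auto
    then have "2 ^ n \<le> side k" by (simp add: side_def power_int_of_nat)
    moreover have "(1::real) \<le> 2 ^ n" by simp
    ultimately have "2 ^ n \<le> side k" "1 \<le> side k" by linarith+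
    then have "side k ^ 1 \<le> side k ^ DIM('a)" by (intro power_increasing) auto
    then have "\<bar>B\<bar> / \<alpha> < side k ^ DIM('a)" using n \<open>2 ^ n \<le> side k\<close> by simp
    then have "\<bar>B\<bar> < \<alpha> * side k ^ DIM('a)" using assms(1) by (simp add: field_simps)
    moreover have "ennreal (\<alpha> * side k ^ DIM('a)) < ennreal \<bar>B\<bar>"
    proof -
      have "ennreal (\<alpha> * side k ^ DIM('a)) = ennreal \<alpha> * emeasure lborel (cube k x)"
        using assms(1) by (simp add: emeasure_cube ennreal_mult less_imp_le)
      also have "\<dots> < nn_on u (cube k x)" using h by (simp add: heavy_def)
      also have "\<dots> \<le> ennreal B" by (rule assms(2))
      also have "\<dots> \<le> ennreal \<bar>B\<bar>" by (intro ennreal_leI) auto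
      finally show ?thesis .
    qed
    ultimately show False using assms(1) by (simp add: ennreal_less_iff)
  qed
  then show ?thesis by blast
qed

text \<open>Each maximal cube has measure at most 1/\<alpha> times the mass of u on it, and the
  cubes are disjoint.\<close>

lemma weak_type:
  fixes u :: "'a::euclidean_space \<Rightarrow> ennreal"
  assumes [measurable]: "u \<in> borel_measurable borel" and "\<alpha> > 0" and fin: "(\<integral>\<^sup>+x. u x \<partial>lborel) < \<infinity>"
  shows "emeasure lborel (level_set u \<alpha>) \<le> ennreal (1 / \<alpha>) * (\<integral>\<^sup>+x. u x \<partial>lborel)"
proof -
  obtain B where B: "(\<integral>\<^sup>+x. u x \<partial>lborel) = ennreal B" using fin by (cases "\<integral>\<^sup>+x. u x \<partial>lborel") auto
  have nb: "nn_on u Q \<le> ennreal B" for Q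
    unfolding B[symmetric] nn_on_def by (intro nn_integral_mono) (auto simp: indicator_def)
  obtain K where K: "\<forall>k x. heavy u \<alpha> (cube k x) \<longrightarrow> K \<le> k" using coarse_not_heavy[OF \<open>\<alpha> > 0\<close> nb] by blast
  note Q = maximal_cubes[of u \<alpha> K, OF K]
  have "emeasure lborel (\<Union>{cube k x | k x. heavy u \<alpha> (cube k x) \<and> (\<forall>j<k. \<not> heavy u \<alpha> (cube j x))})
    \<le> ennreal (1 / \<alpha>) * emeasure (density lborel u) (\<Union>{cube k x | k x. heavy u \<alpha> (cube k x) \<and> (\<forall>j<k. \<not> heavy u \<alpha> (cube j x))})"
  proof (rule countable_disjoint_measure_le[OF Q(1-3)])
    fix Q assume "Q \<in> {cube k x | k x. heavy u \<alpha> (cube k x) \<and> (\<forall>j<k. \<not> heavy u \<alpha> (cube j x))}"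
    then obtain k x where Q: "Q = cube k x" "heavy u \<alpha> (cube k x)" by blast
    have "emeasure lborel Q = ennreal (1 / \<alpha>) * (ennreal \<alpha> * emeasure lborel Q)"
      using \<open>\<alpha> > 0\<close> by (simp add: mult.assoc[symmetric] ennreal_mult[symmetric])
    also have "\<dots> \<le> ennreal (1 / \<alpha>) * nn_on u Q"
      using Q by (intro mult_left_mono) (auto simp: heavy_def)
    also have "nn_on u Q = emeasure (density lborel u) Q"
      using Q by (simp add: nn_on_def emeasure_density)
    finally show "emeasure lborel Q \<le> ennreal (1 / \<alpha>) * emeasure (density lborel u) Q" .
  qed auto
  then have "emeasure lborel (level_set u \<alpha>) \<le> ennreal (1 / \<alpha>) * emeasure (density lborel u) (level_set u \<alpha>)"
    by (simp only: Q(4))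
  also have "emeasure (density lborel u) (level_set u \<alpha>) \<le> emeasure (density lborel u) UNIV"
    by (intro emeasure_mono) auto
  also have "\<dots> = (\<integral>\<^sup>+x. u x \<partial>lborel)" by (simp add: emeasure_density)
  finally show ?thesis by (simp add: mult_left_mono)
qed

lemma nn_on_cauchy_schwarz:
  assumes [measurable]: "f \<in> borel_measurable borel" "A \<in> sets borel"
  shows "(nn_on (\<lambda>x. ennreal (cmod (f x))) A)\<^sup>2 \<le> emeasure lborel A * nn_on (\<lambda>x. ennreal ((cmod (f x))\<^sup>2)) A"
proof -
  have "nn_on (\<lambda>x. ennreal (cmod (f x))) A = (\<integral>\<^sup>+x. indicator A x * (ennreal (cmod (f x)) * indicator A x) \<partial>lborel)"
    unfolding nn_on_def by (intro nn_integral_cong) (auto simp: indicator_def)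
  then have "(nn_on (\<lambda>x. ennreal (cmod (f x))) A)\<^sup>2 \<le> (\<integral>\<^sup>+x. (indicator A x)\<^sup>2 \<partial>lborel) * (\<integral>\<^sup>+x. (ennreal (cmod (f x)) * indicator A x)\<^sup>2 \<partial>lborel)"
    using Cauchy_Schwarz_nn_integral[of "indicator A" lborel "\<lambda>x. ennreal (cmod (f x)) * indicator A x"] by simp
  also have "(\<integral>\<^sup>+x. (indicator A x)\<^sup>2 \<partial>lborel) = (\<integral>\<^sup>+x. indicator A x \<partial>lborel)"
    by (intro nn_integral_cong) (auto simp: indicator_def)
  also have "\<dots> = emeasure lborel A" by simp
  also have "(\<integral>\<^sup>+x. (ennreal (cmod (f x)) * indicator A x)\<^sup>2 \<partial>lborel) = nn_on (\<lambda>x. ennreal ((cmod (f x))\<^sup>2)) A"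
    unfolding nn_on_def by (intro nn_integral_cong) (auto simp: indicator_def ennreal_power)
  finally show ?thesis .
qed

text \<open>By Cauchy-Schwarz the square of an average is at most the average of the square. This
  derives the weak L_2 bound from the weak L_1 bound for |g|^2.\<close>

lemma heavy_square:
  fixes g :: "'a::euclidean_space \<Rightarrow> complex"
  assumes [measurable]: "g \<in> borel_measurable borel" and "\<alpha> > 0" and h: "heavy (\<lambda>x. ennreal (cmod (g x))) \<alpha> (cube k x)"
  shows "heavy (\<lambda>x. ennreal ((cmod (g x))\<^sup>2)) (\<alpha>\<^sup>2) (cube k x)"
proof (rule ccontr)
  let ?Q = "cube k x" and ?m = "side k ^ DIM('a)"
  assume "\<not> ?thesis"
  then have le: "nn_on (\<lambda>x. ennreal ((cmod (g x))\<^sup>2)) ?Q \<le> ennreal (\<alpha>\<^sup>2) * ennreal ?m"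
    by (simp add: heavy_def not_less emeasure_cube)
  have "(nn_on (\<lambda>x. ennreal (cmod (g x))) ?Q)\<^sup>2 \<le> ennreal ?m * nn_on (\<lambda>x. ennreal ((cmod (g x))\<^sup>2)) ?Q"
    using nn_on_cauchy_schwarz[of g ?Q] by (simp add: emeasure_cube)
  also have "\<dots> \<le> ennreal ?m * (ennreal (\<alpha>\<^sup>2) * ennreal ?m)" by (intro mult_left_mono le) auto
  also have "\<dots> = ennreal ((\<alpha> * ?m)\<^sup>2)"
    using assms(2) by (simp add: ennreal_mult[symmetric] power_mult_distrib power2_eq_square mult_ac)
  finally have "nn_on (\<lambda>x. ennreal (cmod (g x))) ?Q \<le> ennreal (\<alpha> * ?m)"
    by (rule ennreal_le_of_sq_le) (use assms(2) in \<open>simp add: less_imp_le\<close>)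
  also have "\<dots> = ennreal \<alpha> * emeasure lborel ?Q" using assms(2) by (simp add: emeasure_cube ennreal_mult less_imp_le)
  finally show False using h by (simp add: heavy_def)
qed

lemma weak_type_L2:
  assumes g: "g \<in> Lp_space 2" and "\<alpha> > 0"
  shows "emeasure lborel (level_set (\<lambda>x. ennreal (cmod (g x))) \<alpha>) \<le> ennreal (1 / \<alpha>\<^sup>2) * N2 g"
proof -
  note [measurable] = L2_measurable[OF g]
  have "level_set (\<lambda>x. ennreal (cmod (g x))) \<alpha> \<subseteq> level_set (\<lambda>x. ennreal ((cmod (g x))\<^sup>2)) (\<alpha>\<^sup>2)"
    unfolding level_set_def using heavy_square[OF _ \<open>\<alpha> > 0\<close>, of g] by auto
  then have "emeasure lborel (level_set (\<lambda>x. ennreal (cmod (g x))) \<alpha>) \<le> emeasure lborel (level_set (\<lambda>x. ennreal ((cmod (g x))\<^sup>2)) (\<alpha>\<^sup>2))"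
    by (intro emeasure_mono) auto
  also have "\<dots> \<le> ennreal (1 / \<alpha>\<^sup>2) * N2 g"
    unfolding N2_def using L2_finite[OF g] \<open>\<alpha> > 0\<close> by (intro weak_type) (auto simp: N2_def)
  finally show ?thesis .
qed

section \<open>Mean oscillation\<close>

definition cube_avg :: "('a::euclidean_space \<Rightarrow> complex) \<Rightarrow> 'a set \<Rightarrow> complex" where
  "cube_avg g Q = (\<integral>x. indicator Q x * g x \<partial>lborel) / of_real (measure lborel Q)"

text \<open>Not divided by |Q|: membership in BMO with norm C reads \<open>osc g Q\<close> <= C
  |Q|.\<close>

definition osc :: "('a::euclidean_space \<Rightarrow> complex) \<Rightarrow> 'a set \<Rightarrow> ennreal" where
  "osc g Q = nn_on (\<lambda>x. ennreal (cmod (g x - cube_avg g Q))) Q"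

lemma measure_cube: "measure lborel (cube k (x::'a::euclidean_space)) = side k ^ DIM('a)"
  by (simp add: measure_def emeasure_cube less_imp_le)

lemma L2_cube_integrable:
  assumes "g \<in> Lp_space 2"
  shows "integrable lborel (\<lambda>y. indicator (cube k x) y * g y)"
  by (intro L2_mult_integrable indicator_L2 assms) (auto simp: emeasure_cube)

lemma cube_avg_bound:
  fixes g :: "'a::euclidean_space \<Rightarrow> complex"
  assumes g: "g \<in> Lp_space 2"
  shows "ennreal (cmod (cube_avg g (cube k x))) * emeasure lborel (cube k x) \<le> nn_on (\<lambda>x. ennreal (cmod (g x))) (cube k x)"
proof -
  let ?Q = "cube k x"
  have "ennreal (cmod (cube_avg g ?Q)) * emeasure lborel ?Q = ennreal (cmod (\<integral>y. indicator ?Q y * g y \<partial>lborel))"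
    by (simp add: cube_avg_def measure_cube emeasure_cube norm_divide norm_power ennreal_mult[symmetric] less_imp_le)
  also have "\<dots> \<le> (\<integral>\<^sup>+y. ennreal (cmod (indicator ?Q y * g y)) \<partial>lborel)"
    by (intro integral_norm_bound_ennreal L2_cube_integrable g)
  also have "\<dots> = nn_on (\<lambda>x. ennreal (cmod (g x))) ?Q"
    unfolding nn_on_def by (intro nn_integral_cong) (auto simp: indicator_def)
  finally show ?thesis .
qed

text \<open>A function in L_2 may have infinite L_1 norm, so the bound on coarse cubes is taken from
  |g|^2.\<close>

lemma level_set_not_heavy_bound:
  assumes g: "g \<in> Lp_space 2" and "\<alpha> > 0"
  shows "\<exists>K. \<forall>k x. heavy (\<lambda>x. ennreal (cmod (g x))) \<alpha> (cube k (x::'a::euclidean_space)) \<longrightarrow> K \<le> k"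
proof -
  obtain B where B: "N2 g = ennreal B" using L2_finite[OF g] by (cases "N2 g") auto
  have "nn_on (\<lambda>x. ennreal ((cmod (g x))\<^sup>2)) Q \<le> ennreal B" for Q
    unfolding B[symmetric] nn_on_def N2_def by (intro nn_integral_mono) (auto simp: indicator_def)
  from coarse_not_heavy[OF _ this, of "\<alpha>\<^sup>2"] \<open>\<alpha> > 0\<close>
  obtain K where "\<forall>k x. heavy (\<lambda>x. ennreal ((cmod (g x))\<^sup>2)) (\<alpha>\<^sup>2) (cube k (x::'a)) \<longrightarrow> K \<le> k" by auto
  then show ?thesis using heavy_square[OF L2_measurable[OF g] \<open>\<alpha> > 0\<close>] by blast
qed

text \<open>For a maximal cube Q at level \<alpha> the parent P is not heavy, so the average c of g
  over P has modulus at most \<alpha>. On a cube inside Q where |g| averages more than 2 \<alpha>,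
  |g - c| averages more than \<alpha>. The weak type bound for |g - c| on Q and the oscillation
  bound on P, of measure 2^d |Q|, give the factor 2^d \<gamma>.\<close>

lemma good_lambda:
  fixes g :: "'a::euclidean_space \<Rightarrow> complex"
  assumes g: "g \<in> Lp_space 2" and \<alpha>: "\<alpha> > 0" and \<gamma>: "\<gamma> > 0"
  defines "u \<equiv> \<lambda>x. ennreal (cmod (g x))"
  shows "emeasure lborel (level_set u (2 * \<alpha>))
    \<le> emeasure lborel {x. \<exists>k. ennreal (\<gamma> * \<alpha>) * emeasure lborel (cube k x) < osc g (cube k x)}
      + ennreal (2 ^ DIM('a) * \<gamma>) * emeasure lborel (level_set u \<alpha>)"
proof -
  note [measurable] = L2_measurable[OF g]
  have um[measurable]: "u \<in> borel_measurable borel" unfolding u_def by measurable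
  define B where "B = {x. \<exists>k. ennreal (\<gamma> * \<alpha>) * emeasure lborel (cube k x) < osc g (cube k x)}"
  have [measurable]: "B \<in> sets borel" unfolding B_def by (rule cube_condition_measurable)
  define E where "E = level_set u (2 * \<alpha>) - B"
  have [measurable]: "E \<in> sets borel" unfolding E_def by measurable
  obtain K where K: "\<forall>k x. heavy u \<alpha> (cube k x) \<longrightarrow> K \<le> k"
    using level_set_not_heavy_bound[OF g \<alpha>] unfolding u_def by blast
  define \<Q> where "\<Q> = {cube k x | k x. heavy u \<alpha> (cube k x) \<and> (\<forall>j<k. \<not> heavy u \<alpha> (cube j x))}"
  note Q = maximal_cubes[of u \<alpha> K, OF K, folded \<Q>_def]
  have heavy2: "heavy u \<alpha> R" if "heavy u (2 * \<alpha>) R" for R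
  proof -
    have "ennreal \<alpha> * emeasure lborel R \<le> ennreal (2 * \<alpha>) * emeasure lborel R"
      using \<alpha> by (intro mult_right_mono ennreal_leI) auto
    then show ?thesis using that by (auto simp: heavy_def elim: order.strict_trans1)
  qed
  have local: "emeasure lborel (E \<inter> Q) \<le> ennreal (2 ^ DIM('a) * \<gamma>) * emeasure lborel Q" if QQ: "Q \<in> \<Q>" for Q
  proof (cases "E \<inter> Q = {}")
    case False
    then obtain z where z: "z \<in> E" "z \<in> Q" by auto
    obtain k x where kx: "Q = cube k x" "\<forall>j<k. \<not> heavy u \<alpha> (cube j x)" using QQ unfolding \<Q>_def by blast
    have zQ: "z \<in> cube k x" using z kx by simp
    let ?P = "cube (k - 1) x"
    define c where "c = cube_avg g ?P"
    have mP: "emeasure lborel ?P = ennreal (2 ^ DIM('a)) * emeasure lborel Q"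
      by (simp add: kx(1) emeasure_cube side_pred power_mult_distrib ennreal_mult)
    have notheavy: "nn_on u (cube j x) \<le> ennreal \<alpha> * emeasure lborel (cube j x)" if "j < k" for j
      using kx(2) that by (simp add: heavy_def not_less)
    have c: "cmod c \<le> \<alpha>"
    proof -
      have "ennreal (cmod c) * emeasure lborel ?P \<le> ennreal \<alpha> * emeasure lborel ?P"
        using cube_avg_bound[OF g, of "k - 1" x] notheavy[of "k - 1"] unfolding c_def u_def by simp
      then have "ennreal (cmod c * side (k - 1) ^ DIM('a)) \<le> ennreal (\<alpha> * side (k - 1) ^ DIM('a))"
        using \<alpha> by (simp add: emeasure_cube ennreal_mult less_imp_le)
      then have "cmod c * side (k - 1) ^ DIM('a) \<le> \<alpha> * side (k - 1) ^ DIM('a)"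
        by (subst (asm) ennreal_le_iff) (use \<alpha> in auto)
      then show ?thesis by (rule mult_right_le_imp_le) simp
    qed
    \<comment> \<open>All cubes around z have small oscillation because z lies outside
      \<open>B\<close>, and P is one of them.\<close>
    have oscP: "nn_on (\<lambda>x. ennreal (cmod (g x - c))) ?P \<le> ennreal (\<gamma> * \<alpha>) * emeasure lborel ?P"
    proof -
      have "cube (k - 1) z = ?P" by (rule cube_eq_coarser[OF zQ]) simp
      moreover have "\<not> ennreal (\<gamma> * \<alpha>) * emeasure lborel (cube (k - 1) z) < osc g (cube (k - 1) z)"
        using z(1) unfolding E_def B_def by blast
      ultimately show ?thesis by (simp add: osc_def c_def not_less)
    qed
    define v where "v y = ennreal (cmod (g y - c)) * indicator Q y" for y
    have [measurable]: "Q \<in> sets borel" by (simp add: kx(1))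
    have [measurable]: "v \<in> borel_measurable borel" unfolding v_def by measurable
    have vint: "(\<integral>\<^sup>+y. v y \<partial>lborel) \<le> ennreal (\<gamma> * \<alpha>) * emeasure lborel ?P"
    proof -
      have "(\<integral>\<^sup>+y. v y \<partial>lborel) = nn_on (\<lambda>x. ennreal (cmod (g x - c))) Q" by (simp add: v_def nn_on_def)
      also have "\<dots> \<le> nn_on (\<lambda>x. ennreal (cmod (g x - c))) ?P"
        using cube_pred_subset[of k x] by (intro nn_on_mono) (auto simp: kx(1))
      finally show ?thesis using oscP by simp
    qed
    have "E \<inter> Q \<subseteq> level_set v \<alpha>"
    proof
      fix y assume y: "y \<in> E \<inter> Q"
      then obtain j where j: "heavy u (2 * \<alpha>) (cube j y)" unfolding E_def level_set_def by auto
      have yQ: "y \<in> cube k x" using y kx by simp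
      have jk: "k \<le> j"
      proof (rule ccontr)
        assume "\<not> k \<le> j"
        then have "cube j y = cube j x" "j < k" using cube_eq_coarser[OF yQ, of j] by auto
        then show False using heavy2[OF j] kx(2) by simp
      qed
      let ?R = "cube j y"
      have RQ: "?R \<subseteq> Q" using cube_subset[OF jk, of y] cube_eq[OF yQ] kx(1) by simp
      have "nn_on u ?R \<le> nn_on (\<lambda>x. v x + ennreal \<alpha>) ?R"
      proof (rule nn_on_mono)
        fix w assume "w \<in> ?R"
        then have w: "w \<in> Q" using RQ by auto
        have "cmod (g w) \<le> cmod (g w - c) + \<alpha>" using norm_triangle_sub[of "g w" c] c by simp
        then have "ennreal (cmod (g w)) \<le> ennreal (cmod (g w - c) + \<alpha>)" by (rule ennreal_leI)
        then show "u w \<le> v w + ennreal \<alpha>" using w \<alpha> by (simp add: u_def v_def)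
      qed simp
      also have "\<dots> = nn_on v ?R + ennreal \<alpha> * emeasure lborel ?R"
        by (subst nn_on_add) (auto simp: nn_on_const)
      finally have le: "nn_on u ?R \<le> nn_on v ?R + ennreal \<alpha> * emeasure lborel ?R" .
      have "ennreal \<alpha> * emeasure lborel ?R + ennreal \<alpha> * emeasure lborel ?R = ennreal (2 * \<alpha>) * emeasure lborel ?R"
        using \<alpha> by (simp add: distrib_right[symmetric] ennreal_plus[symmetric] del: ennreal_plus)
      also have "\<dots> < nn_on u ?R" using j by (simp add: heavy_def)
      also note le
      finally have "ennreal \<alpha> * emeasure lborel ?R < nn_on v ?R"
        by (meson add_right_mono leD leI)
      then show "y \<in> level_set v \<alpha>" unfolding level_set_def heavy_def by blast
    qed
    then have "emeasure lborel (E \<inter> Q) \<le> emeasure lborel (level_set v \<alpha>)" by (intro emeasure_mono) auto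
    also have "\<dots> \<le> ennreal (1 / \<alpha>) * (\<integral>\<^sup>+y. v y \<partial>lborel)"
    proof (rule weak_type[OF _ \<alpha>])
      show "(\<integral>\<^sup>+y. v y \<partial>lborel) < \<infinity>"
        using vint by (rule order.strict_trans1) (simp add: emeasure_cube ennreal_mult_less_top)
    qed measurable
    also have "\<dots> \<le> ennreal (1 / \<alpha>) * (ennreal (\<gamma> * \<alpha>) * emeasure lborel ?P)" by (intro mult_left_mono vint) auto
    also have "\<dots> = (ennreal (1 / \<alpha>) * ennreal (\<gamma> * \<alpha>) * ennreal (2 ^ DIM('a))) * emeasure lborel Q"
      unfolding mP by (simp only: mult.assoc)
    also have "ennreal (1 / \<alpha>) * ennreal (\<gamma> * \<alpha>) * ennreal (2 ^ DIM('a)) = ennreal (2 ^ DIM('a) * \<gamma>)"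
      using \<alpha> \<gamma> by (simp add: ennreal_mult[symmetric] mult.commute)
    finally show ?thesis .
  qed simp
  have "emeasure (density lborel (indicator E)) (\<Union>\<Q>) \<le> ennreal (2 ^ DIM('a) * \<gamma>) * emeasure lborel (\<Union>\<Q>)"
  proof (rule countable_disjoint_measure_le[OF Q(1-3)])
    fix Q assume QQ: "Q \<in> \<Q>"
    then have "Q \<in> sets borel" using Q(3) by auto
    then have "emeasure (density lborel (indicator E)) Q = emeasure lborel (E \<inter> Q)"
      by (simp add: emeasure_density indicator_inter_arith[symmetric])
    then show "emeasure (density lborel (indicator E)) Q \<le> ennreal (2 ^ DIM('a) * \<gamma>) * emeasure lborel Q"
      using local[OF QQ] by simp
  qed auto
  then have "emeasure (density lborel (indicator E)) (level_set u \<alpha>) \<le> ennreal (2 ^ DIM('a) * \<gamma>) * emeasure lborel (level_set u \<alpha>)"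
    by (simp only: Q(4))
  moreover have "emeasure (density lborel (indicator E)) (level_set u \<alpha>) = emeasure lborel (E \<inter> level_set u \<alpha>)"
    by (simp add: emeasure_density indicator_inter_arith[symmetric])
  moreover have "E \<inter> level_set u \<alpha> = E"
    using heavy2 by (auto simp: E_def level_set_def)
  ultimately have E: "emeasure lborel E \<le> ennreal (2 ^ DIM('a) * \<gamma>) * emeasure lborel (level_set u \<alpha>)" by simp
  have "emeasure lborel (level_set u (2 * \<alpha>)) \<le> emeasure lborel (B \<union> E)"
    by (intro emeasure_mono) (auto simp: E_def)
  also have "\<dots> \<le> emeasure lborel B + emeasure lborel E" by (intro emeasure_subadditive) auto
  also have "\<dots> \<le> emeasure lborel B + ennreal (2 ^ DIM('a) * \<gamma>) * emeasure lborel (level_set u \<alpha>)"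
    by (intro add_left_mono E)
  finally show ?thesis unfolding B_def .
qed

text \<open>A substitute for the Lebesgue differentiation theorem. If |g x| exceeds \<alpha> +
  \<eta> and no cube at x is heavy, then |g y - g x| averages at least \<eta> over every cube at x.
  The integrals in x of the corresponding quadratic averages tend to 0 by the L_2 continuity of
  translations, so such points form a null set.\<close>

lemma level_set_AE:
  fixes g :: "'a::euclidean_space \<Rightarrow> complex"
  assumes g: "g \<in> Lp_space 2" and \<alpha>: "\<alpha> > 0"
  shows "AE x in lborel. cmod (g x) > \<alpha> \<longrightarrow> x \<in> level_set (\<lambda>x. ennreal (cmod (g x))) \<alpha>"
proof -
  note [measurable] = L2_measurable[OF g]
  let ?L = "level_set (\<lambda>x. ennreal (cmod (g x))) \<alpha>" and ?d = "real DIM('a)"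
  have small: "emeasure lborel {x. cmod (g x) > \<alpha> + \<eta> \<and> x \<notin> ?L} = 0" if \<eta>: "\<eta> > 0" for \<eta>
  proof -
    let ?S = "{x. cmod (g x) > \<alpha> + \<eta> \<and> x \<notin> ?L}"
    have "?S = {x \<in> space borel. cmod (g x) > \<alpha> + \<eta>} - ?L" by auto
    also have "\<dots> \<in> sets borel" by measurable
    finally have [measurable]: "?S \<in> sets borel" .
    define T where "T k x = (\<integral>\<^sup>+v. ennreal ((cmod (g (x + side (int k) *\<^sub>R v) - g x))\<^sup>2) * indicator (cball 0 ?d) v \<partial>lborel)" for k :: nat and x
    have pt: "ennreal (\<eta>\<^sup>2) \<le> T k x" if x: "x \<in> ?S" for k x
    proof -
      let ?Q = "cube (int k) x" and ?s = "side (int k)"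
      let ?m = "?s ^ DIM('a)"
      have "ennreal (\<alpha> + \<eta>) * emeasure lborel ?Q = nn_on (\<lambda>_. ennreal (\<alpha> + \<eta>)) ?Q" by (simp add: nn_on_const)
      also have "\<dots> \<le> nn_on (\<lambda>y. ennreal (cmod (g y - g x)) + ennreal (cmod (g y))) ?Q"
      proof (rule nn_on_mono)
        fix y
        have "\<alpha> + \<eta> \<le> cmod (g y - g x) + cmod (g y)"
          using x norm_triangle_sub[of "g x" "g y"] by (simp add: norm_minus_commute)
        then show "ennreal (\<alpha> + \<eta>) \<le> ennreal (cmod (g y - g x)) + ennreal (cmod (g y))"
          by (simp add: ennreal_plus[symmetric] ennreal_leI del: ennreal_plus)
      qed simp
      also have "\<dots> = nn_on (\<lambda>y. ennreal (cmod (g y - g x))) ?Q + nn_on (\<lambda>y. ennreal (cmod (g y))) ?Q"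
        by (rule nn_on_add) measurable
      also have "\<dots> \<le> nn_on (\<lambda>y. ennreal (cmod (g y - g x))) ?Q + ennreal \<alpha> * emeasure lborel ?Q"
        using x by (intro add_left_mono) (auto simp: level_set_def heavy_def not_less)
      finally have le: "ennreal (\<alpha> + \<eta>) * emeasure lborel ?Q \<le> nn_on (\<lambda>y. ennreal (cmod (g y - g x))) ?Q + ennreal \<alpha> * emeasure lborel ?Q" .
      have "ennreal (\<alpha> + \<eta>) * emeasure lborel ?Q = ennreal \<eta> * emeasure lborel ?Q + ennreal \<alpha> * emeasure lborel ?Q"
        using \<alpha> \<eta> by (simp add: distrib_right[symmetric] add.commute)
      \<comment> \<open>Cancelling in the extended reals relies on cubes having finite
        measure.\<close>
      with le have "ennreal \<eta> * emeasure lborel ?Q \<le> nn_on (\<lambda>y. ennreal (cmod (g y - g x))) ?Q"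
        by (simp add: emeasure_cube ennreal_mult_eq_top_iff add.commute[of _ "ennreal \<alpha> * _"] ennreal_add_left_cancel_le)
      then have "(ennreal \<eta> * emeasure lborel ?Q)\<^sup>2 \<le> (nn_on (\<lambda>y. ennreal (cmod (g y - g x))) ?Q)\<^sup>2"
        by (intro power_mono) auto
      also have "\<dots> \<le> emeasure lborel ?Q * nn_on (\<lambda>y. ennreal ((cmod (g y - g x))\<^sup>2)) ?Q"
        by (rule nn_on_cauchy_schwarz) measurable
      also have "nn_on (\<lambda>y. ennreal ((cmod (g y - g x))\<^sup>2)) ?Q
         \<le> (\<integral>\<^sup>+y. ennreal ((cmod (g y - g x))\<^sup>2) * indicator (cball 0 (?d * ?s)) (y - x) \<partial>lborel)"
        unfolding nn_on_def using cube_norm_diff by (intro nn_integral_mono) (auto simp: indicator_def)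
      also have "\<dots> = ennreal (\<bar>?s\<bar> ^ DIM('a)) * (\<integral>\<^sup>+v. ennreal ((cmod (g (x + ?s *\<^sub>R v) - g x))\<^sup>2) * indicator (cball 0 (?d * ?s)) ((x + ?s *\<^sub>R v) - x) \<partial>lborel)"
        by (rule nn_integral_affine) (auto simp: less_imp_neq[symmetric])
      also have "(\<integral>\<^sup>+v. ennreal ((cmod (g (x + ?s *\<^sub>R v) - g x))\<^sup>2) * indicator (cball 0 (?d * ?s)) ((x + ?s *\<^sub>R v) - x) \<partial>lborel) = T k x"
        unfolding T_def by (intro nn_integral_cong) (auto simp: indicator_def mult.commute)
      finally have "(ennreal \<eta> * emeasure lborel ?Q)\<^sup>2 \<le> emeasure lborel ?Q * (ennreal ?m * T k x)"
        by (simp add: mult_left_mono less_imp_le)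
      then have "ennreal (?m\<^sup>2) * ennreal (\<eta>\<^sup>2) \<le> ennreal (?m\<^sup>2) * T k x"
      proof -
        assume "(ennreal \<eta> * emeasure lborel ?Q)\<^sup>2 \<le> emeasure lborel ?Q * (ennreal ?m * T k x)"
        moreover have "(ennreal \<eta> * emeasure lborel ?Q)\<^sup>2 = ennreal (?m\<^sup>2) * ennreal (\<eta>\<^sup>2)"
          using \<eta> by (simp add: emeasure_cube power_mult_distrib ennreal_power mult.commute)
        moreover have "emeasure lborel ?Q * (ennreal ?m * T k x) = ennreal (?m\<^sup>2) * T k x"
          by (simp add: emeasure_cube mult.assoc[symmetric] ennreal_mult[symmetric] power2_eq_square)
        ultimately show ?thesis by simp
      qed
      note le2 = this
      have inv: "ennreal (1 / ?m\<^sup>2) * ennreal (?m\<^sup>2) = 1"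
        by (simp add: ennreal_mult[symmetric])
      have "ennreal (\<eta>\<^sup>2) = ennreal (1 / ?m\<^sup>2) * (ennreal (?m\<^sup>2) * ennreal (\<eta>\<^sup>2))"
        by (simp only: mult.assoc[symmetric] inv mult_1_left)
      also have "\<dots> \<le> ennreal (1 / ?m\<^sup>2) * (ennreal (?m\<^sup>2) * T k x)"
        by (intro mult_left_mono le2) auto
      also have "\<dots> = T k x"
        by (simp only: mult.assoc[symmetric] inv mult_1_left)
      finally show ?thesis .
    qed
    have T_int: "(\<integral>\<^sup>+x. T k x \<partial>lborel) = (\<integral>\<^sup>+v. N2 (\<lambda>x. g (x + side (int k) *\<^sub>R v) - g x) * indicator (cball 0 ?d) v \<partial>lborel)" for k
    proof -
      have "(\<integral>\<^sup>+x. T k x \<partial>lborel) = (\<integral>\<^sup>+v. \<integral>\<^sup>+x. ennreal ((cmod (g (x + side (int k) *\<^sub>R v) - g x))\<^sup>2) * indicator (cball 0 ?d) v \<partial>lborel \<partial>lborel)"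
        unfolding T_def by (rule lborel_pair.Fubini'[symmetric]) measurable
      also have "\<dots> = (\<integral>\<^sup>+v. N2 (\<lambda>x. g (x + side (int k) *\<^sub>R v) - g x) * indicator (cball 0 ?d) v \<partial>lborel)"
        unfolding N2_def by (intro nn_integral_cong nn_integral_multc) measurable
      finally show ?thesis .
    qed
    have side0: "(\<lambda>k. side (int k)) \<longlonglongrightarrow> 0"
    proof -
      have "side (int k) = (1/2) ^ k" for k
        by (simp add: side_def power_int_minus power_int_of_nat power_one_over inverse_eq_divide)
      then show ?thesis by (simp add: LIMSEQ_power_zero)
    qed
    have "(\<lambda>k. \<integral>\<^sup>+v. N2 (\<lambda>x. g (x + side (int k) *\<^sub>R v) - g x) * indicator (cball 0 ?d) v \<partial>lborel) \<longlonglongrightarrow> (\<integral>\<^sup>+v. 0 \<partial>(lborel :: 'a measure))"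
    proof (rule nn_integral_dominated_convergence[where w="\<lambda>v. (4 * N2 g) * indicator (cball 0 ?d) v"])
      show "(\<lambda>v. N2 (\<lambda>x. g (x + side (int k) *\<^sub>R v) - g x) * indicator (cball 0 ?d) v) \<in> borel_measurable lborel" for k
        unfolding N2_def by measurable
      show "AE v in lborel. N2 (\<lambda>x. g (x + side (int k) *\<^sub>R v) - g x) * indicator (cball 0 ?d) v \<le> (4 * N2 g) * indicator (cball 0 ?d) v" for k
      proof (intro AE_I2 mult_right_mono)
        fix v
        have "N2 (\<lambda>x. g (x + side (int k) *\<^sub>R v) - g x) \<le> 2 * N2 (\<lambda>x. g (x + side (int k) *\<^sub>R v)) + 2 * N2 g"
          by (rule N2_diff) measurable
        also have "\<dots> = 4 * N2 g" by (simp add: N2_translate distrib_right[symmetric])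
        finally show "N2 (\<lambda>x. g (x + side (int k) *\<^sub>R v) - g x) \<le> 4 * N2 g" .
      qed auto
      show "AE v in lborel. (\<lambda>k. N2 (\<lambda>x. g (x + side (int k) *\<^sub>R v) - g x) * indicator (cball 0 ?d) v) \<longlonglongrightarrow> 0"
      proof (rule AE_I2)
        fix v :: 'a
        have "(\<lambda>k. side (int k) *\<^sub>R v) \<longlonglongrightarrow> 0 *\<^sub>R v" by (intro tendsto_scaleR side0 tendsto_const)
        then have "(\<lambda>k. N2 (\<lambda>x. g (x + side (int k) *\<^sub>R v) - g x)) \<longlonglongrightarrow> 0"
          by (intro L2_translation_tendsto[OF g]) simp
        then show "(\<lambda>k. N2 (\<lambda>x. g (x + side (int k) *\<^sub>R v) - g x) * indicator (cball 0 ?d) v) \<longlonglongrightarrow> 0"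
          by (rule tendsto_0_ennreal_le) (auto simp: indicator_def)
      qed
      show "(\<integral>\<^sup>+v. (4 * N2 g) * indicator (cball 0 ?d) v \<partial>(lborel :: 'a measure)) < \<infinity>"
        using L2_finite[OF g] by (subst nn_integral_cmult_indicator) (auto simp: ennreal_mult_less_top emeasure_cball)
    qed measurable
    then have lim: "(\<lambda>k. \<integral>\<^sup>+x. T k x \<partial>lborel) \<longlonglongrightarrow> 0" by (simp add: T_int)
    have "ennreal (\<eta>\<^sup>2) * emeasure lborel ?S \<le> (\<integral>\<^sup>+x. T k x \<partial>lborel)" for k
    proof -
      have "ennreal (\<eta>\<^sup>2) * emeasure lborel ?S = (\<integral>\<^sup>+x. ennreal (\<eta>\<^sup>2) * indicator ?S x \<partial>lborel)"
        by (simp add: nn_integral_cmult_indicator)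
      also have "\<dots> \<le> (\<integral>\<^sup>+x. T k x \<partial>lborel)"
        using pt by (intro nn_integral_mono) (auto simp: indicator_def)
      finally show ?thesis .
    qed
    then have "(\<lambda>k::nat. ennreal (\<eta>\<^sup>2) * emeasure lborel ?S) \<longlonglongrightarrow> 0" by (rule tendsto_0_ennreal_le[OF lim])
    then have "ennreal (\<eta>\<^sup>2) * emeasure lborel ?S = 0" by (simp add: LIMSEQ_const_iff)
    then show ?thesis using \<eta> by simp
  qed
  \<comment> \<open>The strict inequality |g x| > \<alpha> is exhausted by the countably many values
    \<eta> = 1/(n+1).\<close>
  have "AE x in lborel. \<not> (cmod (g x) > \<alpha> + 1 / real (Suc n) \<and> x \<notin> ?L)" for n
  proof (rule AE_I')
    have "{x. cmod (g x) > \<alpha> + 1 / real (Suc n) \<and> x \<notin> ?L} = {x \<in> space borel. cmod (g x) > \<alpha> + 1 / real (Suc n)} - ?L" by auto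
    also have "\<dots> \<in> sets borel" by measurable
    finally have "{x. cmod (g x) > \<alpha> + 1 / real (Suc n) \<and> x \<notin> ?L} \<in> sets borel" .
    then show "{x. cmod (g x) > \<alpha> + 1 / real (Suc n) \<and> x \<notin> ?L} \<in> null_sets lborel"
      using small[of "1 / real (Suc n)"] by (intro null_setsI) auto
  qed auto
  then have "AE x in lborel. \<forall>n. \<not> (cmod (g x) > \<alpha> + 1 / real (Suc n) \<and> x \<notin> ?L)" unfolding AE_all_countable by blast
  then show ?thesis
  proof eventually_elim
    case (elim x)
    show ?case
    proof
      assume "cmod (g x) > \<alpha>"
      then obtain n where "1 / real (Suc n) < cmod (g x) - \<alpha>" using nat_approx_posE[of "cmod (g x) - \<alpha>"] by auto
      then have "cmod (g x) > \<alpha> + 1 / real (Suc n)" by simp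
      with elim show "x \<in> ?L" by blast
    qed
  qed
qed

section \<open>The \<open>L\<^sub>p\<close> bounds\<close>

definition Np :: "real \<Rightarrow> ('a::euclidean_space \<Rightarrow> complex) \<Rightarrow> ennreal" where
  "Np p f = (\<integral>\<^sup>+x. ennreal (cmod (f x) powr p) \<partial>lborel)"

lemma osc_cong_AE:
  fixes g :: "'a::euclidean_space \<Rightarrow> complex"
  assumes [measurable]: "g \<in> borel_measurable borel" "h \<in> borel_measurable borel" and eq: "AE x in lborel. g x = h x"
  shows "osc g (cube k x) = osc h (cube k x)"
proof -
  have "cube_avg g (cube k x) = cube_avg h (cube k x)"
    unfolding cube_avg_def using eq by (intro arg_cong2[where f="(/)"] integral_cong_AE) auto
  then show ?thesis
    unfolding osc_def nn_on_def using eq by (intro nn_integral_cong_AE) auto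
qed

text \<open>The factor 2 counts h itself and its average.\<close>

lemma osc_add_le:
  fixes g h :: "'a::euclidean_space \<Rightarrow> complex"
  assumes g: "g \<in> Lp_space 2" and h: "h \<in> Lp_space 2"
  shows "osc (\<lambda>x. g x + h x) (cube k x) \<le> osc g (cube k x) + 2 * nn_on (\<lambda>x. ennreal (cmod (h x))) (cube k x)"
proof -
  note [measurable] = L2_measurable[OF g] L2_measurable[OF h]
  let ?Q = "cube k x"
  let ?c = "cube_avg g ?Q" and ?e = "cube_avg h ?Q"
  have avg: "cube_avg (\<lambda>x. g x + h x) ?Q = ?c + ?e"
    unfolding cube_avg_def using L2_cube_integrable[OF g, of k x] L2_cube_integrable[OF h, of k x]
    by (simp add: distrib_left add_divide_distrib)
  have "osc (\<lambda>x. g x + h x) ?Q \<le> nn_on (\<lambda>y. ennreal (cmod (g y - ?c)) + (ennreal (cmod (h y)) + ennreal (cmod ?e))) ?Q"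
    unfolding osc_def avg
  proof (rule nn_on_mono)
    fix y
    have "cmod (g y + h y - (?c + ?e)) \<le> cmod (g y - ?c) + (cmod (h y) + cmod ?e)"
      using norm_triangle_ineq[of "g y - ?c" "h y - ?e"] norm_triangle_ineq4[of "h y" ?e] by (simp add: algebra_simps)
    then show "ennreal (cmod (g y + h y - (?c + ?e))) \<le> ennreal (cmod (g y - ?c)) + (ennreal (cmod (h y)) + ennreal (cmod ?e))"
      by (simp add: ennreal_plus[symmetric] ennreal_leI del: ennreal_plus)
  qed simp
  also have "\<dots> = osc g ?Q + (nn_on (\<lambda>y. ennreal (cmod (h y))) ?Q + ennreal (cmod ?e) * emeasure lborel ?Q)"
    unfolding osc_def by (subst nn_on_add, simp, measurable, subst nn_on_add, simp, measurable) (simp add: nn_on_const)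
  also have "\<dots> \<le> osc g ?Q + (nn_on (\<lambda>y. ennreal (cmod (h y))) ?Q + nn_on (\<lambda>y. ennreal (cmod (h y))) ?Q)"
    by (intro add_left_mono cube_avg_bound h)
  finally show ?thesis by (simp add: mult_2)
qed

text \<open>Young's inequality with constants 1: depending on whether b <= a^(p-1), one of the two
  terms alone dominates the product.\<close>

lemma mult_le_powr_add:
  fixes a b p :: real
  assumes "0 \<le> a" "0 \<le> b" "1 < p"
  shows "a * b \<le> a powr p + b powr (p / (p - 1))"
proof (cases "a = 0 \<or> b = 0")
  case False
  then have ab: "a > 0" "b > 0" using assms by auto
  show ?thesis
  proof (cases "b \<le> a powr (p - 1)")
    case True
    then have "a * b \<le> a * a powr (p - 1)" using ab by (intro mult_left_mono) auto
    also have "\<dots> = a powr p" using ab by (simp add: powr_mult_base)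
    finally show ?thesis using ab by (simp add: add_increasing2)
  next
    case False
    then have "a powr (p - 1) \<le> b" by simp
    then have "(a powr (p - 1)) powr (1 / (p - 1)) \<le> b powr (1 / (p - 1))" using assms by (intro powr_mono2) auto
    then have "a \<le> b powr (1 / (p - 1))" using ab assms by (simp add: powr_powr)
    then have "a * b \<le> b powr (1 / (p - 1)) * b" using ab by (intro mult_right_mono) auto
    also have "\<dots> = b powr (1 + 1 / (p - 1))" using ab by (simp add: powr_mult_base mult.commute)
    also have "1 + 1 / (p - 1) = p / (p - 1)" using assms by (simp add: field_simps)
    finally show ?thesis by (simp add: add_increasing)
  qed
qed (use assms in auto)

text \<open>A geometric sum is at most G = 1/(1 - 2^-q) times its largest term, which lies below
  y^q. It plays the role of integrating \<alpha>^(q-1) up to y.\<close>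

lemma dyadic_powr_sum_le:
  fixes q y \<delta> :: real
  assumes q: "q > 0" and \<delta>: "\<delta> > 0" and y: "y \<ge> 0"
  defines "G \<equiv> 2 powr q / (2 powr q - 1)"
  shows "(\<Sum>n\<le>M. if \<delta> * 2 ^ n < y then (\<delta> * 2 ^ n) powr q else 0) \<le> G * y powr q"
proof -
  have r1: "2 powr q > 1" using q by simp
  have G: "G \<ge> 1" unfolding G_def using r1 by simp
  have pw: "(\<delta> * 2 ^ n) powr q = \<delta> powr q * (2 powr q) ^ n" for n
    using \<delta> by (simp add: powr_mult powr_realpow[symmetric] powr_powr mult.commute)
  have geo: "(\<Sum>n\<le>M. (\<delta> * 2 ^ n) powr q) \<le> G * (\<delta> * 2 ^ M) powr q" for M
  proof (induction M)
    case 0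
    then show ?case using G mult_right_mono[of 1 G "\<delta> powr q"] by simp
  next
    case (Suc M)
    have "(\<Sum>n\<le>Suc M. (\<delta> * 2 ^ n) powr q) \<le> G * (\<delta> * 2 ^ M) powr q + (\<delta> * 2 ^ Suc M) powr q" using Suc by simp
    also have "\<dots> = G * (\<delta> * 2 ^ Suc M) powr q"
    proof -
      have "G * (2 powr q - 1) = 2 powr q" unfolding G_def using r1 q by simp
      then have "\<delta> powr q * (2 powr q) ^ Suc M = (G * (2 powr q - 1)) * (\<delta> powr q * (2 powr q) ^ M)" by simp
      then show ?thesis unfolding pw by (simp add: algebra_simps)
    qed
    finally show ?case .
  qed
  show ?thesis
  proof (induction M)
    case 0
    show ?case
    proof (cases "\<delta> < y")
      case True
      then have "\<delta> powr q \<le> y powr q" using \<delta> q by (intro powr_mono2) auto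
      also have "\<dots> \<le> G * y powr q" using G mult_right_mono[of 1 G "y powr q"] by simp
      finally show ?thesis using True by simp
    qed (use G in auto)
  next
    case (Suc M)
    show ?case
    proof (cases "\<delta> * 2 ^ Suc M < y")
      case True
      have "(\<Sum>n\<le>Suc M. if \<delta> * 2 ^ n < y then (\<delta> * 2 ^ n) powr q else 0) \<le> (\<Sum>n\<le>Suc M. (\<delta> * 2 ^ n) powr q)"
        by (intro sum_mono) auto
      also have "\<dots> \<le> G * (\<delta> * 2 ^ Suc M) powr q" by (rule geo)
      also have "\<dots> \<le> G * y powr q" using True G q \<delta> by (intro mult_left_mono powr_mono2) auto
      finally show ?thesis .
    qed (use Suc in simp)
  qed
qed

lemma dyadic_layer:
  fixes y \<delta> :: real
  assumes "0 < \<delta>" "\<delta> < y" "y \<le> \<delta> * 2 ^ Suc M"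
  shows "\<exists>n\<le>M. \<delta> * 2 ^ n < y \<and> y \<le> 2 * (\<delta> * 2 ^ n)"
  using assms
proof (induction M)
  case (Suc M)
  show ?case
  proof (cases "y \<le> \<delta> * 2 ^ Suc M")
    case True
    with Suc show ?thesis by (metis le_SucI)
  next
    case False
    then show ?thesis using Suc.prems by (intro exI[of _ "Suc M"]) auto
  qed
qed auto

text \<open>Half of S may be subtracted because S is finite; an infinite S would satisfy the
  inequality trivially.\<close>

lemma ennreal_absorb_half:
  fixes S A :: ennreal
  assumes "S \<le> A + ennreal (1/2) * S" "S < \<infinity>"
  shows "S \<le> 2 * A"
proof (cases A)
  case (real a)
  obtain s where s: "S = ennreal s" "0 \<le> s" using assms(2) by (cases S) auto
  have "ennreal (1/2) * ennreal s = ennreal (s / 2)" using s by (subst ennreal_mult[symmetric]) auto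
  moreover have "ennreal a + ennreal (s / 2) = ennreal (a + s / 2)" using s real by (intro ennreal_plus[symmetric]) auto
  ultimately have "ennreal s \<le> ennreal (a + s / 2)"
    using assms(1) unfolding s(1) real by (simp only:)
  then have "s \<le> 2 * a" using s real by (subst (asm) ennreal_le_iff) auto
  then have "ennreal s \<le> ennreal (2 * a)" by (rule ennreal_leI)
  then show ?thesis using s real by (simp add: ennreal_mult'')
qed (simp add: ennreal_mult_top)

context
  fixes \<phi> :: "'a::euclidean_space \<Rightarrow> real"
  assumes smooth: "smooth_on_subset (sphere 0 1) \<phi>"
begin

text \<open>By duality the mean oscillation of \<open>A_op \<phi> t f\<close> over a cube is tested against an atom.\<close>

lemma bmo_bound:
  "\<exists>C\<ge>1. \<forall>t f \<beta> k x. 1 \<le> \<bar>t\<bar> \<longrightarrow> f \<in> Lp_space 2 \<longrightarrow> (\<forall>y. cmod (f y) \<le> \<beta>) \<longrightarrow>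
    osc (A_op \<phi> t f) (cube k x) \<le> ennreal (C * \<bar>t\<bar> powr (real DIM('a) / 2) * \<beta>) * emeasure lborel (cube k x)"
proof -
  obtain C0 where C0: "C0 \<ge> 0" and atom: "\<forall>t a. 1 \<le> \<bar>t\<bar> \<longrightarrow> unit_atom a \<longrightarrow>
    (\<integral>\<^sup>+x. ennreal (cmod (A_op \<phi> t a x)) \<partial>lborel) \<le> ennreal (C0 * \<bar>t\<bar> powr (real DIM('a) / 2))"
    using atom_bound[OF smooth] by blast
  \<comment> \<open>The estimate gives 2 \<open>C0\<close>; the summand 1 makes the constant at
    least 1, hence usable as a divisor in \<open>level_recursion\<close>.\<close>
  have "osc (A_op \<phi> t f) (cube k x) \<le> ennreal ((2 * C0 + 1) * \<bar>t\<bar> powr (real DIM('a) / 2) * \<beta>) * emeasure lborel (cube k x)"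
    if t: "1 \<le> \<bar>t\<bar>" and f: "f \<in> Lp_space 2" and f\<beta>: "\<forall>y. cmod (f y) \<le> \<beta>" for t f \<beta> k x
  proof -
    define \<Lambda> where "\<Lambda> = \<bar>t\<bar> powr (real DIM('a) / 2)"
    have \<Lambda>: "\<Lambda> \<ge> 0" by (simp add: \<Lambda>_def)
    have \<beta>: "\<beta> \<ge> 0" using f\<beta> norm_ge_zero order_trans by blast
    define g where "g = A_op \<phi> t f"
    have g: "g \<in> Lp_space 2" unfolding g_def by (rule A_op_L2[OF smooth f])
    note [measurable] = L2_measurable[OF f] L2_measurable[OF g]
    let ?Q = "cube k x"
    define m where "m = side k ^ DIM('a)"
    have m: "m > 0" by (simp add: m_def)
    have emQ: "emeasure lborel ?Q = ennreal m" by (simp add: m_def emeasure_cube)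
    have indQ: "(\<lambda>y. indicator ?Q y :: complex) \<in> Lp_space 2" by (rule indicator_L2) (auto simp: emQ)
    have intQ: "integrable lborel (\<lambda>y. indicator ?Q y :: complex)" "(\<integral>y. indicator ?Q y \<partial>lborel) = complex_of_real m"
    proof -
      have "(\<lambda>y. indicator ?Q y * indicator ?Q y) = (\<lambda>y. indicator ?Q y :: complex)" by (auto simp: indicator_def)
      with L2_mult_integrable[OF indQ indQ] show "integrable lborel (\<lambda>y. indicator ?Q y :: complex)" by simp
      have "(\<lambda>y. indicator ?Q y :: complex) = (\<lambda>y. of_real (indicator ?Q y))" by (auto simp: indicator_def)
      then have "(\<integral>y. indicator ?Q y \<partial>lborel) = complex_of_real (\<integral>y. indicator ?Q y \<partial>lborel)"
        by (simp only: integral_complex_of_real)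
      then show "(\<integral>y. indicator ?Q y \<partial>lborel) = complex_of_real m" by (simp add: m_def measure_cube)
    qed
    define c where "c = cube_avg g ?Q"
    have cm: "c * of_real m = (\<integral>y. indicator ?Q y * g y \<partial>lborel)"
      using m by (simp add: c_def cube_avg_def measure_cube m_def[symmetric])
    \<comment> \<open>The phase that makes (g - c) s equal to |g - c| on Q; where g = c the quotient
      is 0 by convention.\<close>
    define s where "s y = indicator ?Q y * (cnj (g y - c) / of_real (cmod (g y - c)))" for y
    have [measurable]: "s \<in> borel_measurable borel" unfolding s_def by measurable
    have s1: "cmod (s y) \<le> indicator ?Q y" for y by (auto simp: s_def norm_mult norm_divide indicator_def simp del: complex_cnj_diff)
    have bounded_L2: "h \<in> Lp_space 2" if [measurable]: "h \<in> borel_measurable borel" and "\<And>y. cmod (h y) \<le> B * indicator ?Q y" for h :: "'a \<Rightarrow> complex" and B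
    proof (rule L2_I)
      have "N2 h \<le> N2 (\<lambda>y. of_real B * indicator ?Q y)"
      proof (rule N2_mono)
        show "cmod (h y) \<le> cmod (of_real B * indicator ?Q y)" for y
          using that(2)[of y] by (cases "y \<in> ?Q") auto
      qed
      also have "\<dots> < \<infinity>" using L2_cmult[OF indQ, of "of_real B"] by (simp add: L2_iff)
      finally show "N2 h < \<infinity>" .
    qed measurable
    have sL: "s \<in> Lp_space 2" using s1 by (intro bounded_L2[where B=1]) auto
    have s_int: "integrable lborel s"
    proof (rule Bochner_Integration.integrable_bound[OF intQ(1)], measurable, rule AE_I2)
      show "cmod (s y) \<le> cmod (indicator ?Q y)" for y using s1[of y] by (cases "y \<in> ?Q") auto
    qed
    \<comment> \<open>The mean of s over Q. Subtracting it makes the test function cancel but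
      doubles its bound, which the factor 1/2 in \<open>a\<close> repairs.\<close>
    define \<sigma> where "\<sigma> = (\<integral>y. s y \<partial>lborel) / of_real m"
    have \<sigma>m: "\<sigma> * of_real m = (\<integral>y. s y \<partial>lborel)" using m by (simp add: \<sigma>_def)
    have \<sigma>1: "cmod \<sigma> \<le> 1"
    proof -
      have "cmod (\<integral>y. s y \<partial>lborel) \<le> (\<integral>y. indicator ?Q y \<partial>lborel)"
      proof (rule order_trans[OF integral_norm_bound])
        have "integrable lborel (\<lambda>y. indicator ?Q y :: real)"
          by (rule integrable_real_indicator) (auto simp: emQ)
        then show "(\<integral>y. cmod (s y) \<partial>lborel) \<le> (\<integral>y. indicator ?Q y \<partial>lborel)"
          using s_int by (intro integral_mono integrable_norm s1)
      qed
      also have "\<dots> = m" by (simp add: m_def measure_cube)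
      finally show ?thesis using m by (simp add: \<sigma>_def norm_divide)
    qed
    define a where "a y = (1/2) * (s y - \<sigma> * indicator ?Q y)" for y
    have [measurable]: "a \<in> borel_measurable borel" unfolding a_def by measurable
    have a1: "cmod (a y) \<le> indicator ?Q y" for y
    proof -
      have "cmod (s y - \<sigma> * indicator ?Q y) \<le> indicator ?Q y + indicator ?Q y"
        using norm_triangle_ineq4[of "s y" "\<sigma> * indicator ?Q y"] s1[of y] \<sigma>1
        by (auto simp: indicator_def split: if_splits)
      then show ?thesis by (simp add: a_def norm_mult norm_divide)
    qed
    have aL: "a \<in> Lp_space 2" using a1 by (intro bounded_L2[where B=1]) auto
    have a0: "(\<integral>y. a y \<partial>lborel) = 0"
      unfolding a_def using s_int intQ \<sigma>m by simp
    \<comment> \<open>Subtracting the mean from s or from g has the same effect on the integral: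
      both corrections equal c \<sigma> |Q|.\<close>
    have osc_eq: "complex_of_real (\<integral>y. cmod (g y - c) * indicator ?Q y \<partial>lborel) = 2 * (\<integral>y. g y * a y \<partial>lborel)"
    proof -
      have i1: "integrable lborel (\<lambda>y. g y * s y)" by (rule L2_mult_integrable[OF g sL])
      have i2: "integrable lborel (\<lambda>y. \<sigma> * (indicator ?Q y * g y))" by (intro integrable_mult_right L2_cube_integrable g)
      have "(\<integral>y. g y * a y \<partial>lborel) = (\<integral>y. (1/2) * (g y * s y - \<sigma> * (indicator ?Q y * g y)) \<partial>lborel)"
        by (intro Bochner_Integration.integral_cong) (auto simp: a_def algebra_simps)
      also have "\<dots> = (1/2) * ((\<integral>y. g y * s y \<partial>lborel) - \<sigma> * (\<integral>y. indicator ?Q y * g y \<partial>lborel))"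
        using i1 i2 by (simp add: Bochner_Integration.integral_diff)
      finally have e: "(\<integral>y. g y * a y \<partial>lborel) = (1/2) * ((\<integral>y. g y * s y \<partial>lborel) - \<sigma> * (\<integral>y. indicator ?Q y * g y \<partial>lborel))" .
      have "2 * (\<integral>y. g y * a y \<partial>lborel) = (\<integral>y. g y * s y \<partial>lborel) - \<sigma> * (c * of_real m)"
        unfolding e cm by simp
      also have "\<dots> = (\<integral>y. g y * s y \<partial>lborel) - c * (\<integral>y. s y \<partial>lborel)" by (simp add: \<sigma>m[symmetric] mult_ac)
      also have "\<dots> = (\<integral>y. g y * s y - c * s y \<partial>lborel)" using i1 s_int by (simp add: Bochner_Integration.integral_diff)
      also have "\<dots> = (\<integral>y. complex_of_real (cmod (g y - c) * indicator ?Q y) \<partial>lborel)"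
      proof (intro Bochner_Integration.integral_cong refl)
        fix y
        have z: "z * (cnj z / of_real (cmod z)) = of_real (cmod z)" for z
          by (cases "z = 0") (simp_all add: complex_norm_square[symmetric] power2_eq_square)
        have "g y * s y - c * s y = indicator ?Q y * ((g y - c) * (cnj (g y - c) / of_real (cmod (g y - c))))"
          unfolding s_def left_diff_distrib[symmetric] by (simp only: mult.left_commute)
        also have "\<dots> = complex_of_real (cmod (g y - c) * indicator ?Q y)"
          unfolding z by (simp add: indicator_def)
        finally show "g y * s y - c * s y = complex_of_real (cmod (g y - c) * indicator ?Q y)" .
      qed
      finally show ?thesis by (simp only: integral_complex_of_real)
    qed
    \<comment> \<open>The pairing in \<open>A_op_adjoint\<close> is sesquilinear, so the test
      function enters conjugated.\<close>
    define a' where "a' y = cnj (a y)" for y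
    have a'L: "a' \<in> Lp_space 2" unfolding a'_def[abs_def] by (rule L2_cnj[OF aL])
    note [measurable] = L2_measurable[OF a'L]
    \<comment> \<open>Seen from x at the scale of its side, the cube lies in the ball of radius d,
      as an atom requires.\<close>
    define b where "b z = a' (x + side k *\<^sub>R z)" for z
    have b: "unit_atom b"
      unfolding unit_atom_def
    proof (intro conjI allI impI)
      show "b \<in> borel_measurable borel" unfolding b_def by measurable
      show "cmod (b z) \<le> 1" for z
        using a1[of "x + side k *\<^sub>R z"] by (cases "x + side k *\<^sub>R z \<in> ?Q") (auto simp: b_def a'_def)
      show "b z = 0" if "real DIM('a) < norm z" for z
      proof -
        have "x + side k *\<^sub>R z \<notin> ?Q"
        proof
          assume "x + side k *\<^sub>R z \<in> ?Q"
          then have "norm ((x + side k *\<^sub>R z) - x) \<le> real DIM('a) * side k" by (rule cube_norm_diff)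
          then have "norm z * side k \<le> real DIM('a) * side k" by (simp add: mult.commute)
          then have "norm z \<le> real DIM('a)" by (rule mult_right_le_imp_le) simp
          with that show False by simp
        qed
        then show ?thesis using a1[of "x + side k *\<^sub>R z"] by (simp add: b_def a'_def)
      qed
      have "(\<integral>y. a' y \<partial>lborel) = 0" using a0 by (simp add: a'_def)
      then show "(\<integral>z. b z \<partial>lborel) = 0"
        using integral_affine[of "side k" a' x] by (simp add: b_def)
    qed
    define w where "w = A_op \<phi> (-t) a'"
    have w: "w \<in> Lp_space 2" unfolding w_def by (rule A_op_L2[OF smooth a'L])
    note [measurable] = L2_measurable[OF w]
    have w_int: "(\<integral>\<^sup>+y. ennreal (cmod (w y)) \<partial>lborel) \<le> ennreal (m * (C0 * \<Lambda>))"
    proof -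
      have "(\<integral>\<^sup>+y. ennreal (cmod (w y)) \<partial>lborel) = ennreal m * (\<integral>\<^sup>+z. ennreal (cmod (w (x + side k *\<^sub>R z))) \<partial>lborel)"
        unfolding m_def using nn_integral_affine[of "\<lambda>y. ennreal (cmod (w y))" "side k" x] by simp
      also have "(\<integral>\<^sup>+z. ennreal (cmod (w (x + side k *\<^sub>R z))) \<partial>lborel) = (\<integral>\<^sup>+z. ennreal (cmod (A_op \<phi> (-t) b z)) \<partial>lborel)"
        using A_op_affine[OF smooth a'L side_simps(1), of "-t" x k]
        unfolding b_def[abs_def] w_def by (intro nn_integral_cong_AE) auto
      also have "\<dots> \<le> ennreal (C0 * \<bar>-t\<bar> powr (real DIM('a) / 2))" using atom b t by (metis abs_minus_cancel)
      also have "\<dots> = ennreal (C0 * \<Lambda>)" by (simp add: \<Lambda>_def)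
      finally have "(\<integral>\<^sup>+y. ennreal (cmod (w y)) \<partial>lborel) \<le> ennreal m * ennreal (C0 * \<Lambda>)" by (simp add: mult_left_mono)
      also have "\<dots> = ennreal (m * (C0 * \<Lambda>))" using m C0 \<Lambda> by (simp add: ennreal_mult)
      finally show ?thesis .
    qed
    have "(\<integral>y. g y * a y \<partial>lborel) = (\<integral>y. f y * cnj (w y) \<partial>lborel)"
      using A_op_adjoint[OF smooth f a'L, of t] by (simp add: g_def w_def a'_def)
    then have "ennreal (cmod (\<integral>y. g y * a y \<partial>lborel)) \<le> (\<integral>\<^sup>+y. ennreal (cmod (f y * cnj (w y))) \<partial>lborel)"
      using integral_norm_bound_ennreal[OF L2_mult_integrable[OF f L2_cnj[OF w]]] by simp
    also have "\<dots> \<le> (\<integral>\<^sup>+y. ennreal \<beta> * ennreal (cmod (w y)) \<partial>lborel)"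
      using f\<beta> \<beta> by (intro nn_integral_mono) (auto simp: norm_mult ennreal_mult[symmetric] intro!: ennreal_leI mult_right_mono)
    also have "\<dots> = ennreal \<beta> * (\<integral>\<^sup>+y. ennreal (cmod (w y)) \<partial>lborel)" by (simp add: nn_integral_cmult)
    also have "\<dots> \<le> ennreal \<beta> * ennreal (m * (C0 * \<Lambda>))" by (intro mult_left_mono w_int) auto
    also have "\<dots> = ennreal (\<beta> * (m * (C0 * \<Lambda>)))" using m C0 \<Lambda> \<beta> by (simp add: ennreal_mult)
    finally have "cmod (\<integral>y. g y * a y \<partial>lborel) \<le> \<beta> * (m * (C0 * \<Lambda>))"
      by (subst (asm) ennreal_le_iff) (use m C0 \<Lambda> \<beta> in auto)
    then have "cmod (complex_of_real (\<integral>y. cmod (g y - c) * indicator ?Q y \<partial>lborel)) \<le> 2 * (\<beta> * (m * (C0 * \<Lambda>)))"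
      unfolding osc_eq by (simp add: norm_mult)
    then have "(\<integral>y. cmod (g y - c) * indicator ?Q y \<partial>lborel) \<le> 2 * (\<beta> * (m * (C0 * \<Lambda>)))"
      by simp
    also have "\<dots> \<le> ((2 * C0 + 1) * \<Lambda> * \<beta>) * m" using m \<Lambda> \<beta> by (simp add: algebra_simps)
    finally have le: "(\<integral>y. cmod (g y - c) * indicator ?Q y \<partial>lborel) \<le> ((2 * C0 + 1) * \<Lambda> * \<beta>) * m" .
    have "integrable lborel (\<lambda>y. (g y - c) * indicator ?Q y)"
      using Bochner_Integration.integrable_diff[OF L2_cube_integrable[OF g, of k x] integrable_mult_right[OF intQ(1), of c]]
      by (simp add: algebra_simps)
    then have "integrable lborel (\<lambda>y. cmod (g y - c) * indicator ?Q y)"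
      by (rule integrable_norm[THEN Bochner_Integration.integrable_bound]) (auto simp: norm_mult indicator_def)
    then have "osc g ?Q = ennreal (\<integral>y. cmod (g y - c) * indicator ?Q y \<partial>lborel)"
      unfolding osc_def nn_on_def c_def[symmetric]
      by (subst nn_integral_eq_integral[symmetric]) (auto intro!: nn_integral_cong simp: indicator_def)
    also have "\<dots> \<le> ennreal (((2 * C0 + 1) * \<Lambda> * \<beta>) * m)" by (intro ennreal_leI le)
    also have "\<dots> = ennreal ((2 * C0 + 1) * \<Lambda> * \<beta>) * emeasure lborel ?Q"
      unfolding emQ using C0 \<Lambda> \<beta> m by (intro ennreal_mult) auto
    finally show ?thesis by (simp add: g_def \<Lambda>_def)
  qed
  moreover have "2 * C0 + 1 \<ge> 1" using C0 by simp
  ultimately show ?thesis by blast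
qed

text \<open>The oscillation allowance \<gamma> \<alpha> is split evenly. The part of f below the
  height has an image of oscillation at most \<gamma> \<alpha>/2 by \<open>bmo_bound\<close>, which
  determines the height. Where the allowance is exceeded, the image of the other part must average
  more than \<gamma> \<alpha>/4, by the factor 2 in \<open>osc_add_le\<close>, and the weak L_2
  bound gives 16/(\<gamma> \<alpha>)^2.\<close>

lemma level_recursion:
  "\<exists>C\<ge>1. \<forall>t f \<alpha> \<gamma>. 1 \<le> \<bar>t\<bar> \<longrightarrow> f \<in> Lp_space 2 \<longrightarrow> 0 < \<alpha> \<longrightarrow> 0 < \<gamma> \<longrightarrow>
    emeasure lborel (level_set (\<lambda>x. ennreal (cmod (A_op \<phi> t f x))) (2 * \<alpha>))
     \<le> ennreal (16 / (\<gamma> * \<alpha>)\<^sup>2) * N2 (\<lambda>x. indicator {x. cmod (f x) > \<gamma> / (2 * C * \<bar>t\<bar> powr (real DIM('a) / 2)) * \<alpha>} x * f x)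
      + ennreal (2 ^ DIM('a) * \<gamma>) * emeasure lborel (level_set (\<lambda>x. ennreal (cmod (A_op \<phi> t f x))) \<alpha>)"
proof -
  obtain C where C: "C \<ge> 1" and bmo: "\<forall>t f \<beta> k x. 1 \<le> \<bar>t\<bar> \<longrightarrow> f \<in> Lp_space 2 \<longrightarrow> (\<forall>y. cmod (f y) \<le> \<beta>) \<longrightarrow>
    osc (A_op \<phi> t f) (cube k x) \<le> ennreal (C * \<bar>t\<bar> powr (real DIM('a) / 2) * \<beta>) * emeasure lborel (cube k x)"
    using bmo_bound by blast
  have "emeasure lborel (level_set (\<lambda>x. ennreal (cmod (A_op \<phi> t f x))) (2 * \<alpha>))
     \<le> ennreal (16 / (\<gamma> * \<alpha>)\<^sup>2) * N2 (\<lambda>x. indicator {x. cmod (f x) > \<gamma> / (2 * C * \<bar>t\<bar> powr (real DIM('a) / 2)) * \<alpha>} x * f x)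
      + ennreal (2 ^ DIM('a) * \<gamma>) * emeasure lborel (level_set (\<lambda>x. ennreal (cmod (A_op \<phi> t f x))) \<alpha>)"
    if t: "1 \<le> \<bar>t\<bar>" and f: "f \<in> Lp_space 2" and \<alpha>: "0 < \<alpha>" and \<gamma>: "0 < \<gamma>" for t f \<alpha> \<gamma>
  proof -
    define \<Lambda> where "\<Lambda> = \<bar>t\<bar> powr (real DIM('a) / 2)"
    have \<Lambda>: "\<Lambda> > 0" using t by (simp add: \<Lambda>_def)
    define \<beta> where "\<beta> = \<gamma> / (2 * C * \<Lambda>) * \<alpha>"
    have \<beta>: "\<beta> > 0" using C \<Lambda> \<alpha> \<gamma> by (simp add: \<beta>_def)
    have C\<beta>: "C * \<Lambda> * \<beta> = \<gamma> * \<alpha> / 2" using C \<Lambda> by (simp add: \<beta>_def)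
    note [measurable] = L2_measurable[OF f]
    let ?S = "{x. cmod (f x) > \<beta>}"
    have "?S = {x \<in> space borel. cmod (f x) > \<beta>}" by simp
    also have "\<dots> \<in> sets borel" by measurable
    finally have [measurable]: "?S \<in> sets borel" .
    define f2 where "f2 x = indicator ?S x * f x" for x
    define f1 where "f1 x = indicator (-?S) x * f x" for x
    have f2: "f2 \<in> Lp_space 2" unfolding f2_def[abs_def] by (rule L2_bound_mult[OF f, where C=1]) (auto simp: indicator_def)
    have f1: "f1 \<in> Lp_space 2" unfolding f1_def[abs_def] by (rule L2_bound_mult[OF f, where C=1]) (auto simp: indicator_def)
    have f12: "f = (\<lambda>x. f1 x + 1 * f2 x)" by (auto simp: f1_def f2_def indicator_def fun_eq_iff)
    have f1b: "cmod (f1 y) \<le> \<beta>" for y using \<beta> by (auto simp: f1_def indicator_def)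
    define g where "g = A_op \<phi> t f"
    define g1 where "g1 = A_op \<phi> t f1"
    define g2 where "g2 = A_op \<phi> t f2"
    have g: "g \<in> Lp_space 2" "g1 \<in> Lp_space 2" "g2 \<in> Lp_space 2"
      unfolding g_def g1_def g2_def by (intro A_op_L2 smooth f f1 f2)+
    have gae: "AE x in lborel. g x = g1 x + g2 x"
      using A_op_lincomb[OF smooth f1 f2, of t 1] unfolding f12[symmetric] g_def g1_def g2_def by simp
    have "heavy (\<lambda>x. ennreal (cmod (g2 x))) (\<gamma> * \<alpha> / 4) (cube k x)"
      if h: "ennreal (\<gamma> * \<alpha>) * emeasure lborel (cube k x) < osc g (cube k x)" for k x
    proof (rule ccontr)
      let ?Q = "cube k x"
      assume "\<not> ?thesis"
      then have nh: "nn_on (\<lambda>x. ennreal (cmod (g2 x))) ?Q \<le> ennreal (\<gamma> * \<alpha> / 4) * emeasure lborel ?Q"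
        by (simp add: heavy_def not_less)
      have "osc g ?Q = osc (\<lambda>x. g1 x + g2 x) ?Q"
        using L2_measurable[OF g(1)] L2_measurable[OF L2_add[OF g(2,3)]] by (intro osc_cong_AE gae)
      also have "\<dots> \<le> osc g1 ?Q + 2 * nn_on (\<lambda>x. ennreal (cmod (g2 x))) ?Q" by (rule osc_add_le[OF g(2,3)])
      also have "\<dots> \<le> ennreal (C * \<Lambda> * \<beta>) * emeasure lborel ?Q + 2 * (ennreal (\<gamma> * \<alpha> / 4) * emeasure lborel ?Q)"
        using bmo t f1 f1b unfolding g1_def \<Lambda>_def by (intro add_mono mult_left_mono nh) auto
      also have "\<dots> = (ennreal (\<gamma> * \<alpha> / 2) + ennreal 2 * ennreal (\<gamma> * \<alpha> / 4)) * emeasure lborel ?Q"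
        unfolding C\<beta> by (simp add: distrib_right mult.assoc)
      also have "ennreal (\<gamma> * \<alpha> / 2) + ennreal 2 * ennreal (\<gamma> * \<alpha> / 4) = ennreal (\<gamma> * \<alpha>)"
      proof -
        have "ennreal 2 * ennreal (\<gamma> * \<alpha> / 4) = ennreal (\<gamma> * \<alpha> / 2)"
          using \<alpha> \<gamma> by (subst ennreal_mult[symmetric]) auto
        moreover have "ennreal (\<gamma> * \<alpha> / 2) + ennreal (\<gamma> * \<alpha> / 2) = ennreal (\<gamma> * \<alpha>)"
          using \<alpha> \<gamma> by (subst ennreal_plus[symmetric]) auto
        ultimately show ?thesis by simp
      qed
      finally show False using h by simp
    qed
    then have "{x. \<exists>k. ennreal (\<gamma> * \<alpha>) * emeasure lborel (cube k x) < osc g (cube k x)} \<subseteq> level_set (\<lambda>x. ennreal (cmod (g2 x))) (\<gamma> * \<alpha> / 4)"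
      unfolding level_set_def by blast
    then have "emeasure lborel {x. \<exists>k. ennreal (\<gamma> * \<alpha>) * emeasure lborel (cube k x) < osc g (cube k x)}
       \<le> emeasure lborel (level_set (\<lambda>x. ennreal (cmod (g2 x))) (\<gamma> * \<alpha> / 4))"
      by (intro emeasure_mono) auto
    also have "\<dots> \<le> ennreal (1 / (\<gamma> * \<alpha> / 4)\<^sup>2) * N2 g2"
      using \<alpha> \<gamma> by (intro weak_type_L2 g) auto
    also have "N2 g2 = N2 f2" unfolding g2_def by (rule A_op_norm[OF smooth f2])
    also have "1 / (\<gamma> * \<alpha> / 4)\<^sup>2 = 16 / (\<gamma> * \<alpha>)\<^sup>2" by (simp add: power_divide)
    finally have B: "emeasure lborel {x. \<exists>k. ennreal (\<gamma> * \<alpha>) * emeasure lborel (cube k x) < osc g (cube k x)}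
       \<le> ennreal (16 / (\<gamma> * \<alpha>)\<^sup>2) * N2 f2" .
    have "emeasure lborel (level_set (\<lambda>x. ennreal (cmod (g x))) (2 * \<alpha>))
      \<le> emeasure lborel {x. \<exists>k. ennreal (\<gamma> * \<alpha>) * emeasure lborel (cube k x) < osc g (cube k x)}
        + ennreal (2 ^ DIM('a) * \<gamma>) * emeasure lborel (level_set (\<lambda>x. ennreal (cmod (g x))) \<alpha>)"
      by (rule good_lambda[OF g(1) \<alpha> \<gamma>])
    also have "\<dots> \<le> ennreal (16 / (\<gamma> * \<alpha>)\<^sup>2) * N2 f2 + ennreal (2 ^ DIM('a) * \<gamma>) * emeasure lborel (level_set (\<lambda>x. ennreal (cmod (g x))) \<alpha>)"
      by (intro add_right_mono B)
    finally show ?thesis unfolding g_def f2_def[abs_def] \<beta>_def \<Lambda>_def .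
  qed
  with C show ?thesis by blast
qed

text \<open>The recursion is multiplied by (2 \<alpha>)^p and summed over \<alpha> = \<delta> 2^n.
  The terms with f form a geometric sum at each point and yield |f|^p; the remaining sum is half of
  the left side and is absorbed.\<close>

lemma Lp_bound_gt_2:
  assumes p: "2 < p"
  shows "\<exists>C\<ge>0. \<forall>t f. 1 \<le> \<bar>t\<bar> \<longrightarrow> f \<in> Lp_space 2 \<longrightarrow>
    Np p (A_op \<phi> t f) \<le> ennreal (C * \<bar>t\<bar> powr (real DIM('a) / 2 * (p - 2))) * Np p f"
proof -
  obtain C where C: "C \<ge> 1" and rec: "\<forall>t f \<alpha> \<gamma>. 1 \<le> \<bar>t\<bar> \<longrightarrow> f \<in> Lp_space 2 \<longrightarrow> 0 < \<alpha> \<longrightarrow> 0 < \<gamma> \<longrightarrow>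
    emeasure lborel (level_set (\<lambda>x. ennreal (cmod (A_op \<phi> t f x))) (2 * \<alpha>))
     \<le> ennreal (16 / (\<gamma> * \<alpha>)\<^sup>2) * N2 (\<lambda>x. indicator {x. cmod (f x) > \<gamma> / (2 * C * \<bar>t\<bar> powr (real DIM('a) / 2)) * \<alpha>} x * f x)
      + ennreal (2 ^ DIM('a) * \<gamma>) * emeasure lborel (level_set (\<lambda>x. ennreal (cmod (A_op \<phi> t f x))) \<alpha>)"
    using level_recursion by blast
  \<comment> \<open>Doubling the level costs 2^p, and the recursion contributes 2^d \<gamma>; the
    product is exactly 1/2.\<close>
  define \<gamma> where "\<gamma> = 1 / (2 * 2 powr p * 2 ^ DIM('a))"
  have \<gamma>: "\<gamma> > 0" by (simp add: \<gamma>_def)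
  have \<gamma>d: "2 ^ DIM('a) * \<gamma> = 1 / (2 * 2 powr p)" by (simp add: \<gamma>_def)
  define G where "G = 2 powr (p - 2) / (2 powr (p - 2) - 1)"
  have G: "G > 0" unfolding G_def using p by simp
  \<comment> \<open>The last factor is (1/\<kappa>)^(p-2) stripped of its power of |t|; that power
    is the one in the claim.\<close>
  define K1 where "K1 = 2 powr p * (16 / \<gamma>\<^sup>2) * G * (2 * C / \<gamma>) powr (p - 2)"
  have K1: "K1 \<ge> 0" unfolding K1_def using G by simp
  have "Np p (A_op \<phi> t f) \<le> ennreal ((2 powr p * 2 * K1) * \<bar>t\<bar> powr (real DIM('a) / 2 * (p - 2))) * Np p f"
    if t: "1 \<le> \<bar>t\<bar>" and f: "f \<in> Lp_space 2" for t f
  proof -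
    define \<Lambda> where "\<Lambda> = \<bar>t\<bar> powr (real DIM('a) / 2)"
    have \<Lambda>: "\<Lambda> > 0" using t by (simp add: \<Lambda>_def)
    define \<kappa> where "\<kappa> = \<gamma> / (2 * C * \<Lambda>)"
    have \<kappa>: "\<kappa> > 0" using \<gamma> C \<Lambda> by (simp add: \<kappa>_def)
    define g where "g = A_op \<phi> t f"
    have g: "g \<in> Lp_space 2" unfolding g_def by (rule A_op_L2[OF smooth f])
    note [measurable] = L2_measurable[OF f] L2_measurable[OF g]
    define D where "D \<alpha> = emeasure lborel (level_set (\<lambda>x. ennreal (cmod (g x))) \<alpha>)" for \<alpha>
    define F where "F \<alpha> = N2 (\<lambda>x. indicator {x. cmod (f x) > \<kappa> * \<alpha>} x * f x)" for \<alpha>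
    have D: "D \<alpha> \<le> ennreal (1 / \<alpha>\<^sup>2) * N2 g" if "\<alpha> > 0" for \<alpha>
      unfolding D_def by (rule weak_type_L2[OF g that])
    have Dfin: "D \<alpha> < \<infinity>" if "\<alpha> > 0" for \<alpha>
      using D[OF that] L2_finite[OF g] by (auto elim!: order.strict_trans1 simp: ennreal_mult_less_top)
    have rec': "ennreal ((2 * \<alpha>) powr p) * D (2 * \<alpha>) \<le> ennreal (2 powr p * (16 / \<gamma>\<^sup>2) * \<alpha> powr (p - 2)) * F \<alpha> + ennreal (1/2) * (ennreal (\<alpha> powr p) * D \<alpha>)"
      if \<alpha>: "\<alpha> > 0" for \<alpha>
    proof -
      have a2: "\<alpha> powr p / \<alpha>\<^sup>2 = \<alpha> powr (p - 2)"
        using \<alpha> powr_diff[of \<alpha> p 2] by (simp add: powr_two)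
      have "D (2 * \<alpha>) \<le> ennreal (16 / (\<gamma> * \<alpha>)\<^sup>2) * F \<alpha> + ennreal (1 / (2 * 2 powr p)) * D \<alpha>"
        using rec t f \<alpha> \<gamma> unfolding D_def F_def g_def \<kappa>_def \<Lambda>_def \<gamma>d[symmetric] by blast
      then have "ennreal ((2 * \<alpha>) powr p) * D (2 * \<alpha>)
        \<le> ennreal ((2 * \<alpha>) powr p) * (ennreal (16 / (\<gamma> * \<alpha>)\<^sup>2) * F \<alpha> + ennreal (1 / (2 * 2 powr p)) * D \<alpha>)"
        by (rule mult_left_mono) simp
      also have "\<dots> = (ennreal ((2 * \<alpha>) powr p) * ennreal (16 / (\<gamma> * \<alpha>)\<^sup>2)) * F \<alpha> + (ennreal ((2 * \<alpha>) powr p) * ennreal (1 / (2 * 2 powr p))) * D \<alpha>"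
        by (simp only: distrib_left mult.assoc)
      also have "ennreal ((2 * \<alpha>) powr p) * ennreal (16 / (\<gamma> * \<alpha>)\<^sup>2) = ennreal (2 powr p * (16 / \<gamma>\<^sup>2) * \<alpha> powr (p - 2))"
      proof -
        have "(2 * \<alpha>) powr p * (16 / (\<gamma> * \<alpha>)\<^sup>2) = 2 powr p * (16 / \<gamma>\<^sup>2) * (\<alpha> powr p / \<alpha>\<^sup>2)"
          using \<alpha> by (simp add: powr_mult power_mult_distrib)
        then show ?thesis unfolding a2 by (subst ennreal_mult[symmetric]) auto
      qed
      also have "ennreal ((2 * \<alpha>) powr p) * ennreal (1 / (2 * 2 powr p)) = ennreal (1/2) * ennreal (\<alpha> powr p)"
      proof -
        have "(2 * \<alpha>) powr p * (1 / (2 * 2 powr p)) = (1/2) * \<alpha> powr p" using \<alpha> by (simp add: powr_mult)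
        then show ?thesis by (subst (1 2) ennreal_mult[symmetric]) auto
      qed
      finally show ?thesis by (simp only: mult.assoc)
    qed
    \<comment> \<open>At a fixed point only the levels with \<kappa> \<alpha> < |f x| contribute, so
      |f|^2 times the sum of \<alpha>^(p-2) is at most a multiple of |f|^2
      (|f|/\<kappa>)^(p-2).\<close>
    have Fsum: "(\<Sum>n\<le>M. ennreal ((\<delta> * 2 ^ n) powr (p - 2)) * F (\<delta> * 2 ^ n)) \<le> ennreal (G * (1 / \<kappa>) powr (p - 2)) * Np p f"
      if \<delta>: "\<delta> > 0" for \<delta> M
    proof -
      have [measurable]: "{x. cmod (f x) > c} \<in> sets borel" for c
      proof -
        have "{x. cmod (f x) > c} = {x \<in> space borel. cmod (f x) > c}" by simp
        also have "\<dots> \<in> sets borel" by measurable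
        finally show ?thesis .
      qed
      have "(\<Sum>n\<le>M. ennreal ((\<delta> * 2 ^ n) powr (p - 2)) * F (\<delta> * 2 ^ n))
        = (\<integral>\<^sup>+x. (\<Sum>n\<le>M. ennreal ((\<delta> * 2 ^ n) powr (p - 2)) * ennreal ((cmod (indicator {x. cmod (f x) > \<kappa> * (\<delta> * 2 ^ n)} x * f x))\<^sup>2)) \<partial>lborel)"
        unfolding F_def N2_def by (subst nn_integral_sum, measurable) (simp add: nn_integral_cmult)
      also have "\<dots> \<le> (\<integral>\<^sup>+x. ennreal (G * (1 / \<kappa>) powr (p - 2)) * ennreal (cmod (f x) powr p) \<partial>lborel)"
      proof (intro nn_integral_mono)
        fix x
        let ?y = "cmod (f x) / \<kappa>"
        have "(\<Sum>n\<le>M. ennreal ((\<delta> * 2 ^ n) powr (p - 2)) * ennreal ((cmod (indicator {x. cmod (f x) > \<kappa> * (\<delta> * 2 ^ n)} x * f x))\<^sup>2))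
          = (\<Sum>n\<le>M. ennreal ((cmod (f x))\<^sup>2 * (if \<delta> * 2 ^ n < ?y then (\<delta> * 2 ^ n) powr (p - 2) else 0)))"
          using \<kappa> by (intro sum.cong refl) (auto simp: indicator_def ennreal_mult[symmetric] pos_less_divide_eq mult_ac)
        also have "\<dots> = ennreal ((cmod (f x))\<^sup>2 * (\<Sum>n\<le>M. if \<delta> * 2 ^ n < ?y then (\<delta> * 2 ^ n) powr (p - 2) else 0))"
          unfolding sum_distrib_left by (intro sum_ennreal) auto
        also have "\<dots> \<le> ennreal ((cmod (f x))\<^sup>2 * (G * ?y powr (p - 2)))"
          unfolding G_def using \<kappa> \<delta> p by (intro ennreal_leI mult_left_mono dyadic_powr_sum_le) auto
        also have "(cmod (f x))\<^sup>2 * (G * ?y powr (p - 2)) = G * (1 / \<kappa>) powr (p - 2) * cmod (f x) powr p"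
        proof (cases "f x = 0")
          case False
          have "?y powr (p - 2) = (1 / \<kappa>) powr (p - 2) * cmod (f x) powr (p - 2)"
            using \<kappa> powr_mult[of "1 / \<kappa>" "cmod (f x)" "p - 2"] by simp
          moreover have "(cmod (f x))\<^sup>2 * cmod (f x) powr (p - 2) = cmod (f x) powr p"
            using False powr_add[of "cmod (f x)" 2 "p - 2"] by (simp add: powr_two)
          ultimately show ?thesis by (simp add: mult_ac)
        qed simp
        also have "ennreal (G * (1 / \<kappa>) powr (p - 2) * cmod (f x) powr p) = ennreal (G * (1 / \<kappa>) powr (p - 2)) * ennreal (cmod (f x) powr p)"
          using G by (intro ennreal_mult) auto
        finally show "(\<Sum>n\<le>M. ennreal ((\<delta> * 2 ^ n) powr (p - 2)) * ennreal ((cmod (indicator {x. cmod (f x) > \<kappa> * (\<delta> * 2 ^ n)} x * f x))\<^sup>2))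
          \<le> ennreal (G * (1 / \<kappa>) powr (p - 2)) * ennreal (cmod (f x) powr p)" .
      qed
      also have "\<dots> = ennreal (G * (1 / \<kappa>) powr (p - 2)) * Np p f" unfolding Np_def by (simp add: nn_integral_cmult)
      finally show ?thesis .
    qed
    have K1': "2 powr p * (16 / \<gamma>\<^sup>2) * (G * (1 / \<kappa>) powr (p - 2)) = K1 * \<bar>t\<bar> powr (real DIM('a) / 2 * (p - 2))"
    proof -
      have "1 / \<kappa> = (2 * C / \<gamma>) * \<Lambda>" by (simp add: \<kappa>_def)
      then have "(1 / \<kappa>) powr (p - 2) = (2 * C / \<gamma>) powr (p - 2) * \<Lambda> powr (p - 2)"
        using C \<gamma> \<Lambda> by (simp only: powr_mult)
      also have "\<Lambda> powr (p - 2) = \<bar>t\<bar> powr (real DIM('a) / 2 * (p - 2))" by (simp add: \<Lambda>_def powr_powr)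
      finally show ?thesis by (simp add: K1_def mult_ac)
    qed
    define R where "R = ennreal (K1 * \<bar>t\<bar> powr (real DIM('a) / 2 * (p - 2))) * Np p f"
    \<comment> \<open>Finitely many levels keep the sum finite for the absorption; the lowest level
      is outside the recursion and is bounded by the weak L_2 inequality.\<close>
    have S: "(\<Sum>n\<le>M. ennreal ((\<delta> * 2 ^ n) powr p) * D (\<delta> * 2 ^ n)) \<le> 2 * (ennreal (\<delta> powr (p - 2)) * N2 g + R)"
      if \<delta>: "\<delta> > 0" for \<delta> M
    proof -
      let ?T = "\<lambda>n. ennreal ((\<delta> * 2 ^ n) powr p) * D (\<delta> * 2 ^ n)"
      have T0: "?T 0 \<le> ennreal (\<delta> powr (p - 2)) * N2 g"
      proof -
        have "?T 0 \<le> ennreal (\<delta> powr p) * (ennreal (1 / \<delta>\<^sup>2) * N2 g)" using D[OF \<delta>] by (simp add: mult_left_mono)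
        also have "\<dots> = ennreal (\<delta> powr p * (1 / \<delta>\<^sup>2)) * N2 g"
          by (subst ennreal_mult) (auto simp: mult.assoc)
        also have "\<delta> powr p * (1 / \<delta>\<^sup>2) = \<delta> powr (p - 2)" using \<delta> powr_diff[of \<delta> p 2] by (simp add: powr_two)
        finally show ?thesis .
      qed
      \<comment> \<open>The extra term lets everything beyond \<open>?T 0\<close> be written as
        \<open>?T (Suc n)\<close> for n <= M, so that the recursion returns the original
        sum.\<close>
      have "(\<Sum>n\<le>M. ?T n) \<le> (\<Sum>n\<le>Suc M. ?T n)" by simp
      also have "\<dots> = ?T 0 + (\<Sum>n\<le>M. ?T (Suc n))" by (rule sum.atMost_Suc_shift)
      also have "\<dots> \<le> ennreal (\<delta> powr (p - 2)) * N2 g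
         + (\<Sum>n\<le>M. ennreal (2 powr p * (16 / \<gamma>\<^sup>2) * (\<delta> * 2 ^ n) powr (p - 2)) * F (\<delta> * 2 ^ n) + ennreal (1/2) * ?T n)"
      proof (intro add_mono T0 sum_mono)
        fix n
        have "\<delta> * 2 ^ Suc n = 2 * (\<delta> * 2 ^ n)" by simp
        then show "?T (Suc n) \<le> ennreal (2 powr p * (16 / \<gamma>\<^sup>2) * (\<delta> * 2 ^ n) powr (p - 2)) * F (\<delta> * 2 ^ n) + ennreal (1/2) * ?T n"
          using rec'[of "\<delta> * 2 ^ n"] \<delta> by (simp only:) simp
      qed
      also have "(\<Sum>n\<le>M. ennreal (2 powr p * (16 / \<gamma>\<^sup>2) * (\<delta> * 2 ^ n) powr (p - 2)) * F (\<delta> * 2 ^ n) + ennreal (1/2) * ?T n)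
        = ennreal (2 powr p * (16 / \<gamma>\<^sup>2)) * (\<Sum>n\<le>M. ennreal ((\<delta> * 2 ^ n) powr (p - 2)) * F (\<delta> * 2 ^ n)) + ennreal (1/2) * (\<Sum>n\<le>M. ?T n)"
      proof -
        have "ennreal (2 powr p * (16 / \<gamma>\<^sup>2) * (\<delta> * 2 ^ n) powr (p - 2)) * F (\<delta> * 2 ^ n)
          = ennreal (2 powr p * (16 / \<gamma>\<^sup>2)) * (ennreal ((\<delta> * 2 ^ n) powr (p - 2)) * F (\<delta> * 2 ^ n))" for n
          by (subst ennreal_mult) (auto simp: mult.assoc)
        then show ?thesis by (simp only: sum.distrib sum_distrib_left)
      qed
      also have "ennreal (2 powr p * (16 / \<gamma>\<^sup>2)) * (\<Sum>n\<le>M. ennreal ((\<delta> * 2 ^ n) powr (p - 2)) * F (\<delta> * 2 ^ n))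
         \<le> ennreal (2 powr p * (16 / \<gamma>\<^sup>2)) * (ennreal (G * (1 / \<kappa>) powr (p - 2)) * Np p f)"
        by (intro mult_left_mono Fsum \<delta>) auto
      also have "\<dots> = R"
      proof -
        have "ennreal (2 powr p * (16 / \<gamma>\<^sup>2)) * ennreal (G * (1 / \<kappa>) powr (p - 2)) = ennreal (2 powr p * (16 / \<gamma>\<^sup>2) * (G * (1 / \<kappa>) powr (p - 2)))"
          using G by (intro ennreal_mult[symmetric]) auto
        then show ?thesis unfolding R_def K1'[symmetric] by (simp only: mult.assoc[symmetric])
      qed
      finally have "(\<Sum>n\<le>M. ?T n) \<le> (ennreal (\<delta> powr (p - 2)) * N2 g + R) + ennreal (1/2) * (\<Sum>n\<le>M. ?T n)"
        by (simp add: add.assoc add_left_mono add_right_mono)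
      then show ?thesis
      proof (rule ennreal_absorb_half)
        show "(\<Sum>n\<le>M. ?T n) < \<infinity>" using Dfin \<delta> by (simp add: ennreal_mult_less_top)
      qed
    qed
    \<comment> \<open>With \<delta> = 2^-K and 2K + 1 levels the values of |g| between 2^-K and
      2^(K+1) are covered; this exhausts all nonzero values as K grows, and Fatou's lemma
      concludes.\<close>
    let ?gK = "\<lambda>K x. if (1/2)^K < cmod (g x) \<and> cmod (g x) \<le> (1/2)^K * 2 ^ Suc (2 * K) then cmod (g x) powr p else 0"
    have gK: "(\<integral>\<^sup>+x. ennreal (?gK K x) \<partial>lborel) \<le> ennreal (2 powr p) * (2 * (ennreal (((1/2)^K) powr (p - 2)) * N2 g + R))" for K
    proof -
      let ?\<delta> = "(1/2)^K :: real"
      let ?L = "\<lambda>n. level_set (\<lambda>x. ennreal (cmod (g x))) (?\<delta> * 2 ^ n)"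
      have "AE x in lborel. \<forall>n. cmod (g x) > ?\<delta> * 2 ^ n \<longrightarrow> x \<in> ?L n"
        unfolding AE_all_countable by (intro allI level_set_AE g) simp
      \<comment> \<open>Return from the maximal function to g: on each layer |g| is at most twice a
        level whose level set contains almost every point of the layer.\<close>
      then have "(\<integral>\<^sup>+x. ennreal (?gK K x) \<partial>lborel) \<le> (\<integral>\<^sup>+x. (\<Sum>n\<le>2 * K. ennreal (2 powr p) * (ennreal ((?\<delta> * 2 ^ n) powr p) * indicator (?L n) x)) \<partial>lborel)"
      proof (intro nn_integral_mono_AE, eventually_elim)
        case (elim x)
        show ?case
        proof (cases "?\<delta> < cmod (g x) \<and> cmod (g x) \<le> ?\<delta> * 2 ^ Suc (2 * K)")
          case True
          then obtain n where n: "n \<le> 2 * K" "?\<delta> * 2 ^ n < cmod (g x)" "cmod (g x) \<le> 2 * (?\<delta> * 2 ^ n)"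
            using dyadic_layer[of ?\<delta> "cmod (g x)" "2 * K"] by auto
          have "cmod (g x) powr p \<le> (2 * (?\<delta> * 2 ^ n)) powr p" using n p by (intro powr_mono2) auto
          also have "\<dots> = 2 powr p * (?\<delta> * 2 ^ n) powr p" by (rule powr_mult)
          finally have "ennreal (cmod (g x) powr p) \<le> ennreal (2 powr p) * (ennreal ((?\<delta> * 2 ^ n) powr p) * indicator (?L n) x)"
            using elim n(2) by (simp add: ennreal_mult[symmetric] ennreal_leI)
          also have "\<dots> \<le> (\<Sum>n\<le>2 * K. ennreal (2 powr p) * (ennreal ((?\<delta> * 2 ^ n) powr p) * indicator (?L n) x))"
            using n(1) by (intro member_le_sum[where f="\<lambda>n. ennreal (2 powr p) * (ennreal ((?\<delta> * 2 ^ n) powr p) * indicator (?L n) x)"]) auto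
          finally show ?thesis using True by simp
        next
          case False
          show ?thesis by (simp only: False if_False ennreal_0 zero_le)
        qed
      qed
      also have "\<dots> = ennreal (2 powr p) * (\<Sum>n\<le>2 * K. ennreal ((?\<delta> * 2 ^ n) powr p) * D (?\<delta> * 2 ^ n))"
        unfolding D_def by (subst nn_integral_sum, measurable) (simp add: nn_integral_cmult nn_integral_cmult_indicator sum_distrib_left)
      also have "\<dots> \<le> ennreal (2 powr p) * (2 * (ennreal (?\<delta> powr (p - 2)) * N2 g + R))"
        by (intro mult_left_mono S) auto
      finally show ?thesis .
    qed
    have "Np p g = (\<integral>\<^sup>+x. liminf (\<lambda>K. ennreal (?gK K x)) \<partial>lborel)"
      unfolding Np_def
    proof (intro nn_integral_cong)
      fix x
      have "eventually (\<lambda>K. ?gK K x = cmod (g x) powr p) sequentially"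
      proof (cases "g x = 0")
        case False
        have "(\<lambda>K. (1/2)^K :: real) \<longlonglongrightarrow> 0" by (simp add: LIMSEQ_power_zero)
        then have "eventually (\<lambda>K. (1/2)^K < cmod (g x)) sequentially"
          using False by (intro order_tendstoD(2)) auto
        moreover obtain n0 where n0: "cmod (g x) < 2 ^ n0" using real_arch_pow[of 2 "cmod (g x)"] by auto
        have "eventually (\<lambda>K. cmod (g x) \<le> (1/2)^K * 2 ^ Suc (2 * K)) sequentially"
          using eventually_ge_at_top[of n0]
        proof eventually_elim
          case (elim K)
          have "(2::real) ^ n0 \<le> 2 ^ K" by (rule power_increasing[OF elim]) simp
          then have "cmod (g x) \<le> 2 ^ K" using n0 by linarith
          also have "\<dots> \<le> (1/2)^K * 2 ^ Suc (2 * K)"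
            by (simp add: power_mult power_one_over power2_eq_square power_mult_distrib[symmetric] field_simps)
          finally show ?case .
        qed
        ultimately show ?thesis by eventually_elim simp
      qed simp
      then have "(\<lambda>K. ennreal (?gK K x)) \<longlonglongrightarrow> ennreal (cmod (g x) powr p)"
        by (intro tendsto_eventually) (auto elim: eventually_mono)
      then show "ennreal (cmod (g x) powr p) = liminf (\<lambda>K. ennreal (?gK K x))"
        by (intro lim_imp_Liminf[symmetric]) auto
    qed
    also have "\<dots> \<le> liminf (\<lambda>K. \<integral>\<^sup>+x. ennreal (?gK K x) \<partial>lborel)"
      by (intro nn_integral_liminf) measurable
    also have "\<dots> \<le> liminf (\<lambda>K. ennreal (2 powr p) * (2 * (ennreal (((1/2)^K) powr (p - 2)) * N2 g + R)))"
      by (intro Liminf_mono always_eventually allI gK)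
    also have "\<dots> = ennreal (2 powr p) * (2 * (0 * N2 g + R))"
    proof (rule lim_imp_Liminf)
      have "((1/2)^K :: real) powr (p - 2) = ((1/2) powr (p - 2)) ^ K" for K :: nat
        by (simp add: powr_realpow[symmetric] powr_powr mult.commute)
      \<comment> \<open>Here p > 2 removes the contribution of the lowest level.\<close>
      moreover have "(1/2 :: real) powr (p - 2) < 1"
        using p powr_less_mono2[of "p - 2" "1/2" 1] by simp
      ultimately have "(\<lambda>K. ((1/2)^K :: real) powr (p - 2)) \<longlonglongrightarrow> 0"
        by (simp add: LIMSEQ_power_zero)
      then have "(\<lambda>K. ennreal (((1/2)^K) powr (p - 2))) \<longlonglongrightarrow> ennreal 0" by (rule tendsto_ennrealI)
      then have 1: "(\<lambda>K. ennreal (((1/2)^K) powr (p - 2)) * N2 g) \<longlonglongrightarrow> 0 * N2 g"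
        using L2_finite[OF g] by (intro tendsto_mult_ennreal tendsto_const) auto
      have 2: "(\<lambda>K. ennreal (((1/2)^K) powr (p - 2)) * N2 g + R) \<longlonglongrightarrow> 0 * N2 g + R"
        by (intro tendsto_add 1 tendsto_const)
      have "(\<lambda>K. (ennreal (2 powr p) * 2) * (ennreal (((1/2)^K) powr (p - 2)) * N2 g + R)) \<longlonglongrightarrow> (ennreal (2 powr p) * 2) * (0 * N2 g + R)"
        by (intro tendsto_mult_ennreal tendsto_const 2) (auto simp: ennreal_mult_eq_top_iff)
      then show "(\<lambda>K. ennreal (2 powr p) * (2 * (ennreal (((1/2)^K) powr (p - 2)) * N2 g + R))) \<longlonglongrightarrow> ennreal (2 powr p) * (2 * (0 * N2 g + R))"
        by (simp only: mult.assoc)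
    qed simp
    also have "\<dots> = (ennreal (2 powr p) * ennreal 2 * ennreal (K1 * \<bar>t\<bar> powr (real DIM('a) / 2 * (p - 2)))) * Np p f"
      by (simp add: R_def mult.assoc)
    also have "ennreal (2 powr p) * ennreal 2 * ennreal (K1 * \<bar>t\<bar> powr (real DIM('a) / 2 * (p - 2)))
       = ennreal ((2 powr p * 2 * K1) * \<bar>t\<bar> powr (real DIM('a) / 2 * (p - 2)))"
      using K1 by (subst ennreal_mult[symmetric], simp, simp, subst ennreal_mult[symmetric], simp, simp, simp only: mult.assoc)
    finally show ?thesis by (simp add: g_def)
  qed
  moreover have "2 powr p * 2 * K1 \<ge> 0" using K1 by simp
  ultimately show ?thesis by blast
qed

text \<open>For the dual exponent q the test function is |g|^(p-2) g, cut off to be square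
  integrable; the q-th power of its modulus is |g|^p. Young's inequality with a free parameter,
  followed by absorption, replaces Hoelder's inequality and the extraction of roots.\<close>

lemma Lp_bound_less_2:
  assumes p: "1 < p" "p < 2"
  shows "\<exists>C\<ge>0. \<forall>t f. 1 \<le> \<bar>t\<bar> \<longrightarrow> f \<in> Lp_space 2 \<longrightarrow>
    Np p (A_op \<phi> t f) \<le> ennreal (C * \<bar>t\<bar> powr (real DIM('a) / 2 * (2 - p))) * Np p f"
proof -
  define q where "q = p / (p - 1)"
  have q: "2 < q" using p by (simp add: q_def field_simps)
  have qp: "q * (p - 1) = p" "q - 2 = (2 - p) / (p - 1)" "p / q = p - 1" using p by (auto simp: q_def field_simps)
  obtain C0 where C0: "C0 \<ge> 0" and dual: "\<forall>t f. 1 \<le> \<bar>t\<bar> \<longrightarrow> f \<in> Lp_space 2 \<longrightarrow>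
    Np q (A_op \<phi> t f) \<le> ennreal (C0 * \<bar>t\<bar> powr (real DIM('a) / 2 * (q - 2))) * Np q f"
    using Lp_bound_gt_2[OF q] by blast
  \<comment> \<open>Strictly positive, so that \<open>K\<close> and \<open>s\<close> below are
    positive.\<close>
  define C1 where "C1 = C0 + 1"
  have C1: "C1 > 0" "C0 \<le> C1" using C0 by (auto simp: C1_def)
  have "Np p (A_op \<phi> t f) \<le> ennreal ((2 * (2 * C1) powr (p - 1)) * \<bar>t\<bar> powr (real DIM('a) / 2 * (2 - p))) * Np p f"
    if t: "1 \<le> \<bar>t\<bar>" and f: "f \<in> Lp_space 2" for t f
  proof -
    have t0: "\<bar>t\<bar> > 0" using t by linarith
    define K where "K = C1 * \<bar>t\<bar> powr (real DIM('a) / 2 * (q - 2))"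
    have K: "K > 0" using C1 t0 by (simp add: K_def)
    \<comment> \<open>The weight in Young's inequality: s^-q K = 1/2 makes the term to be absorbed
      exactly one half.\<close>
    define s where "s = (2 * K) powr (1 / q)"
    have s: "s > 0" using K by (simp add: s_def)
    have sq: "s powr - q * K = 1/2"
    proof -
      have "s powr q = 2 * K" using K q by (simp add: s_def powr_powr)
      then show ?thesis using K s by (simp add: powr_minus)
    qed
    \<comment> \<open>The exponents match through p/q = p - 1 and (q - 2)(p - 1) = 2 - p.\<close>
    have sp: "2 * s powr p = (2 * (2 * C1) powr (p - 1)) * \<bar>t\<bar> powr (real DIM('a) / 2 * (2 - p))"
    proof -
      have "s powr p = (2 * K) powr (p - 1)" by (simp add: s_def powr_powr qp(3) mult.commute[of _ p] divide_inverse[symmetric] flip: qp(3))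
      also have "2 * K = (2 * C1) * \<bar>t\<bar> powr (real DIM('a) / 2 * (q - 2))" by (simp add: K_def)
      also have "\<dots> powr (p - 1) = (2 * C1) powr (p - 1) * (\<bar>t\<bar> powr (real DIM('a) / 2 * (q - 2))) powr (p - 1)"
        by (rule powr_mult)
      also have "(\<bar>t\<bar> powr (real DIM('a) / 2 * (q - 2))) powr (p - 1) = \<bar>t\<bar> powr (real DIM('a) / 2 * (2 - p))"
      proof -
        have "(2 - p) / (p - 1) * (p - 1) = 2 - p" using p by simp
        then show ?thesis by (simp only: powr_powr qp(2) mult.assoc)
      qed
      finally show ?thesis by simp
    qed
    define g where "g = A_op \<phi> t f"
    have g: "g \<in> Lp_space 2" unfolding g_def by (rule A_op_L2[OF smooth f])
    note [measurable] = L2_measurable[OF f] L2_measurable[OF g]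
    \<comment> \<open>On this set g is bounded and the measure is finite, so the cut-off test
      function is in L_2 and \<open>X n\<close> is finite.\<close>
    let ?E = "\<lambda>n. {x \<in> cball 0 (real n). cmod (g x) \<le> real n}"
    have Em[measurable]: "?E n \<in> sets borel" for n
    proof -
      have "?E n = {x \<in> space borel. x \<in> cball 0 (real n) \<and> cmod (g x) \<le> real n}" by auto
      also have "\<dots> \<in> sets borel" by measurable
      finally show ?thesis .
    qed
    have Efin: "emeasure lborel (?E n) < \<infinity>" for n
    proof -
      have "emeasure lborel (?E n) \<le> emeasure lborel (cball (0::'a) (real n))" by (intro emeasure_mono) auto
      also have "\<dots> < \<infinity>" by (simp add: emeasure_cball)
      finally show ?thesis .
    qed
    define X where "X n = (\<integral>\<^sup>+x. ennreal (cmod (g x) powr p) * indicator (?E n) x \<partial>lborel)" for n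
    have X: "X n \<le> ennreal (2 * s powr p) * Np p f" for n
    proof -
      define h where "h x = indicator (?E n) x * (g x * of_real (cmod (g x) powr (p - 2)))" for x
      have [measurable]: "h \<in> borel_measurable borel" unfolding h_def by measurable
      have hc: "cmod (h x) = indicator (?E n) x * cmod (g x) powr (p - 1)" for x
      proof (cases "g x = 0")
        case False
        then have "cmod (g x) * cmod (g x) powr (p - 2) = cmod (g x) powr (p - 1)" by (simp add: powr_mult_base)
        then show ?thesis by (simp add: h_def norm_mult indicator_def)
      qed (simp add: h_def)
      have gh: "g x * cnj (h x) = of_real (indicator (?E n) x * cmod (g x) powr p)" for x
      proof (cases "g x = 0")
        case False
        have "g x * cnj (g x) * of_real (cmod (g x) powr (p - 2)) = complex_of_real ((cmod (g x))\<^sup>2 * cmod (g x) powr (p - 2))"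
          by (simp only: complex_norm_square[symmetric] of_real_mult)
        also have "(cmod (g x))\<^sup>2 * cmod (g x) powr (p - 2) = cmod (g x) powr p"
          using False powr_add[of "cmod (g x)" 2 "p - 2"] by (simp add: powr_two)
        finally show ?thesis by (simp add: h_def indicator_def mult_ac)
      qed simp
      have h: "h \<in> Lp_space 2"
      proof (rule L2_I)
        have "N2 h \<le> N2 (\<lambda>x. of_real (real n powr (p - 1)) * indicator (?E n) x)"
        proof (rule N2_mono)
          show "cmod (h x) \<le> cmod (of_real (real n powr (p - 1)) * indicator (?E n) x)" for x
            unfolding hc using p by (auto simp: indicator_def norm_mult intro!: powr_mono2)
        qed
        also have "\<dots> < \<infinity>"
          using L2_cmult[OF indicator_L2[OF Em[of n] Efin[of n]], of "of_real (real n powr (p - 1))"] by (rule L2_finite)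
        finally show "N2 h < \<infinity>" .
      qed measurable
      define w where "w = A_op \<phi> (-t) h"
      have w: "w \<in> Lp_space 2" unfolding w_def by (rule A_op_L2[OF smooth h])
      note [measurable] = L2_measurable[OF w]
      have Nh: "Np q h = X n"
        unfolding Np_def X_def
      proof (intro nn_integral_cong)
        fix x
        show "ennreal (cmod (h x) powr q) = ennreal (cmod (g x) powr p) * indicator (?E n) x"
          unfolding hc using qp(1) by (simp add: indicator_def powr_powr mult.commute)
      qed
      have Xint: "X n = ennreal (\<integral>x. indicator (?E n) x * cmod (g x) powr p \<partial>lborel)"
      proof -
        have "integrable lborel (\<lambda>x. complex_of_real (indicator (?E n) x * cmod (g x) powr p))"
          unfolding gh[symmetric] by (intro L2_mult_integrable L2_cnj g h)
        then have i: "integrable lborel (\<lambda>x. indicator (?E n) x * cmod (g x) powr p)"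
          by (simp only: complex_of_real_integrable_eq)
        show "X n = ennreal (\<integral>x. indicator (?E n) x * cmod (g x) powr p \<partial>lborel)"
          unfolding X_def by (subst nn_integral_eq_integral[OF i, symmetric]) (auto intro!: nn_integral_cong simp: indicator_def)
      qed
      have "complex_of_real (\<integral>x. indicator (?E n) x * cmod (g x) powr p \<partial>lborel) = (\<integral>x. g x * cnj (h x) \<partial>lborel)"
        unfolding gh by (simp only: integral_complex_of_real)
      also have "\<dots> = (\<integral>x. f x * cnj (w x) \<partial>lborel)"
        unfolding g_def w_def by (rule A_op_adjoint[OF smooth f h])
      finally have eq: "complex_of_real (\<integral>x. indicator (?E n) x * cmod (g x) powr p \<partial>lborel) = (\<integral>x. f x * cnj (w x) \<partial>lborel)" .
      have nonneg: "0 \<le> (\<integral>x. indicator (?E n) x * cmod (g x) powr p \<partial>lborel)" by (intro integral_nonneg_AE) auto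
      have "X n = ennreal (cmod (\<integral>x. f x * cnj (w x) \<partial>lborel))"
        unfolding Xint eq[symmetric] using nonneg by simp
      also have "\<dots> \<le> (\<integral>\<^sup>+x. ennreal (cmod (f x * cnj (w x))) \<partial>lborel)"
        by (intro integral_norm_bound_ennreal L2_mult_integrable f L2_cnj w)
      also have "\<dots> \<le> (\<integral>\<^sup>+x. ennreal (s powr p) * ennreal (cmod (f x) powr p) + ennreal (s powr - q) * ennreal (cmod (w x) powr q) \<partial>lborel)"
      proof (intro nn_integral_mono)
        fix x
        have "cmod (f x * cnj (w x)) = (s * cmod (f x)) * (cmod (w x) / s)" using s by (simp add: norm_mult)
        also have "\<dots> \<le> (s * cmod (f x)) powr p + (cmod (w x) / s) powr q"
          unfolding q_def using s p by (intro mult_le_powr_add) auto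
        also have "(s * cmod (f x)) powr p = s powr p * cmod (f x) powr p" by (rule powr_mult)
        also have "(cmod (w x) / s) powr q = s powr - q * cmod (w x) powr q"
          using s by (simp add: powr_divide powr_minus_divide)
        finally have "ennreal (cmod (f x * cnj (w x))) \<le> ennreal (s powr p * cmod (f x) powr p + s powr - q * cmod (w x) powr q)"
          by (rule ennreal_leI)
        then show "ennreal (cmod (f x * cnj (w x))) \<le> ennreal (s powr p) * ennreal (cmod (f x) powr p) + ennreal (s powr - q) * ennreal (cmod (w x) powr q)"
          by (simp add: ennreal_mult)
      qed
      also have "\<dots> = ennreal (s powr p) * Np p f + ennreal (s powr - q) * Np q w"
        unfolding Np_def by (subst nn_integral_add, measurable) (simp add: nn_integral_cmult)
      also have "\<dots> \<le> ennreal (s powr p) * Np p f + ennreal (s powr - q) * (ennreal K * X n)"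
      proof (intro add_left_mono mult_left_mono)
        \<comment> \<open>\<open>w\<close> is the image of \<open>h\<close> under the operator for
          -t, and the bound depends on |t| only.\<close>
        have "Np q w \<le> ennreal (C0 * \<bar>t\<bar> powr (real DIM('a) / 2 * (q - 2))) * Np q h"
          using dual t h unfolding w_def by (metis abs_minus_cancel)
        also have "\<dots> \<le> ennreal K * X n"
          unfolding K_def Nh using C1 by (intro mult_right_mono ennreal_leI) auto
        finally show "Np q w \<le> ennreal K * X n" .
      qed simp
      also have "ennreal (s powr - q) * (ennreal K * X n) = ennreal (1/2) * X n"
      proof -
        have "ennreal (s powr - q) * ennreal K = ennreal (1/2)"
          unfolding sq[symmetric] using K by (intro ennreal_mult[symmetric]) auto
        then show ?thesis by (simp only: mult.assoc[symmetric])
      qed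
      finally have "X n \<le> 2 * (ennreal (s powr p) * Np p f)"
        by (rule ennreal_absorb_half) (simp add: Xint)
      also have "\<dots> = (ennreal 2 * ennreal (s powr p)) * Np p f" by (simp add: mult.assoc)
      also have "ennreal 2 * ennreal (s powr p) = ennreal (2 * s powr p)" by (subst ennreal_mult) auto
      finally show ?thesis .
    qed
    have "Np p g = (\<integral>\<^sup>+x. liminf (\<lambda>n. ennreal (cmod (g x) powr p) * indicator (?E n) x) \<partial>lborel)"
      unfolding Np_def
    proof (intro nn_integral_cong)
      fix x
      have "eventually (\<lambda>n. x \<in> ?E n) sequentially"
        using eventually_ge_at_top[of "nat \<lceil>norm x\<rceil>"] eventually_ge_at_top[of "nat \<lceil>cmod (g x)\<rceil>"]
        by eventually_elim (auto simp: le_nat_iff ceiling_le_iff)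
      then have "(\<lambda>n. ennreal (cmod (g x) powr p) * indicator (?E n) x) \<longlonglongrightarrow> ennreal (cmod (g x) powr p)"
        by (intro tendsto_eventually) (auto elim!: eventually_mono)
      then show "ennreal (cmod (g x) powr p) = liminf (\<lambda>n. ennreal (cmod (g x) powr p) * indicator (?E n) x)"
        by (intro lim_imp_Liminf[symmetric]) auto
    qed
    also have "\<dots> \<le> liminf X" unfolding X_def by (intro nn_integral_liminf) measurable
    also have "\<dots> \<le> liminf (\<lambda>n::nat. ennreal (2 * s powr p) * Np p f)"
      by (intro Liminf_mono always_eventually allI X)
    also have "\<dots> = ennreal (2 * s powr p) * Np p f" by (rule lim_imp_Liminf) auto
    finally show ?thesis unfolding sp g_def .
  qed
  moreover have "2 * (2 * C1) powr (p - 1) \<ge> 0" by simp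
  ultimately show ?thesis by blast
qed

lemma Lp_bound:
  assumes p: "1 < p"
  shows "\<exists>C\<ge>0. \<forall>t f. 1 \<le> \<bar>t\<bar> \<longrightarrow> f \<in> Lp_space 2 \<longrightarrow>
    Np p (A_op \<phi> t f) \<le> ennreal (C * \<bar>t\<bar> powr (real DIM('a) / 2 * \<bar>p - 2\<bar>)) * Np p f"
proof -
  consider "p < 2" | "p = 2" | "p > 2" by linarith
  then show ?thesis
  proof cases
    case 1
    then show ?thesis using Lp_bound_less_2[OF p 1] by simp
  next
    \<comment> \<open>The operator is unitary on L_2, and the exponent of |t| is 0.\<close>
    case 2
    have "Np 2 f = N2 f" for f :: "'a \<Rightarrow> complex" by (simp add: Np_def N2_def powr_two)
    then show ?thesis using 2 by (intro exI[of _ 1]) (auto simp: A_op_norm[OF smooth])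
  next
    case 3
    then show ?thesis using Lp_bound_gt_2[OF 3] by simp
  qed
qed

end

section \<open>From p-th powers to the operator norm\<close>

lemma Lp_space_iff: "f \<in> Lp_space p \<longleftrightarrow> f \<in> borel_measurable borel \<and> Np p f < \<infinity>"
  by (auto simp: Lp_space_def Np_def integrable_iff_bounded)

lemma Lp_norm_Np:
  assumes f: "f \<in> Lp_space p"
  shows "Lp_norm p f = ennreal (enn2real (Np p f) powr (1 / p))"
proof -
  have "integrable lborel (\<lambda>x. cmod (f x) powr p)" using f by (simp add: Lp_space_def)
  then have "Np p f = ennreal (\<integral>x. cmod (f x) powr p \<partial>lborel)"
    unfolding Np_def by (intro nn_integral_eq_integral) auto
  then show ?thesis using f by (simp add: Lp_norm_def)
qed

theorem theorem1:
  fixes p :: real and \<phi> :: "real ^ 'n \<Rightarrow> real"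
  assumes "1 < p"
    and "smooth_on_subset (sphere 0 1) \<phi>"
  shows "\<exists>c::real. \<forall>t::real. \<bar>t\<bar> \<ge> 1 \<longrightarrow>
    Lp_op_norm p (A_op \<phi> t) \<le> ennreal (c * \<bar>t\<bar> powr (real CARD('n) * \<bar>1 / 2 - 1 / p\<bar>))"
proof -
  obtain C where C: "C \<ge> 0" and bound: "\<forall>t f. 1 \<le> \<bar>t\<bar> \<longrightarrow> f \<in> Lp_space 2 \<longrightarrow>
    Np p (A_op \<phi> t f) \<le> ennreal (C * \<bar>t\<bar> powr (real DIM(real ^ 'n) / 2 * \<bar>p - 2\<bar>)) * Np p f"
    using Lp_bound[OF assms(2,1)] by blast
  have "Lp_op_norm p (A_op \<phi> t) \<le> ennreal (C powr (1 / p) * \<bar>t\<bar> powr (real CARD('n) * \<bar>1 / 2 - 1 / p\<bar>))"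
    if t: "\<bar>t\<bar> \<ge> 1" for t
    unfolding Lp_op_norm_def
  proof (rule SUP_least)
    fix f :: "real ^ 'n \<Rightarrow> complex"
    assume "f \<in> {f \<in> Lp_space 2 \<inter> Lp_space p. \<not> (AE x in lborel. f x = 0)}"
    then have f: "f \<in> Lp_space 2" "f \<in> Lp_space p" and nz: "\<not> (AE x in lborel. f x = 0)" by auto
    note [measurable] = L2_measurable[OF f(1)]
    let ?K = "C * \<bar>t\<bar> powr (real DIM(real ^ 'n) / 2 * \<bar>p - 2\<bar>)"
    have K: "?K \<ge> 0" using C by simp
    obtain F where F: "Np p f = ennreal F" "F \<ge> 0" using f(2) by (cases "Np p f") (auto simp: Lp_space_iff)
    \<comment> \<open>A vanishing p-norm would make f null, which the supremum excludes; thus the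
      quotient of norms is a quotient of real numbers.\<close>
    have "F \<noteq> 0"
    proof
      assume "F = 0"
      then have "Np p f = 0" using F by simp
      then have "AE x in lborel. ennreal (cmod (f x) powr p) = 0"
        unfolding Np_def by (subst (asm) nn_integral_0_iff_AE) auto
      then have "AE x in lborel. f x = 0" by eventually_elim (simp add: ennreal_eq_0_iff)
      with nz show False by simp
    qed
    with F(2) have F0: "F > 0" by simp
    let ?g = "A_op \<phi> t f"
    have "Np p ?g \<le> ennreal ?K * Np p f" using bound t f(1) by blast
    also have "\<dots> = ennreal (?K * F)" unfolding F(1) by (rule ennreal_mult[symmetric]) (use K F in auto)
    finally have le: "Np p ?g \<le> ennreal (?K * F)" .
    \<comment> \<open>Outside \<open>Lp_space p\<close> the norm is infinite by definition; the
      finite bound on \<open>Np\<close> rules this out.\<close>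
    have g: "?g \<in> Lp_space p"
      using le L2_measurable[OF A_op_L2[OF assms(2) f(1)]] by (auto simp: Lp_space_iff elim: order.strict_trans1)
    have "enn2real (Np p ?g) \<le> ?K * F" using le K F by (intro enn2real_leI) auto
    then have "enn2real (Np p ?g) powr (1 / p) \<le> (?K * F) powr (1 / p)"
      using assms(1) by (intro powr_mono2) auto
    also have "\<dots> = ?K powr (1 / p) * F powr (1 / p)" by (rule powr_mult)
    also have "?K powr (1 / p) = C powr (1 / p) * \<bar>t\<bar> powr (real CARD('n) * \<bar>1 / 2 - 1 / p\<bar>)"
    proof -
      \<comment> \<open>The p-th root divides the exponent (d/2) |p - 2| by p, which gives d |1/2 -
        1/p|.\<close>
      have "\<bar>1 / 2 - 1 / p\<bar> = \<bar>(p - 2) / (2 * p)\<bar>" using assms(1) by (simp add: field_simps)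
      also have "\<dots> = \<bar>p - 2\<bar> / (2 * p)" using assms(1) by (simp add: abs_mult)
      finally have e: "\<bar>1 / 2 - 1 / p\<bar> = \<bar>p - 2\<bar> / (2 * p)" .
      have "?K powr (1 / p) = C powr (1 / p) * (\<bar>t\<bar> powr (real DIM(real ^ 'n) / 2 * \<bar>p - 2\<bar>)) powr (1 / p)"
        by (rule powr_mult)
      also have "(\<bar>t\<bar> powr (real DIM(real ^ 'n) / 2 * \<bar>p - 2\<bar>)) powr (1 / p) = \<bar>t\<bar> powr (real CARD('n) * \<bar>1 / 2 - 1 / p\<bar>)"
        unfolding e by (simp add: powr_powr)
      finally show ?thesis .
    qed
    finally have fin: "enn2real (Np p ?g) powr (1 / p) \<le> C powr (1 / p) * \<bar>t\<bar> powr (real CARD('n) * \<bar>1 / 2 - 1 / p\<bar>) * F powr (1 / p)" .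
    have Fp: "F powr (1 / p) > 0" using F0 by simp
    have "Lp_norm p ?g / Lp_norm p f = ennreal (enn2real (Np p ?g) powr (1 / p) / F powr (1 / p))"
      unfolding Lp_norm_Np[OF g] Lp_norm_Np[OF f(2)] using F Fp by (simp add: divide_ennreal)
    also have "\<dots> \<le> ennreal (C powr (1 / p) * \<bar>t\<bar> powr (real CARD('n) * \<bar>1 / 2 - 1 / p\<bar>))"
      using fin Fp by (intro ennreal_leI) (simp add: pos_divide_le_eq)
    finally show "Lp_norm p ?g / Lp_norm p f \<le> ennreal (C powr (1 / p) * \<bar>t\<bar> powr (real CARD('n) * \<bar>1 / 2 - 1 / p\<bar>))" .
  qed
  then show ?thesis by blast
qed

end
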